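(* Let $(C,\Delta_C)$ be a quantum group obtained from a modular multiplicative unitary $\mathbb W^C$ on $\mathcal H_C\otimes\mathcal H_C$, with reduced bicharacter $\mathrm W\in\mathcal U\mathcal M(\hat C\otimes C)$. There is a unique $\mathcal X\in\mathcal U\mathcal M(\hat C^{\mathrm u}\otimes C^{\mathrm u})$ such that $$\mathcal V_{23}\tilde{\mathcal V}_{12}=\tilde{\mathcal V}_{12}\mathcal X_{13}\mathcal V_{23}\qquad\text{in }\mathcal U\mathcal M(\hat C^{\mathrm u}\otimes\mathbb K(\mathcal H_C)\otimes C^{\mathrm u}).$$ Moreover, this $\mathcal X$ is a bicharacter, that is, $(\Delta_{\hat C^{\mathrm u}}\otimes\mathrm{id})\mathcal X=\mathcal X_{23}\mathcal X_{13}$ and $(\mathrm{id}\otimes\Delta_{C^{\mathrm u}})\mathcal X=\mathcal X_{12}\mathcal X_{13}$, and it satisfies $$(\mathrm{id}_{\hat C^{\mathrm u}}\otimes\Lambda)\mathcal X=\tilde{\mathcal V},\qquad(\hat\Lambda\otimes\mathrm{id}_{C^{\mathrm u}})\mathcal X=\mathcal V,\qquad(\hat\Lambda\otimes\Lambda)\mathcal X=\mathrm W.$$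
   Context: Tensor products of $C^*$-algebras are spatial; $\mathcal M(A)$ is the multiplier algebra, $\mathcal U\mathcal M(A)$ its unitary group, $\mathbb K(\mathcal H)$ the compact operators; leg numbering notation is used; $\sigma$ is the flip of tensor factors. A morphism $A\to B$ of $C^*$-algebras is a nondegenerate $*$-homomorphism $A\to\mathcal M(B)$ (extended to multipliers). A unitary $\mathbb W$ on $\mathcal H\otimes\mathcal H$ is multiplicative if $\mathbb W_{23}\mathbb W_{12}=\mathbb W_{12}\mathbb W_{13}\mathbb W_{23}$. It is modular if there are positive self-adjoint operators $\hat Q,Q$ on $\mathcal H$ with trivial kernels and a unitary $\widetilde{\mathbb W}$ on $\overline{\mathcal H}\otimes\mathcal H$ ($\overline{\mathcal H}$ the complex-conjugate Hilbert space) such that $\mathbb W^*(\hat Q\otimes Q)\mathbb W=\hat Q\otimes Q$ and $(x\otimes y\mid\mathbb W\mid z\otimes u)=(\overline z\otimes Qy\mid\widetilde{\mathbb W}\mid\overline x\otimes Q^{-1}u)$ for all $x,z\in\mathcal H$, $y\in\mathrm{dom}(Q)$, $u\in\mathrm{dom}(Q^{-1})$, where $(x\mid T\mid y):=(x\mid Ty)$. The quantum group obtained from $\mathbb W^C$ is $(C,\Delta_C)$, where $C\subseteq\mathbb B(\mathcal H_C)$ is the norm closure of $\{(\omega\otimes\mathrm{id})(\mathbb W^C):\omega\in\mathbb B(\mathcal H_C)_*\}$ and $\Delta_C(x)=\mathbb W^C(x\otimes1)(\mathbb W^C)^*$. Its dual $(\hat C,\Delta_{\hat C})$ is the quantum group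 obtained in the same way from the (again modular) multiplicative unitary $\Sigma(\mathbb W^C)^*\Sigma$ ($\Sigma$ the flip), so $\Delta_{\hat C}(y)=\Sigma(\mathbb W^C)^*(1\otimes y)\mathbb W^C\Sigma$; the double dual of $C$ is $C$. $\mathbb W^C$ is the image of a unitary $\mathrm W\in\mathcal U\mathcal M(\hat C\otimes C)$, the reduced bicharacter, satisfying $(\Delta_{\hat C}\otimes\mathrm{id})\mathrm W=\mathrm W_{23}\mathrm W_{13}$, $(\mathrm{id}\otimes\Delta_C)\mathrm W=\mathrm W_{12}\mathrm W_{13}$. A left corepresentation of $\hat C$ on a $C^*$-algebra $D$ is $U\in\mathcal U\mathcal M(\hat C\otimes D)$ with $(\Delta_{\hat C}\otimes\mathrm{id}_D)(U)=U_{23}U_{13}$. The pair $(C^{\mathrm u},\mathcal V)$ consists of a $C^*$-algebra $C^{\mathrm u}$ and a left corepresentation $\mathcal V\in\mathcal U\mathcal M(\hat C\otimes C^{\mathrm u})$ that is universal: for every left corepresentation $U\in\mathcal U\mathcal M(\hat C\otimes D)$ there is a unique morphism $\varphi\colon C^{\mathrm u}\to D$ with $U=(\mathrm{id}\otimes\varphi)(\mathcal V)$. The comultiplication $\Delta_{C^{\mathrm u}}$ is determined by $(\mathrm{id}\otimes\Delta_{C^{\mathrm u}})(\mathcal V)=\mathcal V_{12}\mathcal V_{13}$, and the reducing morphism $\Lambda\colon C^{\mathrm u}\to C$ by $(\mathrm{id}_{\hat C}\otimes\Lambda)(\mathcal V)=\mathrm W$. The same construction applied to the dual of $C$ gives $(\hat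 C^{\mathrm u},\mathcal V^{\hat C})$ with $\mathcal V^{\hat C}\in\mathcal U\mathcal M(C\otimes\hat C^{\mathrm u})$ and comultiplication $\Delta_{\hat C^{\mathrm u}}$; put $\tilde{\mathcal V}:=\sigma(\mathcal V^{\hat C})^*\in\mathcal U\mathcal M(\hat C^{\mathrm u}\otimes C)$. Thus $(\mathrm{id}\otimes\Delta_C)\tilde{\mathcal V}=\tilde{\mathcal V}_{12}\tilde{\mathcal V}_{13}$, $(\Delta_{\hat C^{\mathrm u}}\otimes\mathrm{id})\tilde{\mathcal V}=\tilde{\mathcal V}_{23}\tilde{\mathcal V}_{13}$, and the reducing morphism $\hat\Lambda\colon\hat C^{\mathrm u}\to\hat C$ is determined by $(\hat\Lambda\otimes\mathrm{id}_C)(\tilde{\mathcal V})=\mathrm W$. In the equation in $\mathcal U\mathcal M(\hat C^{\mathrm u}\otimes\mathbb K(\mathcal H_C)\otimes C^{\mathrm u})$, the second leg $C$ of $\tilde{\mathcal V}_{12}$ and the first leg $\hat C$ of $\mathcal V_{23}$ are represented faithfully on $\mathcal H_C$ via $C,\hat C\subseteq\mathbb B(\mathcal H_C)$. *)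

theory Defs
  imports "HOL-Analysis.Analysis"
begin

section \<open>Complex Hilbert spaces\<close>

text \<open>The real part of the complex inner product is the library's \<^const>\<open>inner\<close>, so norm, topology
  and completeness are those of \<^class>\<open>real_inner\<close> and \<^class>\<open>complete_space\<close>. The complex inner
  product is antilinear in its first argument.\<close>

class chilbert_space = real_inner + complete_space +
  fixes scaleC :: "complex \<Rightarrow> 'a \<Rightarrow> 'a" (infixr \<open>*\<^sub>C\<close> 75)
    and cinner :: "'a \<Rightarrow> 'a \<Rightarrow> complex"
  assumes scaleC_add_right: "c *\<^sub>C (x + y) = c *\<^sub>C x + c *\<^sub>C y"
    and scaleC_add_left: "(c + d) *\<^sub>C x = c *\<^sub>C x + d *\<^sub>C x"
    and scaleC_scaleC: "c *\<^sub>C d *\<^sub>C x = (c * d) *\<^sub>C x"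
    and scaleC_of_real: "complex_of_real r *\<^sub>C x = r *\<^sub>R x"
    and cinner_commute: "cinner x y = cnj (cinner y x)"
    and cinner_add_right: "cinner x (y + z) = cinner x y + cinner x z"
    and cinner_scaleC_right: "cinner x (c *\<^sub>C y) = c * cinner x y"
    and Re_cinner: "Re (cinner x y) = inner x y"

lemma cinner_scaleC_left: "cinner (c *\<^sub>C x) y = cnj c * cinner x y"
  for x y :: "'a::chilbert_space"
  by (metis cinner_commute cinner_scaleC_right complex_cnj_mult)

lemma cinner_add_left: "cinner (x + y) z = cinner x z + cinner y z"
  for x y z :: "'a::chilbert_space"
  by (metis cinner_commute cinner_add_right complex_cnj_add)

lemma cinner_scaleR_right: "cinner x (r *\<^sub>R y) = of_real r * cinner x y"
  for x y :: "'a::chilbert_space"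
  by (metis cinner_scaleC_right scaleC_of_real)

lemma cinner_scaleR_left: "cinner (r *\<^sub>R x) y = of_real r * cinner x y"
  for x y :: "'a::chilbert_space"
  by (metis cinner_scaleC_left scaleC_of_real complex_cnj_complex_of_real)

lemma cinner_minus_right: "cinner x (- y) = - cinner x y"
  for x y :: "'a::chilbert_space"
  using cinner_scaleR_right[of x "-1" y] by simp

lemma cinner_minus_left: "cinner (- x) y = - cinner x y"
  for x y :: "'a::chilbert_space"
  using cinner_scaleR_left[of "-1" x y] by simp

lemma cinner_diff_right: "cinner x (y - z) = cinner x y - cinner x z"
  for x y z :: "'a::chilbert_space"
  by (metis cinner_add_right cinner_minus_right diff_conv_add_uminus)

lemma cinner_diff_left: "cinner (x - y) z = cinner x z - cinner y z"
  for x y z :: "'a::chilbert_space"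
  by (metis cinner_add_left cinner_minus_left diff_conv_add_uminus)

lemma cinner_zero_right [simp]: "cinner x 0 = 0" for x :: "'a::chilbert_space"
  using cinner_diff_right[of x 0 0] by simp

lemma cinner_zero_left [simp]: "cinner 0 x = 0" for x :: "'a::chilbert_space"
  using cinner_diff_left[of 0 0 x] by simp

lemma cinner_sum_right: "cinner x (\<Sum>i\<in>A. f i) = (\<Sum>i\<in>A. cinner x (f i))"
  for x :: "'a::chilbert_space"
  by (induction A rule: infinite_finite_induct) (auto simp: cinner_add_right)

lemma cinner_sum_left: "cinner (\<Sum>i\<in>A. f i) x = (\<Sum>i\<in>A. cinner (f i) x)"
  for x :: "'a::chilbert_space"
  by (induction A rule: infinite_finite_induct) (auto simp: cinner_add_left)

lemma cinner_self: "cinner x x = of_real ((norm x)\<^sup>2)" for x :: "'a::chilbert_space"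
proof (rule complex_eqI)
  show "Re (cinner x x) = Re (of_real ((norm x)\<^sup>2))"
    by (simp add: Re_cinner power2_norm_eq_inner)
  have "Im (cinner x x) = - Im (cinner x x)"
    by (metis cinner_commute cnj.simps(2))
  then show "Im (cinner x x) = Im (of_real ((norm x)\<^sup>2))" by simp
qed

lemma norm_scaleC [simp]: "norm (c *\<^sub>C x) = cmod c * norm x" for x :: "'a::chilbert_space"
proof -
  have "complex_of_real ((norm (c *\<^sub>C x))\<^sup>2) = c * cnj c * of_real ((norm x)\<^sup>2)"
    by (metis cinner_self cinner_scaleC_left cinner_scaleC_right mult.assoc)
  also have "c * cnj c = of_real ((cmod c)\<^sup>2)"
    by (metis complex_norm_square)
  finally have "(norm (c *\<^sub>C x))\<^sup>2 = (cmod c * norm x)\<^sup>2"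
    by (metis of_real_eq_iff of_real_mult power_mult_distrib)
  then show ?thesis by (simp add: power2_eq_iff_nonneg)
qed

lemma scaleC_zero_left [simp]: "0 *\<^sub>C x = 0" for x :: "'a::chilbert_space"
  using scaleC_of_real[of 0 x] by simp

lemma scaleC_one [simp]: "1 *\<^sub>C x = x" for x :: "'a::chilbert_space"
  using scaleC_of_real[of 1 x] by simp

lemma scaleC_zero_right [simp]: "c *\<^sub>C 0 = 0" for c :: complex
  by (metis norm_scaleC norm_zero mult_zero_right norm_eq_zero)

lemma Im_cinner: "Im (cinner x y) = - inner x (\<i> *\<^sub>C y)" for x y :: "'a::chilbert_space"
  by (simp add: Re_cinner[symmetric] cinner_scaleC_right)

lemma cinner_polar_Re: "inner x y = ((norm (x + y))\<^sup>2 - (norm (x - y))\<^sup>2) / 4"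
  for x y :: "'a::real_inner"
  by (simp add: power2_norm_eq_inner inner_add inner_diff inner_commute)

section \<open>Orthonormal bases\<close>

definition is_onb :: "'a::chilbert_space set \<Rightarrow> bool" where
  "is_onb B \<longleftrightarrow> (\<forall>e\<in>B. norm e = 1) \<and> (\<forall>e\<in>B. \<forall>e'\<in>B. e \<noteq> e' \<longrightarrow> cinner e e' = 0) \<and>
     (\<forall>x. (\<forall>e\<in>B. cinner e x = 0) \<longrightarrow> x = 0)"

lemma is_onb_exists: "\<exists>B::'a::chilbert_space set. is_onb B"
proof -
  define ON where "ON = {B::'a set. (\<forall>e\<in>B. norm e = 1) \<and>
    (\<forall>e\<in>B. \<forall>e'\<in>B. e \<noteq> e' \<longrightarrow> cinner e e' = 0)}"
  have "\<exists>M\<in>ON. \<forall>X\<in>ON. M \<subseteq> X \<longrightarrow> X = M"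
  proof (rule subset_Zorn_nonempty)
    have "{} \<in> ON" by (simp add: ON_def)
    then show "ON \<noteq> {}" by blast
  next
    fix \<C> assume "\<C> \<noteq> {}" and ch: "subset.chain ON \<C>"
    have sub: "\<C> \<subseteq> ON" using ch by (simp add: subset.chain_def)
    have tot: "A \<subseteq> B \<or> B \<subseteq> A" if "A \<in> \<C>" "B \<in> \<C>" for A B
      using ch that by (auto simp: subset.chain_def)
    have "cinner e e' = 0" if ee: "A \<in> \<C>" "B \<in> \<C>" "e \<in> A" "e' \<in> B" "e \<noteq> e'" for A B e e'
    proof -
      obtain D where "D \<in> \<C>" "e \<in> D" "e' \<in> D" using tot[OF ee(1,2)] ee by blast
      then show ?thesis using sub ee(5) unfolding ON_def by blast
    qed
    then show "\<Union> \<C> \<in> ON" using sub unfolding ON_def by blast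
  qed
  then obtain M where M: "M \<in> ON" and max: "\<And>X. X \<in> ON \<Longrightarrow> M \<subseteq> X \<Longrightarrow> X = M" by blast
  have "x = 0" if x: "\<forall>e\<in>M. cinner e x = 0" for x
  proof (rule ccontr)
    assume "x \<noteq> 0"
    define u where "u = (1 / norm x) *\<^sub>R x"
    have nu: "norm u = 1" using \<open>x \<noteq> 0\<close> by (simp add: u_def)
    have ou: "cinner e u = 0" "cinner u e = 0" if "e \<in> M" for e
      using x that by (simp_all add: u_def cinner_scaleR_right cinner_scaleR_left)
        (metis cinner_commute complex_cnj_zero)
    have "insert u M \<in> ON" using M nu ou by (auto simp: ON_def)
    then have "u \<in> M" using max by blast
    then have "cinner u u = 0" using ou by blast
    then show False using nu by (simp add: cinner_self)
  qed
  then have "is_onb M" using M unfolding is_onb_def ON_def by blast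
  then show ?thesis ..
qed

definition onb :: "'a::chilbert_space set" where
  "onb = (SOME B. is_onb B)"

lemma is_onb_onb: "is_onb onb"
  unfolding onb_def by (rule someI_ex[OF is_onb_exists])

lemma cinner_onb: "e \<in> onb \<Longrightarrow> e' \<in> onb \<Longrightarrow> cinner e e' = (if e = e' then 1 else 0)"
  using is_onb_onb unfolding is_onb_def by (auto simp: cinner_self)

lemma bessel_aux:
  fixes x :: "'a::chilbert_space"
  assumes "finite F" "F \<subseteq> onb"
  defines "P \<equiv> (\<Sum>e\<in>F. cinner e x *\<^sub>C e)"
  shows "cinner P P = of_real (\<Sum>e\<in>F. (cmod (cinner e x))\<^sup>2)"
    and "cinner x P = of_real (\<Sum>e\<in>F. (cmod (cinner e x))\<^sup>2)"
    and "(norm (x - P))\<^sup>2 = (norm x)\<^sup>2 - (\<Sum>e\<in>F. (cmod (cinner e x))\<^sup>2)"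
proof -
  let ?S = "\<Sum>e\<in>F. (cmod (cinner e x))\<^sup>2"
  have sq: "cinner e x * cnj (cinner e x) = of_real ((cmod (cinner e x))\<^sup>2)" for e
    by (metis complex_norm_square)
  show xP: "cinner x P = of_real ?S"
    unfolding P_def cinner_sum_right cinner_scaleC_right of_real_sum
    by (rule sum.cong) (simp, metis cinner_commute sq)
  have eP: "cinner e P = cinner e x" if "e \<in> F" for e
  proof -
    have "cinner e P = (\<Sum>e'\<in>F. cinner e' x * (if e = e' then 1 else 0))"
      unfolding P_def cinner_sum_right cinner_scaleC_right
      by (rule sum.cong) (use that assms(2) in \<open>auto simp: cinner_onb subset_iff\<close>)
    also have "\<dots> = cinner e x" using that assms(1) by (simp add: if_distrib cong: if_cong)
    finally show ?thesis .
  qed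
  have "cinner P P = (\<Sum>e\<in>F. cnj (cinner e x) * cinner e P)"
    by (subst (1) P_def) (simp add: cinner_sum_left cinner_scaleC_left)
  also have "\<dots> = of_real ?S"
    unfolding of_real_sum by (rule sum.cong) (simp_all add: eP sq mult.commute)
  finally show PP: "cinner P P = of_real ?S" .
  have "(norm (x - P))\<^sup>2 = Re (cinner (x - P) (x - P))" by (simp add: cinner_self)
  also have "\<dots> = Re (cinner x x) - Re (cinner x P) - Re (cinner P x) + Re (cinner P P)"
    by (simp add: cinner_diff_left cinner_diff_right)
  also have "Re (cinner P x) = Re (cinner x P)" by (simp add: Re_cinner inner_commute)
  finally show "(norm (x - P))\<^sup>2 = (norm x)\<^sup>2 - ?S"
    by (simp only: xP PP Re_complex_of_real) (simp add: cinner_self)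
qed

lemma parseval_norm:
  fixes x :: "'a::chilbert_space"
  shows "((\<lambda>e. (cmod (cinner e x))\<^sup>2) has_sum (norm x)\<^sup>2) onb"
proof -
  let ?s = "\<lambda>e. (cmod (cinner e x))\<^sup>2"
  have bessel: "sum ?s F \<le> (norm x)\<^sup>2" if "finite F" "F \<subseteq> onb" for F
  proof -
    have "0 \<le> (norm x)\<^sup>2 - sum ?s F" using bessel_aux(3)[OF that, of x] by (metis zero_le_power2)
    then show ?thesis by simp
  qed
  have summ: "?s summable_on onb"
    by (rule nonneg_bdd_above_summable_on) (auto intro!: bdd_aboveI2 bessel)
  then have hs: "(?s has_sum infsum ?s onb) onb" by (rule has_sum_infsum)
  let ?S = "infsum ?s onb"
  have fin_le: "sum ?s F \<le> ?S" if "finite F" "F \<subseteq> onb" for F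
    by (rule finite_sum_le_infsum[OF summ that]) auto
  have "\<exists>F. finite F \<and> F \<subseteq> onb \<and> ?S - inverse (real (Suc n)) < sum ?s F" for n :: nat
  proof -
    have "eventually (\<lambda>F. ?S - inverse (real (Suc n)) < sum ?s F) (finite_subsets_at_top onb)"
      using hs unfolding has_sum_def by (rule order_tendstoD(1)) simp
    then show ?thesis unfolding eventually_finite_subsets_at_top by blast
  qed
  then obtain G where G: "\<And>n. finite (G n)" "\<And>n. G n \<subseteq> onb"
    "\<And>n. ?S - inverse (real (Suc n)) < sum ?s (G n)" by metis
  define F where "F n = (\<Union>i\<le>n. G i)" for n :: nat
  have F: "finite (F n)" "F n \<subseteq> onb" for n using G by (auto simp: F_def)
  have Fmono: "F m \<subseteq> F n" if "m \<le> n" for m n using that by (force simp: F_def)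
  have FS: "?S - inverse (real (Suc n)) < sum ?s (F n)" for n
  proof -
    have "sum ?s (G n) \<le> sum ?s (F n)" by (rule sum_mono2) (auto simp: F_def G)
    then show ?thesis using G(3)[of n] by simp
  qed
  define P where "P n = (\<Sum>e\<in>F n. cinner e x *\<^sub>C e)" for n
  have diff: "(norm (P n - P m))\<^sup>2 \<le> inverse (real (Suc m))" if "m \<le> n" for m n
  proof -
    have "P n - P m = (\<Sum>e\<in>F n - F m. cinner e x *\<^sub>C e)"
      unfolding P_def using F Fmono[OF that] by (simp add: sum_diff)
    then have "cinner (P n - P m) (P n - P m) = of_real (sum ?s (F n - F m))"
      using bessel_aux(1)[of "F n - F m" x] F by auto
    then have "(norm (P n - P m))\<^sup>2 = sum ?s (F n - F m)"
      by (metis cinner_self of_real_eq_iff)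
    also have "\<dots> = sum ?s (F n) - sum ?s (F m)" using F Fmono[OF that] by (simp add: sum_diff)
    also have "\<dots> \<le> inverse (real (Suc m))" using FS[of m] fin_le[OF F, of n] by simp
    finally show ?thesis .
  qed
  have "Cauchy P"
  proof (rule metric_CauchyI)
    fix \<epsilon> :: real assume "\<epsilon> > 0"
    then obtain M where M: "inverse (real (Suc M)) < (\<epsilon> / 2)\<^sup>2"
      using reals_Archimedean[of "(\<epsilon>/2)\<^sup>2"] by auto
    have "norm (P n - P M) < \<epsilon> / 2" if "n \<ge> M" for n
    proof -
      have "(norm (P n - P M))\<^sup>2 < (\<epsilon> / 2)\<^sup>2" using diff[OF that] M by linarith
      then show ?thesis by (rule power_less_imp_less_base) (use \<open>\<epsilon> > 0\<close> in simp)
    qed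
    then have "dist (P m) (P n) < \<epsilon>" if "m \<ge> M" "n \<ge> M" for m n
      using that dist_triangle_half_l[of "P m" "P M" \<epsilon> "P n"] by (simp only: dist_norm)
    then show "\<exists>M. \<forall>m\<ge>M. \<forall>n\<ge>M. dist (P m) (P n) < \<epsilon>" by blast
  qed
  then obtain p where p: "P \<longlonglongrightarrow> p" using Cauchy_convergent convergent_def by blast
  have cin: "(\<lambda>n. cinner e (P n)) \<longlonglongrightarrow> cinner e p" for e
  proof -
    have "bounded_linear (\<lambda>y. cinner e y)"
    proof (rule bounded_linear_intro)
      show "cinner e (y + z) = cinner e y + cinner e z" for y z by (rule cinner_add_right)
      show "cinner e (r *\<^sub>R y) = r *\<^sub>R cinner e y" for r y
        by (simp add: cinner_scaleR_right scaleR_conv_of_real)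
      show "norm (cinner e y) \<le> norm y * (2 * norm e)" for y
      proof -
        have "norm (cinner e y) \<le> \<bar>Re (cinner e y)\<bar> + \<bar>Im (cinner e y)\<bar>" by (rule cmod_le)
        also have "\<dots> \<le> norm e * norm y + norm e * norm (\<i> *\<^sub>C y)"
          using Cauchy_Schwarz_ineq2[of e y] Cauchy_Schwarz_ineq2[of e "\<i> *\<^sub>C y"]
          by (simp add: Re_cinner Im_cinner)
        finally show ?thesis by (simp add: algebra_simps)
      qed
    qed
    then show ?thesis using p by (rule bounded_linear.tendsto)
  qed
  have "cinner e (x - p) = 0" if e: "e \<in> onb" for e
  proof -
    have "(\<lambda>n. cinner e (P n)) \<longlonglongrightarrow> cinner e x"
    proof (cases "\<exists>m. e \<in> F m")
      case True
      then obtain m where m: "e \<in> F m" ..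
      have "cinner e (P n) = cinner e x" if "n \<ge> m" for n
      proof -
        have en: "e \<in> F n" using m Fmono that by blast
        have "cinner e (P n) = (\<Sum>e'\<in>F n. cinner e' x * (if e = e' then 1 else 0))"
          unfolding P_def cinner_sum_right cinner_scaleC_right
          by (rule sum.cong) (use e F(2)[of n] in \<open>auto simp: cinner_onb subset_iff\<close>)
        also have "\<dots> = cinner e x" using en F(1) by (simp add: if_distrib cong: if_cong)
        finally show ?thesis .
      qed
      then show ?thesis by (intro tendsto_eventually) (auto simp: eventually_sequentially)
    next
      case False
      have "?s e \<le> inverse (real (Suc n))" for n
      proof -
        have "sum ?s (insert e (F n)) \<le> ?S" using F e by (intro fin_le) auto
        then show ?thesis using False F(1)[of n] FS[of n] by auto
      qed
      then have "?s e \<le> 0"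
        using LIMSEQ_le_const[OF LIMSEQ_inverse_real_of_nat] by blast
      then have ex: "cinner e x = 0" by simp
      have "cinner e (P n) = 0" for n
        unfolding P_def cinner_sum_right cinner_scaleC_right
        by (rule sum.neutral) (use e F(2)[of n] False in \<open>auto simp: cinner_onb subset_iff\<close>)
      then show ?thesis using ex by simp
    qed
    then have "cinner e p = cinner e x" using cin[of e] LIMSEQ_unique by blast
    then show ?thesis by (simp add: cinner_diff_right)
  qed
  then have "x - p = 0" using is_onb_onb unfolding is_onb_def by blast
  then have xp: "P \<longlonglongrightarrow> x" using p by simp
  have "(\<lambda>n. (norm (P n))\<^sup>2) \<longlonglongrightarrow> (norm x)\<^sup>2" by (intro tendsto_intros xp)
  moreover have "(norm (P n))\<^sup>2 = sum ?s (F n)" for n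
    using bessel_aux(1)[OF F, of x n] unfolding P_def[symmetric] by (metis cinner_self of_real_eq_iff)
  ultimately have "(\<lambda>n. sum ?s (F n)) \<longlonglongrightarrow> (norm x)\<^sup>2" by simp
  then have "(norm x)\<^sup>2 \<le> ?S" by (rule LIMSEQ_le_const2) (use fin_le[OF F] in blast)
  moreover have "?S \<le> (norm x)\<^sup>2" by (rule infsum_le_finite_sums[OF summ]) (rule bessel)
  ultimately show ?thesis using hs by simp
qed

lemma parseval:
  fixes x y :: "'a::chilbert_space"
  shows "((\<lambda>e. cinner x e * cinner e y) has_sum cinner x y) onb"
proof -
  have re: "((\<lambda>e. Re (cinner u e * cinner e v)) has_sum inner u v) onb" for u v :: 'a
  proof -
    have "((\<lambda>e. (1/4) * ((cmod (cinner e (u + v)))\<^sup>2 + - (cmod (cinner e (u - v)))\<^sup>2))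
       has_sum (1/4) * ((norm (u + v))\<^sup>2 + - (norm (u - v))\<^sup>2)) onb"
      by (intro has_sum_cmult_right has_sum_add has_sum_uminusI parseval_norm)
    moreover have "(1/4) * ((cmod (cinner e (u + v)))\<^sup>2 + - (cmod (cinner e (u - v)))\<^sup>2) =
        Re (cinner u e * cinner e v)" for e
    proof -
      have "cinner u e = cnj (cinner e u)" by (rule cinner_commute)
      then show ?thesis
        unfolding cinner_add_right cinner_diff_right cmod_power2
        by (simp add: power2_eq_square algebra_simps)
    qed
    ultimately have "((\<lambda>e. Re (cinner u e * cinner e v)) has_sum
        (1/4) * ((norm (u + v))\<^sup>2 + - (norm (u - v))\<^sup>2)) onb" by (simp only:)
    then show ?thesis by (simp add: cinner_polar_Re)
  qed
  have im: "((\<lambda>e. Im (cinner x e * cinner e y)) has_sum Im (cinner x y)) onb"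
  proof -
    have "((\<lambda>e. - Re (cinner x e * cinner e (\<i> *\<^sub>C y))) has_sum - inner x (\<i> *\<^sub>C y)) onb"
      by (intro has_sum_uminusI re)
    then show ?thesis by (simp add: Im_cinner cinner_scaleC_right algebra_simps)
  qed
  have "((\<lambda>e. of_real (Re (cinner x e * cinner e y)) + \<i> * of_real (Im (cinner x e * cinner e y)))
      has_sum of_real (Re (cinner x y)) + \<i> * of_real (Im (cinner x y))) onb"
    by (intro has_sum_add has_sum_cmult_right has_sum_of_real im) (simp only: Re_cinner re)
  then show ?thesis by (simp only: complex_eq[symmetric])
qed

section \<open>The Hilbert space tensor product\<close>

text \<open>The Hilbert space tensor product is realised as the \<open>\<ell>\<^sup>2\<close>-direct sum of copies of the second
  factor, indexed by an orthonormal basis of the first. The lemmas \<open>cinner_tensor\<close> and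
  \<open>closure_span_tensor\<close> below are its two characteristic properties; they determine it, with the
  bilinear map \<open>(x, y) \<mapsto> x \<otimes> y\<close>, up to a unique unitary.\<close>

typedef (overloaded) ('a::chilbert_space, 'b::chilbert_space) htensor (infixr \<open>\<otimes>\<^sub>H\<close> 75) =
  "{f :: 'a \<Rightarrow> 'b. (\<forall>e. e \<notin> onb \<longrightarrow> f e = 0) \<and> (\<lambda>e. (norm (f e))\<^sup>2) summable_on onb}"
  morphisms coord Abs_htensor
  by (rule exI[of _ "\<lambda>_. 0"]) (simp add: summable_on_0)

setup_lifting type_definition_htensor

lemma cmod_cinner_le: "cmod (cinner x y) \<le> (norm x)\<^sup>2 + (norm y)\<^sup>2" for x y :: "'a::chilbert_space"
proof -
  have "cmod (cinner x y) \<le> \<bar>Re (cinner x y)\<bar> + \<bar>Im (cinner x y)\<bar>" by (rule cmod_le)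
  also have "\<dots> \<le> norm x * norm y + norm x * norm (\<i> *\<^sub>C y)"
    using Cauchy_Schwarz_ineq2[of x y] Cauchy_Schwarz_ineq2[of x "\<i> *\<^sub>C y"]
    by (simp add: Re_cinner Im_cinner)
  also have "\<dots> \<le> (norm x)\<^sup>2 + (norm y)\<^sup>2"
    using sum_squares_bound[of "norm x" "norm y"] by simp
  finally show ?thesis .
qed

lemma norm_add_sq_le: "(norm (x + y))\<^sup>2 \<le> 2 * (norm x)\<^sup>2 + 2 * (norm y)\<^sup>2"
  for x y :: "'a::real_normed_vector"
proof -
  have "(norm (x + y))\<^sup>2 \<le> (norm x + norm y)\<^sup>2" by (simp add: norm_triangle_ineq)
  also have "\<dots> \<le> 2 * (norm x)\<^sup>2 + 2 * (norm y)\<^sup>2"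
    using sum_squares_bound[of "norm x" "norm y"] by (simp add: power2_sum)
  finally show ?thesis .
qed

lemma summable_on_bound:
  fixes f :: "'a \<Rightarrow> 'b::banach" and g :: "'a \<Rightarrow> real"
  assumes "g summable_on A" "\<And>x. x \<in> A \<Longrightarrow> norm (f x) \<le> g x"
  shows "f summable_on A"
proof (rule abs_summable_summable)
  show "(\<lambda>x. norm (f x)) summable_on A"
    by (rule summable_on_comparison_test[OF assms]) auto
qed

lemma coord_summable: "(\<lambda>e. (norm (coord f e))\<^sup>2) summable_on onb"
  using coord[of f] by blast

lemma coord_outside: "e \<notin> onb \<Longrightarrow> coord f e = 0"
  using coord[of f] by blast

lemma cinner_coord_summable: "(\<lambda>e. cinner (coord f e) (coord g e)) summable_on onb"
  by (rule summable_on_bound[OF summable_on_add[OF coord_summable[of f] coord_summable[of g]]])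
    (rule cmod_cinner_le)

lemma inner_coord_summable: "(\<lambda>e. inner (coord f e) (coord g e)) summable_on onb"
  using summable_on_Re[OF cinner_coord_summable[of f g]] by (simp add: Re_cinner)

instantiation htensor :: (chilbert_space, chilbert_space) real_inner
begin

lift_definition zero_htensor :: "'a \<otimes>\<^sub>H 'b" is "\<lambda>_. 0"
  by (simp add: summable_on_0)

lift_definition plus_htensor :: "'a \<otimes>\<^sub>H 'b \<Rightarrow> 'a \<otimes>\<^sub>H 'b \<Rightarrow> 'a \<otimes>\<^sub>H 'b" is "\<lambda>f g e. f e + g e"
proof -
  fix f g :: "'a \<Rightarrow> 'b"
  assume f: "(\<forall>e. e \<notin> onb \<longrightarrow> f e = 0) \<and> (\<lambda>e. (norm (f e))\<^sup>2) summable_on onb"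
    and g: "(\<forall>e. e \<notin> onb \<longrightarrow> g e = 0) \<and> (\<lambda>e. (norm (g e))\<^sup>2) summable_on onb"
  have "(\<lambda>e. 2 * (norm (f e))\<^sup>2 + 2 * (norm (g e))\<^sup>2) summable_on onb"
    using f g by (intro summable_on_add summable_on_cmult_right) auto
  then have "(\<lambda>e. (norm (f e + g e))\<^sup>2) summable_on onb"
    by (rule summable_on_bound) (simp add: norm_add_sq_le)
  then show "(\<forall>e. e \<notin> onb \<longrightarrow> f e + g e = 0) \<and> (\<lambda>e. (norm (f e + g e))\<^sup>2) summable_on onb"
    using f g by simp
qed

lift_definition scaleR_htensor :: "real \<Rightarrow> 'a \<otimes>\<^sub>H 'b \<Rightarrow> 'a \<otimes>\<^sub>H 'b" is "\<lambda>r f e. r *\<^sub>R f e"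
  by (simp add: power_mult_distrib summable_on_cmult_right)

lift_definition uminus_htensor :: "'a \<otimes>\<^sub>H 'b \<Rightarrow> 'a \<otimes>\<^sub>H 'b" is "\<lambda>f e. - f e"
  by simp

definition minus_htensor :: "'a \<otimes>\<^sub>H 'b \<Rightarrow> 'a \<otimes>\<^sub>H 'b \<Rightarrow> 'a \<otimes>\<^sub>H 'b" where
  "minus_htensor f g = f + - g"

definition inner_htensor :: "'a \<otimes>\<^sub>H 'b \<Rightarrow> 'a \<otimes>\<^sub>H 'b \<Rightarrow> real" where
  "inner_htensor f g = infsum (\<lambda>e. inner (coord f e) (coord g e)) onb"

definition norm_htensor :: "'a \<otimes>\<^sub>H 'b \<Rightarrow> real" where
  "norm_htensor f = sqrt (inner f f)"

definition sgn_htensor :: "'a \<otimes>\<^sub>H 'b \<Rightarrow> 'a \<otimes>\<^sub>H 'b" where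
  "sgn_htensor f = inverse (norm f) *\<^sub>R f"

definition dist_htensor :: "'a \<otimes>\<^sub>H 'b \<Rightarrow> 'a \<otimes>\<^sub>H 'b \<Rightarrow> real" where
  "dist_htensor f g = norm (f - g)"

definition uniformity_htensor :: "(('a \<otimes>\<^sub>H 'b) \<times> ('a \<otimes>\<^sub>H 'b)) filter" where
  "uniformity_htensor = (INF \<epsilon>\<in>{0<..}. principal {(f, g). dist f g < \<epsilon>})"

definition open_htensor :: "('a \<otimes>\<^sub>H 'b) set \<Rightarrow> bool" where
  "open_htensor U \<longleftrightarrow> (\<forall>f\<in>U. \<forall>\<^sub>F (f', g) in uniformity. f' = f \<longrightarrow> g \<in> U)"

instance
proof
  fix f g h :: "'a \<otimes>\<^sub>H 'b" and r s :: real and U :: "('a \<otimes>\<^sub>H 'b) set"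
  show "f + g + h = f + (g + h)" by transfer (simp add: add.assoc)
  show "f + g = g + f" by transfer (simp add: add.commute)
  show "0 + f = f" by transfer simp
  show "- f + f = 0" by transfer simp
  show "f - g = f + - g" by (rule minus_htensor_def)
  show "r *\<^sub>R (f + g) = r *\<^sub>R f + r *\<^sub>R g" by transfer (simp add: scaleR_add_right)
  show "(r + s) *\<^sub>R f = r *\<^sub>R f + s *\<^sub>R f" by transfer (simp add: scaleR_add_left)
  show "r *\<^sub>R s *\<^sub>R f = (r * s) *\<^sub>R f" by transfer simp
  show "1 *\<^sub>R f = f" by transfer simp
  show "sgn f = inverse (norm f) *\<^sub>R f" by (rule sgn_htensor_def)
  show "dist f g = norm (f - g)" by (rule dist_htensor_def)
  show "(uniformity :: (('a \<otimes>\<^sub>H 'b) \<times> ('a \<otimes>\<^sub>H 'b)) filter) = (INF \<epsilon>\<in>{0<..}. principal {(f, g). dist f g < \<epsilon>})"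
    by (rule uniformity_htensor_def)
  show "open U \<longleftrightarrow> (\<forall>f\<in>U. \<forall>\<^sub>F (f', g) in uniformity. f' = f \<longrightarrow> g \<in> U)"
    by (rule open_htensor_def)
  show "inner f g = inner g f" unfolding inner_htensor_def by (simp add: inner_commute)
  show "inner (f + g) h = inner f h + inner g h"
    unfolding inner_htensor_def plus_htensor.rep_eq inner_add_left
    by (rule infsum_add) (rule inner_coord_summable)+
  show "inner (r *\<^sub>R f) g = r * inner f g"
    unfolding inner_htensor_def scaleR_htensor.rep_eq inner_scaleR_left
    by (rule infsum_cmult_right')
  show "0 \<le> inner f f" unfolding inner_htensor_def by (rule infsum_nonneg) simp
  show "inner f f = 0 \<longleftrightarrow> f = 0"
  proof
    assume "inner f f = 0"
    then have "inner (coord f e) (coord f e) = 0" if "e \<in> onb" for e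
      using nonneg_infsum_le_0D[OF _ inner_coord_summable[of f f] _ that]
      unfolding inner_htensor_def by simp
    then have "coord f e = 0" for e using coord_outside[of e f] by (cases "e \<in> onb") auto
    then show "f = 0" by transfer auto
  next
    assume "f = 0"
    then show "inner f f = 0" unfolding inner_htensor_def by (simp add: zero_htensor.rep_eq)
  qed
  show "norm f = sqrt (inner f f)" by (rule norm_htensor_def)
qed

end

lemma coord_add: "coord (f + g) e = coord f e + coord g e"
  by (rule fun_cong[OF plus_htensor.rep_eq])

lemma coord_zero: "coord 0 e = 0"
  by (rule fun_cong[OF zero_htensor.rep_eq])

lemma coord_diff: "coord (f - g) e = coord f e - coord g e"
  unfolding minus_htensor_def coord_add uminus_htensor.rep_eq by simp

lemma coord_sum: "coord (\<Sum>i\<in>A. f i) e = (\<Sum>i\<in>A. coord (f i) e)"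
  by (induction A rule: infinite_finite_induct) (auto simp: coord_add coord_zero)

lemma norm_htensor_sq: "(norm f)\<^sup>2 = infsum (\<lambda>e. (norm (coord f e))\<^sup>2) onb"
  by (simp add: power2_norm_eq_inner inner_htensor_def)

lemma norm_coord_le: "norm (coord f e) \<le> norm f"
proof (cases "e \<in> onb")
  case True
  have "(\<Sum>e\<in>{e}. (norm (coord f e))\<^sup>2) \<le> infsum (\<lambda>e. (norm (coord f e))\<^sup>2) onb"
    by (rule finite_sum_le_infsum) (use True in \<open>auto intro: coord_summable\<close>)
  then show ?thesis by (simp add: norm_htensor_sq[symmetric])
qed (simp add: coord_outside)

lemma sum_coord_le: "finite S \<Longrightarrow> S \<subseteq> onb \<Longrightarrow> (\<Sum>e\<in>S. (norm (coord f e))\<^sup>2) \<le> (norm f)\<^sup>2"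
  unfolding norm_htensor_sq by (rule finite_sum_le_infsum[OF coord_summable]) auto

instance htensor :: (chilbert_space, chilbert_space) complete_space
proof
  fix F :: "nat \<Rightarrow> 'a \<otimes>\<^sub>H 'b"
  assume F: "Cauchy F"
  have "Cauchy (\<lambda>n. coord (F n) e)" for e
  proof (rule metric_CauchyI)
    fix \<epsilon> :: real assume "\<epsilon> > 0"
    then obtain M where M: "\<forall>m\<ge>M. \<forall>n\<ge>M. dist (F m) (F n) < \<epsilon>" using metric_CauchyD[OF F] by blast
    have "dist (coord (F m) e) (coord (F n) e) \<le> dist (F m) (F n)" for m n
      unfolding dist_norm coord_diff[symmetric] by (rule norm_coord_le)
    then show "\<exists>M. \<forall>m\<ge>M. \<forall>n\<ge>M. dist (coord (F m) e) (coord (F n) e) < \<epsilon>"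
      using M le_less_trans by blast
  qed
  then have "\<exists>l. (\<lambda>n. coord (F n) e) \<longlonglongrightarrow> l" for e
    using Cauchy_convergent convergent_def by blast
  then obtain g where g: "\<And>e. (\<lambda>n. coord (F n) e) \<longlonglongrightarrow> g e" by metis
  have g0: "g e = 0" if "e \<notin> onb" for e
    using g[of e] that by (simp add: coord_outside LIMSEQ_const_iff)
  have close: "\<exists>M. \<forall>n\<ge>M. \<forall>S. finite S \<longrightarrow> S \<subseteq> onb \<longrightarrow> (\<Sum>e\<in>S. (norm (coord (F n) e - g e))\<^sup>2) \<le> \<epsilon>\<^sup>2"
    if "\<epsilon> > 0" for \<epsilon> :: real
  proof -
    obtain M where M: "\<forall>m\<ge>M. \<forall>n\<ge>M. dist (F m) (F n) < \<epsilon>" using metric_CauchyD[OF F \<open>\<epsilon> > 0\<close>] by blast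
    have "(\<Sum>e\<in>S. (norm (coord (F n) e - g e))\<^sup>2) \<le> \<epsilon>\<^sup>2" if "n \<ge> M" "finite S" "S \<subseteq> onb" for n S
    proof (rule LIMSEQ_le_const2)
      show "(\<lambda>m. \<Sum>e\<in>S. (norm (coord (F n) e - coord (F m) e))\<^sup>2) \<longlonglongrightarrow> (\<Sum>e\<in>S. (norm (coord (F n) e - g e))\<^sup>2)"
        by (intro tendsto_intros g)
      have "(\<Sum>e\<in>S. (norm (coord (F n) e - coord (F m) e))\<^sup>2) \<le> \<epsilon>\<^sup>2" if "m \<ge> M" for m
      proof -
        have "(\<Sum>e\<in>S. (norm (coord (F n) e - coord (F m) e))\<^sup>2) \<le> (norm (F n - F m))\<^sup>2"
          using sum_coord_le[OF \<open>finite S\<close> \<open>S \<subseteq> onb\<close>, of "F n - F m"] by (simp only: coord_diff)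
        also have "\<dots> \<le> \<epsilon>\<^sup>2" using M \<open>n \<ge> M\<close> \<open>m \<ge> M\<close> by (intro power_mono) (auto simp: dist_norm less_imp_le)
        finally show ?thesis .
      qed
      then show "\<exists>N. \<forall>m\<ge>N. (\<Sum>e\<in>S. (norm (coord (F n) e - coord (F m) e))\<^sup>2) \<le> \<epsilon>\<^sup>2" by blast
    qed
    then show ?thesis by blast
  qed
  have diffs: "(\<lambda>e. (norm (coord (F n) e - g e))\<^sup>2) summable_on onb"
    if "\<forall>S. finite S \<longrightarrow> S \<subseteq> onb \<longrightarrow> (\<Sum>e\<in>S. (norm (coord (F n) e - g e))\<^sup>2) \<le> c" for n c
    by (rule nonneg_bdd_above_summable_on) (use that in \<open>auto intro!: bdd_aboveI2[of _ _ c]\<close>)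
  obtain M where M: "\<forall>n\<ge>M. \<forall>S. finite S \<longrightarrow> S \<subseteq> onb \<longrightarrow> (\<Sum>e\<in>S. (norm (coord (F n) e - g e))\<^sup>2) \<le> 1\<^sup>2"
    using close[of 1] by auto
  have "(\<lambda>e. (norm (coord (F M) e - g e))\<^sup>2) summable_on onb"
    by (rule diffs[of M "1\<^sup>2"]) (rule M[THEN spec, THEN mp, OF order_refl])
  then have "(\<lambda>e. 2 * (norm (coord (F M) e))\<^sup>2 + 2 * (norm (coord (F M) e - g e))\<^sup>2) summable_on onb"
    by (intro summable_on_add summable_on_cmult_right coord_summable)
  then have "(\<lambda>e. (norm (g e))\<^sup>2) summable_on onb"
  proof (rule summable_on_bound)
    fix e
    show "norm ((norm (g e))\<^sup>2) \<le> 2 * (norm (coord (F M) e))\<^sup>2 + 2 * (norm (coord (F M) e - g e))\<^sup>2"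
      using norm_add_sq_le[of "coord (F M) e" "- (coord (F M) e - g e)"] by (simp add: norm_minus_commute)
  qed
  then obtain G where G: "coord G = g"
    using g0 Abs_htensor_inverse[of g] by auto
  have "F \<longlonglongrightarrow> G"
  proof (rule metric_LIMSEQ_I)
    fix \<epsilon> :: real assume "\<epsilon> > 0"
    then obtain M where M: "\<forall>n\<ge>M. \<forall>S. finite S \<longrightarrow> S \<subseteq> onb \<longrightarrow> (\<Sum>e\<in>S. (norm (coord (F n) e - g e))\<^sup>2) \<le> (\<epsilon>/2)\<^sup>2"
      using close[of "\<epsilon>/2"] by auto
    have "dist (F n) G < \<epsilon>" if "n \<ge> M" for n
    proof -
      have "(norm (F n - G))\<^sup>2 \<le> (\<epsilon>/2)\<^sup>2"
        unfolding norm_htensor_sq coord_diff G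
      proof (rule infsum_le_finite_sums)
        show "(\<lambda>e. (norm (coord (F n) e - g e))\<^sup>2) summable_on onb"
          by (rule diffs[of n "(\<epsilon>/2)\<^sup>2"]) (rule M[THEN spec, THEN mp, OF that])
        show "(\<Sum>e\<in>S. (norm (coord (F n) e - g e))\<^sup>2) \<le> (\<epsilon>/2)\<^sup>2" if "finite S" "S \<subseteq> onb" for S
          by (rule M[THEN spec, THEN mp, OF \<open>n \<ge> M\<close>, THEN spec, THEN mp, THEN mp, OF that])
      qed
      then have "norm (F n - G) \<le> \<epsilon>/2" using \<open>\<epsilon> > 0\<close> by (simp add: power2_le_iff_abs_le)
      then show ?thesis using \<open>\<epsilon> > 0\<close> by (simp add: dist_norm)
    qed
    then show "\<exists>M. \<forall>n\<ge>M. dist (F n) G < \<epsilon>" by blast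
  qed
  then show "convergent F" unfolding convergent_def by blast
qed

instantiation htensor :: (chilbert_space, chilbert_space) chilbert_space
begin

lift_definition scaleC_htensor :: "complex \<Rightarrow> 'a \<otimes>\<^sub>H 'b \<Rightarrow> 'a \<otimes>\<^sub>H 'b" is "\<lambda>c f e. c *\<^sub>C f e"
  by (simp add: power_mult_distrib summable_on_cmult_right)

definition cinner_htensor :: "'a \<otimes>\<^sub>H 'b \<Rightarrow> 'a \<otimes>\<^sub>H 'b \<Rightarrow> complex" where
  "cinner_htensor f g = infsum (\<lambda>e. cinner (coord f e) (coord g e)) onb"

instance
proof
  fix f g h :: "'a \<otimes>\<^sub>H 'b" and r :: real and c d :: complex
  show "c *\<^sub>C (f + g) = c *\<^sub>C f + c *\<^sub>C g" by transfer (simp add: scaleC_add_right)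
  show "(c + d) *\<^sub>C f = c *\<^sub>C f + d *\<^sub>C f" by transfer (simp add: scaleC_add_left)
  show "c *\<^sub>C d *\<^sub>C f = (c * d) *\<^sub>C f" by transfer (simp add: scaleC_scaleC)
  show "complex_of_real r *\<^sub>C f = r *\<^sub>R f" by transfer (simp add: scaleC_of_real)
  show "cinner f g = cnj (cinner g f)"
    unfolding cinner_htensor_def infsum_cnj[symmetric]
    by (rule infsum_cong) (rule cinner_commute)
  show "cinner f (g + h) = cinner f g + cinner f h"
    unfolding cinner_htensor_def plus_htensor.rep_eq cinner_add_right
    by (rule infsum_add) (rule cinner_coord_summable)+
  show "cinner f (c *\<^sub>C g) = c * cinner f g"
    unfolding cinner_htensor_def scaleC_htensor.rep_eq cinner_scaleC_right
    by (rule infsum_cmult_right')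
  show "Re (cinner f g) = inner f g"
    unfolding cinner_htensor_def inner_htensor_def infsum_Re[OF cinner_coord_summable, symmetric]
    by (simp add: Re_cinner)
qed

end

lift_definition tensor :: "'a::chilbert_space \<Rightarrow> 'b::chilbert_space \<Rightarrow> 'a \<otimes>\<^sub>H 'b" (infixr \<open>\<otimes>\<close> 75)
  is "\<lambda>x y e. if e \<in> onb then cinner e x *\<^sub>C y else 0"
proof -
  fix x :: 'a and y :: 'b
  have "(\<lambda>e. (cmod (cinner e x))\<^sup>2 * (norm y)\<^sup>2) summable_on onb"
    using parseval_norm[of x] by (intro summable_on_cmult_left) (rule has_sum_imp_summable)
  also have "?this \<longleftrightarrow> (\<lambda>e. (norm (if e \<in> onb then cinner e x *\<^sub>C y else 0))\<^sup>2) summable_on onb"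
    by (rule summable_on_cong) (simp add: power_mult_distrib)
  finally show "(\<forall>e. e \<notin> onb \<longrightarrow> (if e \<in> onb then cinner e x *\<^sub>C y else 0) = 0) \<and>
     (\<lambda>e. (norm (if e \<in> onb then cinner e x *\<^sub>C y else 0))\<^sup>2) summable_on onb" by simp
qed

lemma tensor_add_left: "(x + x') \<otimes> y = x \<otimes> y + x' \<otimes> y"
  by transfer (auto simp: cinner_add_right scaleC_add_left)

lemma tensor_add_right: "x \<otimes> (y + y') = x \<otimes> y + x \<otimes> y'"
  by transfer (auto simp: scaleC_add_right)

lemma tensor_scaleC_left: "(c *\<^sub>C x) \<otimes> y = c *\<^sub>C (x \<otimes> y)"
  by transfer (auto simp: cinner_scaleC_right scaleC_scaleC)

lemma tensor_scaleC_right: "x \<otimes> (c *\<^sub>C y) = c *\<^sub>C (x \<otimes> y)"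
  by transfer (auto simp: scaleC_scaleC mult.commute)

theorem cinner_tensor: "cinner (x \<otimes> y) (x' \<otimes> y') = cinner x x' * cinner y y'"
proof -
  have "cinner (x \<otimes> y) (x' \<otimes> y') = infsum (\<lambda>e. (cinner x e * cinner e x') * cinner y y') onb"
    unfolding cinner_htensor_def tensor.rep_eq
    by (rule infsum_cong)
      (simp add: cinner_scaleC_left cinner_scaleC_right cinner_commute[of x] mult.assoc)
  also have "\<dots> = cinner x x' * cinner y y'"
    using parseval[of x x'] by (simp add: infsum_cmult_left' infsumI)
  finally show ?thesis .
qed

theorem closure_span_tensor: "closure (span {x \<otimes> y |x y. True}) = (UNIV :: ('a::chilbert_space \<otimes>\<^sub>H 'b::chilbert_space) set)"
proof -
  have "f \<in> closure (span {x \<otimes> y |x y. True})" for f :: "'a \<otimes>\<^sub>H 'b"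
    unfolding closure_approachable
  proof (intro allI impI)
    fix \<epsilon> :: real assume "\<epsilon> > 0"
    let ?s = "\<lambda>e. (norm (coord f e))\<^sup>2"
    have hs: "(?s has_sum (norm f)\<^sup>2) onb"
      unfolding norm_htensor_sq by (rule has_sum_infsum[OF coord_summable])
    have "eventually (\<lambda>F. (norm f)\<^sup>2 - \<epsilon>\<^sup>2 < sum ?s F) (finite_subsets_at_top onb)"
      using hs unfolding has_sum_def by (rule order_tendstoD(1)) (use \<open>\<epsilon> > 0\<close> in simp)
    then obtain F where F: "finite F" "F \<subseteq> onb" "(norm f)\<^sup>2 - \<epsilon>\<^sup>2 < sum ?s F"
      unfolding eventually_finite_subsets_at_top by blast
    define p where "p = (\<Sum>e\<in>F. e \<otimes> coord f e)"
    have cp: "coord p e = (if e \<in> F then coord f e else 0)" for e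
    proof -
      have "coord p e = (\<Sum>e'\<in>F. if e = e' then coord f e' else 0)"
        unfolding p_def coord_sum tensor.rep_eq
        by (rule sum.cong) (use F(2) in \<open>auto simp: cinner_onb subset_iff\<close>)
      then show ?thesis using F(1) by simp
    qed
    have "(norm (f - p))\<^sup>2 = infsum ?s (onb - F)"
      unfolding norm_htensor_sq coord_diff cp
      by (rule infsum_cong_neutral) auto
    also have "\<dots> = infsum ?s onb - sum ?s F"
      using infsum_Diff[OF coord_summable[of f] summable_on_finite[OF F(1)] F(2), of ] F(1)
      by simp
    also have "\<dots> < \<epsilon>\<^sup>2" using F(3) by (simp add: norm_htensor_sq)
    finally have "norm (f - p) < \<epsilon>"
      by (rule power_less_imp_less_base) (use \<open>\<epsilon> > 0\<close> in simp)
    moreover have "p \<in> span {x \<otimes> y |x y. True}"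
      unfolding p_def by (intro span_sum span_base) blast
    ultimately show "\<exists>q\<in>span {x \<otimes> y |x y. True}. dist q f < \<epsilon>"
      by (auto simp: dist_norm norm_minus_commute)
  qed
  then show ?thesis by blast
qed

section \<open>The complex-conjugate Hilbert space\<close>

typedef (overloaded) 'a hconj = "UNIV :: 'a::chilbert_space set"
  morphisms unbar bar ..

setup_lifting type_definition_hconj

instantiation hconj :: (chilbert_space) real_inner
begin

lift_definition zero_hconj :: "'a hconj" is 0 .
lift_definition plus_hconj :: "'a hconj \<Rightarrow> 'a hconj \<Rightarrow> 'a hconj" is "(+)" .
lift_definition minus_hconj :: "'a hconj \<Rightarrow> 'a hconj \<Rightarrow> 'a hconj" is "(-)" .
lift_definition uminus_hconj :: "'a hconj \<Rightarrow> 'a hconj" is uminus .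
lift_definition scaleR_hconj :: "real \<Rightarrow> 'a hconj \<Rightarrow> 'a hconj" is "(*\<^sub>R)" .
lift_definition inner_hconj :: "'a hconj \<Rightarrow> 'a hconj \<Rightarrow> real" is inner .
lift_definition norm_hconj :: "'a hconj \<Rightarrow> real" is norm .
lift_definition sgn_hconj :: "'a hconj \<Rightarrow> 'a hconj" is sgn .
lift_definition dist_hconj :: "'a hconj \<Rightarrow> 'a hconj \<Rightarrow> real" is dist .

definition uniformity_hconj :: "('a hconj \<times> 'a hconj) filter" where
  "uniformity_hconj = (INF \<epsilon>\<in>{0<..}. principal {(x, y). dist x y < \<epsilon>})"

definition open_hconj :: "'a hconj set \<Rightarrow> bool" where
  "open_hconj U \<longleftrightarrow> (\<forall>x\<in>U. \<forall>\<^sub>F (x', y) in uniformity. x' = x \<longrightarrow> y \<in> U)"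

instance
proof
  fix x y z :: "'a hconj" and r s :: real and U :: "'a hconj set"
  show "x + y + z = x + (y + z)" by transfer (simp add: add.assoc)
  show "x + y = y + x" by transfer (simp add: add.commute)
  show "0 + x = x" by transfer simp
  show "- x + x = 0" by transfer simp
  show "x - y = x + - y" by transfer simp
  show "r *\<^sub>R (x + y) = r *\<^sub>R x + r *\<^sub>R y" by transfer (simp add: scaleR_add_right)
  show "(r + s) *\<^sub>R x = r *\<^sub>R x + s *\<^sub>R x" by transfer (simp add: scaleR_add_left)
  show "r *\<^sub>R s *\<^sub>R x = (r * s) *\<^sub>R x" by transfer simp
  show "1 *\<^sub>R x = x" by transfer simp
  show "sgn x = inverse (norm x) *\<^sub>R x" by transfer (rule sgn_div_norm)
  show "dist x y = norm (x - y)" by transfer (rule dist_norm)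
  show "(uniformity :: ('a hconj \<times> 'a hconj) filter) = (INF \<epsilon>\<in>{0<..}. principal {(x, y). dist x y < \<epsilon>})"
    by (rule uniformity_hconj_def)
  show "open U \<longleftrightarrow> (\<forall>x\<in>U. \<forall>\<^sub>F (x', y) in uniformity. x' = x \<longrightarrow> y \<in> U)"
    by (rule open_hconj_def)
  show "inner x y = inner y x" by transfer (rule inner_commute)
  show "inner (x + y) z = inner x z + inner y z" by transfer (rule inner_add_left)
  show "inner (r *\<^sub>R x) y = r * inner x y" by transfer simp
  show "0 \<le> inner x x" by transfer simp
  show "inner x x = 0 \<longleftrightarrow> x = 0" by transfer simp
  show "norm x = sqrt (inner x x)" by transfer (rule norm_eq_sqrt_inner)
qed

end

instance hconj :: (chilbert_space) complete_space
proof
  fix X :: "nat \<Rightarrow> 'a hconj"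
  assume "Cauchy X"
  then have "Cauchy (\<lambda>n. unbar (X n))" unfolding Cauchy_def dist_hconj.rep_eq .
  then obtain l where "(\<lambda>n. unbar (X n)) \<longlonglongrightarrow> l" using Cauchy_convergent convergent_def by blast
  then have "X \<longlonglongrightarrow> bar l" unfolding LIMSEQ_def dist_hconj.rep_eq by (simp add: bar_inverse)
  then show "convergent X" unfolding convergent_def by blast
qed

instantiation hconj :: (chilbert_space) chilbert_space
begin

lift_definition scaleC_hconj :: "complex \<Rightarrow> 'a hconj \<Rightarrow> 'a hconj" is "\<lambda>c x. cnj c *\<^sub>C x" .
lift_definition cinner_hconj :: "'a hconj \<Rightarrow> 'a hconj \<Rightarrow> complex" is "\<lambda>x y. cinner y x" .

instance
proof
  fix x y z :: "'a hconj" and r :: real and c d :: complex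
  show "c *\<^sub>C (x + y) = c *\<^sub>C x + c *\<^sub>C y" by transfer (rule scaleC_add_right)
  show "(c + d) *\<^sub>C x = c *\<^sub>C x + d *\<^sub>C x" by transfer (simp add: scaleC_add_left)
  show "c *\<^sub>C d *\<^sub>C x = (c * d) *\<^sub>C x" by transfer (simp add: scaleC_scaleC)
  show "complex_of_real r *\<^sub>C x = r *\<^sub>R x" by transfer (simp add: scaleC_of_real)
  show "cinner x y = cnj (cinner y x)" by transfer (rule cinner_commute)
  show "cinner x (y + z) = cinner x y + cinner x z" by transfer (rule cinner_add_left)
  show "cinner x (c *\<^sub>C y) = c * cinner x y" by transfer (simp add: cinner_scaleC_left)
  show "Re (cinner x y) = inner x y" by transfer (simp add: Re_cinner inner_commute)
qed

end

section \<open>Bounded operators\<close>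

text \<open>Bounded operators are elements of the library's type of bounded real-linear maps, with its
  operator norm; \<open>bops\<close> is the set of the complex-linear ones.\<close>

type_synonym 'a op = "'a \<Rightarrow>\<^sub>L 'a"

definition bops :: "('a::chilbert_space \<Rightarrow>\<^sub>L 'b::chilbert_space) set" where
  "bops = {T. \<forall>c x. blinfun_apply T (c *\<^sub>C x) = c *\<^sub>C blinfun_apply T x}"

definition scaleC_op :: "complex \<Rightarrow> ('a::chilbert_space \<Rightarrow>\<^sub>L 'b::chilbert_space) \<Rightarrow> ('a \<Rightarrow>\<^sub>L 'b)" where
  "scaleC_op c T = Blinfun (\<lambda>x. c *\<^sub>C blinfun_apply T x)"

definition adj :: "('a::chilbert_space \<Rightarrow>\<^sub>L 'b::chilbert_space) \<Rightarrow> ('b \<Rightarrow>\<^sub>L 'a)" where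
  "adj T = (THE S. \<forall>x y. cinner (blinfun_apply T x) y = cinner x (blinfun_apply S y))"

definition unitary :: "('a::chilbert_space \<Rightarrow>\<^sub>L 'b::chilbert_space) \<Rightarrow> bool" where
  "unitary U \<longleftrightarrow> U \<in> bops \<and> adj U o\<^sub>L U = id_blinfun \<and> U o\<^sub>L adj U = id_blinfun"

definition compact_ops :: "'a::chilbert_space op set" where
  "compact_ops = {T \<in> bops. compact (closure (blinfun_apply T ` cball 0 1))}"

text \<open>A bounded operator on a tensor product is determined by its values on the vectors
  \<open>x \<otimes> y\<close>, whose span is dense.\<close>

definition tensor_op :: "('a::chilbert_space \<Rightarrow>\<^sub>L 'c::chilbert_space) \<Rightarrow> ('b::chilbert_space \<Rightarrow>\<^sub>L 'd::chilbert_space)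
    \<Rightarrow> ('a \<otimes>\<^sub>H 'b \<Rightarrow>\<^sub>L 'c \<otimes>\<^sub>H 'd)" (infixr \<open>\<otimes>\<^sub>o\<close> 75) where
  "S \<otimes>\<^sub>o T = (THE R. \<forall>x y. blinfun_apply R (x \<otimes> y) = blinfun_apply S x \<otimes> blinfun_apply T y)"

definition flip :: "'a::chilbert_space \<otimes>\<^sub>H 'b::chilbert_space \<Rightarrow>\<^sub>L 'b \<otimes>\<^sub>H 'a" where
  "flip = (THE R. \<forall>x y. blinfun_apply R (x \<otimes> y) = y \<otimes> x)"

definition assoc :: "('a::chilbert_space \<otimes>\<^sub>H 'b::chilbert_space) \<otimes>\<^sub>H 'c::chilbert_space \<Rightarrow>\<^sub>L 'a \<otimes>\<^sub>H 'b \<otimes>\<^sub>H 'c" where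
  "assoc = (THE R. \<forall>x y z. blinfun_apply R ((x \<otimes> y) \<otimes> z) = x \<otimes> y \<otimes> z)"

text \<open>In the leg numbering notation, triple tensor products are nested to the right.\<close>

definition reassoc :: "(('a::chilbert_space \<otimes>\<^sub>H 'b::chilbert_space) \<otimes>\<^sub>H 'c::chilbert_space) op
    \<Rightarrow> ('a \<otimes>\<^sub>H 'b \<otimes>\<^sub>H 'c) op" where
  "reassoc T = assoc o\<^sub>L T o\<^sub>L adj assoc"

definition leg12 :: "('a::chilbert_space \<otimes>\<^sub>H 'b::chilbert_space) op \<Rightarrow> ('a \<otimes>\<^sub>H 'b \<otimes>\<^sub>H 'c::chilbert_space) op" where
  "leg12 T = reassoc (T \<otimes>\<^sub>o id_blinfun)"

definition leg23 :: "('b::chilbert_space \<otimes>\<^sub>H 'c::chilbert_space) op \<Rightarrow> ('a::chilbert_space \<otimes>\<^sub>H 'b \<otimes>\<^sub>H 'c) op" where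
  "leg23 T = id_blinfun \<otimes>\<^sub>o T"

definition leg13 :: "('a::chilbert_space \<otimes>\<^sub>H 'c::chilbert_space) op \<Rightarrow> ('a \<otimes>\<^sub>H 'b::chilbert_space \<otimes>\<^sub>H 'c) op" where
  "leg13 T = (id_blinfun \<otimes>\<^sub>o flip) o\<^sub>L leg12 T o\<^sub>L (id_blinfun \<otimes>\<^sub>o flip)"

section \<open>Unbounded operators\<close>

text \<open>An unbounded operator is represented by its graph, so that its inverse is the converse relation
  and composition is relation composition.\<close>

definition graph :: "('a::chilbert_space \<Rightarrow>\<^sub>L 'b::chilbert_space) \<Rightarrow> ('a \<times> 'b) set" where
  "graph T = {(x, blinfun_apply T x) |x. True}"

text \<open>The right-hand side of the second conjunct is the graph of the adjoint; since the domain is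
  dense, it is the graph of a closed complex-linear operator.\<close>

definition self_adjoint :: "('a::chilbert_space \<times> 'a) set \<Rightarrow> bool" where
  "self_adjoint Q \<longleftrightarrow> closure (Domain Q) = UNIV \<and>
     Q = {(y, z). \<forall>(x, w)\<in>Q. cinner w y = cinner x z}"

definition positive_self_adjoint :: "('a::chilbert_space \<times> 'a) set \<Rightarrow> bool" where
  "positive_self_adjoint Q \<longleftrightarrow> self_adjoint Q \<and> (\<forall>(x, w)\<in>Q. cinner x w \<in> \<real>\<^sub>\<ge>\<^sub>0)"

text \<open>The closed operator \<open>P \<otimes> Q\<close> is the closure of the algebraic tensor product. The real-linear
  \<^const>\<open>span\<close>, here and in the definitions of algebras below, is a complex subspace because the spanning set is closed under complex multiples.\<close>

definition tensor_graph :: "('a::chilbert_space \<times> 'a) set \<Rightarrow> ('b::chilbert_space \<times> 'b) set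
    \<Rightarrow> (('a \<otimes>\<^sub>H 'b) \<times> ('a \<otimes>\<^sub>H 'b)) set" where
  "tensor_graph P Q = closure (span {(x \<otimes> y, x' \<otimes> y') |x x' y y'. (x, x') \<in> P \<and> (y, y') \<in> Q})"

section \<open>Modular multiplicative unitaries\<close>

definition multiplicative_unitary :: "('h::chilbert_space \<otimes>\<^sub>H 'h) op \<Rightarrow> bool" where
  "multiplicative_unitary W \<longleftrightarrow> unitary W \<and>
     leg23 W o\<^sub>L leg12 W = leg12 W o\<^sub>L leg13 W o\<^sub>L (leg23 W :: ('h \<otimes>\<^sub>H 'h \<otimes>\<^sub>H 'h) op)"

text \<open>In the last condition \<open>y' = Q y\<close> and \<open>u' = Q\<^sup>-\<^sup>1 u\<close>.\<close>

definition modular :: "('h::chilbert_space \<otimes>\<^sub>H 'h) op \<Rightarrow> bool" where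
  "modular W \<longleftrightarrow> (\<exists>(Qh :: ('h \<times> 'h) set) (Q :: ('h \<times> 'h) set) (Wt :: ('h hconj \<otimes>\<^sub>H 'h) op).
     positive_self_adjoint Qh \<and> (\<forall>x. (x, 0) \<in> Qh \<longrightarrow> x = 0) \<and>
     positive_self_adjoint Q \<and> (\<forall>x. (x, 0) \<in> Q \<longrightarrow> x = 0) \<and>
     unitary Wt \<and>
     graph W O tensor_graph Qh Q O graph (adj W) = tensor_graph Qh Q \<and>
     (\<forall>x z. \<forall>(y, y')\<in>Q. \<forall>(u, u')\<in>Q\<inverse>.
        cinner (x \<otimes> y) (blinfun_apply W (z \<otimes> u)) =
        cinner (bar z \<otimes> y') (blinfun_apply Wt (bar x \<otimes> u'))))"

definition dual_mu :: "('h::chilbert_space \<otimes>\<^sub>H 'h) op \<Rightarrow> ('h \<otimes>\<^sub>H 'h) op" where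
  "dual_mu W = flip o\<^sub>L adj W o\<^sub>L flip"

text \<open>The normal functionals on \<open>B(H)\<close>, written as norm-convergent sums of vector functionals
  \<open>T \<mapsto> cinner x (T y)\<close>.\<close>

definition predual :: "('a::chilbert_space op \<Rightarrow> complex) set" where
  "predual = {\<lambda>T. \<Sum>n. cinner (x n) (blinfun_apply T (y n)) |x y.
     summable (\<lambda>n. (norm (x n))\<^sup>2) \<and> summable (\<lambda>n. (norm (y n))\<^sup>2)}"

definition tensor_right :: "'b::chilbert_space \<Rightarrow> ('a::chilbert_space \<Rightarrow>\<^sub>L 'a \<otimes>\<^sub>H 'b)" where
  "tensor_right y = Blinfun (\<lambda>x. x \<otimes> y)"

text \<open>The slice \<open>(\<omega> \<otimes> id)(T)\<close>, determined by its matrix coefficients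
  \<open>\<omega>((id \<otimes> \<omega>\<^sub>a\<^sub>b)(T))\<close>, where \<open>\<omega>\<^sub>a\<^sub>b(S) = cinner a (S b)\<close>.\<close>

definition slice :: "('a::chilbert_space op \<Rightarrow> complex) \<Rightarrow> ('a \<otimes>\<^sub>H 'b::chilbert_space) op \<Rightarrow> 'b op" where
  "slice \<omega> T = (THE S. S \<in> bops \<and>
     (\<forall>a b. cinner a (blinfun_apply S b) = \<omega> (adj (tensor_right a) o\<^sub>L T o\<^sub>L tensor_right b)))"

definition qg_algebra :: "('h::chilbert_space \<otimes>\<^sub>H 'h) op \<Rightarrow> 'h op set" where
  "qg_algebra W = closure {slice \<omega> W |\<omega>. \<omega> \<in> predual}"

definition qg_comult :: "('h::chilbert_space \<otimes>\<^sub>H 'h) op \<Rightarrow> 'h op \<Rightarrow> ('h \<otimes>\<^sub>H 'h) op" where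
  "qg_comult W x = W o\<^sub>L (x \<otimes>\<^sub>o id_blinfun) o\<^sub>L adj W"

section \<open>C*-algebras and morphisms\<close>

text \<open>C*-algebras are represented faithfully and nondegenerately on Hilbert spaces. The multiplier
  algebra is then the idealiser of \<open>A\<close> in \<open>B(H)\<close>, and the spatial tensor product of \<open>A\<close> and \<open>B\<close> is
  the closed span of the operators \<open>a \<otimes>\<^sub>o b\<close>.\<close>

definition cstar_algebra :: "'a::chilbert_space op set \<Rightarrow> bool" where
  "cstar_algebra A \<longleftrightarrow> A \<subseteq> bops \<and> subspace A \<and> (\<forall>c. \<forall>a\<in>A. scaleC_op c a \<in> A) \<and>
     (\<forall>a\<in>A. \<forall>b\<in>A. a o\<^sub>L b \<in> A) \<and> (\<forall>a\<in>A. adj a \<in> A) \<and> closed A \<and>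
     closure (span {blinfun_apply a x |a x. a \<in> A}) = UNIV"

definition multiplier :: "'a::chilbert_space op set \<Rightarrow> 'a op set" where
  "multiplier A = {T \<in> bops. \<forall>a\<in>A. T o\<^sub>L a \<in> A \<and> a o\<^sub>L T \<in> A}"

definition unitary_multiplier :: "'a::chilbert_space op set \<Rightarrow> 'a op set" where
  "unitary_multiplier A = {U \<in> multiplier A. unitary U}"

definition tensor_alg :: "'a::chilbert_space op set \<Rightarrow> 'b::chilbert_space op set \<Rightarrow> ('a \<otimes>\<^sub>H 'b) op set"
    (infixr \<open>\<otimes>\<^sub>A\<close> 75) where
  "A \<otimes>\<^sub>A B = closure (span {a \<otimes>\<^sub>o b |a b. a \<in> A \<and> b \<in> B})"

text \<open>Nondegenerate *-homomorphisms \<open>A \<rightarrow> M(B)\<close>; only the values of \<open>\<phi>\<close> on \<open>A\<close> matter.\<close>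

definition cstar_morphism :: "'a::chilbert_space op set \<Rightarrow> 'b::chilbert_space op set \<Rightarrow> ('a op \<Rightarrow> 'b op) \<Rightarrow> bool" where
  "cstar_morphism A B \<phi> \<longleftrightarrow> (\<forall>a\<in>A. \<phi> a \<in> multiplier B) \<and>
     (\<forall>a\<in>A. \<forall>a'\<in>A. \<phi> (a + a') = \<phi> a + \<phi> a') \<and>
     (\<forall>c. \<forall>a\<in>A. \<phi> (scaleC_op c a) = scaleC_op c (\<phi> a)) \<and>
     (\<forall>a\<in>A. \<forall>a'\<in>A. \<phi> (a o\<^sub>L a') = \<phi> a o\<^sub>L \<phi> a') \<and>
     (\<forall>a\<in>A. \<phi> (adj a) = adj (\<phi> a)) \<and>
     closure (span {\<phi> a o\<^sub>L b |a b. a \<in> A \<and> b \<in> B}) = B"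

definition multiplier_ext :: "'a::chilbert_space op set \<Rightarrow> ('a op \<Rightarrow> 'b::chilbert_space op) \<Rightarrow> 'a op \<Rightarrow> 'b op" where
  "multiplier_ext A \<phi> m = (THE T. T \<in> bops \<and> (\<forall>a\<in>A. T o\<^sub>L \<phi> a = \<phi> (m o\<^sub>L a)))"

text \<open>\<open>tensor_hom\<close> is \<open>\<phi> \<otimes> \<psi>\<close> on the spatial tensor product, as the continuous linear extension from
  elementary tensors; \<open>tensor_morphism\<close> is its extension to multipliers.\<close>

definition tensor_hom :: "'a::chilbert_space op set \<Rightarrow> ('a op \<Rightarrow> 'c::chilbert_space op) \<Rightarrow>
    'b::chilbert_space op set \<Rightarrow> ('b op \<Rightarrow> 'd::chilbert_space op) \<Rightarrow> ('a \<otimes>\<^sub>H 'b) op \<Rightarrow> ('c \<otimes>\<^sub>H 'd) op" where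
  "tensor_hom A \<phi> B \<psi> = (THE \<Phi>. \<Phi> \<in> extensional (A \<otimes>\<^sub>A B) \<and>
     (\<forall>s\<in>A \<otimes>\<^sub>A B. \<forall>t\<in>A \<otimes>\<^sub>A B. \<Phi> (s + t) = \<Phi> s + \<Phi> t) \<and>
     (\<forall>c. \<forall>s\<in>A \<otimes>\<^sub>A B. \<Phi> (scaleC_op c s) = scaleC_op c (\<Phi> s)) \<and>
     continuous_on (A \<otimes>\<^sub>A B) \<Phi> \<and>
     (\<forall>a\<in>A. \<forall>b\<in>B. \<Phi> (a \<otimes>\<^sub>o b) = \<phi> a \<otimes>\<^sub>o \<psi> b))"

definition tensor_morphism :: "'a::chilbert_space op set \<Rightarrow> ('a op \<Rightarrow> 'c::chilbert_space op) \<Rightarrow>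
    'b::chilbert_space op set \<Rightarrow> ('b op \<Rightarrow> 'd::chilbert_space op) \<Rightarrow> ('a \<otimes>\<^sub>H 'b) op \<Rightarrow> ('c \<otimes>\<^sub>H 'd) op" where
  "tensor_morphism A \<phi> B \<psi> = multiplier_ext (A \<otimes>\<^sub>A B) (tensor_hom A \<phi> B \<psi>)"

section \<open>Corepresentations\<close>

definition left_corep :: "'a::chilbert_space op set \<Rightarrow> ('a op \<Rightarrow> ('a \<otimes>\<^sub>H 'a) op) \<Rightarrow>
    'd::chilbert_space op set \<Rightarrow> ('a \<otimes>\<^sub>H 'd) op \<Rightarrow> bool" where
  "left_corep A \<Delta> D U \<longleftrightarrow> U \<in> unitary_multiplier (A \<otimes>\<^sub>A D) \<and>
     reassoc (tensor_morphism A \<Delta> D (\<lambda>d. d) U) = leg23 U o\<^sub>L leg13 U"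

text \<open>A formula cannot quantify over types, so the first argument fixes the type of the Hilbert space
  on which the test algebras \<open>D\<close> act. The full universal property is this condition for all types
  \<open>'d\<close> and implies it for each of them; hence a theorem assuming \<open>universal_corep TYPE('d)\<close> with \<open>'d\<close>
  arbitrary applies to every universal pair.\<close>

definition universal_corep :: "'d::chilbert_space itself \<Rightarrow> 'a::chilbert_space op set \<Rightarrow>
    ('a op \<Rightarrow> ('a \<otimes>\<^sub>H 'a) op) \<Rightarrow> 'u::chilbert_space op set \<Rightarrow> ('a \<otimes>\<^sub>H 'u) op \<Rightarrow> bool" where
  "universal_corep _ A \<Delta> Au V \<longleftrightarrow> cstar_algebra Au \<and> left_corep A \<Delta> Au V \<and>
     (\<forall>(D :: 'd op set) U. cstar_algebra D \<and> left_corep A \<Delta> D U \<longrightarrow>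
        (\<exists>!\<phi>. \<phi> \<in> extensional Au \<and> cstar_morphism Au D \<phi> \<and>
           U = tensor_morphism A (\<lambda>a. a) Au \<phi> V))"

end

theory Submission
  imports Defs
begin

text \<open>Put \<open>Y = Vt\<^sub>1\<^sub>2\<^sup>* V\<^sub>2\<^sub>3 Vt\<^sub>1\<^sub>2 V\<^sub>2\<^sub>3\<^sup>*\<close>; the task is to show that \<open>Y = X\<^sub>1\<^sub>3\<close>. The corepresentation
  properties of \<open>V\<close> and \<open>Vt\<close> read \<open>W\<^sub>1\<^sub>2\<^sup>* V\<^sub>2\<^sub>3 W\<^sub>1\<^sub>2 = V\<^sub>1\<^sub>3 V\<^sub>2\<^sub>3\<close> and \<open>W\<^sub>2\<^sub>3 Vt\<^sub>1\<^sub>2 = Vt\<^sub>1\<^sub>2 Vt\<^sub>1\<^sub>3 W\<^sub>2\<^sub>3\<close>, and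
  together they give \<open>W\<^sub>2\<^sub>3 Y\<^sub>1\<^sub>2\<^sub>4 = Y\<^sub>1\<^sub>3\<^sub>4 W\<^sub>2\<^sub>3\<close>. So every slice \<open>a\<close> of \<open>Y\<close> on the outer legs satisfies
  \<open>W (a \<otimes> 1) = (1 \<otimes> a) W\<close>. Modularity turns this relation into one between matrix coefficients with
  respect to \<open>Qh\<close> and \<open>Q\<close>, which forces \<open>a\<close> to be scalar. Modularity is also what makes the closed span
  of the slices of \<open>W\<close> a C*-algebra: the second unitary satisfies a pentagon equation with \<open>W\<close>, which
  rewrites the products \<open>a\<^sup>* b\<close> of two slices as slices. The formulas for \<open>(id \<otimes> \<phi>) X\<close> follow by applying
  \<open>id \<otimes> id \<otimes> \<phi>\<close> to the equation defining \<open>X\<close> and cancelling; those on the first leg follow from these by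
  the symmetry that exchanges \<open>W\<close> with \<open>dual_mu W\<close>.\<close>

section \<open>Bounded operators and adjoints\<close>

text \<open>A slice \<open>a\<close> of \<open>Y\<close> satisfies
  \<open>qg_comult W a = id_blinfun \<otimes>\<^sub>o a\<close>. For functions on a group this reads
  f(st) = f(t), so f is constant; here no invariant weight is at hand to average with. Instead two
  descriptions of the coefficients of \<open>Wt\<close> are compared. As \<open>Qh\<close> and
  \<open>Q\<close> are unbounded, this requires essential self-adjointness of the algebraic tensor
  product of the conjugate of \<open>Qh\<close> with the inverse of \<open>Q\<close>, which is the
  task of the resolvents. The second obstacle is the middle leg: the equation for \<open>X\<close>
  lives over the compact operators, whereas the tensor morphisms are defined on multipliers over
  \<open>Ch\<close>, \<open>C\<close> or \<open>Chu\<close>. All these multipliers are adjointable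
  operators of one column module over the second algebra, on which a single unital *-homomorphism
  \<open>amp B \<phi>\<close> extends every \<open>id \<otimes> \<phi>\<close>. So
  \<open>id \<otimes> id \<otimes> \<phi>\<close> may be applied to the equation factor by factor,
  and \<open>Ch\<close> enters only through nondegeneracy, which holds for the slices of any
  unitary.\<close>

instance chilbert_space \<subseteq> banach ..

lemma cmod_cinner_le_norm: "cmod (cinner x y) \<le> norm x * norm y" for x y :: "'a::chilbert_space"
proof (cases "cinner x y = 0")
  case False
  let ?c = "cinner x y"
  \<comment> \<open>Scaling \<open>y\<close> by the conjugate of \<open>?c\<close> makes the inner
    product real, so that the Cauchy-Schwarz inequality of the real \<open>inner\<close>
    applies.\<close>
  have "(cmod ?c)\<^sup>2 = Re (cinner x (cnj ?c *\<^sub>C y))"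
    unfolding cmod_power2 by (simp add: cinner_scaleC_right power2_eq_square)
  also have "\<dots> \<le> norm x * norm (cnj ?c *\<^sub>C y)"
    unfolding Re_cinner by (rule norm_cauchy_schwarz)
  finally have "cmod ?c * cmod ?c \<le> cmod ?c * (norm x * norm y)"
    by (simp add: power2_eq_square algebra_simps)
  then show ?thesis using False by simp
qed simp

lemma bounded_bilinear_cinner: "bounded_bilinear (cinner :: 'a::chilbert_space \<Rightarrow> 'a \<Rightarrow> complex)"
proof
  show "\<exists>K. \<forall>a b :: 'a. norm (cinner a b) \<le> norm a * norm b * K"
    by (rule exI[of _ 1]) (simp add: cmod_cinner_le_norm)
qed (simp_all add: cinner_add_left cinner_add_right cinner_scaleR_left cinner_scaleR_right scaleR_conv_of_real)

lemmas tendsto_cinner [tendsto_intros] = bounded_bilinear.tendsto[OF bounded_bilinear_cinner]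
lemmas bounded_linear_cinner_right = bounded_bilinear.bounded_linear_right[OF bounded_bilinear_cinner]
lemmas bounded_linear_cinner_left = bounded_bilinear.bounded_linear_left[OF bounded_bilinear_cinner]

lemma cinner_extI: "(\<And>y. cinner y x = cinner y x') \<Longrightarrow> x = x'" for x x' :: "'a::chilbert_space"
  using cinner_self[of "x - x'"] by (simp add: cinner_diff_right)

section \<open>Closed real-linear spans and total sets\<close>

lemma subspace_closure:
  fixes S :: "'a::real_normed_vector set"
  assumes "subspace S"
  shows "subspace (closure S)"
proof (rule subspaceI)
  show "0 \<in> closure S" using subspace_0[OF assms] closure_subset by blast
  show "x + y \<in> closure S" if xy: "x \<in> closure S" "y \<in> closure S" for x y
  proof -
    obtain s t where "\<And>n. s n \<in> S" "s \<longlonglongrightarrow> x" "\<And>n. t n \<in> S" "t \<longlonglongrightarrow> y"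
      using xy unfolding closure_sequential by blast
    then show ?thesis unfolding closure_sequential
      by (intro exI[of _ "\<lambda>n. s n + t n"]) (auto intro: tendsto_add subspace_add[OF assms])
  qed
  show "r *\<^sub>R x \<in> closure S" if x: "x \<in> closure S" for r x
  proof -
    obtain s where "\<forall>n. s n \<in> S" "s \<longlonglongrightarrow> x"
      using x unfolding closure_sequential by blast
    then show ?thesis unfolding closure_sequential
      by (intro exI[of _ "\<lambda>n. r *\<^sub>R s n"]) (auto intro: tendsto_scaleR subspace_scale[OF assms])
  qed
qed

lemma subspace_closure_span [simp]: "subspace (closure (span S))" for S :: "'a::real_normed_vector set"
  by (intro subspace_closure subspace_span)

lemma closure_span_superset: "x \<in> S \<Longrightarrow> x \<in> closure (span S)"
  by (meson closure_subset span_base subsetD)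

text \<open>All algebras, modules and graphs below are closures of real spans. This rule reduces a
  closed linear condition to generators; antilinear maps are covered as well, being
  real-linear.\<close>

lemma bounded_linear_closure_span:
  assumes f: "bounded_linear f" and T: "subspace T" "closed T"
    and "\<And>s. s \<in> S \<Longrightarrow> f s \<in> T" "x \<in> closure (span S)"
  shows "f x \<in> T"
proof -
  interpret f: bounded_linear f by fact
  have "span S \<subseteq> f -` T"
    by (rule span_minimal) (use assms(4) T(1) in
        \<open>auto simp: subspace_def f.add f.scaleR f.zero\<close>)
  then have "closure (span S) \<subseteq> f -` T"
    by (rule closure_minimal) (intro continuous_closed_vimage T linear_continuous_at f)
  then show ?thesis using assms(5) by blast
qed

lemma closed_eq_on_total:
  fixes f g :: "'a::real_normed_vector \<Rightarrow> 'b::real_normed_vector"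
  assumes "bounded_linear f" "bounded_linear g" "\<And>x. x \<in> S \<Longrightarrow> f x = g x" "x \<in> closure (span S)"
  shows "f x = g x"
proof -
  interpret f: bounded_linear f by fact
  interpret g: bounded_linear g by fact
  have "span S \<subseteq> {x. f x = g x}"
    by (rule span_minimal) (use assms(3) in \<open>auto simp: subspace_def f.add g.add f.scaleR g.scaleR f.zero g.zero\<close>)
  then have "closure (span S) \<subseteq> {x. f x = g x}"
    by (rule closure_minimal) (intro closed_Collect_eq linear_continuous_on assms)
  then show ?thesis using assms(4) by blast
qed

lemma blinfun_eq_on_total:
  fixes S T :: "'a::real_normed_vector \<Rightarrow>\<^sub>L 'b::real_normed_vector"
  assumes "\<And>x. x \<in> X \<Longrightarrow> blinfun_apply S x = blinfun_apply T x" "closure (span X) = UNIV"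
  shows "S = T"
  by (rule blinfun_eqI, rule closed_eq_on_total[of _ _ X]) (use assms in \<open>auto intro: blinfun.bounded_linear_right\<close>)

lemma cinner_total_eqI:
  fixes x x' :: "'a::chilbert_space"
  assumes "closure (span X) = UNIV" "\<And>y. y \<in> X \<Longrightarrow> cinner y x = cinner y x'"
  shows "x = x'"
  by (rule cinner_extI, rule closed_eq_on_total[where S = X, OF bounded_linear_cinner_left bounded_linear_cinner_left])
    (use assms in auto)

section \<open>Orthogonal projections and the Riesz theorem for the real inner product\<close>

theorem projection_exists:
  fixes M :: "'a::{real_inner,complete_space} set"
  assumes M: "subspace M" "closed M"
  shows "\<exists>m\<in>M. \<forall>y\<in>M. inner (x - m) y = 0"
proof -
  let ?N = "(\<lambda>m. (norm (x - m))\<^sup>2) ` M"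
  define D where "D = Inf ?N"
  have ne: "?N \<noteq> {}" using subspace_0[OF M(1)] by blast
  have bdd: "bdd_below ?N" by (rule bdd_belowI2[of _ 0]) simp
  have D_le: "D \<le> (norm (x - m))\<^sup>2" if "m \<in> M" for m
    unfolding D_def by (rule cInf_lower) (use that bdd in auto)
  have "\<exists>m\<in>M. (norm (x - m))\<^sup>2 < D + inverse (real (Suc n))" for n
    using cInf_lessD[OF ne, of "D + inverse (real (Suc n))"] by (auto simp: D_def)
  then obtain m where m: "\<And>n. m n \<in> M" "\<And>n. (norm (x - m n))\<^sup>2 < D + inverse (real (Suc n))" by metis
  have dist: "(norm (m i - m j))\<^sup>2 \<le> 2 * inverse (real (Suc i)) + 2 * inverse (real (Suc j))" for i j
  proof -
    have "(1/2) *\<^sub>R (m i + m j) \<in> M" using M(1) m(1) by (intro subspace_scale subspace_add)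
    then have "D \<le> (norm (x - (1/2) *\<^sub>R (m i + m j)))\<^sup>2" by (rule D_le)
    \<comment> \<open>The parallelogram identity for \<open>x - m i\<close> and
      \<open>x - m j\<close>. The midpoint stays in \<open>M\<close>, so a minimising sequence is
      Cauchy.\<close>
    moreover have "(norm (m i - m j))\<^sup>2 = 2 * (norm (x - m i))\<^sup>2 + 2 * (norm (x - m j))\<^sup>2
        - 4 * (norm (x - (1/2) *\<^sub>R (m i + m j)))\<^sup>2"
      by (simp add: power2_norm_eq_inner inner_diff inner_add inner_commute algebra_simps)
    ultimately show ?thesis using m(2)[of i] m(2)[of j] by linarith
  qed
  have "Cauchy m"
  proof (rule metric_CauchyI)
    fix \<epsilon> :: real assume "\<epsilon> > 0"
    then obtain K where K: "inverse (real (Suc K)) < \<epsilon>\<^sup>2 / 4" using reals_Archimedean[of "\<epsilon>\<^sup>2/4"] by auto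
    have "dist (m i) (m j) < \<epsilon>" if "i \<ge> K" "j \<ge> K" for i j
    proof -
      have "inverse (real (Suc i)) \<le> inverse (real (Suc K))" "inverse (real (Suc j)) \<le> inverse (real (Suc K))"
        using that by (auto intro!: le_imp_inverse_le)
      then have "(norm (m i - m j))\<^sup>2 < \<epsilon>\<^sup>2" using dist[of i j] K by linarith
      then show ?thesis unfolding dist_norm by (rule power_less_imp_less_base) (use \<open>\<epsilon> > 0\<close> in simp)
    qed
    then show "\<exists>K. \<forall>i\<ge>K. \<forall>j\<ge>K. dist (m i) (m j) < \<epsilon>" by blast
  qed
  then obtain p where p: "m \<longlonglongrightarrow> p" using Cauchy_convergent convergent_def by blast
  have pM: "p \<in> M" using M(2) m(1) p by (rule closed_sequentially)
  have "(\<lambda>n. (norm (x - m n))\<^sup>2) \<longlonglongrightarrow> (norm (x - p))\<^sup>2" by (intro tendsto_intros p)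
  moreover have "(\<lambda>n. D + inverse (real (Suc n))) \<longlonglongrightarrow> D + 0"
    by (intro tendsto_intros LIMSEQ_inverse_real_of_nat)
  ultimately have pD: "(norm (x - p))\<^sup>2 \<le> D"
    using m(2) by (intro LIMSEQ_le[of _ _ _ D]) (auto intro: less_imp_le)
  have "inner (x - p) y = 0" if y: "y \<in> M" for y
  proof (rule ccontr)
    assume c: "inner (x - p) y \<noteq> 0"
    then have y0: "inner y y > 0" by (auto simp: inner_gt_zero_iff)
    \<comment> \<open>The minimiser of the squared norm of \<open>x - (p + t *\<^sub>R y)\<close> as
      a quadratic polynomial in \<open>t\<close>; a nonzero inner product would push the distance
      below its infimum.\<close>
    define t where "t = inner (x - p) y / inner y y"
    have "p + t *\<^sub>R y \<in> M" using M(1) pM y by (intro subspace_add subspace_scale)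
    then have "(norm (x - p))\<^sup>2 \<le> (norm (x - (p + t *\<^sub>R y)))\<^sup>2" using pD D_le[of "p + t *\<^sub>R y"] by linarith
    also have "\<dots> = (norm (x - p))\<^sup>2 - 2 * t * inner (x - p) y + t\<^sup>2 * inner y y"
      unfolding power2_norm_eq_inner
      by (simp add: inner_diff inner_add inner_commute algebra_simps power2_eq_square)
    also have "\<dots> = (norm (x - p))\<^sup>2 - (inner (x - p) y)\<^sup>2 / inner y y"
      using y0 by (simp add: t_def power2_eq_square field_simps)
    finally show False using c y0 by (simp add: field_simps)
  qed
  then show ?thesis using pM by blast
qed

lemma closed_subspace_eq_UNIV:
  fixes M :: "'a::{real_inner,complete_space} set"
  assumes "subspace M" "closed M" "\<And>z. (\<And>y. y \<in> M \<Longrightarrow> inner z y = 0) \<Longrightarrow> z = 0"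
  shows "M = UNIV"
proof -
  have "x \<in> M" for x
    using projection_exists[OF assms(1,2), of x] assms(3) by force
  then show ?thesis by blast
qed

theorem riesz_exists:
  fixes f :: "'a::{real_inner,complete_space} \<Rightarrow> real"
  assumes "bounded_linear f"
  shows "\<exists>y. \<forall>x. f x = inner y x"
proof (cases "\<forall>x. f x = 0")
  case False
  then obtain x0 where x0: "f x0 \<noteq> 0" by blast
  interpret f: bounded_linear f by fact
  let ?M = "{x. f x = 0}"
  have "subspace ?M" by (auto simp: subspace_def f.add f.scaleR f.zero)
  moreover have "closed ?M" by (intro closed_Collect_eq linear_continuous_on assms continuous_on_const)
  ultimately obtain m where m: "f m = 0" "\<And>y. f y = 0 \<Longrightarrow> inner (x0 - m) y = 0"
    using projection_exists[of ?M x0] by blast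
  define z where "z = x0 - m"
  have fz: "f z \<noteq> 0" using x0 m(1) by (simp add: z_def f.diff)
  then have z0: "inner z z \<noteq> 0" using f.zero by auto
  have "f x = inner ((f z / inner z z) *\<^sub>R z) x" for x
  proof -
    have "f (x - (f x / f z) *\<^sub>R z) = 0" using fz by (simp add: f.diff f.scaleR)
    then have "inner z (x - (f x / f z) *\<^sub>R z) = 0" using m(2) by (simp add: z_def)
    then show ?thesis using fz z0 by (simp add: inner_diff field_simps)
  qed
  then show ?thesis by blast
qed (auto intro: exI[of _ 0])

section \<open>Complex-linear operators and their adjoints\<close>

lemma bopsD: "T \<in> bops \<Longrightarrow> blinfun_apply T (c *\<^sub>C x) = c *\<^sub>C blinfun_apply T x"
  by (simp add: bops_def)

lemma scaleC_scaleR: "c *\<^sub>C (r *\<^sub>R x) = r *\<^sub>R (c *\<^sub>C x)" for x :: "'a::chilbert_space"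
  by (simp add: scaleC_of_real[symmetric] scaleC_scaleC mult.commute)

lemma bounded_linear_scaleC: "bounded_linear (\<lambda>x::'a::chilbert_space. c *\<^sub>C x)"
  by (rule bounded_linear_intro[of _ "cmod c"]) (simp_all add: scaleC_add_right scaleC_scaleR mult.commute)

lemma scaleC_op_apply [simp]: "blinfun_apply (scaleC_op c T) x = c *\<^sub>C blinfun_apply T x"
  unfolding scaleC_op_def
  by (subst bounded_linear_Blinfun_apply)
    (auto intro: bounded_linear_compose[OF bounded_linear_scaleC] blinfun.bounded_linear_right)

lemma scaleC_op_of_real: "scaleC_op (of_real r) T = r *\<^sub>R T"
  by (rule blinfun_eqI) (simp add: scaleC_of_real blinfun.scaleR_left)

lemma scaleC_op_add: "scaleC_op c (S + T) = scaleC_op c S + scaleC_op c T"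
  by (rule blinfun_eqI) (simp add: blinfun.add_left scaleC_add_right)

lemma scaleC_op_scaleR: "scaleC_op c (r *\<^sub>R T) = r *\<^sub>R scaleC_op c T"
  by (rule blinfun_eqI) (simp add: blinfun.scaleR_left scaleC_scaleR)

lemma bounded_linear_scaleC_op: "bounded_linear (scaleC_op c)"
proof (rule bounded_linear_intro[of _ "cmod c"])
  show "norm (scaleC_op c T) \<le> norm T * cmod c" for T :: "'a \<Rightarrow>\<^sub>L 'b"
  proof (rule norm_blinfun_bound)
    show "norm (blinfun_apply (scaleC_op c T) x) \<le> norm T * cmod c * norm x" for x
      using mult_left_mono[OF norm_blinfun[of T x], of "cmod c"] by (simp add: mult.commute mult.left_commute)
  qed simp
qed (simp_all add: scaleC_op_add scaleC_op_scaleR)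

lemma scaleC_op_comp_left: "scaleC_op c S o\<^sub>L T = scaleC_op c (S o\<^sub>L T)"
  by (rule blinfun_eqI) simp

lemma scaleC_op_comp_right: "S \<in> bops \<Longrightarrow> S o\<^sub>L scaleC_op c T = scaleC_op c (S o\<^sub>L T)"
  by (rule blinfun_eqI) (simp add: bopsD)

lemma subspace_bops: "subspace bops"
  by (auto simp: subspace_def bops_def blinfun.add_left blinfun.scaleR_left scaleC_add_right scaleC_scaleR)

lemma closed_bops: "closed bops"
proof -
  have "closed {T::'a \<Rightarrow>\<^sub>L 'b. blinfun_apply T (c *\<^sub>C x) = c *\<^sub>C blinfun_apply T x}" for c x
    by (intro closed_Collect_eq linear_continuous_on bounded_linear_compose[OF bounded_linear_scaleC]
        blinfun.bounded_linear_left)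
  then show ?thesis unfolding bops_def by (intro closed_Collect_all)
qed

lemma bops_0 [simp]: "0 \<in> bops" by (simp add: bops_def)
lemma bops_id [simp]: "id_blinfun \<in> bops" by (simp add: bops_def)
lemma bops_comp [simp, intro]: "S \<in> bops \<Longrightarrow> T \<in> bops \<Longrightarrow> S o\<^sub>L T \<in> bops" by (simp add: bops_def)
lemma bops_add [simp, intro]: "S \<in> bops \<Longrightarrow> T \<in> bops \<Longrightarrow> S + T \<in> bops"
  by (rule subspace_add[OF subspace_bops])
lemma bops_diff [simp, intro]: "S \<in> bops \<Longrightarrow> T \<in> bops \<Longrightarrow> S - T \<in> bops"
  by (rule subspace_diff[OF subspace_bops])
lemma bops_scaleR [simp, intro]: "T \<in> bops \<Longrightarrow> r *\<^sub>R T \<in> bops"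
  by (rule subspace_scale[OF subspace_bops])
lemma bops_scaleC_op [simp, intro]: "T \<in> bops \<Longrightarrow> scaleC_op c T \<in> bops"
  by (simp add: bops_def scaleC_scaleC mult.commute)

lemma cinner_i_left: "Im (cinner x y) = inner (\<i> *\<^sub>C x) y" for x y :: "'a::chilbert_space"
  by (simp add: Re_cinner[symmetric] cinner_scaleC_left)

text \<open>The real Riesz theorem yields an adjoint for \<open>inner\<close>. Imaginary parts are
  real inner products with a vector multiplied by \<open>\<i>\<close>, and \<open>T\<close> commutes
  with that multiplication, so it is an adjoint for \<open>cinner\<close> too.\<close>

theorem adj_ex1:
  assumes T: "T \<in> bops"
  shows "\<exists>!S. \<forall>x y. cinner (blinfun_apply T x) y = cinner x (blinfun_apply S y)"
proof (rule ex_ex1I)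
  have "\<exists>z. \<forall>x. inner (blinfun_apply T x) y = inner z x" for y
    by (rule riesz_exists)
      (rule bounded_linear_compose[OF bounded_linear_inner_left blinfun.bounded_linear_right])
  then obtain S where S: "\<And>x y. inner (blinfun_apply T x) y = inner (S y) x" by metis
  have uniq: "u = v" if "\<And>x. inner u x = inner v x" for u v :: 'a
    using that[of "u - v"] by (metis eq_iff_diff_eq_0 inner_diff_left inner_eq_zero_iff)
  have "bounded_linear S"
  proof (rule bounded_linear_intro[of _ "norm T"])
    show "S (x + y) = S x + S y" for x y
      by (rule uniq) (simp add: S[symmetric] inner_add_left inner_add_right)
    show "S (r *\<^sub>R x) = r *\<^sub>R S x" for r x
      by (rule uniq) (simp add: S[symmetric])
    show "norm (S y) \<le> norm y * norm T" for y
    proof (cases "norm (S y) = 0")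
      case False
      have "norm (S y) * norm (S y) = inner (blinfun_apply T (S y)) y"
        unfolding S by (simp add: power2_norm_eq_inner[symmetric] power2_eq_square)
      also have "\<dots> \<le> norm (blinfun_apply T (S y)) * norm y" by (rule norm_cauchy_schwarz)
      also have "\<dots> \<le> (norm T * norm (S y)) * norm y" by (intro mult_right_mono norm_blinfun) simp
      finally show ?thesis using False by (simp add: mult.commute mult.left_commute)
    qed simp
  qed
  then have ap: "blinfun_apply (Blinfun S) = S" by (rule bounded_linear_Blinfun_apply)
  have "cinner (blinfun_apply T x) y = cinner x (blinfun_apply (Blinfun S) y)" for x y
    by (rule complex_eqI)
      (simp_all add: Re_cinner cinner_i_left ap S inner_commute[of _ "S y"] flip: bopsD[OF T])
  then show "\<exists>S. \<forall>x y. cinner (blinfun_apply T x) y = cinner x (blinfun_apply S y)" by blast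
next
  fix S S' assume "\<forall>x y. cinner (blinfun_apply T x) y = cinner x (blinfun_apply S y)"
    "\<forall>x y. cinner (blinfun_apply T x) y = cinner x (blinfun_apply S' y)"
  then show "S = S'" by (intro blinfun_eqI cinner_extI) metis
qed

lemma adj_right: "T \<in> bops \<Longrightarrow> cinner x (blinfun_apply (adj T) y) = cinner (blinfun_apply T x) y"
proof -
  assume "T \<in> bops"
  then have "\<forall>x y. cinner (blinfun_apply T x) y = cinner x (blinfun_apply (adj T) y)"
    unfolding adj_def by (rule theI'[OF adj_ex1])
  then show ?thesis by simp
qed

lemma adj_left: "T \<in> bops \<Longrightarrow> cinner (blinfun_apply (adj T) y) x = cinner y (blinfun_apply T x)"
  by (subst (1 2) cinner_commute) (simp only: adj_right)

lemma adj_eqI: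
  assumes "T \<in> bops" "\<And>x y. cinner (blinfun_apply T x) y = cinner x (blinfun_apply S y)"
  shows "adj T = S"
  by (intro blinfun_eqI cinner_extI) (simp add: adj_right assms)

lemma bops_adj [simp, intro]: "T \<in> bops \<Longrightarrow> adj T \<in> bops"
  by (subst bops_def, clarify, rule cinner_extI) (simp add: adj_right cinner_scaleC_right)

lemma adj_adj [simp]: "T \<in> bops \<Longrightarrow> adj (adj T) = T"
  by (rule adj_eqI) (auto simp: adj_left)

lemma adj_comp: "S \<in> bops \<Longrightarrow> T \<in> bops \<Longrightarrow> adj (S o\<^sub>L T) = adj T o\<^sub>L adj S"
  by (rule adj_eqI) (auto simp: adj_right)

lemma adj_id [simp]: "adj id_blinfun = id_blinfun"
  by (rule adj_eqI) auto

lemma adj_add: "S \<in> bops \<Longrightarrow> T \<in> bops \<Longrightarrow> adj (S + T) = adj S + adj T"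
  by (rule adj_eqI) (auto simp: adj_right blinfun.add_left cinner_add_left cinner_add_right)

lemma adj_diff: "S \<in> bops \<Longrightarrow> T \<in> bops \<Longrightarrow> adj (S - T) = adj S - adj T"
  by (rule adj_eqI) (auto simp: adj_right blinfun.diff_left cinner_diff_left cinner_diff_right)

lemma adj_scaleR: "T \<in> bops \<Longrightarrow> adj (r *\<^sub>R T) = r *\<^sub>R adj T"
  by (rule adj_eqI) (auto simp: adj_right blinfun.scaleR_left cinner_scaleR_left cinner_scaleR_right)

lemma adj_scaleC_op: "T \<in> bops \<Longrightarrow> adj (scaleC_op c T) = scaleC_op (cnj c) (adj T)"
  by (rule adj_eqI) (auto simp: adj_right cinner_scaleC_left cinner_scaleC_right)

text \<open>One half of the C*-identity; with submultiplicativity of the norm it already implies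
  that \<open>adj\<close> is isometric.\<close>

lemma norm_adj_comp_self: "T \<in> bops \<Longrightarrow> (norm T)\<^sup>2 \<le> norm (adj T o\<^sub>L T)"
proof -
  assume T: "T \<in> bops"
  have "norm T \<le> sqrt (norm (adj T o\<^sub>L T))"
  proof (rule norm_blinfun_bound)
    fix x
    have "complex_of_real ((norm (blinfun_apply T x))\<^sup>2) = cinner x (blinfun_apply (adj T o\<^sub>L T) x)"
      by (simp add: adj_right[OF T] cinner_self)
    then have "cmod (complex_of_real ((norm (blinfun_apply T x))\<^sup>2)) =
        cmod (cinner x (blinfun_apply (adj T o\<^sub>L T) x))"
      by (rule arg_cong)
    then have "(norm (blinfun_apply T x))\<^sup>2 = cmod (cinner x (blinfun_apply (adj T o\<^sub>L T) x))"
      by (simp only: norm_of_real) simp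
    also have "\<dots> \<le> norm x * (norm (adj T o\<^sub>L T) * norm x)"
      by (rule order_trans[OF cmod_cinner_le_norm]) (intro mult_left_mono norm_blinfun norm_ge_zero)
    also have "\<dots> = (sqrt (norm (adj T o\<^sub>L T)) * norm x)\<^sup>2"
      by (simp add: power_mult_distrib) (simp add: power2_eq_square)
    finally show "norm (blinfun_apply T x) \<le> sqrt (norm (adj T o\<^sub>L T)) * norm x"
      by (rule power2_le_imp_le) simp
  qed simp
  then have "(norm T)\<^sup>2 \<le> (sqrt (norm (adj T o\<^sub>L T)))\<^sup>2" by (intro power_mono) auto
  then show ?thesis by simp
qed

lemma norm_adj: "T \<in> bops \<Longrightarrow> norm (adj T) = norm T"
proof -
  have *: "norm T \<le> norm (adj T)" if "T \<in> bops" for T :: "'x::chilbert_space \<Rightarrow>\<^sub>L 'y::chilbert_space"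
  proof (cases "norm T = 0")
    case False
    have "norm T * norm T \<le> norm (adj T) * norm T"
      using norm_adj_comp_self[OF that] norm_blinfun_compose[of "adj T" T] by (simp add: power2_eq_square)
    then show ?thesis using False by simp
  qed simp
  assume T: "T \<in> bops"
  then show ?thesis using *[OF T] *[OF bops_adj[OF T]] by simp
qed

section \<open>Unitary operators and rules for composition\<close>

lemma unitary_bops [simp]: "unitary U \<Longrightarrow> U \<in> bops" by (simp only: unitary_def)
lemma unitary_adj_comp [simp]: "unitary U \<Longrightarrow> adj U o\<^sub>L U = id_blinfun" by (simp only: unitary_def)
lemma unitary_comp_adj [simp]: "unitary U \<Longrightarrow> U o\<^sub>L adj U = id_blinfun" by (simp only: unitary_def)
lemma unitary_adj [simp, intro]: "unitary U \<Longrightarrow> unitary (adj U)"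
  unfolding unitary_def by auto
lemma unitary_apply_adj [simp]: "unitary U \<Longrightarrow> blinfun_apply U (blinfun_apply (adj U) x) = x"
  by (simp flip: blinfun_apply_blinfun_compose)
lemma unitary_adj_apply [simp]: "unitary U \<Longrightarrow> blinfun_apply (adj U) (blinfun_apply U x) = x"
  by (simp flip: blinfun_apply_blinfun_compose)
lemma unitary_comp [simp, intro]: "unitary U \<Longrightarrow> unitary V \<Longrightarrow> unitary (U o\<^sub>L V)"
  unfolding unitary_def[of "U o\<^sub>L V"] by (auto simp: adj_comp intro!: blinfun_eqI)

lemma unitary_cinner: "unitary U \<Longrightarrow> cinner (blinfun_apply U x) (blinfun_apply U y) = cinner x y"
  using adj_right[of U x "blinfun_apply U y"] by simp

lemma blinfun_compose_add_left: "(S + S') o\<^sub>L T = (S o\<^sub>L T) + (S' o\<^sub>L T)"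
  by (rule bounded_bilinear.add_left[OF bounded_bilinear_blinfun_compose])
lemma blinfun_compose_add_right: "S o\<^sub>L (T + T') = (S o\<^sub>L T) + (S o\<^sub>L T')"
  by (rule bounded_bilinear.add_right[OF bounded_bilinear_blinfun_compose])
lemma blinfun_compose_diff_left: "(S - S') o\<^sub>L T = (S o\<^sub>L T) - (S' o\<^sub>L T)"
  by (rule bounded_bilinear.diff_left[OF bounded_bilinear_blinfun_compose])
lemma blinfun_compose_diff_right: "S o\<^sub>L (T - T') = (S o\<^sub>L T) - (S o\<^sub>L T')"
  by (rule bounded_bilinear.diff_right[OF bounded_bilinear_blinfun_compose])
lemmas bounded_linear_comp_left = bounded_bilinear.bounded_linear_left[OF bounded_bilinear_blinfun_compose]
lemmas bounded_linear_comp_right = bounded_bilinear.bounded_linear_right[OF bounded_bilinear_blinfun_compose]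

lemma comp_id_left [simp]: "id_blinfun o\<^sub>L T = T" by (rule blinfun_eqI) simp
lemma comp_id_right [simp]: "T o\<^sub>L id_blinfun = T" by (rule blinfun_eqI) simp
lemma comp_assoc: "(R o\<^sub>L S) o\<^sub>L T = R o\<^sub>L (S o\<^sub>L T)" by (rule blinfun_eqI) simp

lemma unitary_comp_adj_left [simp]: "unitary U \<Longrightarrow> U o\<^sub>L (adj U o\<^sub>L T) = T"
  by (simp flip: comp_assoc)
lemma unitary_adj_comp_left [simp]: "unitary U \<Longrightarrow> adj U o\<^sub>L (U o\<^sub>L T) = T"
  by (simp flip: comp_assoc)

section \<open>Bounded operators prescribed on a total set\<close>

lemma closure_graph_norm_le:
  assumes "\<And>u u'. (u, u') \<in> span G \<Longrightarrow> norm u' \<le> c * norm u" "(u, u') \<in> closure (span G)"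
  shows "norm u' \<le> c * norm u"
proof -
  have "closure (span G) \<subseteq> {p. norm (snd p) \<le> c * norm (fst p)}"
    by (rule closure_minimal) (use assms(1) in \<open>auto intro!: closed_Collect_le continuous_intros\<close>)
  then show ?thesis using assms(2) by auto
qed

lemma closure_graph_total:
  fixes G :: "('a::banach \<times> 'b::banach) set"
  assumes bound: "\<And>u u'. (u, u') \<in> span G \<Longrightarrow> norm u' \<le> c * norm u" and c: "0 \<le> c"
    and u: "u \<in> closure (span (fst ` G))"
  shows "\<exists>u'. (u, u') \<in> closure (span G)"
proof -
  obtain s where s: "\<And>n. s n \<in> span (fst ` G)" "s \<longlonglongrightarrow> u" using u by (auto simp: closure_sequential)
  have "span (fst ` G) = fst ` span G" by (rule linear_span_image[OF linear_fst])
  then have "\<forall>n. \<exists>t. (s n, t) \<in> span G" using s(1) by force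
  then obtain t where t: "\<And>n. (s n, t n) \<in> span G" by metis
  have "Cauchy t"
  proof (rule metric_CauchyI)
    fix \<epsilon> :: real assume \<epsilon>: "\<epsilon> > 0"
    have "Cauchy s" using s(2) by (rule LIMSEQ_imp_Cauchy)
    \<comment> \<open>The divisor is \<open>c + 1\<close> because \<open>c\<close> may be 0.\<close>
    then obtain N where N: "\<And>m n. m \<ge> N \<Longrightarrow> n \<ge> N \<Longrightarrow> dist (s m) (s n) < \<epsilon> / (c + 1)"
      using metric_CauchyD[of s "\<epsilon> / (c + 1)"] divide_pos_pos[OF \<epsilon> add_nonneg_pos[OF c zero_less_one]] by blast
    have "dist (t m) (t n) < \<epsilon>" if "m \<ge> N" "n \<ge> N" for m n
    proof -
      have "(s m - s n, t m - t n) \<in> span G" using span_diff[OF t[of m] t[of n]] by simp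
      then have "dist (t m) (t n) \<le> c * dist (s m) (s n)" unfolding dist_norm by (rule bound)
      also have "\<dots> \<le> (c + 1) * dist (s m) (s n)" by (intro mult_right_mono) auto
      also have "\<dots> < \<epsilon>" using N[OF that] c by (simp add: field_simps)
      finally show ?thesis .
    qed
    then show "\<exists>N. \<forall>m\<ge>N. \<forall>n\<ge>N. dist (t m) (t n) < \<epsilon>" by blast
  qed
  then obtain u' where "t \<longlonglongrightarrow> u'" using Cauchy_convergent convergent_def by blast
  then have "(\<lambda>n. (s n, t n)) \<longlonglongrightarrow> (u, u')" using s(2) by (intro tendsto_Pair)
  then have "(u, u') \<in> closure (span G)"
    using t unfolding closure_sequential by (intro exI[of _ "\<lambda>n. (s n, t n)"]) auto
  then show ?thesis by blast
qed

text \<open>Flips, amplifications and resolvents are prescribed on generators only. The bound on the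
  real span of \<open>G\<close> settles consistency: two values over the same vector differ by a
  vector of norm at most \<open>c * 0\<close>.\<close>

theorem blinfun_of_graph:
  fixes G :: "('a::banach \<times> 'b::banach) set"
  assumes bound: "\<And>u u'. (u, u') \<in> span G \<Longrightarrow> norm u' \<le> c * norm u"
    and dense: "closure (span (fst ` G)) = UNIV" and c: "0 \<le> c"
  shows "\<exists>R. (\<forall>(u, u')\<in>G. blinfun_apply R u = u') \<and> norm R \<le> c"
proof -
  let ?G = "closure (span G)"
  have bound': "norm u' \<le> c * norm u" if "(u, u') \<in> ?G" for u u'
    using closure_graph_norm_le[of G c u u'] bound that by blast
  have uniq: "u' = u''" if "(u, u') \<in> ?G" "(u, u'') \<in> ?G" for u u' u''
    using bound'[of 0 "u' - u''"] subspace_diff[OF subspace_closure_span that] by simp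
  obtain R where R: "\<And>u. (u, R u) \<in> ?G"
    using closure_graph_total[OF bound c] dense by (metis UNIV_I)
  have bl: "bounded_linear R"
  proof (rule bounded_linear_intro[of _ c])
    show "R (x + y) = R x + R y" for x y
      by (rule uniq[OF R]) (use subspace_add[OF subspace_closure_span R[of x] R[of y]] in simp)
    show "R (r *\<^sub>R x) = r *\<^sub>R R x" for r x
      by (rule uniq[OF R]) (use subspace_scale[OF subspace_closure_span R[of x], of r] in simp)
    show "norm (R x) \<le> norm x * c" for x using bound'[OF R[of x]] by (simp add: mult.commute)
  qed
  then have ap: "blinfun_apply (Blinfun R) = R" by (rule bounded_linear_Blinfun_apply)
  have "norm (Blinfun R) \<le> c" by (rule norm_blinfun_bound[OF c]) (simp add: ap bound'[OF R])
  moreover have "\<forall>(u, u')\<in>G. blinfun_apply (Blinfun R) u = u'"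
    using uniq[OF R] by (auto simp: ap intro: closure_span_superset)
  ultimately show ?thesis by blast
qed

text \<open>The generators of the domain have dense real span, so their complex multiples need a separate
  hypothesis for complex linearity of the extension.\<close>

lemma blinfun_isometry_of_graph:
  fixes G :: "('a::chilbert_space \<times> 'b::chilbert_space) set"
  assumes inn: "\<And>u u' v v'. (u, u') \<in> G \<Longrightarrow> (v, v') \<in> G \<Longrightarrow> cinner u' v' = cinner u v"
    and dense: "closure (span (fst ` G)) = UNIV"
    and scale: "\<And>u u' c. (u, u') \<in> G \<Longrightarrow> (c *\<^sub>C u, c *\<^sub>C u') \<in> G"
  shows "\<exists>R\<in>bops. (\<forall>(u, u')\<in>G. blinfun_apply R u = u') \<and> adj R o\<^sub>L R = id_blinfun"
proof -
  have sp: "cinner (snd p) (snd q) = cinner (fst p) (fst q)" if p: "p \<in> span G" and q: "q \<in> span G" for p q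
  proof -
    have 0: "cinner (snd p) (snd q) = cinner (fst p) (fst q)" if "p \<in> G" "q \<in> G" for p q
      using inn[of "fst p" "snd p" "fst q" "snd q"] that by simp
    have 1: "cinner (snd p) (snd q) = cinner (fst p) (fst q)" if "p \<in> span G" "q \<in> G" for p q
      using that(1) by (induction rule: span_induct_alt)
        (simp_all add: cinner_add_left cinner_scaleR_left 0[OF _ that(2)])
    show ?thesis using q by (induction rule: span_induct_alt)
        (simp_all add: cinner_add_right cinner_scaleR_right 1[OF p])
  qed
  have "norm u' \<le> 1 * norm u" if "(u, u') \<in> span G" for u u'
    using sp[OF that that] unfolding fst_conv snd_conv cinner_self of_real_eq_iff by simp
  then obtain R where "\<forall>(u, u')\<in>G. blinfun_apply R u = u'"
    using blinfun_of_graph[OF _ dense, of 1] by (metis zero_le_one)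
  then have R: "blinfun_apply R u = u'" if "(u, u') \<in> G" for u u' using that by auto
  have "blinfun_apply R (c *\<^sub>C x) = c *\<^sub>C blinfun_apply R x" for c x
  proof (rule closed_eq_on_total[of "\<lambda>x. blinfun_apply R (c *\<^sub>C x)" "\<lambda>x. c *\<^sub>C blinfun_apply R x" "fst ` G"])
    show "bounded_linear (\<lambda>x. blinfun_apply R (c *\<^sub>C x))" "bounded_linear (\<lambda>x. c *\<^sub>C blinfun_apply R x)"
      by (intro bounded_linear_compose[OF blinfun.bounded_linear_right bounded_linear_scaleC]
          bounded_linear_compose[OF bounded_linear_scaleC blinfun.bounded_linear_right])+
    show "blinfun_apply R (c *\<^sub>C u) = c *\<^sub>C blinfun_apply R u" if u: "u \<in> fst ` G" for u
    proof -
      obtain u' where "(u, u') \<in> G" using u by force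
      then show ?thesis using R[of u u'] R[OF scale[of u u' c]] by simp
    qed
  qed (simp add: dense)
  then have Rb: "R \<in> bops" by (simp add: bops_def)
  moreover have "adj R o\<^sub>L R = id_blinfun"
  proof (rule blinfun_eq_on_total[OF _ dense], rule cinner_total_eqI[OF dense])
    fix x y assume "x \<in> fst ` G" "y \<in> fst ` G"
    then obtain x' y' where "(x, x') \<in> G" "(y, y') \<in> G" by force
    then show "cinner y (blinfun_apply (adj R o\<^sub>L R) x) = cinner y (blinfun_apply id_blinfun x)"
      using inn[of y y' x x'] R[of x x'] R[of y y'] by (simp add: adj_right[OF Rb])
  qed
  moreover have "\<forall>(u, u')\<in>G. blinfun_apply R u = u'" using R by auto
  ultimately show ?thesis by blast
qed

section \<open>Operators on Hilbert space tensor products\<close>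

lemma norm_tensor: "norm (x \<otimes> y) = norm x * norm y"
proof -
  have "complex_of_real ((norm (x \<otimes> y))\<^sup>2) = of_real ((norm x * norm y)\<^sup>2)"
    unfolding cinner_self[symmetric] cinner_tensor by (simp add: cinner_self power_mult_distrib)
  then have "(norm (x \<otimes> y))\<^sup>2 = (norm x * norm y)\<^sup>2" by (simp only: of_real_eq_iff)
  then show ?thesis by (simp add: power2_eq_iff_nonneg)
qed

lemma bounded_bilinear_tensor: "bounded_bilinear (\<otimes>)"
proof
  show "(r *\<^sub>R x) \<otimes> y = r *\<^sub>R (x \<otimes> y)" for r and x :: 'a and y :: 'b
    by (simp add: tensor_scaleC_left flip: scaleC_of_real)
  show "x \<otimes> (r *\<^sub>R y) = r *\<^sub>R (x \<otimes> y)" for r and x :: 'a and y :: 'b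
    by (simp add: tensor_scaleC_right flip: scaleC_of_real)
  show "\<exists>K. \<forall>(x::'a) (y::'b). norm (x \<otimes> y) \<le> norm x * norm y * K"
    by (rule exI[of _ 1]) (simp add: norm_tensor)
qed (simp_all add: tensor_add_left tensor_add_right)

lemmas bounded_linear_tensor_left = bounded_bilinear.bounded_linear_left[OF bounded_bilinear_tensor]
lemmas bounded_linear_tensor_right = bounded_bilinear.bounded_linear_right[OF bounded_bilinear_tensor]
lemmas tendsto_tensor [tendsto_intros] = bounded_bilinear.tendsto[OF bounded_bilinear_tensor]

text \<open>Density is extended one factor at a time: first \<open>x\<close> becomes arbitrary while
  \<open>y\<close> stays a generator, then \<open>y\<close> as well.\<close>

lemma total_tensor:
  assumes X: "closure (span X) = UNIV" and Y: "closure (span Y) = UNIV"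
  shows "closure (span {x \<otimes> y |x y. x \<in> X \<and> y \<in> Y}) = (UNIV :: ('a::chilbert_space \<otimes>\<^sub>H 'b::chilbert_space) set)"
proof -
  let ?M = "closure (span {x \<otimes> y |x y. x \<in> X \<and> y \<in> Y})"
  have 1: "x \<otimes> y \<in> ?M" if "y \<in> Y" for x y
    by (rule bounded_linear_closure_span[OF bounded_linear_tensor_left _ _ _ , of ?M X])
      (use that X in \<open>auto intro!: closure_span_superset\<close>)
  have "x \<otimes> y \<in> ?M" for x y
    by (rule bounded_linear_closure_span[OF bounded_linear_tensor_right, of ?M Y])
      (use 1 Y in auto)
  then have "closure (span {x \<otimes> y |x y. True}) \<subseteq> ?M"
    by (intro closure_minimal span_minimal) (auto simp: subspace_closure_span)
  then show ?thesis unfolding closure_span_tensor by blast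
qed

section \<open>Operators determined by elementary tensors\<close>

lemma htensor_eqI:
  fixes S T :: "'a::chilbert_space \<otimes>\<^sub>H 'b::chilbert_space \<Rightarrow>\<^sub>L 'c::real_normed_vector"
  assumes "\<And>x y. blinfun_apply S (x \<otimes> y) = blinfun_apply T (x \<otimes> y)"
  shows "S = T"
  by (rule blinfun_eq_on_total[OF _ closure_span_tensor]) (use assms in auto)

lemma htensor_cinner_eqI:
  assumes "\<And>x y. cinner (x \<otimes> y) u = cinner (x \<otimes> y) v"
  shows "u = v"
  by (rule cinner_total_eqI[OF closure_span_tensor]) (use assms in auto)

lemma total_tensor3:
  "closure (span {x \<otimes> y \<otimes> z |x y z. True}) = (UNIV :: ('a::chilbert_space \<otimes>\<^sub>H 'b::chilbert_space \<otimes>\<^sub>H 'c::chilbert_space) set)"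
proof -
  have *: "{x \<otimes> y \<otimes> z |(x::'a) (y::'b) (z::'c). True} =
      {x \<otimes> w |x w. x \<in> UNIV \<and> w \<in> {y \<otimes> z |y z. True}}" by auto
  show ?thesis unfolding * by (rule total_tensor) (simp, rule closure_span_tensor)
qed

lemma total_tensor3':
  "closure (span {(x \<otimes> y) \<otimes> z |x y z. True}) = (UNIV :: (('a::chilbert_space \<otimes>\<^sub>H 'b::chilbert_space) \<otimes>\<^sub>H 'c::chilbert_space) set)"
proof -
  have *: "{(x \<otimes> y) \<otimes> z |(x::'a) (y::'b) (z::'c). True} =
      {w \<otimes> z |w z. w \<in> {x \<otimes> y |x y. True} \<and> z \<in> UNIV}" by auto
  show ?thesis unfolding * by (rule total_tensor) (rule closure_span_tensor, simp)
qed

lemma htensor3_eqI: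
  assumes "\<And>x y z. blinfun_apply S (x \<otimes> y \<otimes> z) = blinfun_apply T (x \<otimes> y \<otimes> z)"
  shows "S = T"
  by (rule blinfun_eq_on_total[OF _ total_tensor3]) (use assms in auto)

lemma htensor3'_eqI:
  assumes "\<And>x y z. blinfun_apply S ((x \<otimes> y) \<otimes> z) = blinfun_apply T ((x \<otimes> y) \<otimes> z)"
  shows "S = T"
  by (rule blinfun_eq_on_total[OF _ total_tensor3']) (use assms in auto)

lemma htensor4_eqI:
  assumes "\<And>w x y z. blinfun_apply S (w \<otimes> x \<otimes> y \<otimes> z) = blinfun_apply T (w \<otimes> x \<otimes> y \<otimes> z)"
  shows "S = T"
  by (rule blinfun_eq_on_total[OF _ total_tensor[OF _ total_tensor3, of UNIV]]) (use assms in auto)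

text \<open>Its adjoint contracts the first leg with \<open>x\<close>. Columns, slices and matrix
  coefficients are all composed from these maps and from \<open>tensor_right\<close>.\<close>

definition tensor_left :: "'a::chilbert_space \<Rightarrow> ('b::chilbert_space \<Rightarrow>\<^sub>L 'a \<otimes>\<^sub>H 'b)" where
  "tensor_left x = Blinfun (\<lambda>y. x \<otimes> y)"

lemma tensor_left_apply [simp]: "blinfun_apply (tensor_left x) y = x \<otimes> y"
  by (simp add: tensor_left_def bounded_linear_Blinfun_apply bounded_linear_tensor_right)

lemma tensor_right_apply [simp]: "blinfun_apply (tensor_right y) x = x \<otimes> y"
  by (simp add: tensor_right_def bounded_linear_Blinfun_apply bounded_linear_tensor_left)

lemma bops_tensor_left [simp]: "tensor_left x \<in> bops" by (simp add: bops_def tensor_scaleC_right)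
lemma bops_tensor_right [simp]: "tensor_right x \<in> bops" by (simp add: bops_def tensor_scaleC_left)

lemma norm_tensor_left: "norm (tensor_left x) \<le> norm x"
  by (rule norm_blinfun_bound) (simp_all add: norm_tensor)
lemma bounded_linear_of_tensor_left: "bounded_linear tensor_left"
  by (rule bounded_linear_intro[of _ 1])
    (auto intro!: blinfun_eqI simp: norm_tensor_left blinfun.add_left blinfun.scaleR_left
      bounded_bilinear.add_left[OF bounded_bilinear_tensor] bounded_bilinear.scaleR_left[OF bounded_bilinear_tensor])

lemma adj_tensor_left_apply [simp]: "blinfun_apply (adj (tensor_left x)) (x' \<otimes> y) = cinner x x' *\<^sub>C y"
  by (rule cinner_extI) (simp add: adj_right cinner_tensor cinner_scaleC_right)

lemma adj_tensor_right_apply [simp]: "blinfun_apply (adj (tensor_right y)) (x \<otimes> y') = cinner y y' *\<^sub>C x"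
  by (rule cinner_extI) (simp add: adj_right cinner_tensor cinner_scaleC_right mult.commute)

text \<open>In the model of the tensor product as a direct sum of copies of the second factor,
  \<open>id \<otimes> T\<close> acts componentwise, which yields its norm bound at once. Operators
  on the first factor are reached from it through \<open>flip\<close>.\<close>

lift_definition map_second :: "('b::chilbert_space \<Rightarrow>\<^sub>L 'd::chilbert_space) \<Rightarrow> 'a::chilbert_space \<otimes>\<^sub>H 'b \<Rightarrow> 'a \<otimes>\<^sub>H 'd"
  is "\<lambda>T f e. blinfun_apply T (f e)"
proof -
  fix T :: "'b \<Rightarrow>\<^sub>L 'd" and f :: "'a \<Rightarrow> 'b"
  assume f: "(\<forall>e. e \<notin> onb \<longrightarrow> f e = 0) \<and> (\<lambda>e. (norm (f e))\<^sup>2) summable_on onb"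
  then have "(\<lambda>e. (norm T)\<^sup>2 * (norm (f e))\<^sup>2) summable_on onb" by (intro summable_on_cmult_right) auto
  then have "(\<lambda>e. (norm (blinfun_apply T (f e)))\<^sup>2) summable_on onb"
  proof (rule summable_on_bound)
    show "norm ((norm (blinfun_apply T (f e)))\<^sup>2) \<le> (norm T)\<^sup>2 * (norm (f e))\<^sup>2" for e
      using power_mono[OF norm_blinfun[of T "f e"], of 2] by (simp add: power_mult_distrib)
  qed
  then show "(\<forall>e. e \<notin> onb \<longrightarrow> blinfun_apply T (f e) = 0) \<and>
      (\<lambda>e. (norm (blinfun_apply T (f e)))\<^sup>2) summable_on onb"
    using f by simp
qed

lemma
  fixes T :: "'a::chilbert_space \<Rightarrow>\<^sub>L 'b::chilbert_space"
  shows bounded_linear_map_second: "bounded_linear (map_second T :: 'c::chilbert_space \<otimes>\<^sub>H 'a \<Rightarrow> 'c \<otimes>\<^sub>H 'b)"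
    and norm_map_second: "\<And>f :: 'c \<otimes>\<^sub>H 'a. norm (map_second T f) \<le> norm T * norm f"
proof -
  show n: "norm (map_second T f) \<le> norm T * norm f" for f :: "'c \<otimes>\<^sub>H 'a"
  proof (rule power2_le_imp_le)
    have "(norm (map_second T f))\<^sup>2 = infsum (\<lambda>e. (norm (blinfun_apply T (coord f e)))\<^sup>2) onb"
      unfolding norm_htensor_sq by (simp add: map_second.rep_eq)
    also have "\<dots> \<le> infsum (\<lambda>e. (norm T)\<^sup>2 * (norm (coord f e))\<^sup>2) onb"
    proof (rule infsum_mono)
      show "(\<lambda>e. (norm (blinfun_apply T (coord f e)))\<^sup>2) summable_on onb"
        using coord_summable[of "map_second T f"] by (simp add: map_second.rep_eq)
      show "(\<lambda>e. (norm T)\<^sup>2 * (norm (coord f e))\<^sup>2) summable_on onb"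
        by (intro summable_on_cmult_right coord_summable)
      show "(norm (blinfun_apply T (coord f e)))\<^sup>2 \<le> (norm T)\<^sup>2 * (norm (coord f e))\<^sup>2" for e
        using power_mono[OF norm_blinfun[of T "coord f e"], of 2] by (simp add: power_mult_distrib)
    qed
    also have "\<dots> = (norm T * norm f)\<^sup>2"
      by (simp add: infsum_cmult_right' norm_htensor_sq power_mult_distrib)
    finally show "(norm (map_second T f))\<^sup>2 \<le> (norm T * norm f)\<^sup>2" .
  qed simp
  show "bounded_linear (map_second T :: 'c \<otimes>\<^sub>H 'a \<Rightarrow> 'c \<otimes>\<^sub>H 'b)"
  proof (rule bounded_linear_intro[of _ "norm T"])
    show "map_second T (f + g) = map_second T f + map_second T g" for f g :: "'c \<otimes>\<^sub>H 'a"
      by transfer (simp add: blinfun.add_right)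
    show "map_second T (r *\<^sub>R f) = r *\<^sub>R map_second T f" for r and f :: "'c \<otimes>\<^sub>H 'a"
      by transfer (simp add: blinfun.scaleR_right)
    show "norm (map_second T f) \<le> norm f * norm T" for f :: "'c \<otimes>\<^sub>H 'a"
      using n[of f] by (simp add: mult.commute)
  qed
qed

lemma map_second_tensor: "T \<in> bops \<Longrightarrow> map_second T (x \<otimes> y) = x \<otimes> blinfun_apply T y"
  by transfer (auto simp: bopsD)

lemma bops_htensorI:
  fixes R :: "'a::chilbert_space \<otimes>\<^sub>H 'b::chilbert_space \<Rightarrow>\<^sub>L 'c::chilbert_space"
  assumes "\<And>x y c. blinfun_apply R (c *\<^sub>C (x \<otimes> y)) = c *\<^sub>C blinfun_apply R (x \<otimes> y)"
  shows "R \<in> bops"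
proof -
  have "blinfun_apply R (c *\<^sub>C f) = c *\<^sub>C blinfun_apply R f" for c f
  proof (rule closed_eq_on_total[of "\<lambda>f. blinfun_apply R (c *\<^sub>C f)" "\<lambda>f. c *\<^sub>C blinfun_apply R f"])
    show "bounded_linear (\<lambda>x. blinfun_apply R (c *\<^sub>C x))"
      by (rule bounded_linear_compose[OF blinfun.bounded_linear_right bounded_linear_scaleC])
    show "bounded_linear (\<lambda>x. c *\<^sub>C blinfun_apply R x)"
      by (rule bounded_linear_compose[OF bounded_linear_scaleC blinfun.bounded_linear_right])
    show "f \<in> closure (span {x \<otimes> y |x y. True})" unfolding closure_span_tensor by (rule UNIV_I)
  qed (use assms in auto)
  then show ?thesis by (simp add: bops_def)
qed

text \<open>The model treats the two factors differently, so the flip is no mere rearrangement of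
  coordinates. It exists because it preserves inner products of elementary tensors.\<close>

lemma flip_ex: "\<exists>R. \<forall>x y. blinfun_apply R (x \<otimes> y) = y \<otimes> x"
proof -
  let ?G = "{(x \<otimes> y, y \<otimes> x) |(x::'a) (y::'b). True}"
  have "\<exists>R\<in>bops. (\<forall>(u, u')\<in>?G. blinfun_apply R u = u') \<and> adj R o\<^sub>L R = id_blinfun"
  proof (rule blinfun_isometry_of_graph)
    have *: "fst ` ?G = {x \<otimes> y |x y. True}" by force
    show "closure (span (fst ` ?G)) = UNIV" unfolding * by (rule closure_span_tensor)
    show "(c *\<^sub>C u, c *\<^sub>C u') \<in> ?G" if uu: "(u, u') \<in> ?G" for u u' c
    proof -
      obtain x y where "u = x \<otimes> y" "u' = y \<otimes> x" using uu by blast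
      then have "(c *\<^sub>C u, c *\<^sub>C u') = ((c *\<^sub>C x) \<otimes> y, y \<otimes> (c *\<^sub>C x))"
        by (simp add: tensor_scaleC_left tensor_scaleC_right)
      then show ?thesis by blast
    qed
  qed (auto simp: cinner_tensor)
  then obtain R where R: "\<forall>(u, u')\<in>?G. blinfun_apply R u = u'" by blast
  have "blinfun_apply R (x \<otimes> y) = y \<otimes> x" for x y
    using bspec[OF R, of "(x \<otimes> y, y \<otimes> x)"] by auto
  then show ?thesis by blast
qed

lemma flip_apply [simp]: "blinfun_apply flip (x \<otimes> y) = y \<otimes> x"
proof -
  have "\<exists>!R. \<forall>x y. blinfun_apply R (x \<otimes> y) = y \<otimes> x"
    using flip_ex by (rule ex_ex1I) (auto intro: htensor_eqI)
  then have "\<forall>x y. blinfun_apply flip (x \<otimes> y) = y \<otimes> x" unfolding flip_def by (rule theI')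
  then show ?thesis by blast
qed

lemma bops_flip [simp]: "flip \<in> bops"
  by (rule bops_htensorI) (simp add: tensor_scaleC_right flip: tensor_scaleC_left)

lemma flip_flip [simp]: "flip o\<^sub>L flip = id_blinfun"
  by (rule htensor_eqI) simp

lemma flip_flip_comp [simp]: "flip o\<^sub>L (flip o\<^sub>L T) = T"
  by (simp flip: comp_assoc)

lemma adj_flip [simp]: "adj flip = flip"
  by (rule htensor_eqI, rule htensor_cinner_eqI) (simp add: adj_right cinner_tensor)

lemma unitary_flip [simp]: "unitary flip" by (simp add: unitary_def)

lemma unitary_id [simp]: "unitary id_blinfun" by (simp add: unitary_def)

lemma norm_unitary_apply: "unitary U \<Longrightarrow> norm (blinfun_apply U x) = norm x"
proof -
  assume "unitary U"
  then have "complex_of_real ((norm (blinfun_apply U x))\<^sup>2) = of_real ((norm x)\<^sup>2)"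
    unfolding cinner_self[symmetric] by (rule unitary_cinner)
  then have "(norm (blinfun_apply U x))\<^sup>2 = (norm x)\<^sup>2" by (simp only: of_real_eq_iff)
  then show ?thesis by (simp add: power2_eq_iff_nonneg)
qed

lemma norm_unitary: "unitary U \<Longrightarrow> norm U \<le> 1"
  by (rule norm_blinfun_bound) (auto simp: norm_unitary_apply)

lemma tensor_op_ex:
  fixes S :: "'a::chilbert_space \<Rightarrow>\<^sub>L 'c::chilbert_space" and T :: "'b::chilbert_space \<Rightarrow>\<^sub>L 'd::chilbert_space"
  assumes S: "S \<in> bops" and T: "T \<in> bops"
  shows "\<exists>R. (\<forall>x y. blinfun_apply R (x \<otimes> y) = blinfun_apply S x \<otimes> blinfun_apply T y) \<and> norm R \<le> norm S * norm T"
proof -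
  define L :: "'a \<otimes>\<^sub>H 'b \<Rightarrow>\<^sub>L 'a \<otimes>\<^sub>H 'd" where "L = Blinfun (map_second T)"
  define K :: "'d \<otimes>\<^sub>H 'a \<Rightarrow>\<^sub>L 'd \<otimes>\<^sub>H 'c" where "K = Blinfun (map_second S)"
  have ap: "blinfun_apply L = map_second T" "blinfun_apply K = map_second S"
    unfolding L_def K_def by (intro bounded_linear_Blinfun_apply bounded_linear_map_second)+
  have n: "norm L \<le> norm T" "norm K \<le> norm S"
    by (rule norm_blinfun_bound; simp add: ap norm_map_second)+
  \<comment> \<open>This is \<open>(S \<otimes> 1) (1 \<otimes> T)\<close>, where
    \<open>S \<otimes> 1\<close> is obtained from \<open>1 \<otimes> S\<close> by two flips.\<close>
  let ?R = "flip o\<^sub>L K o\<^sub>L flip o\<^sub>L L"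
  have "norm ?R \<le> norm (flip o\<^sub>L K o\<^sub>L flip) * norm L" by (rule norm_blinfun_compose)
  also have "\<dots> \<le> (norm (flip o\<^sub>L K) * 1) * norm L"
    by (intro mult_right_mono order_trans[OF norm_blinfun_compose] mult_left_mono norm_unitary) auto
  also have "\<dots> \<le> ((1 * norm K) * 1) * norm L"
    by (intro mult_right_mono order_trans[OF norm_blinfun_compose] norm_unitary) auto
  also have "\<dots> \<le> norm S * norm T" using n by (simp add: mult_mono)
  finally show ?thesis
    by (intro exI[of _ ?R]) (simp add: ap map_second_tensor S T)
qed

lemma tensor_op_eqI:
  assumes "\<And>x y. blinfun_apply R (x \<otimes> y) = blinfun_apply S x \<otimes> blinfun_apply T y"
  shows "S \<otimes>\<^sub>o T = R"
  unfolding tensor_op_def by (rule the_equality) (use assms in \<open>auto intro: htensor_eqI\<close>)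

lemma tensor_op_apply [simp]:
  "S \<in> bops \<Longrightarrow> T \<in> bops \<Longrightarrow> blinfun_apply (S \<otimes>\<^sub>o T) (x \<otimes> y) = blinfun_apply S x \<otimes> blinfun_apply T y"
  using tensor_op_ex[of S T] tensor_op_eqI by metis

lemma norm_tensor_op: "S \<in> bops \<Longrightarrow> T \<in> bops \<Longrightarrow> norm (S \<otimes>\<^sub>o T) \<le> norm S * norm T"
  using tensor_op_ex[of S T] tensor_op_eqI by metis

lemma bops_tensor_op [simp, intro]: "S \<in> bops \<Longrightarrow> T \<in> bops \<Longrightarrow> S \<otimes>\<^sub>o T \<in> bops"
  by (rule bops_htensorI) (simp add: bopsD flip: tensor_scaleC_left)

lemma tensor_op_comp:
  "S \<in> bops \<Longrightarrow> T \<in> bops \<Longrightarrow> S' \<in> bops \<Longrightarrow> T' \<in> bops \<Longrightarrow>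
    (S \<otimes>\<^sub>o T) o\<^sub>L (S' \<otimes>\<^sub>o T') = (S o\<^sub>L S') \<otimes>\<^sub>o (T o\<^sub>L T')"
  by (rule tensor_op_eqI[symmetric]) simp

lemma adj_tensor_op: "S \<in> bops \<Longrightarrow> T \<in> bops \<Longrightarrow> adj (S \<otimes>\<^sub>o T) = adj S \<otimes>\<^sub>o adj T"
proof (rule tensor_op_eqI[symmetric], rule htensor_cinner_eqI)
  fix x y x' y' assume S: "S \<in> bops" and T: "T \<in> bops"
  show "cinner (x' \<otimes> y') (blinfun_apply (adj (S \<otimes>\<^sub>o T)) (x \<otimes> y)) =
    cinner (x' \<otimes> y') (blinfun_apply (adj S) x \<otimes> blinfun_apply (adj T) y)"
    using S T by (simp add: adj_right cinner_tensor)
qed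

lemma tensor_op_id [simp]: "id_blinfun \<otimes>\<^sub>o id_blinfun = id_blinfun"
  by (rule tensor_op_eqI) simp

lemma tensor_op_add_left: "S \<in> bops \<Longrightarrow> S' \<in> bops \<Longrightarrow> T \<in> bops \<Longrightarrow> (S + S') \<otimes>\<^sub>o T = S \<otimes>\<^sub>o T + S' \<otimes>\<^sub>o T"
  by (rule tensor_op_eqI) (simp add: blinfun.add_left tensor_add_left)
lemma tensor_op_scaleC_left: "S \<in> bops \<Longrightarrow> T \<in> bops \<Longrightarrow> scaleC_op c S \<otimes>\<^sub>o T = scaleC_op c (S \<otimes>\<^sub>o T)"
  by (rule tensor_op_eqI) (simp add: tensor_scaleC_left)
lemma tensor_op_scaleR_left: "S \<in> bops \<Longrightarrow> T \<in> bops \<Longrightarrow> (r *\<^sub>R S) \<otimes>\<^sub>o T = r *\<^sub>R (S \<otimes>\<^sub>o T)"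
  using tensor_op_scaleC_left[of S T "of_real r"] by (simp add: scaleC_op_of_real)
lemma tensor_op_diff_left: "S \<in> bops \<Longrightarrow> S' \<in> bops \<Longrightarrow> T \<in> bops \<Longrightarrow> (S - S') \<otimes>\<^sub>o T = S \<otimes>\<^sub>o T - S' \<otimes>\<^sub>o T"
  using tensor_op_add_left[of "S - S'" S' T] by simp
lemma unitary_tensor_op [simp, intro]: "unitary U \<Longrightarrow> unitary V \<Longrightarrow> unitary (U \<otimes>\<^sub>o V)"
  unfolding unitary_def[of "U \<otimes>\<^sub>o V"] by (simp add: adj_tensor_op tensor_op_comp)

lemma assoc_ex:
  "\<exists>R. \<forall>(x::'a::chilbert_space) (y::'b::chilbert_space) (z::'c::chilbert_space). blinfun_apply R ((x \<otimes> y) \<otimes> z) =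
      x \<otimes> y \<otimes> z"
proof -
  let ?G = "{((x \<otimes> y) \<otimes> z, x \<otimes> y \<otimes> z) |(x::'a) (y::'b) (z::'c). True}"
  have "\<exists>R\<in>bops. (\<forall>(u, u')\<in>?G. blinfun_apply R u = u') \<and> adj R o\<^sub>L R = id_blinfun"
  proof (rule blinfun_isometry_of_graph)
    have *: "fst ` ?G = {(x \<otimes> y) \<otimes> z |x y z. True}" by force
    show "closure (span (fst ` ?G)) = UNIV" unfolding * by (rule total_tensor3')
    show "(c *\<^sub>C u, c *\<^sub>C u') \<in> ?G" if uu: "(u, u') \<in> ?G" for u u' c
    proof -
      obtain x y z where "u = (x \<otimes> y) \<otimes> z" "u' = x \<otimes> y \<otimes> z" using uu by blast
      then have "(c *\<^sub>C u, c *\<^sub>C u') = (((c *\<^sub>C x) \<otimes> y) \<otimes> z, (c *\<^sub>C x) \<otimes> y \<otimes> z)"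
        by (simp add: tensor_scaleC_left)
      then show ?thesis by blast
    qed
  qed (auto simp: cinner_tensor)
  then obtain R where R: "\<forall>(u, u')\<in>?G. blinfun_apply R u = u'" by blast
  have "blinfun_apply R ((x \<otimes> y) \<otimes> z) = x \<otimes> y \<otimes> z" for x y z
    using bspec[OF R, of "((x \<otimes> y) \<otimes> z, x \<otimes> y \<otimes> z)"] by auto
  then show ?thesis by blast
qed

lemma assoc_apply [simp]: "blinfun_apply assoc ((x \<otimes> y) \<otimes> z) = x \<otimes> y \<otimes> z"
proof -
  have "\<exists>!R. \<forall>x y z. blinfun_apply R ((x \<otimes> y) \<otimes> z) = x \<otimes> y \<otimes> z"
    using assoc_ex by (rule ex_ex1I) (auto intro: htensor3'_eqI)
  then have "\<forall>x y z. blinfun_apply assoc ((x \<otimes> y) \<otimes> z) = x \<otimes> y \<otimes> z" unfolding assoc_def by (rule theI')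
  then show ?thesis by blast
qed

lemma bops_assoc [simp]: "(assoc :: ('a::chilbert_space \<otimes>\<^sub>H 'b::chilbert_space) \<otimes>\<^sub>H 'c::chilbert_space \<Rightarrow>\<^sub>L _) \<in> bops"
proof -
  have "blinfun_apply assoc (c *\<^sub>C f) = c *\<^sub>C blinfun_apply assoc f" for c and f :: "('a \<otimes>\<^sub>H 'b) \<otimes>\<^sub>H 'c"
  proof (rule closed_eq_on_total[of "\<lambda>f. blinfun_apply assoc (c *\<^sub>C f)" "\<lambda>f. c *\<^sub>C blinfun_apply assoc f"])
    show "bounded_linear (\<lambda>x. blinfun_apply assoc (c *\<^sub>C (x :: ('a \<otimes>\<^sub>H 'b) \<otimes>\<^sub>H 'c)))"
      by (rule bounded_linear_compose[OF blinfun.bounded_linear_right bounded_linear_scaleC])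
    show "bounded_linear (\<lambda>x. c *\<^sub>C blinfun_apply assoc (x :: ('a \<otimes>\<^sub>H 'b) \<otimes>\<^sub>H 'c))"
      by (rule bounded_linear_compose[OF bounded_linear_scaleC blinfun.bounded_linear_right])
    show "f \<in> closure (span {(x \<otimes> y) \<otimes> z |x y z. True})" unfolding total_tensor3' by (rule UNIV_I)
    fix f :: "('a \<otimes>\<^sub>H 'b) \<otimes>\<^sub>H 'c" assume "f \<in> {(x \<otimes> y) \<otimes> z |(x::'a) (y::'b) (z::'c). True}"
    then obtain x y z where f: "f = (x \<otimes> y) \<otimes> z" by blast
    have "blinfun_apply assoc (((c *\<^sub>C x) \<otimes> y) \<otimes> z) = c *\<^sub>C (x \<otimes> y \<otimes> z)"
      by (subst assoc_apply) (simp only: tensor_scaleC_left)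
    then show "blinfun_apply assoc (c *\<^sub>C f) = c *\<^sub>C blinfun_apply assoc f"
      unfolding f tensor_scaleC_left assoc_apply .
  qed
  then show ?thesis by (simp add: bops_def)
qed

lemma adj_assoc_apply [simp]:
  fixes x :: "'a::chilbert_space" and y :: "'b::chilbert_space" and z :: "'c::chilbert_space"
  shows "blinfun_apply (adj assoc) (x \<otimes> y \<otimes> z) = (x \<otimes> y) \<otimes> z"
proof (rule cinner_total_eqI[OF total_tensor3'])
  fix w :: "('a \<otimes>\<^sub>H 'b) \<otimes>\<^sub>H 'c" assume "w \<in> {(x \<otimes> y) \<otimes> z |x y z. True}"
  then show "cinner w (blinfun_apply (adj assoc) (x \<otimes> y \<otimes> z)) = cinner w ((x \<otimes> y) \<otimes> z)"
    by (auto simp: adj_right cinner_tensor)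
qed

lemma unitary_assoc [simp]: "unitary assoc"
  unfolding unitary_def by (auto intro!: htensor3_eqI htensor3'_eqI)

section \<open>Leg numbering\<close>

lemma leg23_tensor [simp]: "T \<in> bops \<Longrightarrow> blinfun_apply (leg23 T) (x \<otimes> f) = x \<otimes> blinfun_apply T f"
  by (simp add: leg23_def)

lemma leg12_tensor [simp]: "T \<in> bops \<Longrightarrow>
    blinfun_apply (leg12 T) (x \<otimes> y \<otimes> z) = blinfun_apply assoc (blinfun_apply T (x \<otimes> y) \<otimes> z)"
  by (simp add: leg12_def reassoc_def)

text \<open>With it \<open>leg13 T\<close> is the conjugate of
  \<open>T \<otimes>\<^sub>o id_blinfun\<close> by a single unitary, which gives its products and
  coefficients directly.\<close>

definition perm13 :: "('a::chilbert_space \<otimes>\<^sub>H 'c::chilbert_space) \<otimes>\<^sub>H 'b::chilbert_space \<Rightarrow>\<^sub>L 'a \<otimes>\<^sub>H 'b \<otimes>\<^sub>H 'c" where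
  "perm13 = (id_blinfun \<otimes>\<^sub>o flip) o\<^sub>L assoc"

lemma perm13_tensor [simp]: "blinfun_apply perm13 ((x \<otimes> z) \<otimes> y) = x \<otimes> y \<otimes> z"
  by (simp add: perm13_def)

lemma unitary_perm13 [simp]: "unitary perm13"
  unfolding perm13_def by (intro unitary_comp unitary_tensor_op unitary_flip unitary_assoc unitary_id)

lemma adj_perm13_tensor [simp]: "blinfun_apply (adj perm13) (x \<otimes> y \<otimes> z) = (x \<otimes> z) \<otimes> y"
  using unitary_adj_apply[OF unitary_perm13, of "(x \<otimes> z) \<otimes> y"] by simp

lemma leg13_eq: "T \<in> bops \<Longrightarrow> leg13 T = perm13 o\<^sub>L (T \<otimes>\<^sub>o id_blinfun) o\<^sub>L adj perm13"
  unfolding leg13_def leg12_def reassoc_def perm13_def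
  by (simp add: adj_comp adj_tensor_op comp_assoc)

lemma leg13_tensor [simp]: "T \<in> bops \<Longrightarrow>
    blinfun_apply (leg13 T) (x \<otimes> y \<otimes> z) = blinfun_apply perm13 (blinfun_apply T (x \<otimes> z) \<otimes> y)"
  by (simp add: leg13_eq)

lemma bops_reassoc [simp]: "T \<in> bops \<Longrightarrow> reassoc T \<in> bops" by (simp add: reassoc_def)
lemma bops_leg12 [simp]: "T \<in> bops \<Longrightarrow> leg12 T \<in> bops" by (simp add: leg12_def)
lemma bops_leg23 [simp]: "T \<in> bops \<Longrightarrow> leg23 T \<in> bops" by (simp add: leg23_def)
lemma bops_leg13 [simp]: "T \<in> bops \<Longrightarrow> leg13 T \<in> bops" by (simp add: leg13_def)

lemma reassoc_comp: "S \<in> bops \<Longrightarrow> T \<in> bops \<Longrightarrow> reassoc (S o\<^sub>L T) = reassoc S o\<^sub>L reassoc T"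
  by (simp add: reassoc_def comp_assoc)
lemma leg12_comp: "S \<in> bops \<Longrightarrow> T \<in> bops \<Longrightarrow> leg12 (S o\<^sub>L T) = leg12 S o\<^sub>L leg12 T"
  unfolding leg12_def by (subst reassoc_comp[symmetric]) (simp_all add: tensor_op_comp)
lemma leg23_comp: "S \<in> bops \<Longrightarrow> T \<in> bops \<Longrightarrow> leg23 (S o\<^sub>L T) = leg23 S o\<^sub>L leg23 T"
  unfolding leg23_def by (simp add: tensor_op_comp)
lemma leg13_comp: "S \<in> bops \<Longrightarrow> T \<in> bops \<Longrightarrow> leg13 (S o\<^sub>L T) = leg13 S o\<^sub>L leg13 T"
  by (rule htensor3_eqI) (simp add: leg13_eq)

lemma adj_leg12: "T \<in> bops \<Longrightarrow> adj (leg12 T) = leg12 (adj T)"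
  by (simp add: leg12_def reassoc_def adj_comp adj_tensor_op comp_assoc)
lemma adj_leg23: "T \<in> bops \<Longrightarrow> adj (leg23 T) = leg23 (adj T)"
  by (simp add: leg23_def adj_tensor_op)
lemma adj_leg13: "T \<in> bops \<Longrightarrow> adj (leg13 T) = leg13 (adj T)"
  by (simp add: leg13_def adj_comp adj_tensor_op adj_leg12 comp_assoc)

lemma leg12_id [simp]: "leg12 id_blinfun = id_blinfun" by (rule htensor3_eqI) simp
lemma leg23_id [simp]: "leg23 id_blinfun = id_blinfun" by (simp add: leg23_def)
lemma leg13_id [simp]: "leg13 id_blinfun = id_blinfun" by (rule htensor3_eqI) simp

lemma unitary_leg12 [simp, intro]: "unitary U \<Longrightarrow> unitary (leg12 U)"
  unfolding unitary_def[of "leg12 U"] by (simp add: adj_leg12 flip: leg12_comp)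
lemma unitary_leg23 [simp, intro]: "unitary U \<Longrightarrow> unitary (leg23 U)"
  unfolding unitary_def[of "leg23 U"] by (simp add: adj_leg23 flip: leg23_comp)
lemma unitary_leg13 [simp, intro]: "unitary U \<Longrightarrow> unitary (leg13 U)"
  unfolding unitary_def[of "leg13 U"] by (simp add: adj_leg13 flip: leg13_comp)

text \<open>The identities below are checked on elementary tensors. Since \<open>T (x \<otimes> y)\<close> need not be
  elementary, each of them is reduced to an identity of permutation operators, evaluated at \<open>T (x \<otimes> y)\<close>.\<close>

definition leg123 :: "('a::chilbert_space \<otimes>\<^sub>H 'b::chilbert_space \<otimes>\<^sub>H 'c::chilbert_space) op
    \<Rightarrow> ('a \<otimes>\<^sub>H 'b \<otimes>\<^sub>H 'c \<otimes>\<^sub>H 'd::chilbert_space) op" where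
  "leg123 T = ((id_blinfun \<otimes>\<^sub>o assoc) o\<^sub>L assoc) o\<^sub>L (T \<otimes>\<^sub>o id_blinfun) o\<^sub>L adj ((id_blinfun \<otimes>\<^sub>o assoc) o\<^sub>L assoc)"

lemma leg123_tensor [simp]: "T \<in> bops \<Longrightarrow> blinfun_apply (leg123 T) (x \<otimes> y \<otimes> z \<otimes> w) =
    blinfun_apply (id_blinfun \<otimes>\<^sub>o assoc) (blinfun_apply assoc (blinfun_apply T (x \<otimes> y \<otimes> z) \<otimes> w))"
  by (simp add: leg123_def adj_comp adj_tensor_op)

lemma leg123_comp: "S \<in> bops \<Longrightarrow> T \<in> bops \<Longrightarrow> leg123 (S o\<^sub>L T) = leg123 S o\<^sub>L leg123 T"
proof -
  assume *: "S \<in> bops" "T \<in> bops"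
  define A where "A = (id_blinfun \<otimes>\<^sub>o assoc) o\<^sub>L (assoc :: (('a \<otimes>\<^sub>H 'b \<otimes>\<^sub>H 'c) \<otimes>\<^sub>H 'd) \<Rightarrow>\<^sub>L _)"
  have "unitary A"
    unfolding A_def by (intro unitary_comp unitary_tensor_op) simp_all
  then show ?thesis
    using * tensor_op_comp[of S "id_blinfun :: 'd op" T id_blinfun]
    unfolding leg123_def A_def[symmetric] by (simp add: comp_assoc) (simp flip: comp_assoc)
qed

text \<open>On four legs, the operators T_12, T_13, T_14, T_23, T_24, T_34 are written
  \<open>leg12 T\<close>, \<open>leg13 (leg12 T)\<close>, \<open>leg13 (leg13 T)\<close>,
  \<open>leg23 (leg12 T)\<close>, \<open>leg23 (leg13 T)\<close>, \<open>leg23 (leg23 T)\<close>.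
  The next lemmas bring the images under \<open>leg123\<close> into these forms.\<close>

lemma leg123_leg12: assumes T: "T \<in> bops" shows "leg123 (leg12 T) = leg12 T"
proof (rule htensor4_eqI)
  fix x y z w
  have "(id_blinfun \<otimes>\<^sub>o assoc) o\<^sub>L assoc o\<^sub>L tensor_right w o\<^sub>L assoc o\<^sub>L tensor_right z =
      assoc o\<^sub>L tensor_right (z \<otimes> w)"
    by (rule htensor_eqI) simp
  from arg_cong[OF this, of "\<lambda>S. blinfun_apply S (blinfun_apply T (x \<otimes> y))"]
  show "blinfun_apply (leg123 (leg12 T)) (x \<otimes> y \<otimes> z \<otimes> w) = blinfun_apply (leg12 T) (x \<otimes> y \<otimes> z \<otimes> w)"
    by (simp add: T)
qed

lemma leg123_leg13: assumes T: "T \<in> bops" shows "leg123 (leg13 T) = leg13 (leg12 T)"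
proof (rule htensor4_eqI)
  fix x y z w
  have "(id_blinfun \<otimes>\<^sub>o assoc) o\<^sub>L assoc o\<^sub>L tensor_right w o\<^sub>L perm13 o\<^sub>L tensor_right y =
      perm13 o\<^sub>L tensor_right y o\<^sub>L assoc o\<^sub>L tensor_right w"
    by (rule htensor_eqI) simp
  from arg_cong[OF this, of "\<lambda>S. blinfun_apply S (blinfun_apply T (x \<otimes> z))"]
  show "blinfun_apply (leg123 (leg13 T)) (x \<otimes> y \<otimes> z \<otimes> w) = blinfun_apply (leg13 (leg12 T)) (x \<otimes> y \<otimes> z \<otimes> w)"
    by (simp add: T)
qed

lemma leg123_leg23: assumes T: "T \<in> bops" shows "leg123 (leg23 T) = leg23 (leg12 T)"
proof (rule htensor4_eqI)
  fix x y z w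
  have "(id_blinfun \<otimes>\<^sub>o assoc) o\<^sub>L assoc o\<^sub>L tensor_right w o\<^sub>L tensor_left x =
      tensor_left x o\<^sub>L assoc o\<^sub>L tensor_right w"
    by (rule htensor_eqI) simp
  from arg_cong[OF this, of "\<lambda>S. blinfun_apply S (blinfun_apply T (y \<otimes> z))"]
  show "blinfun_apply (leg123 (leg23 T)) (x \<otimes> y \<otimes> z \<otimes> w) = blinfun_apply (leg23 (leg12 T)) (x \<otimes> y \<otimes> z \<otimes> w)"
    by (simp add: T)
qed

lemma leg13_leg23:
  fixes T :: "('c::chilbert_space \<otimes>\<^sub>H 'd::chilbert_space) op"
  assumes T: "T \<in> bops" shows "leg13 (leg23 T) = leg23 (leg23 T)"
proof (rule htensor4_eqI)
  fix x y z w
  have "perm13 o\<^sub>L tensor_right y o\<^sub>L (tensor_left x :: 'c \<otimes>\<^sub>H 'd \<Rightarrow>\<^sub>L _) = tensor_left x o\<^sub>L tensor_left y"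
    by (rule htensor_eqI) simp
  from arg_cong[OF this, of "\<lambda>S. blinfun_apply S (blinfun_apply T (z \<otimes> w))"]
  show "blinfun_apply (leg13 (leg23 T)) (x \<otimes> y \<otimes> z \<otimes> w) = blinfun_apply (leg23 (leg23 T)) (x \<otimes> y \<otimes> z \<otimes> w)"
    by (simp add: T)
qed

lemma leg12_leg34_commute:
  assumes T: "T \<in> bops" and S: "S \<in> bops"
  shows "leg12 T o\<^sub>L leg23 (leg23 S) = leg23 (leg23 S) o\<^sub>L leg12 T"
proof (rule htensor3_eqI)
  fix x y w
  have "leg23 (leg23 S) o\<^sub>L assoc o\<^sub>L tensor_right w = assoc o\<^sub>L tensor_right (blinfun_apply S w)"
    by (rule htensor_eqI) (simp add: S)
  from arg_cong[OF this, of "\<lambda>S. blinfun_apply S (blinfun_apply T (x \<otimes> y))"]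
  show "blinfun_apply (leg12 T o\<^sub>L leg23 (leg23 S)) (x \<otimes> y \<otimes> w) =
      blinfun_apply (leg23 (leg23 S) o\<^sub>L leg12 T) (x \<otimes> y \<otimes> w)"
    by (simp add: T S)
qed

lemma leg13_leg2_commute:
  assumes T: "T \<in> bops" and S: "S \<in> bops"
  shows "leg13 T o\<^sub>L leg23 (S \<otimes>\<^sub>o id_blinfun) = leg23 (S \<otimes>\<^sub>o id_blinfun) o\<^sub>L leg13 T"
proof (rule htensor3_eqI)
  fix x y w
  have "leg23 (S \<otimes>\<^sub>o id_blinfun) o\<^sub>L perm13 o\<^sub>L tensor_right y = perm13 o\<^sub>L tensor_right (blinfun_apply S y)"
    by (rule htensor_eqI) (simp add: S)
  from arg_cong[OF this, of "\<lambda>S. blinfun_apply S (blinfun_apply T (x \<otimes> w))"]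
  show "blinfun_apply (leg13 T o\<^sub>L leg23 (S \<otimes>\<^sub>o id_blinfun)) (x \<otimes> y \<otimes> w) =
      blinfun_apply (leg23 (S \<otimes>\<^sub>o id_blinfun) o\<^sub>L leg13 T) (x \<otimes> y \<otimes> w)"
    by (simp add: T S)
qed

text \<open>When the two middle legs are grouped into one, T_14 becomes \<open>leg13 T\<close>. This
  reduces commutation with an operator on the middle legs to
  \<open>leg13_leg2_commute\<close>.\<close>

lemma leg13_leg13:
  fixes T :: "('a::chilbert_space \<otimes>\<^sub>H 'd::chilbert_space) op"
  assumes T: "T \<in> bops"
  shows "leg13 (leg13 T) o\<^sub>L (id_blinfun \<otimes>\<^sub>o assoc) =
    (id_blinfun \<otimes>\<^sub>o (assoc :: ('b::chilbert_space \<otimes>\<^sub>H 'c::chilbert_space) \<otimes>\<^sub>H 'd \<Rightarrow>\<^sub>L _)) o\<^sub>L leg13 T"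
proof (rule blinfun_eq_on_total)
  fix u :: "'a \<otimes>\<^sub>H ('b \<otimes>\<^sub>H 'c) \<otimes>\<^sub>H 'd" assume "u \<in> {x \<otimes> w |x w. x \<in> UNIV \<and> w \<in> {(y \<otimes> z) \<otimes> w |y z w. True}}"
  then obtain x y z w where u: "u = x \<otimes> (y \<otimes> z) \<otimes> w" by blast
  have "perm13 o\<^sub>L tensor_right y o\<^sub>L perm13 o\<^sub>L tensor_right z =
      (id_blinfun \<otimes>\<^sub>o assoc) o\<^sub>L perm13 o\<^sub>L tensor_right (y \<otimes> z)"
    by (rule htensor_eqI) simp
  from arg_cong[OF this, of "\<lambda>S. blinfun_apply S (blinfun_apply T (x \<otimes> w))"]
  show "blinfun_apply (leg13 (leg13 T) o\<^sub>L (id_blinfun \<otimes>\<^sub>o assoc)) u =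
      blinfun_apply ((id_blinfun \<otimes>\<^sub>o assoc) o\<^sub>L leg13 T) u"
    by (simp add: T u)
qed (rule total_tensor, simp, rule total_tensor3')

lemma leg14_leg23_commute:
  assumes T: "T \<in> bops" and S: "S \<in> bops"
  shows "leg13 (leg13 T) o\<^sub>L leg23 (leg12 S) = leg23 (leg12 S) o\<^sub>L leg13 (leg13 T)"
proof -
  let ?A = "id_blinfun \<otimes>\<^sub>o assoc"
  have uA: "unitary ?A" by (intro unitary_tensor_op) simp_all
  have 1: "leg23 (leg12 S) = ?A o\<^sub>L leg23 (S \<otimes>\<^sub>o id_blinfun) o\<^sub>L adj ?A"
    by (simp add: leg23_def leg12_def reassoc_def tensor_op_comp adj_tensor_op S)
  have 2: "leg13 (leg13 T) = ?A o\<^sub>L leg13 T o\<^sub>L adj ?A"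
    unfolding leg13_leg13[OF T, symmetric] by (simp add: comp_assoc uA)
  show ?thesis unfolding 1 2
    using leg13_leg2_commute[OF T S] by (simp add: comp_assoc uA) (simp flip: comp_assoc)
qed

lemma leg12_flip_leg23:
  fixes T :: "('a::chilbert_space \<otimes>\<^sub>H 'b::chilbert_space) op"
  assumes T: "T \<in> bops" shows "leg12 flip o\<^sub>L leg23 T o\<^sub>L leg12 flip = leg13 T"
proof (rule htensor3_eqI)
  fix x y :: 'a and z :: 'b
  have "leg12 flip o\<^sub>L (tensor_left y :: 'a \<otimes>\<^sub>H 'b \<Rightarrow>\<^sub>L _) = perm13 o\<^sub>L tensor_right y"
    by (rule htensor_eqI) simp
  from arg_cong[OF this, of "\<lambda>S. blinfun_apply S (blinfun_apply T (x \<otimes> z))"]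
  show "blinfun_apply (leg12 flip o\<^sub>L leg23 T o\<^sub>L leg12 flip) (x \<otimes> y \<otimes> z) = blinfun_apply (leg13 T) (x \<otimes> y \<otimes> z)"
    by (simp add: T)
qed

text \<open>The cyclic permutation moves the algebra leg of a corepresentation from the last place
  to the first, as needed in passing from \<open>Vh\<close> to \<open>Vt\<close>.\<close>

definition cyc :: "'a::chilbert_space \<otimes>\<^sub>H 'b::chilbert_space \<otimes>\<^sub>H 'c::chilbert_space \<Rightarrow>\<^sub>L 'c \<otimes>\<^sub>H 'a \<otimes>\<^sub>H 'b" where
  "cyc = flip o\<^sub>L adj assoc"

lemma cyc_tensor [simp]: "blinfun_apply cyc (x \<otimes> y \<otimes> z) = z \<otimes> x \<otimes> y" by (simp add: cyc_def)
lemma unitary_cyc [simp]: "unitary cyc" unfolding cyc_def by (intro unitary_comp unitary_adj) simp_all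

lemma cyc_leg12: assumes T: "T \<in> bops" shows "cyc o\<^sub>L leg12 T = leg23 T o\<^sub>L cyc"
proof (rule htensor3_eqI)
  fix x y z
  have "cyc o\<^sub>L assoc o\<^sub>L tensor_right z = tensor_left z" by (rule htensor_eqI) simp
  from arg_cong[OF this, of "\<lambda>S. blinfun_apply S (blinfun_apply T (x \<otimes> y))"]
  show "blinfun_apply (cyc o\<^sub>L leg12 T) (x \<otimes> y \<otimes> z) = blinfun_apply (leg23 T o\<^sub>L cyc) (x \<otimes> y \<otimes> z)"
    by (simp add: T)
qed

lemma cyc_leg13: assumes T: "T \<in> bops" shows "cyc o\<^sub>L leg13 T = leg12 (flip o\<^sub>L T o\<^sub>L flip) o\<^sub>L cyc"
proof (rule htensor3_eqI)
  fix x y z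
  have "cyc o\<^sub>L perm13 o\<^sub>L tensor_right y = assoc o\<^sub>L tensor_right y o\<^sub>L flip" by (rule htensor_eqI) simp
  from arg_cong[OF this, of "\<lambda>S. blinfun_apply S (blinfun_apply T (x \<otimes> z))"]
  show "blinfun_apply (cyc o\<^sub>L leg13 T) (x \<otimes> y \<otimes> z) = blinfun_apply (leg12 (flip o\<^sub>L T o\<^sub>L flip) o\<^sub>L cyc) (x \<otimes> y \<otimes> z)"
    by (simp add: T)
qed

lemma cyc_leg23: assumes T: "T \<in> bops" shows "cyc o\<^sub>L leg23 T = leg13 (flip o\<^sub>L T o\<^sub>L flip) o\<^sub>L cyc"
proof (rule htensor3_eqI)
  fix x y z
  have "cyc o\<^sub>L tensor_left x = perm13 o\<^sub>L tensor_right x o\<^sub>L flip" by (rule htensor_eqI) simp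
  from arg_cong[OF this, of "\<lambda>S. blinfun_apply S (blinfun_apply T (y \<otimes> z))"]
  show "blinfun_apply (cyc o\<^sub>L leg23 T) (x \<otimes> y \<otimes> z) = blinfun_apply (leg13 (flip o\<^sub>L T o\<^sub>L flip) o\<^sub>L cyc) (x \<otimes> y \<otimes> z)"
    by (simp add: T)
qed

text \<open>Reversal of the legs realises the symmetry between the two universal algebras: the
  \<open>v\<close> leg and the \<open>u\<close> leg change places around the Hilbert space
  leg.\<close>

definition rev3 :: "'a::chilbert_space \<otimes>\<^sub>H 'b::chilbert_space \<otimes>\<^sub>H 'c::chilbert_space \<Rightarrow>\<^sub>L 'c \<otimes>\<^sub>H 'b \<otimes>\<^sub>H 'a" where
  "rev3 = (id_blinfun \<otimes>\<^sub>o flip) o\<^sub>L cyc"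

lemma rev3_tensor [simp]: "blinfun_apply rev3 (x \<otimes> y \<otimes> z) = z \<otimes> y \<otimes> x" by (simp add: rev3_def)
lemma unitary_rev3 [simp]: "unitary rev3"
  unfolding rev3_def by (intro unitary_comp unitary_tensor_op) simp_all

lemma rev3_leg12: assumes T: "T \<in> bops" shows "rev3 o\<^sub>L leg12 T = leg23 (flip o\<^sub>L T o\<^sub>L flip) o\<^sub>L rev3"
proof (rule htensor3_eqI)
  fix x y z
  have "rev3 o\<^sub>L assoc o\<^sub>L tensor_right z = tensor_left z o\<^sub>L flip" by (rule htensor_eqI) simp
  from arg_cong[OF this, of "\<lambda>S. blinfun_apply S (blinfun_apply T (x \<otimes> y))"]
  show "blinfun_apply (rev3 o\<^sub>L leg12 T) (x \<otimes> y \<otimes> z) =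
      blinfun_apply (leg23 (flip o\<^sub>L T o\<^sub>L flip) o\<^sub>L rev3) (x \<otimes> y \<otimes> z)"
    by (simp add: T)
qed

lemma rev3_leg23: assumes T: "T \<in> bops" shows "rev3 o\<^sub>L leg23 T = leg12 (flip o\<^sub>L T o\<^sub>L flip) o\<^sub>L rev3"
proof (rule htensor3_eqI)
  fix x y z
  have "rev3 o\<^sub>L tensor_left x = assoc o\<^sub>L tensor_right x o\<^sub>L flip" by (rule htensor_eqI) simp
  from arg_cong[OF this, of "\<lambda>S. blinfun_apply S (blinfun_apply T (y \<otimes> z))"]
  show "blinfun_apply (rev3 o\<^sub>L leg23 T) (x \<otimes> y \<otimes> z) =
      blinfun_apply (leg12 (flip o\<^sub>L T o\<^sub>L flip) o\<^sub>L rev3) (x \<otimes> y \<otimes> z)"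
    by (simp add: T)
qed

lemma rev3_leg13: assumes T: "T \<in> bops" shows "rev3 o\<^sub>L leg13 T = leg13 (flip o\<^sub>L T o\<^sub>L flip) o\<^sub>L rev3"
proof (rule htensor3_eqI)
  fix x y z
  have "rev3 o\<^sub>L perm13 o\<^sub>L tensor_right y = perm13 o\<^sub>L tensor_right y o\<^sub>L flip" by (rule htensor_eqI) simp
  from arg_cong[OF this, of "\<lambda>S. blinfun_apply S (blinfun_apply T (x \<otimes> z))"]
  show "blinfun_apply (rev3 o\<^sub>L leg13 T) (x \<otimes> y \<otimes> z) =
      blinfun_apply (leg13 (flip o\<^sub>L T o\<^sub>L flip) o\<^sub>L rev3) (x \<otimes> y \<otimes> z)"
    by (simp add: T)
qed

lemma cinner_leg13:
  assumes T: "T \<in> bops"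
  shows "cinner (a \<otimes> x \<otimes> f) (blinfun_apply (leg13 T) (b \<otimes> y \<otimes> g)) =
      cinner x y * cinner (a \<otimes> f) (blinfun_apply T (b \<otimes> g))"
proof -
  have "cinner (blinfun_apply perm13 ((a \<otimes> f) \<otimes> x)) (blinfun_apply perm13 (blinfun_apply T (b \<otimes> g) \<otimes> y)) =
      cinner ((a \<otimes> f) \<otimes> x) (blinfun_apply T (b \<otimes> g) \<otimes> y)"
    by (rule unitary_cinner) simp
  then show ?thesis by (simp add: T cinner_tensor)
qed

text \<open>Inserts a fixed vector as the middle leg. For a unit vector, compression by this
  isometry recovers \<open>T\<close> from \<open>leg13 T\<close>.\<close>

definition tensor_mid :: "'b::chilbert_space \<Rightarrow> ('a::chilbert_space \<otimes>\<^sub>H 'c::chilbert_space \<Rightarrow>\<^sub>L 'a \<otimes>\<^sub>H 'b \<otimes>\<^sub>H 'c)" where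
  "tensor_mid e = perm13 o\<^sub>L tensor_right e"

lemma tensor_mid_tensor [simp]: "blinfun_apply (tensor_mid e) (x \<otimes> z) = x \<otimes> e \<otimes> z" by (simp add: tensor_mid_def)
lemma bops_tensor_mid [simp]: "tensor_mid e \<in> bops" by (simp add: tensor_mid_def)

lemma adj_tensor_mid_tensor [simp]: "blinfun_apply (adj (tensor_mid e)) (x \<otimes> y \<otimes> z) = cinner e y *\<^sub>C (x \<otimes> z)"
  by (simp add: tensor_mid_def adj_comp)

lemma leg13_tensor_mid: "T \<in> bops \<Longrightarrow> leg13 T o\<^sub>L tensor_mid e = tensor_mid e o\<^sub>L T"
  by (rule htensor_eqI) (simp add: tensor_mid_def)

lemma adj_tensor_mid_comp: "norm e = 1 \<Longrightarrow> adj (tensor_mid e) o\<^sub>L tensor_mid e = id_blinfun"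
  by (rule htensor_eqI) (simp add: cinner_self)

lemma leg13_inject:
  fixes S T :: "('a::chilbert_space \<otimes>\<^sub>H 'c::chilbert_space) op"
  assumes "(leg13 S :: ('a \<otimes>\<^sub>H 'b::chilbert_space \<otimes>\<^sub>H 'c) op) = leg13 T" "S \<in> bops" "T \<in> bops" "\<exists>x::'b. x \<noteq> 0"
  shows "S = T"
proof -
  obtain x :: 'b where "x \<noteq> 0" using assms(4) by blast
  define e where "e = (1 / norm x) *\<^sub>R x"
  have e: "norm e = 1" using \<open>x \<noteq> 0\<close> by (simp add: e_def)
  have "adj (tensor_mid e) o\<^sub>L (leg13 R o\<^sub>L tensor_mid e) = R" if "R \<in> bops" for R :: "('a \<otimes>\<^sub>H 'c) op"
    using that by (simp add: leg13_tensor_mid adj_tensor_mid_comp[OF e] flip: comp_assoc)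
  then show ?thesis using assms by metis
qed

section \<open>Representations of C*-algebras\<close>

lemma adj_tendsto:
  assumes "\<And>n. T n \<in> bops" "T' \<in> bops" "T \<longlonglongrightarrow> T'"
  shows "(\<lambda>n. adj (T n)) \<longlonglongrightarrow> adj T'"
proof -
  have "(\<lambda>n. norm (T n - T')) \<longlonglongrightarrow> 0" using assms(3) by (intro tendsto_norm_zero LIM_zero)
  moreover have "norm (T n - T') = norm (adj (T n) - adj T')" for n
    using assms by (simp add: norm_adj flip: adj_diff)
  ultimately show ?thesis using LIM_zero_cancel tendsto_norm_zero_cancel by fastforce
qed

text \<open>Outside \<open>bops\<close> the definite description \<open>adj\<close> is unspecified,
  so this set cannot be handled as a preimage under a continuous map; closedness is shown by
  sequences within \<open>bops\<close>.\<close>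

lemma closed_adj_image:
  assumes "closed X" "X \<subseteq> bops"
  shows "closed {T \<in> bops. adj T \<in> X}"
  unfolding closed_sequential_limits
proof (intro allI impI, elim conjE)
  fix T T' assume T: "\<forall>n. T n \<in> {T \<in> bops. adj T \<in> X}" "T \<longlonglongrightarrow> T'"
  then have T': "T' \<in> bops" using closed_bops unfolding closed_sequential_limits by blast
  then have "(\<lambda>n. adj (T n)) \<longlonglongrightarrow> adj T'" using T by (intro adj_tendsto) auto
  then have "adj T' \<in> X" using closed_sequentially[OF assms(1), of "\<lambda>n. adj (T n)"] T(1) by auto
  then show "T' \<in> {T \<in> bops. adj T \<in> X}" using T' by simp
qed

lemma subspace_adj_image: "subspace X \<Longrightarrow> subspace {T \<in> bops. adj T \<in> X}"
  by (auto simp: subspace_def adj_add adj_scaleR) (metis adj_scaleR bops_0 scaleR_zero_left)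

lemma closed_selfadjoint: "closed {T \<in> bops. adj T = T}"
proof -
  have *: "adj T = T \<longleftrightarrow> (\<forall>x y. cinner (blinfun_apply T x) y = cinner x (blinfun_apply T y))"
    if T: "T \<in> bops" for T :: "'a op"
  proof
    assume "adj T = T"
    then show "\<forall>x y. cinner (blinfun_apply T x) y = cinner x (blinfun_apply T y)" using adj_right[OF T] by simp
  next
    assume "\<forall>x y. cinner (blinfun_apply T x) y = cinner x (blinfun_apply T y)"
    then show "adj T = T" by (intro adj_eqI[OF T]) blast
  qed
  have "closed {T :: 'a op. \<forall>x y. cinner (blinfun_apply T x) y = cinner x (blinfun_apply T y)}"
    by (intro closed_Collect_all closed_Collect_eq linear_continuous_on
        bounded_linear_compose[OF bounded_linear_cinner_left blinfun.bounded_linear_left]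
        bounded_linear_compose[OF bounded_linear_cinner_right blinfun.bounded_linear_left])
  moreover have "{T :: 'a op. T \<in> bops \<and> adj T = T} =
      bops \<inter> {T. \<forall>x y. cinner (blinfun_apply T x) y = cinner x (blinfun_apply T y)}"
    using * by blast
  ultimately show ?thesis by (simp only:) (rule closed_Int[OF closed_bops])
qed

text \<open>With \<open>k = 1 - s\<close> the equation reads \<open>k\<^sup>2 = 1 - h\<close>: this is a square root of \<open>1 - h\<close> up to the
  unit, which \<open>X\<close> need not contain.\<close>

lemma quasi_sqrt_exists:
  fixes h :: "'a::banach \<Rightarrow>\<^sub>L 'a"
  assumes X: "closed X" "subspace X" "\<And>s. s \<in> X \<Longrightarrow> s o\<^sub>L s \<in> X" and h: "h \<in> X" "norm h < 1"
  shows "\<exists>s\<in>X. 2 *\<^sub>R s - (s o\<^sub>L s) = h"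
proof -
  define r where "r = norm h"
  \<comment> \<open>Its fixed points are the solutions of the equation. On the ball of radius
    \<open>norm h\<close> it is a contraction with constant \<open>norm h\<close>, hence the
    condition \<open>norm h < 1\<close>.\<close>
  define f where "f s = (1/2) *\<^sub>R (h + (s o\<^sub>L s))" for s
  let ?S = "X \<inter> {s. norm s \<le> r}"
  have sq: "norm (s o\<^sub>L s) \<le> r" if "norm s \<le> r" for s :: "'a \<Rightarrow>\<^sub>L 'a"
  proof -
    have "norm (s o\<^sub>L s) \<le> norm s * norm s" by (rule norm_blinfun_compose)
    also have "\<dots> \<le> r * 1" using that h(2) by (intro mult_mono) (auto simp: r_def)
    finally show ?thesis by simp
  qed
  have "\<exists>!s\<in>?S. f s = s"
  proof (rule Banach_fix)
    have "closed {s :: 'a \<Rightarrow>\<^sub>L 'a. norm s \<le> r}" by (intro closed_Collect_le continuous_intros)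
    then show "complete ?S" using X(1) by (simp add: complete_eq_closed closed_Int)
    show "?S \<noteq> {}" using h(1) by (auto simp: r_def)
    show "f ` ?S \<subseteq> ?S"
    proof safe
      fix s assume s: "s \<in> X" "norm s \<le> r"
      show "f s \<in> X" unfolding f_def using X s h by (intro subspace_scale subspace_add) auto
      have "norm (f s) \<le> 1/2 * (norm h + norm (s o\<^sub>L s))" unfolding f_def by (simp add: norm_triangle_ineq)
      then show "norm (f s) \<le> r" using sq[OF s(2)] by (simp add: r_def)
    qed
    show "dist (f s) (f t) \<le> r * dist s t" if st: "s \<in> ?S" "t \<in> ?S" for s t
    proof -
      have "f s - f t = (1/2) *\<^sub>R ((s o\<^sub>L (s - t)) + ((s - t) o\<^sub>L t))"
        by (simp add: f_def blinfun_compose_diff_left blinfun_compose_diff_right scaleR_diff_right[symmetric])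
      then have "norm (f s - f t) \<le> 1/2 * (norm (s o\<^sub>L (s - t)) + norm ((s - t) o\<^sub>L t))"
        by (simp add: norm_triangle_ineq)
      also have "\<dots> \<le> 1/2 * (norm s * norm (s - t) + norm (s - t) * norm t)"
        by (intro mult_left_mono add_mono norm_blinfun_compose) simp
      also have "\<dots> \<le> 1/2 * (r * norm (s - t) + norm (s - t) * r)"
        using st by (intro mult_left_mono add_mono mult_right_mono) auto
      finally show ?thesis by (simp add: dist_norm)
    qed
  qed (use h(2) in \<open>auto simp: r_def\<close>)
  then obtain s where s: "s \<in> X" "f s = s" by blast
  have "2 *\<^sub>R f s = h + (s o\<^sub>L s)" by (simp add: f_def)
  then show ?thesis using s by (intro bexI[of _ s]) (simp_all add: algebra_simps)
qed

section \<open>Nondegenerate *-representations\<close>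

lemma cstar_bops: "cstar_algebra B \<Longrightarrow> b \<in> B \<Longrightarrow> b \<in> bops" by (auto simp: cstar_algebra_def)
lemma cstar_adj: "cstar_algebra B \<Longrightarrow> b \<in> B \<Longrightarrow> adj b \<in> B" by (auto simp: cstar_algebra_def)
lemma cstar_comp: "cstar_algebra B \<Longrightarrow> b \<in> B \<Longrightarrow> c \<in> B \<Longrightarrow> b o\<^sub>L c \<in> B" by (auto simp: cstar_algebra_def)
lemma cstar_subspace: "cstar_algebra B \<Longrightarrow> subspace B" by (simp add: cstar_algebra_def)
lemma cstar_closed: "cstar_algebra B \<Longrightarrow> closed B" by (simp add: cstar_algebra_def)
lemma cstar_scaleC: "cstar_algebra B \<Longrightarrow> b \<in> B \<Longrightarrow> scaleC_op c b \<in> B" by (auto simp: cstar_algebra_def)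

text \<open>What remains of a morphism when its target algebra is forgotten: a nondegenerate
  *-representation on the Hilbert space of the target. The passage is
  \<open>star_rep_of_morphism\<close>.\<close>

definition star_rep :: "'b::chilbert_space op set \<Rightarrow> ('b op \<Rightarrow> 'c::chilbert_space op) \<Rightarrow> bool" where
  "star_rep B \<phi> \<longleftrightarrow> cstar_algebra B \<and> (\<forall>b\<in>B. \<phi> b \<in> bops) \<and>
     (\<forall>a\<in>B. \<forall>b\<in>B. \<phi> (a + b) = \<phi> a + \<phi> b) \<and>
     (\<forall>c. \<forall>b\<in>B. \<phi> (scaleC_op c b) = scaleC_op c (\<phi> b)) \<and>
     (\<forall>a\<in>B. \<forall>b\<in>B. \<phi> (a o\<^sub>L b) = \<phi> a o\<^sub>L \<phi> b) \<and>
     (\<forall>b\<in>B. \<phi> (adj b) = adj (\<phi> b)) \<and>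
     closure (span {blinfun_apply (\<phi> b) x |b x. b \<in> B}) = UNIV"

context
  fixes B :: "'b::chilbert_space op set" and \<phi> :: "'b op \<Rightarrow> 'c::chilbert_space op"
  assumes rep: "star_rep B \<phi>"
begin

lemma rep_cstar: "cstar_algebra B"
  and rep_bops: "b \<in> B \<Longrightarrow> \<phi> b \<in> bops"
  and rep_add: "a \<in> B \<Longrightarrow> b \<in> B \<Longrightarrow> \<phi> (a + b) = \<phi> a + \<phi> b"
  and rep_scaleC: "b \<in> B \<Longrightarrow> \<phi> (scaleC_op c b) = scaleC_op c (\<phi> b)"
  and rep_comp: "a \<in> B \<Longrightarrow> b \<in> B \<Longrightarrow> \<phi> (a o\<^sub>L b) = \<phi> a o\<^sub>L \<phi> b"
  and rep_adj: "b \<in> B \<Longrightarrow> \<phi> (adj b) = adj (\<phi> b)"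
  and rep_total: "closure (span {blinfun_apply (\<phi> b) x |b x. b \<in> B}) = UNIV"
  using rep unfolding star_rep_def by blast+

lemma rep_scaleR: "b \<in> B \<Longrightarrow> \<phi> (r *\<^sub>R b) = r *\<^sub>R \<phi> b"
  using rep_scaleC[of b "of_real r"] by (simp add: scaleC_op_of_real)

lemma rep_diff: "a \<in> B \<Longrightarrow> b \<in> B \<Longrightarrow> \<phi> (a - b) = \<phi> a - \<phi> b"
  using rep_add[of "a - b" b] subspace_diff[OF cstar_subspace[OF rep_cstar], of a b] by simp

text \<open>A *-homomorphism is contractive without any continuity assumption: if \<open>b\<^sup>* b = 2 s - s\<^sup>2\<close>, then
  \<open>1 - \<phi>(b)\<^sup>* \<phi>(b) = (1 - \<phi>(s))\<^sup>2 \<ge> 0\<close>.\<close>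

lemma rep_norm: assumes b: "b \<in> B" shows "norm (\<phi> b) \<le> norm b"
proof -
  have 1: "norm (\<phi> b) \<le> 1" if b: "b \<in> B" "norm b < 1" for b
  proof -
    let ?X = "B \<inter> {T \<in> bops. adj T = T}"
    define h where "h = adj b o\<^sub>L b"
    have hB: "h \<in> ?X" using b rep_cstar
      by (auto simp: h_def adj_comp cstar_bops intro: cstar_comp cstar_adj)
    have "norm h \<le> norm (adj b) * norm b" unfolding h_def by (rule norm_blinfun_compose)
    also have "\<dots> < 1" using b cstar_bops[OF rep_cstar]
      by (simp add: norm_adj mult_strict_mono[of "norm b" 1 "norm b" 1, simplified])
    finally have "norm h < 1" .
    moreover have "closed ?X" using cstar_closed[OF rep_cstar] closed_selfadjoint by (rule closed_Int)
    moreover have "subspace ?X" using cstar_subspace[OF rep_cstar]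
      by (auto simp: subspace_def adj_add adj_scaleR) (metis adj_scaleR bops_0 scaleR_zero_left)
    moreover have "s o\<^sub>L s \<in> ?X" if "s \<in> ?X" for s using that cstar_comp[OF rep_cstar] by (auto simp: adj_comp)
    ultimately obtain s where s: "s \<in> ?X" "2 *\<^sub>R s - (s o\<^sub>L s) = h" using quasi_sqrt_exists[of ?X h] hB by blast
    have sB: "s \<in> B" "s o\<^sub>L s \<in> B" "2 *\<^sub>R s \<in> B" using s(1) cstar_comp[OF rep_cstar] cstar_subspace[OF rep_cstar]
      by (auto intro: subspace_scale)
    have sa: "adj (\<phi> s) = \<phi> s" using s(1) rep_adj[of s] by simp
    have \<phi>h: "adj (\<phi> b) o\<^sub>L \<phi> b = 2 *\<^sub>R \<phi> s - (\<phi> s o\<^sub>L \<phi> s)"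
      using arg_cong[OF s(2), of \<phi>] sB b(1) cstar_adj[OF rep_cstar b(1)]
      by (simp add: h_def rep_comp rep_adj rep_diff rep_scaleR)
    show ?thesis
    proof (rule norm_blinfun_bound)
      fix x
      have "(norm (blinfun_apply (\<phi> b) x))\<^sup>2 = Re (cinner x (blinfun_apply (adj (\<phi> b) o\<^sub>L \<phi> b) x))"
        using rep_bops[OF b(1)] by (simp add: adj_right cinner_self)
      moreover have "(norm (x - blinfun_apply (\<phi> s) x))\<^sup>2 =
          (norm x)\<^sup>2 - Re (cinner x (blinfun_apply (2 *\<^sub>R \<phi> s - (\<phi> s o\<^sub>L \<phi> s)) x))"
        using arg_cong[OF adj_right[OF rep_bops[OF sB(1)], of x "blinfun_apply (\<phi> s) x"], of Re]
        unfolding sa Re_cinner blinfun.diff_left blinfun.scaleR_left power2_norm_eq_inner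
        by (simp add: inner_diff inner_commute)
      ultimately have "(norm (blinfun_apply (\<phi> b) x))\<^sup>2 \<le> (norm x)\<^sup>2"
        unfolding \<phi>h by (metis diff_ge_0_iff_ge zero_le_power2)
      then show "norm (blinfun_apply (\<phi> b) x) \<le> 1 * norm x" by (simp add: power2_le_iff_abs_le)
    qed simp
  qed
  \<comment> \<open>The square root exists only below norm 1, so \<open>b\<close> is rescaled by
    every \<open>k\<close> above its norm.\<close>
  have 2: "norm (\<phi> b) \<le> k" if "norm b < k" for k
  proof -
    have k: "0 < k" using that norm_ge_zero[of b] by linarith
    have "norm (\<phi> ((1/k) *\<^sub>R b)) \<le> 1"
      using b k that cstar_subspace[OF rep_cstar] by (intro 1) (auto intro: subspace_scale)
    then show ?thesis using b k by (simp add: rep_scaleR field_simps)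
  qed
  show ?thesis by (rule dense_ge) (rule 2)
qed

end

section \<open>Amplifications of representations\<close>

text \<open>\<open>col_module B\<close> is the Hilbert module \<open>H \<otimes> B\<close> of columns, realised as operators \<open>K \<rightarrow> H \<otimes> K\<close>;
  its adjointable operators form the multiplier algebra of the compact operators tensor \<open>B\<close>.\<close>

definition col_module :: "'b::chilbert_space op set \<Rightarrow> ('b \<Rightarrow>\<^sub>L 'a::chilbert_space \<otimes>\<^sub>H 'b) set" where
  "col_module B = closure (span {tensor_left z o\<^sub>L b |z b. b \<in> B})"

text \<open>The map that \<open>\<phi>\<close> induces on columns, kept as a closed relation: that
  it is single-valued and total on \<open>col_module B\<close> is known only after
  \<open>col_graph_unique\<close> and \<open>col_graph_ex\<close>.\<close>

definition col_graph :: "'b::chilbert_space op set \<Rightarrow> ('b op \<Rightarrow> 'c::chilbert_space op) \<Rightarrow>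
    (('b \<Rightarrow>\<^sub>L 'a::chilbert_space \<otimes>\<^sub>H 'b) \<times> ('c \<Rightarrow>\<^sub>L 'a \<otimes>\<^sub>H 'c)) set" where
  "col_graph B \<phi> = closure (span {(tensor_left z o\<^sub>L b, tensor_left z o\<^sub>L \<phi> b) |z b. b \<in> B})"

definition adjointable :: "'b::chilbert_space op set \<Rightarrow> ('a::chilbert_space \<otimes>\<^sub>H 'b) op set" where
  "adjointable B = {t \<in> bops. \<forall>e\<in>col_module B. t o\<^sub>L e \<in> col_module B \<and> adj t o\<^sub>L e \<in> col_module B}"

text \<open>The operator that \<open>t\<close> induces on the internal tensor product of the column
  module with the representation space of \<open>\<phi>\<close>; on elementary operators it is
  \<open>id \<otimes> \<phi>\<close>.\<close>

definition amp :: "'b::chilbert_space op set \<Rightarrow> ('b op \<Rightarrow> 'c::chilbert_space op) \<Rightarrow>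
    ('a::chilbert_space \<otimes>\<^sub>H 'b) op \<Rightarrow> ('a \<otimes>\<^sub>H 'c) op" where
  "amp B \<phi> t = (THE R. R \<in> bops \<and> (\<forall>(e, e')\<in>col_graph B \<phi>. (t o\<^sub>L e, R o\<^sub>L e') \<in> col_graph B \<phi>))"

lemma subspace_col_module: "subspace (col_module B)" unfolding col_module_def by simp
lemma closed_col_module: "closed (col_module B)" unfolding col_module_def by simp
lemma col_module_gen: "b \<in> B \<Longrightarrow> tensor_left z o\<^sub>L b \<in> col_module B"
  unfolding col_module_def by (rule closure_span_superset) blast
lemma subspace_col_graph: "subspace (col_graph B \<phi>)" unfolding col_graph_def by simp
lemma closed_col_graph: "closed (col_graph B \<phi>)" unfolding col_graph_def by simp
lemma col_graph_gen: "b \<in> B \<Longrightarrow> (tensor_left z o\<^sub>L b, tensor_left z o\<^sub>L \<phi> b) \<in> col_graph B \<phi>"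
  unfolding col_graph_def by (rule closure_span_superset) blast

lemma col_module_induct:
  assumes "bounded_linear F" "subspace T" "closed T" "\<And>z b. b \<in> B \<Longrightarrow> F (tensor_left z o\<^sub>L b) \<in> T" "e \<in> col_module B"
  shows "F e \<in> T"
  by (rule bounded_linear_closure_span[OF assms(1-3) _ assms(5)[unfolded col_module_def]]) (use assms(4) in blast)

lemma col_graph_induct:
  assumes "bounded_linear F" "subspace T" "closed T"
    "\<And>z b. b \<in> B \<Longrightarrow> F (tensor_left z o\<^sub>L b, tensor_left z o\<^sub>L \<phi> b) \<in> T" "p \<in> col_graph B \<phi>"
  shows "F p \<in> T"
  by (rule bounded_linear_closure_span[OF assms(1-3) _ assms(5)[unfolded col_graph_def]]) (use assms(4) in blast)

lemma col_graph_subset: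
  assumes "subspace T" "closed T" "\<And>z b. b \<in> B \<Longrightarrow> (tensor_left z o\<^sub>L b, tensor_left z o\<^sub>L \<phi> b) \<in> T"
  shows "col_graph B \<phi> \<subseteq> T"
  unfolding col_graph_def by (intro closure_minimal span_minimal) (use assms in auto)

lemma adj_0 [simp]: "adj 0 = 0" using adj_scaleR[OF bops_0, of 0] by simp

lemma adjointable_bops: "t \<in> adjointable B \<Longrightarrow> t \<in> bops" by (simp add: adjointable_def)
lemma adjointable_col: "t \<in> adjointable B \<Longrightarrow> e \<in> col_module B \<Longrightarrow> t o\<^sub>L e \<in> col_module B"
  by (simp add: adjointable_def)
lemma adjointable_adj [intro]: "t \<in> adjointable B \<Longrightarrow> adj t \<in> adjointable B"
  by (simp add: adjointable_def)
lemma adjointable_comp [intro]: "s \<in> adjointable B \<Longrightarrow> t \<in> adjointable B \<Longrightarrow> s o\<^sub>L t \<in> adjointable B"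
  by (simp add: adjointable_def adj_comp comp_assoc)

lemma closed_left_stable:
  assumes "closed E"
  shows "closed {s. \<forall>e\<in>E. s o\<^sub>L e \<in> E}"
proof -
  have "closed ((\<lambda>s. s o\<^sub>L e) -` E)" for e
    by (intro continuous_closed_vimage assms linear_continuous_at bounded_linear_comp_left)
  then have "closed (\<Inter>e\<in>E. (\<lambda>s. s o\<^sub>L e) -` E)" by blast
  moreover have "(\<Inter>e\<in>E. (\<lambda>s. s o\<^sub>L e) -` E) = {s. \<forall>e\<in>E. s o\<^sub>L e \<in> E}" by auto
  ultimately show ?thesis by simp
qed

lemma subspace_left_stable: "subspace E \<Longrightarrow> subspace {s. \<forall>e\<in>E. s o\<^sub>L e \<in> E}"
  unfolding subspace_def
  by (auto simp: blinfun_compose_add_left bounded_bilinear.scaleR_left[OF bounded_bilinear_blinfun_compose]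
      bounded_bilinear.zero_left[OF bounded_bilinear_blinfun_compose])

lemma adjointable_eq: "adjointable B =
    (bops \<inter> {s. \<forall>e\<in>col_module B. s o\<^sub>L e \<in> col_module B}) \<inter>
    {t \<in> bops. adj t \<in> bops \<inter> {s. \<forall>e\<in>col_module B. s o\<^sub>L e \<in> col_module B}}"
  unfolding adjointable_def by auto

lemma closed_adjointable: "closed (adjointable B)"
  unfolding adjointable_eq
  by (intro closed_Int closed_bops closed_adj_image closed_left_stable closed_col_module) auto

lemma subspace_adjointable: "subspace (adjointable B)"
proof -
  note sub = subspace_inter[OF subspace_bops subspace_left_stable[OF subspace_col_module[of B]]]
  show ?thesis unfolding subspace_def
  proof safe
    show "0 \<in> adjointable B"
      using subspace_0[OF sub] by (auto simp: adjointable_eq)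
    fix s t :: "('a \<otimes>\<^sub>H 'b) op" and r :: real
    assume s: "s \<in> adjointable B"
    then show "r *\<^sub>R s \<in> adjointable B"
      using subspace_scale[OF sub, of s r] subspace_scale[OF sub, of "adj s" r]
      by (auto simp: adjointable_eq adj_scaleR)
    assume t: "t \<in> adjointable B"
    show "s + t \<in> adjointable B"
      using s t subspace_add[OF sub, of s t] subspace_add[OF sub, of "adj s" "adj t"]
      by (auto simp: adjointable_eq adj_add)
  qed
qed

text \<open>Testing on a total set \<open>Z\<close> is what later allows vectors from the ranges of
  embeddings, as in \<open>adjointable_transfer\<close>.\<close>

lemma adjointableI:
  assumes t: "t \<in> bops" and Z: "closure (span Z) = UNIV"
    and gen: "\<And>z b. z \<in> Z \<Longrightarrow> b \<in> B \<Longrightarrow> t o\<^sub>L (tensor_left z o\<^sub>L b) \<in> col_module B"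
      "\<And>z b. z \<in> Z \<Longrightarrow> b \<in> B \<Longrightarrow> adj t o\<^sub>L (tensor_left z o\<^sub>L b) \<in> col_module B"
  shows "t \<in> adjointable B"
proof -
  have *: "s o\<^sub>L e \<in> col_module B" if s: "\<And>z b. z \<in> Z \<Longrightarrow> b \<in> B \<Longrightarrow> s o\<^sub>L (tensor_left z o\<^sub>L b) \<in> col_module B"
    and e: "e \<in> col_module B" for s :: "('a \<otimes>\<^sub>H 'b) op" and e
  proof (rule col_module_induct[OF bounded_linear_comp_right subspace_col_module closed_col_module _ e])
    show "s o\<^sub>L (tensor_left z o\<^sub>L b) \<in> col_module B" if b: "b \<in> B" for z b
      by (rule bounded_linear_closure_span[where S = Z and x = z,
          OF bounded_linear_compose[OF bounded_linear_comp_right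
            bounded_linear_compose[OF bounded_linear_comp_left bounded_linear_of_tensor_left]]
          subspace_col_module closed_col_module])
        (use s b Z in auto)
  qed
  show ?thesis unfolding adjointable_def using t *[OF gen(1)] *[OF gen(2)] by simp
qed

section \<open>Existence and algebraic properties of amplifications\<close>

context
  fixes B :: "'b::chilbert_space op set" and \<phi> :: "'b op \<Rightarrow> 'c::chilbert_space op"
  assumes rep: "star_rep B \<phi>"
begin

lemmas cstar = rep_cstar[OF rep]

lemma rep_tendsto:
  assumes b: "\<And>n. b n \<in> B" "b' \<in> B" "b \<longlonglongrightarrow> b'"
  shows "(\<lambda>n. \<phi> (b n)) \<longlonglongrightarrow> \<phi> b'"
proof -
  have "(\<lambda>n. norm (b n - b')) \<longlonglongrightarrow> 0" using b(3) by (intro tendsto_norm_zero LIM_zero)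
  moreover have "norm (\<phi> (b n) - \<phi> b') \<le> norm (b n - b')" for n
    using rep_norm[OF rep, of "b n - b'"] b(1)[of n] b(2)
    by (simp add: rep_diff[OF rep] subspace_diff[OF cstar_subspace[OF cstar]])
  ultimately have "(\<lambda>n. \<phi> (b n) - \<phi> b') \<longlonglongrightarrow> 0"
    by (intro Lim_null_comparison[of "\<lambda>n. \<phi> (b n) - \<phi> b'" "\<lambda>n. norm (b n - b')"] always_eventually allI)
  then show ?thesis by (rule LIM_zero_cancel)
qed

lemma col_graph_bops: "(e, e') \<in> col_graph B \<phi> \<Longrightarrow> e \<in> bops \<and> e' \<in> bops"
  using col_graph_subset[of "bops \<times> bops" B \<phi>] cstar_bops[OF cstar] rep_bops[OF rep]
  by (auto simp: closed_Times closed_bops subspace_Times subspace_bops)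

lemma col_graph_fst: "(e, e') \<in> col_graph B \<phi> \<Longrightarrow> e \<in> col_module B"
  using col_graph_induct[OF bounded_linear_fst subspace_col_module closed_col_module, of B \<phi> B "(e, e')"]
  by (simp add: col_module_gen)

text \<open>The pairs whose operator-valued inner product with \<open>q\<close> is respected by
  \<open>\<phi>\<close>. Being a closed subspace, it contains the whole graph of columns once it
  contains the generators.\<close>

definition inner_match :: "('b \<Rightarrow>\<^sub>L 'a::chilbert_space \<otimes>\<^sub>H 'b) \<times> ('c \<Rightarrow>\<^sub>L 'a \<otimes>\<^sub>H 'c) \<Rightarrow>
    (('b \<Rightarrow>\<^sub>L 'a \<otimes>\<^sub>H 'b) \<times> ('c \<Rightarrow>\<^sub>L 'a \<otimes>\<^sub>H 'c)) set" where
  "inner_match q = {p. fst p \<in> bops \<and> snd p \<in> bops \<and> adj (fst p) o\<^sub>L fst q \<in> B \<and>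
     \<phi> (adj (fst p) o\<^sub>L fst q) = adj (snd p) o\<^sub>L snd q}"

lemma inner_match_sym:
  assumes "fst q \<in> bops" "snd q \<in> bops" "p \<in> inner_match q"
  shows "q \<in> inner_match p"
proof -
  have p: "fst p \<in> bops" "snd p \<in> bops" "adj (fst p) o\<^sub>L fst q \<in> B"
    "\<phi> (adj (fst p) o\<^sub>L fst q) = adj (snd p) o\<^sub>L snd q"
    using assms(3) by (auto simp: inner_match_def)
  have "adj (fst q) o\<^sub>L fst p = adj (adj (fst p) o\<^sub>L fst q)" "adj (snd q) o\<^sub>L snd p = adj (adj (snd p) o\<^sub>L snd q)"
    using p assms by (simp_all add: adj_comp)
  then show ?thesis
    using p assms cstar_adj[OF cstar p(3)] rep_adj[OF rep p(3)] by (simp add: inner_match_def)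
qed

lemma inner_match_subspace: "subspace (inner_match q)"
  unfolding subspace_def
proof safe
  note sub = cstar_subspace[OF cstar]
  note b0 = subspace_0[OF sub] and bs = subspace_scale[OF sub] and ba = subspace_add[OF sub]
  note lin = blinfun_compose_add_left bounded_bilinear.scaleR_left[OF bounded_bilinear_blinfun_compose]
    bounded_bilinear.zero_left[OF bounded_bilinear_blinfun_compose]
  show "0 \<in> inner_match q"
    using rep_scaleR[OF rep b0, of 0] b0 by (simp add: inner_match_def lin)
  fix e e' f f' and r :: real
  assume e: "(e, e') \<in> inner_match q"
  then show "r *\<^sub>R (e, e') \<in> inner_match q"
    using bs rep_scaleR[OF rep] by (simp add: inner_match_def adj_scaleR lin)
  assume f: "(f, f') \<in> inner_match q"
  show "(e, e') + (f, f') \<in> inner_match q"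
    using e f ba rep_add[OF rep] by (simp add: inner_match_def adj_add lin)
qed

lemma inner_match_closed: "closed (inner_match q)"
  unfolding closed_sequential_limits
proof (intro allI impI, elim conjE)
  fix p l assume p: "\<forall>n. p n \<in> inner_match q" and l: "p \<longlonglongrightarrow> l"
  have f: "(\<lambda>n. fst (p n)) \<longlonglongrightarrow> fst l" and s: "(\<lambda>n. snd (p n)) \<longlonglongrightarrow> snd l"
    using l by (auto intro: tendsto_fst tendsto_snd)
  have pb: "fst (p n) \<in> bops" "snd (p n) \<in> bops" "adj (fst (p n)) o\<^sub>L fst q \<in> B"
    "\<phi> (adj (fst (p n)) o\<^sub>L fst q) = adj (snd (p n)) o\<^sub>L snd q" for n
    using p by (auto simp: inner_match_def)
  have lb: "fst l \<in> bops" "snd l \<in> bops"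
    using closed_sequentially[OF closed_bops _ f] closed_sequentially[OF closed_bops _ s] pb by auto
  have 1: "(\<lambda>n. adj (fst (p n)) o\<^sub>L fst q) \<longlonglongrightarrow> (adj (fst l) o\<^sub>L fst q)"
    by (rule bounded_linear.tendsto[OF bounded_linear_comp_left adj_tendsto[OF pb(1) lb(1) f]])
  have 2: "(\<lambda>n. adj (snd (p n)) o\<^sub>L snd q) \<longlonglongrightarrow> (adj (snd l) o\<^sub>L snd q)"
    by (rule bounded_linear.tendsto[OF bounded_linear_comp_left adj_tendsto[OF pb(2) lb(2) s]])
  have B: "adj (fst l) o\<^sub>L fst q \<in> B"
    using closed_sequentially[OF cstar_closed[OF cstar] _ 1] pb(3) by blast
  have "\<phi> (adj (fst l) o\<^sub>L fst q) = adj (snd l) o\<^sub>L snd q"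
    using LIMSEQ_unique[OF rep_tendsto[OF pb(3) B 1]] 2 by (simp add: pb(4))
  then show "l \<in> inner_match q" using lb B by (simp add: inner_match_def)
qed

lemma col_graph_inner_match:
  assumes p: "p \<in> col_graph B \<phi>" and q: "q \<in> col_graph B \<phi>"
  shows "p \<in> inner_match q"
proof -
  have bops: "fst r \<in> bops" "snd r \<in> bops" if "r \<in> col_graph B \<phi>" for r :: "('b \<Rightarrow>\<^sub>L 'a \<otimes>\<^sub>H 'b) \<times> ('c \<Rightarrow>\<^sub>L 'a \<otimes>\<^sub>H 'c)"
    using col_graph_bops[of "fst r" "snd r"] that by auto
  have gen: "(tensor_left z o\<^sub>L b, tensor_left z o\<^sub>L \<phi> b) \<in> inner_match (tensor_left z' o\<^sub>L c, tensor_left z' o\<^sub>L \<phi> c)"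
    if bc: "b \<in> B" "c \<in> B" for z z' :: 'a and b c
  proof -
    have bb: "b \<in> bops" "c \<in> bops" "\<phi> b \<in> bops" "\<phi> c \<in> bops"
      using bc cstar_bops[OF cstar] rep_bops[OF rep] by auto
    have *: "adj (tensor_left z o\<^sub>L x) o\<^sub>L (tensor_left z' o\<^sub>L y) = scaleC_op (cinner z z') (adj x o\<^sub>L y)"
      if "x \<in> bops" for x y :: "'d::chilbert_space op"
      using that by (intro blinfun_eqI) (simp add: adj_comp bopsD)
    have "adj b o\<^sub>L c \<in> B" using bc by (intro cstar_comp[OF cstar] cstar_adj[OF cstar])
    then show ?thesis using bb bc
      by (simp add: inner_match_def * cstar_scaleC[OF cstar] rep_scaleC[OF rep] rep_comp[OF rep] rep_adj[OF rep] cstar_adj[OF cstar])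
  qed
  \<comment> \<open>The condition is linear in the left pair \<open>p\<close>, so the left pair is
    extended first; \<open>inner_match_sym\<close> then exchanges the two roles.\<close>
  have 1: "p \<in> inner_match (tensor_left z o\<^sub>L b, tensor_left z o\<^sub>L \<phi> b)" if b: "b \<in> B" and p: "p \<in> col_graph B \<phi>"
    for z :: 'a and b p
    by (rule subsetD[OF col_graph_subset[OF inner_match_subspace inner_match_closed] p]) (rule gen[OF _ b])
  have 2: "(tensor_left z o\<^sub>L b, tensor_left z o\<^sub>L \<phi> b) \<in> inner_match q" if b: "b \<in> B" for z :: 'a and b
    by (rule inner_match_sym) (use 1[OF b q] bops[OF col_graph_gen[OF b]] in auto)
  show ?thesis
    by (rule subsetD[OF col_graph_subset[OF inner_match_subspace inner_match_closed] p]) (rule 2)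
qed

lemma col_graph_inner:
  assumes "(e, e') \<in> col_graph B \<phi>" "(f, f') \<in> col_graph B \<phi>"
  shows "adj e o\<^sub>L f \<in> B" "\<phi> (adj e o\<^sub>L f) = adj e' o\<^sub>L f'"
  using col_graph_inner_match[OF assms] by (auto simp: inner_match_def)

text \<open>The squared norm of a column is that of its inner product with itself, an element of
  \<open>B\<close>, where \<open>\<phi>\<close> is contractive.\<close>

lemma col_graph_norm: assumes e: "(e, e') \<in> col_graph B \<phi>" shows "norm e' \<le> norm e"
proof (rule power2_le_imp_le)
  note eb = col_graph_bops[OF e]
  have "(norm e')\<^sup>2 \<le> norm (\<phi> (adj e o\<^sub>L e))"
    unfolding col_graph_inner(2)[OF e e] using eb by (simp add: norm_adj_comp_self)
  also have "\<dots> \<le> norm (adj e o\<^sub>L e)" by (rule rep_norm[OF rep col_graph_inner(1)[OF e e]])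
  also have "\<dots> \<le> norm (adj e) * norm e" by (rule norm_blinfun_compose)
  finally show "(norm e')\<^sup>2 \<le> (norm e)\<^sup>2" using eb by (simp add: norm_adj power2_eq_square)
qed simp

lemma col_graph_unique: assumes "(e, e') \<in> col_graph B \<phi>" "(e, e'') \<in> col_graph B \<phi>" shows "e' = e''"
  using col_graph_norm[of 0 "e' - e''"] subspace_diff[OF subspace_col_graph assms] by simp

lemma col_graph_ex: assumes e: "e \<in> col_module B" shows "\<exists>e'. (e, e') \<in> col_graph B \<phi>"
proof -
  let ?G = "{(tensor_left z o\<^sub>L b, tensor_left z o\<^sub>L \<phi> b) |(z::'a) b. b \<in> B}"
  have "fst ` ?G = {tensor_left z o\<^sub>L b |z b. b \<in> B}" by force
  then have "e \<in> closure (span (fst ` ?G))" using e by (simp add: col_module_def)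
  moreover have "norm u' \<le> 1 * norm u" if "(u, u') \<in> span ?G" for u u'
    using col_graph_norm[of u u'] that closure_subset[of "span ?G"] by (auto simp: col_graph_def)
  ultimately show ?thesis unfolding col_graph_def using closure_graph_total[of ?G 1 e] by auto
qed

lemma col_graph_total: "closure (span {blinfun_apply e' x |e e' x. (e, e') \<in> col_graph B \<phi>}) =
    (UNIV :: ('a::chilbert_space \<otimes>\<^sub>H 'c) set)"
proof -
  have "UNIV = closure (span {z \<otimes> y |(z::'a) y. z \<in> UNIV \<and> y \<in> {blinfun_apply (\<phi> b) x |b x. b \<in> B}})"
    by (rule total_tensor[symmetric], simp, rule rep_total[OF rep])
  also have "\<dots> \<subseteq> closure (span {blinfun_apply e' x |(e :: 'b \<Rightarrow>\<^sub>L 'a \<otimes>\<^sub>H 'b) e' x. (e, e') \<in> col_graph B \<phi>})"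
  proof (intro closure_mono span_mono subsetI)
    fix u assume "u \<in> {z \<otimes> y |(z::'a) y. z \<in> UNIV \<and> y \<in> {blinfun_apply (\<phi> b) x |b x. b \<in> B}}"
    then obtain z b x where u: "u = blinfun_apply (tensor_left z o\<^sub>L \<phi> b) x" "b \<in> B" by auto
    then show "u \<in> {blinfun_apply e' x |(e :: 'b \<Rightarrow>\<^sub>L 'a \<otimes>\<^sub>H 'b) e' x. (e, e') \<in> col_graph B \<phi>}"
      using col_graph_gen[OF u(2), of z \<phi>] by blast
  qed
  finally show ?thesis by blast
qed

text \<open>For \<open>\<parallel>t\<parallel> < 1\<close> write \<open>1 - t\<^sup>* t = (1 - s)\<^sup>2\<close> with \<open>s\<close> adjointable; then the difference of the two squared
  norms below is the squared norm of the vector obtained from \<open>1 - s\<close>. This replaces complete positivity.\<close>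

lemma amp_bound_aux:
  fixes t :: "('a::chilbert_space \<otimes>\<^sub>H 'b) op"
  assumes t: "t \<in> adjointable B" "norm t < 1" and I: "finite I"
    and e: "\<And>i. i \<in> I \<Longrightarrow> (e i, e' i) \<in> col_graph B \<phi>" and f: "\<And>i. i \<in> I \<Longrightarrow> (t o\<^sub>L e i, f i) \<in> col_graph B \<phi>"
  shows "norm (\<Sum>i\<in>I. blinfun_apply (f i) (x i)) \<le> norm (\<Sum>i\<in>I. blinfun_apply (e' i) (x i))"
proof -
  let ?X = "{T \<in> bops. adj T = T} \<inter> {s. \<forall>e\<in>(col_module B :: ('b \<Rightarrow>\<^sub>L 'a \<otimes>\<^sub>H 'b) set). s o\<^sub>L e \<in> col_module B}"
  define h where "h = adj t o\<^sub>L t"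
  note tb = adjointable_bops[OF t(1)]
  have hX: "h \<in> ?X" using tb t(1) by (auto simp: h_def adj_comp comp_assoc adjointable_def)
  have "norm h \<le> norm (adj t) * norm t" unfolding h_def by (rule norm_blinfun_compose)
  also have "\<dots> < 1" using t(2) tb by (simp add: norm_adj mult_strict_mono[of "norm t" 1 "norm t" 1, simplified])
  finally have "norm h < 1" .
  moreover have "closed ?X" by (intro closed_Int closed_selfadjoint closed_left_stable closed_col_module)
  moreover have "subspace {T \<in> bops. adj T = T}" for T :: "('a \<otimes>\<^sub>H 'b) op"
    by (auto simp: subspace_def adj_add adj_scaleR)
  then have "subspace ?X" by (intro subspace_inter subspace_left_stable subspace_col_module)
  moreover have "s o\<^sub>L s \<in> ?X" if "s \<in> ?X" for s using that by (auto simp: adj_comp comp_assoc)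
  ultimately obtain s where s: "s \<in> ?X" "2 *\<^sub>R s - (s o\<^sub>L s) = h" using quasi_sqrt_exists[of ?X h] hX by blast
  have "\<exists>g. (s o\<^sub>L e i, g) \<in> col_graph B \<phi>" if "i \<in> I" for i
    using s(1) col_graph_fst[OF e[OF that]] by (intro col_graph_ex) blast
  then obtain g where g: "\<And>i. i \<in> I \<Longrightarrow> (s o\<^sub>L e i, g i) \<in> col_graph B \<phi>" by metis
  define d where "d i = e' i - g i" for i
  have d: "(e i - (s o\<^sub>L e i), d i) \<in> col_graph B \<phi>" if "i \<in> I" for i
    using subspace_diff[OF subspace_col_graph e[OF that] g[OF that]] by (simp add: d_def)
  have key: "adj (d i) o\<^sub>L d j = (adj (e' i) o\<^sub>L e' j) - (adj (f i) o\<^sub>L f j)" if ij: "i \<in> I" "j \<in> I" for i j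
  proof -
    have eb: "e i \<in> bops" "e j \<in> bops" using col_graph_bops[OF e] ij by auto
    have "adj (e i - (s o\<^sub>L e i)) o\<^sub>L (e j - (s o\<^sub>L e j)) =
        (adj (e i) o\<^sub>L e j) - (adj (e i) o\<^sub>L ((2 *\<^sub>R s - (s o\<^sub>L s)) o\<^sub>L e j))"
      using s(1) eb
      by (intro blinfun_eqI) (simp add: adj_diff adj_comp blinfun.diff_left blinfun.diff_right blinfun.scaleR_left blinfun.scaleR_right scaleR_2 blinfun.add_left blinfun.add_right)
    also have "\<dots> = (adj (e i) o\<^sub>L e j) - (adj (t o\<^sub>L e i) o\<^sub>L (t o\<^sub>L e j))"
      unfolding s(2) using tb eb by (simp add: h_def adj_comp comp_assoc)
    finally have *: "adj (e i - (s o\<^sub>L e i)) o\<^sub>L (e j - (s o\<^sub>L e j)) =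
      (adj (e i) o\<^sub>L e j) - (adj (t o\<^sub>L e i) o\<^sub>L (t o\<^sub>L e j))" .
    show ?thesis
      using arg_cong[OF *, of \<phi>] rep_diff[OF rep col_graph_inner(1)[OF e e] col_graph_inner(1)[OF f f], OF ij ij]
      by (simp add: col_graph_inner(2)[OF d d] col_graph_inner(2)[OF e e] col_graph_inner(2)[OF f f] ij)
  qed
  have sum: "(norm (\<Sum>i\<in>I. blinfun_apply (A i) (x i)))\<^sup>2 =
      Re (\<Sum>i\<in>I. \<Sum>j\<in>I. cinner (x i) (blinfun_apply (adj (A i) o\<^sub>L A j) (x j)))"
    if A: "\<And>i. i \<in> I \<Longrightarrow> A i \<in> bops" for A :: "_ \<Rightarrow> 'c \<Rightarrow>\<^sub>L 'a \<otimes>\<^sub>H 'c"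
  proof -
    have "(norm (\<Sum>i\<in>I. blinfun_apply (A i) (x i)))\<^sup>2 =
        Re (cinner (\<Sum>i\<in>I. blinfun_apply (A i) (x i)) (\<Sum>i\<in>I. blinfun_apply (A i) (x i)))"
      by (simp add: cinner_self)
    also have "cinner (\<Sum>i\<in>I. blinfun_apply (A i) (x i)) (\<Sum>i\<in>I. blinfun_apply (A i) (x i)) =
        (\<Sum>i\<in>I. \<Sum>j\<in>I. cinner (x i) (blinfun_apply (adj (A i) o\<^sub>L A j) (x j)))"
      unfolding cinner_sum_left
      unfolding cinner_sum_right by (intro sum.cong refl) (simp add: adj_right A)
    finally show ?thesis .
  qed
  have bops: "d i \<in> bops" "e' i \<in> bops" "f i \<in> bops" if "i \<in> I" for i
    using col_graph_bops[OF d[OF that]] col_graph_bops[OF e[OF that]] col_graph_bops[OF f[OF that]] by auto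
  have "(\<Sum>i\<in>I. \<Sum>j\<in>I. cinner (x i) (blinfun_apply (adj (d i) o\<^sub>L d j) (x j))) =
      (\<Sum>i\<in>I. \<Sum>j\<in>I. cinner (x i) (blinfun_apply (adj (e' i) o\<^sub>L e' j) (x j))) -
      (\<Sum>i\<in>I. \<Sum>j\<in>I. cinner (x i) (blinfun_apply (adj (f i) o\<^sub>L f j) (x j)))"
    unfolding sum_subtractf[symmetric]
    by (intro sum.cong refl) (simp only: key blinfun.diff_left cinner_diff_right)
  then have "(norm (\<Sum>i\<in>I. blinfun_apply (d i) (x i)))\<^sup>2 =
      (norm (\<Sum>i\<in>I. blinfun_apply (e' i) (x i)))\<^sup>2 - (norm (\<Sum>i\<in>I. blinfun_apply (f i) (x i)))\<^sup>2"
    by (simp only: sum[OF bops(1)] sum[OF bops(2)] sum[OF bops(3)] minus_complex.sel)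
  then have "(norm (\<Sum>i\<in>I. blinfun_apply (f i) (x i)))\<^sup>2 \<le> (norm (\<Sum>i\<in>I. blinfun_apply (e' i) (x i)))\<^sup>2"
    using zero_le_power2[of "norm (\<Sum>i\<in>I. blinfun_apply (d i) (x i))"] by linarith
  then show ?thesis by (rule power2_le_imp_le) simp
qed

lemma amp_ex:
  fixes t :: "('a::chilbert_space \<otimes>\<^sub>H 'b) op"
  assumes t: "t \<in> adjointable B"
  shows "\<exists>R. R \<in> bops \<and> norm R \<le> norm t \<and> (\<forall>(e, e')\<in>col_graph B \<phi>. (t o\<^sub>L e, R o\<^sub>L e') \<in> col_graph B \<phi>)"
proof -
  define G where "G = {(blinfun_apply e' x, blinfun_apply f x) |e e' f x.
    (e, e') \<in> col_graph B \<phi> \<and> (t o\<^sub>L e, f) \<in> col_graph B \<phi>}"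
  have ex: "\<exists>f. (t o\<^sub>L e, f) \<in> col_graph B \<phi>" if "(e, e') \<in> col_graph B \<phi>" for e e'
    by (rule col_graph_ex[OF adjointable_col[OF t col_graph_fst[OF that]]])
  have bound: "norm u' \<le> norm t * norm u" if uu: "(u, u') \<in> span G" for u u'
  proof -
    \<comment> \<open>\<open>amp_bound_aux\<close> demands norm below 1, so it is applied to
      \<open>t\<close> divided by an arbitrary \<open>k\<close> above \<open>norm t\<close>. The
      real coefficients of the linear combination are absorbed into the vectors.\<close>
    have k: "norm u' \<le> k * norm u" if k: "norm t < k" for k
    proof -
      have k0: "0 < k" using k norm_ge_zero[of t] by linarith
      obtain J r where J: "finite J" "J \<subseteq> G" "(u, u') = (\<Sum>p\<in>J. r p *\<^sub>R p)"
        using uu unfolding span_explicit by blast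
      have "\<forall>p\<in>J. \<exists>e e' f x. p = (blinfun_apply e' x, blinfun_apply f x) \<and>
          (e, e') \<in> col_graph B \<phi> \<and> (t o\<^sub>L e, f) \<in> col_graph B \<phi>"
        using J(2) unfolding G_def by blast
      then obtain e e' f x where p: "\<And>p. p \<in> J \<Longrightarrow> p = (blinfun_apply (e' p) (x p), blinfun_apply (f p) (x p)) \<and>
          (e p, e' p) \<in> col_graph B \<phi> \<and> (t o\<^sub>L e p, f p) \<in> col_graph B \<phi>"
        by metis
      have u: "u = (\<Sum>p\<in>J. blinfun_apply (e' p) (r p *\<^sub>R x p))"
        using arg_cong[OF J(3), of fst]
          by (auto simp: fst_sum blinfun.scaleR_right intro!: sum.cong) (metis p fst_conv)
      have "u' = (\<Sum>p\<in>J. blinfun_apply (f p) (r p *\<^sub>R x p))"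
        using arg_cong[OF J(3), of snd]
          by (auto simp: snd_sum blinfun.scaleR_right intro!: sum.cong) (metis p snd_conv)
      then have u': "(1/k) *\<^sub>R u' = (\<Sum>p\<in>J. blinfun_apply ((1/k) *\<^sub>R f p) (r p *\<^sub>R x p))"
        by (simp add: scaleR_sum_right blinfun.scaleR_left)
      have "norm ((1/k) *\<^sub>R u') \<le> norm u"
        unfolding u u'
      proof (rule amp_bound_aux[of "(1/k) *\<^sub>R t" _ e])
        show "(1/k) *\<^sub>R t \<in> adjointable B" by (rule subspace_scale[OF subspace_adjointable t])
        show "norm ((1/k) *\<^sub>R t) < 1" using k k0 by simp
        show "((1/k) *\<^sub>R t o\<^sub>L e i, (1/k) *\<^sub>R f i) \<in> col_graph B \<phi>" if "i \<in> J" for i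
          using subspace_scale[OF subspace_col_graph, of "(t o\<^sub>L e i, f i)" B \<phi> "1/k"] p[OF that]
          by (simp add: bounded_bilinear.scaleR_left[OF bounded_bilinear_blinfun_compose])
      qed (use p J(1) in auto)
      then show ?thesis using k0 by (simp add: field_simps)
    qed
    show ?thesis
    proof (cases "norm u = 0")
      case True
      then show ?thesis using k[of "norm t + 1"] by simp
    next
      case False
      have "norm u' / norm u \<le> norm t"
        by (rule dense_ge) (use k False in \<open>simp add: field_simps\<close>)
      then show ?thesis using False by (simp add: field_simps)
    qed
  qed
  have "{blinfun_apply e' x |(e :: 'b \<Rightarrow>\<^sub>L 'a \<otimes>\<^sub>H 'b) e' x. (e, e') \<in> col_graph B \<phi>} \<subseteq> fst ` G"
    using ex unfolding G_def by force
  then have "closure (span {blinfun_apply e' x |(e :: 'b \<Rightarrow>\<^sub>L 'a \<otimes>\<^sub>H 'b) e' x. (e, e') \<in> col_graph B \<phi>}) \<subseteq>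
      closure (span (fst ` G))"
    by (intro closure_mono span_mono)
  then have "closure (span (fst ` G)) = UNIV" unfolding col_graph_total by blast
  then obtain R where R: "\<forall>(u, u')\<in>G. blinfun_apply R u = u'" "norm R \<le> norm t"
    using blinfun_of_graph[OF bound _ norm_ge_zero] by blast
  have Rf: "blinfun_apply R (blinfun_apply e' x) = blinfun_apply f x"
    if "(e, e') \<in> col_graph B \<phi>" "(t o\<^sub>L e, f) \<in> col_graph B \<phi>" for e e' f x
  proof -
    have "(blinfun_apply e' x, blinfun_apply f x) \<in> G" using that unfolding G_def by blast
    then show ?thesis using R(1) by auto
  qed
  have "blinfun_apply R (c *\<^sub>C v) = c *\<^sub>C blinfun_apply R v" for c v
  proof (rule closed_eq_on_total[of "\<lambda>v. blinfun_apply R (c *\<^sub>C v)" "\<lambda>v. c *\<^sub>C blinfun_apply R v"])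
    show "bounded_linear (\<lambda>v. blinfun_apply R (c *\<^sub>C v))"
      by (rule bounded_linear_compose[OF blinfun.bounded_linear_right bounded_linear_scaleC])
    show "bounded_linear (\<lambda>v. c *\<^sub>C blinfun_apply R v)"
      by (rule bounded_linear_compose[OF bounded_linear_scaleC blinfun.bounded_linear_right])
    show "v \<in> closure (span {blinfun_apply e' x |e e' x. (e, e') \<in> col_graph B \<phi>})"
      unfolding col_graph_total by (rule UNIV_I)
    fix v :: "'a \<otimes>\<^sub>H 'c" assume "v \<in> {blinfun_apply e' x |e e' x. (e, e') \<in> col_graph B \<phi>}"
    then obtain e e' x where v: "v = blinfun_apply e' x" "(e, e') \<in> col_graph B \<phi>" by blast
    then obtain f where f: "(t o\<^sub>L e, f) \<in> col_graph B \<phi>" using ex by blast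
    have "c *\<^sub>C v = blinfun_apply e' (c *\<^sub>C x)" using v col_graph_bops[OF v(2)] by (simp add: bopsD)
    then show "blinfun_apply R (c *\<^sub>C v) = c *\<^sub>C blinfun_apply R v"
      using Rf[OF v(2) f] v(1) col_graph_bops[OF f] by (simp add: bopsD)
  qed
  then have "R \<in> bops" by (simp add: bops_def)
  moreover have "(t o\<^sub>L e, R o\<^sub>L e') \<in> col_graph B \<phi>" if e: "(e, e') \<in> col_graph B \<phi>" for e e'
  proof -
    obtain f where f: "(t o\<^sub>L e, f) \<in> col_graph B \<phi>" using ex e by blast
    have "R o\<^sub>L e' = f" by (rule blinfun_eqI) (simp add: Rf[OF e f])
    then show ?thesis using f by simp
  qed
  ultimately show ?thesis using R(2) by blast
qed

lemma amp_unique: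
  fixes R R' :: "('a::chilbert_space \<otimes>\<^sub>H 'c) op"
  assumes "\<And>e e'. (e, e') \<in> col_graph B \<phi> \<Longrightarrow> (t o\<^sub>L e, R o\<^sub>L e') \<in> col_graph B \<phi>"
    and "\<And>e e'. (e, e') \<in> col_graph B \<phi> \<Longrightarrow> (t o\<^sub>L e, R' o\<^sub>L e') \<in> col_graph B \<phi>"
  shows "R = R'"
proof (rule blinfun_eq_on_total[OF _ col_graph_total])
  fix v :: "'a \<otimes>\<^sub>H 'c" assume "v \<in> {blinfun_apply e' x |e e' x. (e, e') \<in> col_graph B \<phi>}"
  then obtain e e' x where v: "v = blinfun_apply e' x" "(e, e') \<in> col_graph B \<phi>" by blast
  have "R o\<^sub>L e' = R' o\<^sub>L e'" by (rule col_graph_unique[OF assms[OF v(2)]])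
  then show "blinfun_apply R v = blinfun_apply R' v" unfolding v(1) by (metis blinfun_apply_blinfun_compose)
qed

lemma
  assumes t: "t \<in> adjointable B"
  shows amp_bops [simp]: "amp B \<phi> t \<in> bops"
    and amp_norm: "norm (amp B \<phi> t) \<le> norm t"
    and amp_graph: "(e, e') \<in> col_graph B \<phi> \<Longrightarrow> (t o\<^sub>L e, amp B \<phi> t o\<^sub>L e') \<in> col_graph B \<phi>"
proof -
  obtain R where R: "R \<in> bops" "norm R \<le> norm t" "\<forall>(e, e')\<in>col_graph B \<phi>. (t o\<^sub>L e, R o\<^sub>L e') \<in> col_graph B \<phi>"
    using amp_ex[OF t] by blast
  have "amp B \<phi> t = R" unfolding amp_def
    by (rule the_equality) (use R in \<open>auto intro!: amp_unique[of t]\<close>)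
  then show "amp B \<phi> t \<in> bops" "norm (amp B \<phi> t) \<le> norm t"
    "(e, e') \<in> col_graph B \<phi> \<Longrightarrow> (t o\<^sub>L e, amp B \<phi> t o\<^sub>L e') \<in> col_graph B \<phi>" using R by auto
qed

lemma amp_eqI_graph:
  assumes "t \<in> adjointable B" "\<And>e e'. (e, e') \<in> col_graph B \<phi> \<Longrightarrow> (t o\<^sub>L e, R o\<^sub>L e') \<in> col_graph B \<phi>"
  shows "amp B \<phi> t = R"
  by (rule amp_unique[OF amp_graph[OF assms(1)] assms(2)])

lemma amp_eqI:
  fixes R :: "('a::chilbert_space \<otimes>\<^sub>H 'c) op"
  assumes t: "t \<in> adjointable B" and Z: "closure (span Z) = UNIV"
    and gen: "\<And>z b. z \<in> Z \<Longrightarrow> b \<in> B \<Longrightarrow> (t o\<^sub>L (tensor_left z o\<^sub>L b), R o\<^sub>L (tensor_left z o\<^sub>L \<phi> b)) \<in> col_graph B \<phi>"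
  shows "amp B \<phi> t = R"
proof (rule amp_eqI_graph[OF t])
  have bl: "bounded_linear (\<lambda>p. (t o\<^sub>L fst p, R o\<^sub>L snd p))"
    by (intro bounded_linear_Pair bounded_linear_compose[OF bounded_linear_comp_right] bounded_linear_fst bounded_linear_snd)
  fix e :: "'b \<Rightarrow>\<^sub>L 'a \<otimes>\<^sub>H 'b" and e' assume e: "(e, e') \<in> col_graph B \<phi>"
  have "(\<lambda>p. (t o\<^sub>L fst p, R o\<^sub>L snd p)) (e, e') \<in> col_graph B \<phi>"
  proof (rule col_graph_induct[OF bl subspace_col_graph closed_col_graph _ e])
    fix z :: 'a and b assume b: "b \<in> B"
    have bl: "bounded_linear (\<lambda>z. (t o\<^sub>L (tensor_left z o\<^sub>L b), R o\<^sub>L (tensor_left z o\<^sub>L \<phi> b)))"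
      by (intro bounded_linear_Pair bounded_linear_compose[OF bounded_linear_comp_right
            bounded_linear_compose[OF bounded_linear_comp_left bounded_linear_of_tensor_left]])
    have "(t o\<^sub>L (tensor_left z o\<^sub>L b), R o\<^sub>L (tensor_left z o\<^sub>L \<phi> b)) \<in> col_graph B \<phi>"
      by (rule bounded_linear_closure_span[where S = Z and x = z, OF bl subspace_col_graph closed_col_graph])
        (use gen b Z in auto)
    then show "(t o\<^sub>L fst (tensor_left z o\<^sub>L b, tensor_left z o\<^sub>L \<phi> b), R o\<^sub>L snd (tensor_left z o\<^sub>L b, tensor_left z o\<^sub>L \<phi> b)) \<in> col_graph B \<phi>"
      by simp
  qed
  then show "(t o\<^sub>L e, R o\<^sub>L e') \<in> col_graph B \<phi>" by simp
qed

lemma amp_comp: assumes "s \<in> adjointable B" "t \<in> adjointable B"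
  shows "amp B \<phi> (s o\<^sub>L t) = amp B \<phi> s o\<^sub>L amp B \<phi> t"
  by (rule amp_eqI_graph) (use assms in \<open>auto simp: comp_assoc amp_graph\<close>)

lemma amp_add:
  fixes s :: "('a::chilbert_space \<otimes>\<^sub>H 'b) op"
  assumes "s \<in> adjointable B" "t \<in> adjointable B"
  shows "amp B \<phi> (s + t) = amp B \<phi> s + amp B \<phi> t"
proof (rule amp_eqI_graph)
  fix e :: "'b \<Rightarrow>\<^sub>L 'a \<otimes>\<^sub>H 'b" and e' assume e: "(e, e') \<in> col_graph B \<phi>"
  show "((s + t) o\<^sub>L e, (amp B \<phi> s + amp B \<phi> t) o\<^sub>L e') \<in> col_graph B \<phi>"
    using subspace_add[OF subspace_col_graph amp_graph[OF assms(1) e] amp_graph[OF assms(2) e]]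
    by (simp add: blinfun_compose_add_left)
qed (use assms subspace_add[OF subspace_adjointable] in auto)

lemma amp_adj:
  fixes t :: "('a::chilbert_space \<otimes>\<^sub>H 'b) op"
  assumes t: "t \<in> adjointable B"
  shows "amp B \<phi> (adj t) = adj (amp B \<phi> t)"
proof (rule blinfun_eq_on_total[OF _ col_graph_total], rule cinner_total_eqI[OF col_graph_total])
  fix u v :: "'a \<otimes>\<^sub>H 'c"
  assume "u \<in> {blinfun_apply e' x |e e' x. (e, e') \<in> col_graph B \<phi>}"
    and "v \<in> {blinfun_apply e' x |e e' x. (e, e') \<in> col_graph B \<phi>}"
  then obtain e e' x f f' y where u: "u = blinfun_apply e' x" "(e, e') \<in> col_graph B \<phi>"
    and v: "v = blinfun_apply f' y" "(f, f') \<in> col_graph B \<phi>" by blast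
  note g = amp_graph[OF t v(2)] and h = amp_graph[OF adjointable_adj[OF t] u(2)]
  note tb = adjointable_bops[OF t]
  have fb: "f \<in> bops" "f' \<in> bops" using col_graph_bops[OF v(2)] by auto
  \<comment> \<open>Both sides are \<open>\<phi>\<close> of the same element
    \<open>adj f o\<^sub>L adj t o\<^sub>L e\<close> of \<open>B\<close>.\<close>
  have "adj f' o\<^sub>L (amp B \<phi> (adj t) o\<^sub>L e') = adj (amp B \<phi> t o\<^sub>L f') o\<^sub>L e'"
    using col_graph_inner(2)[OF v(2) h] col_graph_inner(2)[OF g u(2)] tb fb
    by (simp add: adj_comp comp_assoc)
  from arg_cong[OF this, of "\<lambda>T. cinner y (blinfun_apply T x)"]
  show "cinner v (blinfun_apply (amp B \<phi> (adj t)) u) = cinner v (blinfun_apply (adj (amp B \<phi> t)) u)"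
    using fb t by (simp add: u(1) v(1) adj_right adj_comp)
qed

section \<open>Amplification of elementary operators\<close>

lemma adjointable_tensor_id:
  fixes s :: "'a::chilbert_space op"
  assumes s: "s \<in> bops" shows "s \<otimes>\<^sub>o id_blinfun \<in> adjointable B"
proof (rule adjointableI[of _ UNIV])
  have *: "(r \<otimes>\<^sub>o id_blinfun) o\<^sub>L (tensor_left z o\<^sub>L b) \<in> col_module B"
    if "r \<in> bops" "b \<in> B" for r :: "'a op" and z b
  proof -
    have "(r \<otimes>\<^sub>o id_blinfun) o\<^sub>L (tensor_left z o\<^sub>L b) = tensor_left (blinfun_apply r z) o\<^sub>L b"
      using that by (intro blinfun_eqI) simp
    then show ?thesis using that by (simp add: col_module_gen)
  qed
  show "(s \<otimes>\<^sub>o id_blinfun) o\<^sub>L (tensor_left z o\<^sub>L b) \<in> col_module B" if "b \<in> B" for z b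
    using * s that by blast
  show "adj (s \<otimes>\<^sub>o id_blinfun) o\<^sub>L (tensor_left z o\<^sub>L b) \<in> col_module B" if "b \<in> B" for z b
    using *[of "adj s"] s that by (simp add: adj_tensor_op)
qed (use s in auto)

lemma amp_tensor_id:
  assumes s: "s \<in> bops" shows "amp B \<phi> (s \<otimes>\<^sub>o id_blinfun) = s \<otimes>\<^sub>o id_blinfun"
proof (rule amp_eqI[of _ UNIV])
  fix z b assume b: "b \<in> B"
  have *: "(s \<otimes>\<^sub>o id_blinfun) o\<^sub>L (tensor_left z o\<^sub>L r) = tensor_left (blinfun_apply s z) o\<^sub>L r"
    for r :: "'d::chilbert_space op"
    using s by (intro blinfun_eqI) simp
  show "((s \<otimes>\<^sub>o id_blinfun) o\<^sub>L (tensor_left z o\<^sub>L b), (s \<otimes>\<^sub>o id_blinfun) o\<^sub>L (tensor_left z o\<^sub>L \<phi> b)) \<in> col_graph B \<phi>"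
    using b by (simp add: * col_graph_gen)
qed (use s in \<open>auto simp: adjointable_tensor_id\<close>)

lemma adjointable_tensor:
  fixes a :: "'a::chilbert_space op"
  assumes a: "a \<in> bops" and b: "b \<in> B" shows "a \<otimes>\<^sub>o b \<in> adjointable B"
proof (rule adjointableI[of _ UNIV])
  have *: "(r \<otimes>\<^sub>o b) o\<^sub>L (tensor_left z o\<^sub>L c) \<in> col_module B"
    if "r \<in> bops" "b \<in> B" "c \<in> B" for r :: "'a op" and z b c
  proof -
    have "(r \<otimes>\<^sub>o b) o\<^sub>L (tensor_left z o\<^sub>L c) = tensor_left (blinfun_apply r z) o\<^sub>L (b o\<^sub>L c)"
      using that cstar_bops[OF cstar] by (intro blinfun_eqI) simp
    then show ?thesis using that by (simp add: col_module_gen cstar_comp[OF cstar])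
  qed
  show "(a \<otimes>\<^sub>o b) o\<^sub>L (tensor_left z o\<^sub>L c) \<in> col_module B" if "c \<in> B" for z c
    using * a b that by blast
  show "adj (a \<otimes>\<^sub>o b) o\<^sub>L (tensor_left z o\<^sub>L c) \<in> col_module B" if "c \<in> B" for z c
    using *[of "adj a" "adj b"] a b that cstar_bops[OF cstar b] by (simp add: adj_tensor_op cstar_adj[OF cstar])
qed (use assms cstar_bops[OF cstar] in auto)

lemma amp_tensor:
  assumes a: "a \<in> bops" and b: "b \<in> B" shows "amp B \<phi> (a \<otimes>\<^sub>o b) = a \<otimes>\<^sub>o \<phi> b"
proof (rule amp_eqI[of _ UNIV])
  fix z c assume c: "c \<in> B"
  have *: "(a \<otimes>\<^sub>o r) o\<^sub>L (tensor_left z o\<^sub>L r') = tensor_left (blinfun_apply a z) o\<^sub>L (r o\<^sub>L r')"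
    if "r \<in> bops" for r r' :: "'d::chilbert_space op"
    using a that by (intro blinfun_eqI) simp
  show "((a \<otimes>\<^sub>o b) o\<^sub>L (tensor_left z o\<^sub>L c), (a \<otimes>\<^sub>o \<phi> b) o\<^sub>L (tensor_left z o\<^sub>L \<phi> c)) \<in> col_graph B \<phi>"
    using b c cstar_bops[OF cstar b] rep_bops[OF rep b] col_graph_gen[OF cstar_comp[OF cstar b c], of "blinfun_apply a z" \<phi>]
    by (simp add: * rep_comp[OF rep])
qed (use assms in \<open>auto simp: adjointable_tensor\<close>)

text \<open>A complex scalar is the operator \<open>scaleC_op c id_blinfun\<close> on the first leg,
  and operators on the first leg are fixed by \<open>amp\<close>.\<close>

lemma amp_scaleC:
  fixes t :: "('a::chilbert_space \<otimes>\<^sub>H 'b) op"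
  assumes t: "t \<in> adjointable B" shows "amp B \<phi> (scaleC_op c t) = scaleC_op c (amp B \<phi> t)"
  using amp_comp[OF adjointable_tensor_id[of "scaleC_op c id_blinfun"] t] amp_tensor_id[of "scaleC_op c id_blinfun :: 'a op"]
  by (simp add: tensor_op_scaleC_left scaleC_op_comp_left)

end

text \<open>Conjugation by the flip lets \<open>amp\<close>, which acts on the second leg, serve for
  morphisms on the first leg too.\<close>

abbreviation (input) swap :: "('a::chilbert_space \<otimes>\<^sub>H 'b::chilbert_space) op \<Rightarrow> ('b \<otimes>\<^sub>H 'a) op" where
  "swap T \<equiv> flip o\<^sub>L T o\<^sub>L flip"

lemma swap_comp: "swap (S o\<^sub>L T) = swap S o\<^sub>L swap T"
  by (simp add: comp_assoc)

lemma swap_swap: "swap (swap T) = T"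
  by (simp add: comp_assoc)

lemma swap_tensor_op: "a \<in> bops \<Longrightarrow> b \<in> bops \<Longrightarrow> swap (a \<otimes>\<^sub>o b) = b \<otimes>\<^sub>o a"
  by (rule htensor_eqI) simp

lemma norm_swap: fixes T :: "('a::chilbert_space \<otimes>\<^sub>H 'b::chilbert_space) op" shows "norm (swap T) \<le> norm T"
proof -
  have "norm (swap T) \<le> norm (flip o\<^sub>L T) * norm (flip :: 'b \<otimes>\<^sub>H 'a \<Rightarrow>\<^sub>L _)" by (rule norm_blinfun_compose)
  also have "\<dots> \<le> norm (flip o\<^sub>L T) * 1" by (intro mult_left_mono norm_unitary) simp_all
  also have "\<dots> \<le> norm (flip :: 'a \<otimes>\<^sub>H 'b \<Rightarrow>\<^sub>L _) * norm T" by (simp add: norm_blinfun_compose)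
  also have "\<dots> \<le> 1 * norm T" by (intro mult_right_mono norm_unitary) simp_all
  finally show ?thesis by simp
qed

lemma bounded_linear_swap: "bounded_linear (\<lambda>T. swap T)"
  by (rule bounded_linear_compose[OF bounded_linear_comp_left bounded_linear_comp_right])

lemma unitary_swap: "unitary U \<Longrightarrow> unitary (swap U)" by (intro unitary_comp) simp_all

lemma swap_add: "swap (S + T) = swap S + swap T"
  by (simp add: blinfun_compose_add_left blinfun_compose_add_right)

lemma swap_scaleC: "swap (scaleC_op c T) = scaleC_op c (swap T)"
  by (simp add: scaleC_op_comp_left scaleC_op_comp_right)

section \<open>Amplification with an additional leg\<close>

lemma tensor_id_tensor_left: "J \<in> bops \<Longrightarrow> (J \<otimes>\<^sub>o id_blinfun) o\<^sub>L (tensor_left z o\<^sub>L r) =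
    tensor_left (blinfun_apply J z) o\<^sub>L r"
  by (rule blinfun_eqI) simp

lemma col_module_map:
  assumes J: "J \<in> bops" and e: "e \<in> col_module B"
  shows "(J \<otimes>\<^sub>o id_blinfun) o\<^sub>L e \<in> col_module B"
  by (rule col_module_induct[OF bounded_linear_comp_right subspace_col_module closed_col_module _ e])
    (simp add: tensor_id_tensor_left[OF J] col_module_gen)

context
  fixes B :: "'b::chilbert_space op set" and \<phi> :: "'b op \<Rightarrow> 'c::chilbert_space op"
  assumes rep: "star_rep B \<phi>"
begin

lemma col_graph_map:
  assumes J: "J \<in> bops" and e: "(e, e') \<in> col_graph B \<phi>"
  shows "((J \<otimes>\<^sub>o id_blinfun) o\<^sub>L e, (J \<otimes>\<^sub>o id_blinfun) o\<^sub>L e') \<in> col_graph B \<phi>"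
proof -
  have "bounded_linear (\<lambda>p. ((J \<otimes>\<^sub>o id_blinfun) o\<^sub>L fst p, (J \<otimes>\<^sub>o id_blinfun) o\<^sub>L snd p))"
    by (intro bounded_linear_Pair bounded_linear_compose[OF bounded_linear_comp_right] bounded_linear_fst bounded_linear_snd)
  from col_graph_induct[OF this subspace_col_graph closed_col_graph _ e, of B \<phi>] show ?thesis
    by (simp add: tensor_id_tensor_left[OF J] col_graph_gen)
qed

text \<open>Here \<open>t\<close> is a copy of \<open>m\<close> along each \<open>J i\<close>, and
  the ranges of all \<open>J i\<close> together are total. With \<open>J\<close> equal to
  \<open>tensor_left\<close> or \<open>tensor_right\<close> this adds a leg on which the operator is
  idle.\<close>

lemma
  fixes t :: "('a2::chilbert_space \<otimes>\<^sub>H 'b) op" and m :: "('a::chilbert_space \<otimes>\<^sub>H 'b) op"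
  assumes t: "t \<in> bops" and m: "m \<in> adjointable B"
    and J: "\<And>i. J i \<in> bops" "closure (span {blinfun_apply (J i) z |i z. True}) = UNIV"
    and int: "\<And>i. t o\<^sub>L (J i \<otimes>\<^sub>o id_blinfun) = (J i \<otimes>\<^sub>o id_blinfun) o\<^sub>L m"
      "\<And>i. adj t o\<^sub>L (J i \<otimes>\<^sub>o id_blinfun) = (J i \<otimes>\<^sub>o id_blinfun) o\<^sub>L adj m"
  shows adjointable_transfer: "t \<in> adjointable B"
    and amp_transfer: "(\<And>i. R o\<^sub>L (J i \<otimes>\<^sub>o id_blinfun) = (J i \<otimes>\<^sub>o id_blinfun) o\<^sub>L amp B \<phi> m) \<Longrightarrow> amp B \<phi> t = R"
proof -
  have push: "s o\<^sub>L (tensor_left (blinfun_apply (J i) z) o\<^sub>L r) = (J i \<otimes>\<^sub>o id_blinfun) o\<^sub>L (n o\<^sub>L (tensor_left z o\<^sub>L r))"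
    if "s o\<^sub>L (J i \<otimes>\<^sub>o id_blinfun) = (J i \<otimes>\<^sub>o id_blinfun) o\<^sub>L n"
    for s :: "('a2 \<otimes>\<^sub>H 'x::chilbert_space) op" and n i z and r :: "'x::chilbert_space op"
    using arg_cong[OF that, of "\<lambda>T. T o\<^sub>L (tensor_left z o\<^sub>L r)"]
    by (simp only: comp_assoc tensor_id_tensor_left[OF J(1)])
  show t': "t \<in> adjointable B"
  proof (rule adjointableI[OF t J(2)])
    fix z b assume "z \<in> {blinfun_apply (J i) z |i z. True}" and b: "b \<in> B"
    then obtain i w where z: "z = blinfun_apply (J i) w" by blast
    show "t o\<^sub>L (tensor_left z o\<^sub>L b) \<in> col_module B"
      unfolding z push[OF int(1)] by (intro col_module_map J adjointable_col m col_module_gen b)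
    show "adj t o\<^sub>L (tensor_left z o\<^sub>L b) \<in> col_module B"
      unfolding z push[OF int(2)] by (intro col_module_map J adjointable_col adjointable_adj m col_module_gen b)
  qed
  assume R: "\<And>i. R o\<^sub>L (J i \<otimes>\<^sub>o id_blinfun) = (J i \<otimes>\<^sub>o id_blinfun) o\<^sub>L amp B \<phi> m"
  show "amp B \<phi> t = R"
  proof (rule amp_eqI[OF rep t' J(2)])
    fix z b assume "z \<in> {blinfun_apply (J i) z |i z. True}" and b: "b \<in> B"
    then obtain i w where z: "z = blinfun_apply (J i) w" by blast
    show "(t o\<^sub>L (tensor_left z o\<^sub>L b), R o\<^sub>L (tensor_left z o\<^sub>L \<phi> b)) \<in> col_graph B \<phi>"
      unfolding z push[OF int(1)] push[OF R] by (intro col_graph_map J amp_graph[OF rep m] col_graph_gen b)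
  qed
qed

end

text \<open>The first two legs together play the part of the Hilbert space of the column module;
  \<open>assoc\<close> regroups them, as triple tensor products are nested to the right.\<close>

definition adjointable3 :: "'b::chilbert_space op set \<Rightarrow> ('v::chilbert_space \<otimes>\<^sub>H 'h::chilbert_space \<otimes>\<^sub>H 'b) op set" where
  "adjointable3 B = {t. adj assoc o\<^sub>L t o\<^sub>L assoc \<in> adjointable B}"

definition amp3 :: "'b::chilbert_space op set \<Rightarrow> ('b op \<Rightarrow> 'c::chilbert_space op) \<Rightarrow>
    ('v::chilbert_space \<otimes>\<^sub>H 'h::chilbert_space \<otimes>\<^sub>H 'b) op \<Rightarrow> ('v \<otimes>\<^sub>H 'h \<otimes>\<^sub>H 'c) op" where
  "amp3 B \<phi> t = assoc o\<^sub>L amp B \<phi> (adj assoc o\<^sub>L t o\<^sub>L assoc) o\<^sub>L adj assoc"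

lemma unassoc_comp: "adj assoc o\<^sub>L (s o\<^sub>L t) o\<^sub>L assoc = (adj assoc o\<^sub>L s o\<^sub>L assoc) o\<^sub>L (adj assoc o\<^sub>L t o\<^sub>L assoc)"
  by (simp add: comp_assoc)

lemma adjointable3_comp: "s \<in> adjointable3 B \<Longrightarrow> t \<in> adjointable3 B \<Longrightarrow> s o\<^sub>L t \<in> adjointable3 B"
  unfolding adjointable3_def mem_Collect_eq unassoc_comp by (rule adjointable_comp)

lemma unassoc_leg12: "s \<in> bops \<Longrightarrow> adj assoc o\<^sub>L leg12 s o\<^sub>L assoc = s \<otimes>\<^sub>o id_blinfun"
  by (simp add: leg12_def reassoc_def comp_assoc)

lemma unassoc_intertwine:
  assumes t: "t o\<^sub>L K = K o\<^sub>L m" and K: "assoc o\<^sub>L L = K"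
  shows "(adj assoc o\<^sub>L t o\<^sub>L assoc) o\<^sub>L L = L o\<^sub>L m"
proof -
  have L: "L = adj assoc o\<^sub>L K" unfolding K[symmetric] by simp
  have "(adj assoc o\<^sub>L t o\<^sub>L assoc) o\<^sub>L L = adj assoc o\<^sub>L (t o\<^sub>L K)" by (simp only: comp_assoc K)
  also have "\<dots> = L o\<^sub>L m" unfolding t L by (simp only: comp_assoc)
  finally show ?thesis .
qed

context
  fixes B :: "'b::chilbert_space op set" and \<phi> :: "'b op \<Rightarrow> 'c::chilbert_space op"
  assumes rep: "star_rep B \<phi>"
begin

lemma amp3_comp:
  assumes "s \<in> adjointable3 B" "t \<in> adjointable3 B"
  shows "amp3 B \<phi> (s o\<^sub>L t) = amp3 B \<phi> s o\<^sub>L amp3 B \<phi> t"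
  using assms unfolding amp3_def adjointable3_def mem_Collect_eq unassoc_comp
  by (subst amp_comp[OF rep]) (simp_all add: comp_assoc)

lemma
  assumes s: "s \<in> bops"
  shows adjointable3_leg12: "leg12 s \<in> adjointable3 B"
    and amp3_leg12: "amp3 B \<phi> (leg12 s) = leg12 s"
  unfolding adjointable3_def amp3_def mem_Collect_eq unassoc_leg12[OF s] amp_tensor_id[OF rep s]
  by (simp_all add: adjointable_tensor_id[OF rep s] leg12_def reassoc_def)

lemma
  fixes m :: "('h::chilbert_space \<otimes>\<^sub>H 'b) op"
  assumes m: "m \<in> adjointable B"
  shows adjointable3_leg23: "(leg23 m :: ('v::chilbert_space \<otimes>\<^sub>H 'h \<otimes>\<^sub>H 'b) op) \<in> adjointable3 B"
    and amp3_leg23: "amp3 B \<phi> (leg23 m :: ('v \<otimes>\<^sub>H 'h \<otimes>\<^sub>H 'b) op) = leg23 (amp B \<phi> m)"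
proof -
  note mb = adjointable_bops[OF m] and ab = amp_bops[OF rep m]
  let ?J = "tensor_left :: 'v \<Rightarrow> 'h \<Rightarrow>\<^sub>L 'v \<otimes>\<^sub>H 'h"
  let ?t = "adj assoc o\<^sub>L (leg23 m :: ('v \<otimes>\<^sub>H 'h \<otimes>\<^sub>H 'b) op) o\<^sub>L assoc"
  let ?R = "adj assoc o\<^sub>L (leg23 (amp B \<phi> m) :: ('v \<otimes>\<^sub>H 'h \<otimes>\<^sub>H 'c) op) o\<^sub>L assoc"
  have K: "assoc o\<^sub>L (?J i \<otimes>\<^sub>o id_blinfun) = tensor_left i" for i
    by (rule htensor_eqI) simp
  have leg: "leg23 r o\<^sub>L tensor_left i = tensor_left i o\<^sub>L r" if "r \<in> bops"
    for r :: "('h \<otimes>\<^sub>H 'd::chilbert_space) op" and i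
    using that by (intro blinfun_eqI) simp
  have "adj ?t = adj assoc o\<^sub>L leg23 (adj m) o\<^sub>L assoc" using mb by (simp add: adj_comp adj_leg23 comp_assoc)
  note * = unassoc_intertwine[OF leg[OF mb] K] unassoc_intertwine[OF leg[OF bops_adj[OF mb]] K, folded this]
    unassoc_intertwine[OF leg[OF ab] K]
  have "{blinfun_apply (?J i) z |i z. True} = {x \<otimes> y |x y. True}" by auto
  then have tot: "closure (span {blinfun_apply (?J i) z |i z. True}) = UNIV" by (simp only: closure_span_tensor)
  have t: "?t \<in> bops" using mb by auto
  show "(leg23 m :: ('v \<otimes>\<^sub>H 'h \<otimes>\<^sub>H 'b) op) \<in> adjointable3 B" unfolding adjointable3_def mem_Collect_eq
    by (rule adjointable_transfer[OF rep t m _ tot *(1,2)]) simp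
  have "amp B \<phi> ?t = ?R" by (rule amp_transfer[OF rep t m _ tot *]) simp
  then show "amp3 B \<phi> (leg23 m :: ('v \<otimes>\<^sub>H 'h \<otimes>\<^sub>H 'b) op) = leg23 (amp B \<phi> m)" unfolding amp3_def
    by (simp add: comp_assoc)
qed

lemma
  fixes m :: "('v::chilbert_space \<otimes>\<^sub>H 'b) op"
  assumes m: "m \<in> adjointable B"
  shows adjointable3_leg13: "(leg13 m :: ('v \<otimes>\<^sub>H 'h::chilbert_space \<otimes>\<^sub>H 'b) op) \<in> adjointable3 B"
    and amp3_leg13: "amp3 B \<phi> (leg13 m :: ('v \<otimes>\<^sub>H 'h \<otimes>\<^sub>H 'b) op) = leg13 (amp B \<phi> m)"
proof -
  note mb = adjointable_bops[OF m] and ab = amp_bops[OF rep m]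
  \<comment> \<open>Fixing a vector in the middle leg: after regrouping,
    \<open>tensor_right i\<close> becomes \<open>tensor_mid i\<close>, which intertwines
    \<open>m\<close> with \<open>leg13 m\<close>.\<close>
  let ?J = "tensor_right :: 'h \<Rightarrow> 'v \<Rightarrow>\<^sub>L 'v \<otimes>\<^sub>H 'h"
  let ?t = "adj assoc o\<^sub>L (leg13 m :: ('v \<otimes>\<^sub>H 'h \<otimes>\<^sub>H 'b) op) o\<^sub>L assoc"
  let ?R = "adj assoc o\<^sub>L (leg13 (amp B \<phi> m) :: ('v \<otimes>\<^sub>H 'h \<otimes>\<^sub>H 'c) op) o\<^sub>L assoc"
  have K: "assoc o\<^sub>L (?J i \<otimes>\<^sub>o id_blinfun) = tensor_mid i" for i
    by (rule htensor_eqI) simp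
  have "adj ?t = adj assoc o\<^sub>L leg13 (adj m) o\<^sub>L assoc" using mb by (simp add: adj_comp adj_leg13 comp_assoc)
  note * = unassoc_intertwine[OF leg13_tensor_mid[OF mb] K] unassoc_intertwine[OF leg13_tensor_mid[OF bops_adj[OF mb]] K, folded this]
    unassoc_intertwine[OF leg13_tensor_mid[OF ab] K]
  have "{blinfun_apply (?J i) z |i z. True} = {x \<otimes> y |x y. True}" by auto
  then have tot: "closure (span {blinfun_apply (?J i) z |i z. True}) = UNIV" by (simp only: closure_span_tensor)
  have t: "?t \<in> bops" using mb by auto
  show "(leg13 m :: ('v \<otimes>\<^sub>H 'h \<otimes>\<^sub>H 'b) op) \<in> adjointable3 B" unfolding adjointable3_def mem_Collect_eq
    by (rule adjointable_transfer[OF rep t m _ tot *(1,2)]) simp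
  have "amp B \<phi> ?t = ?R" by (rule amp_transfer[OF rep t m _ tot *]) simp
  then show "amp3 B \<phi> (leg13 m :: ('v \<otimes>\<^sub>H 'h \<otimes>\<^sub>H 'b) op) = leg13 (amp B \<phi> m)" unfolding amp3_def
    by (simp add: comp_assoc)
qed

end

section \<open>Tensor products of morphisms\<close>

lemma subspace_tensor_alg: "subspace (A \<otimes>\<^sub>A B)" unfolding tensor_alg_def by simp
lemma closed_tensor_alg: "closed (A \<otimes>\<^sub>A B)" unfolding tensor_alg_def by simp
lemma tensor_alg_gen: "a \<in> A \<Longrightarrow> b \<in> B \<Longrightarrow> a \<otimes>\<^sub>o b \<in> A \<otimes>\<^sub>A B"
  unfolding tensor_alg_def by (rule closure_span_superset) blast
lemma tensor_alg_subset:
  assumes "subspace T" "closed T" "\<And>a b. a \<in> A \<Longrightarrow> b \<in> B \<Longrightarrow> a \<otimes>\<^sub>o b \<in> T"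
  shows "A \<otimes>\<^sub>A B \<subseteq> T"
  unfolding tensor_alg_def by (intro closure_minimal span_minimal) (use assms in auto)
lemma tensor_alg_induct:
  assumes "bounded_linear F" "subspace T" "closed T" "\<And>a b. a \<in> A \<Longrightarrow> b \<in> B \<Longrightarrow> F (a \<otimes>\<^sub>o b) \<in> T" "t \<in> A \<otimes>\<^sub>A B"
  shows "F t \<in> T"
  by (rule bounded_linear_closure_span[OF assms(1-3) _ assms(5)[unfolded tensor_alg_def]]) (use assms(4) in blast)
lemma tensor_alg_bops: "A \<subseteq> bops \<Longrightarrow> B \<subseteq> bops \<Longrightarrow> A \<otimes>\<^sub>A B \<subseteq> bops"
  by (rule tensor_alg_subset[OF subspace_bops closed_bops]) auto

lemma tensor_alg_scaleC:
  assumes "A \<subseteq> bops" "B \<subseteq> bops" "\<And>c a. a \<in> A \<Longrightarrow> scaleC_op c a \<in> A" "t \<in> A \<otimes>\<^sub>A B"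
  shows "scaleC_op c t \<in> A \<otimes>\<^sub>A B"
  by (rule tensor_alg_induct[OF bounded_linear_scaleC_op subspace_tensor_alg closed_tensor_alg _ assms(4)])
    (use assms(1-3) in \<open>auto simp: subset_iff tensor_alg_gen simp flip: tensor_op_scaleC_left\<close>)

lemma swap_tensor_alg:
  assumes "A \<subseteq> bops" "B \<subseteq> bops" "t \<in> A \<otimes>\<^sub>A B"
  shows "swap t \<in> B \<otimes>\<^sub>A A"
  by (rule tensor_alg_induct[OF bounded_linear_swap subspace_tensor_alg closed_tensor_alg _ assms(3)])
    (use assms(1,2) in \<open>auto simp: subset_iff swap_tensor_op tensor_alg_gen\<close>)

lemma adj_tensor_alg:
  assumes "A \<subseteq> bops" "B \<subseteq> bops" "\<And>a. a \<in> A \<Longrightarrow> adj a \<in> A" "\<And>b. b \<in> B \<Longrightarrow> adj b \<in> B" "t \<in> A \<otimes>\<^sub>A B"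
  shows "adj t \<in> A \<otimes>\<^sub>A B"
proof -
  have sub: "A \<otimes>\<^sub>A B \<subseteq> bops" by (rule tensor_alg_bops[OF assms(1,2)])
  have "A \<otimes>\<^sub>A B \<subseteq> {t \<in> bops. adj t \<in> A \<otimes>\<^sub>A B}"
  proof (rule tensor_alg_subset)
    show "closed {t \<in> bops. adj t \<in> A \<otimes>\<^sub>A B}" by (rule closed_adj_image[OF closed_tensor_alg sub])
    show "subspace {t \<in> bops. adj t \<in> A \<otimes>\<^sub>A B}" by (rule subspace_adj_image[OF subspace_tensor_alg])
    show "a \<otimes>\<^sub>o b \<in> {t \<in> bops. adj t \<in> A \<otimes>\<^sub>A B}" if "a \<in> A" "b \<in> B" for a b
      using that assms(1,2) by (auto simp: subset_iff adj_tensor_op assms(3,4) tensor_alg_gen)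
  qed
  then show ?thesis using assms(5) by blast
qed

lemma multiplier_bops: "m \<in> multiplier A \<Longrightarrow> m \<in> bops" by (simp add: multiplier_def)

lemma additive_bounded_continuous_on:
  fixes f :: "'a::real_normed_vector \<Rightarrow> 'b::real_normed_vector"
  assumes S: "subspace S" and add: "\<And>s t. s \<in> S \<Longrightarrow> t \<in> S \<Longrightarrow> f (s + t) = f s + f t"
    and bound: "\<And>s. s \<in> S \<Longrightarrow> norm (f s) \<le> norm s"
  shows "continuous_on S f"
  unfolding continuous_on_iff
proof (intro ballI allI impI)
  fix s \<epsilon> :: real and x assume x: "x \<in> S" and e: "0 < \<epsilon>"
  have "dist (f y) (f x) \<le> dist y x" if "y \<in> S" for y
    using add[of "y - x" x] bound[of "y - x"] subspace_diff[OF S that x] x by (simp add: dist_norm)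
  then show "\<exists>d>0. \<forall>y\<in>S. dist y x < d \<longrightarrow> dist (f y) (f x) < \<epsilon>" using e by (meson le_less_trans)
qed

text \<open>Evaluates two nested definite descriptions. A contractive linear \<open>\<Phi>\<close>
  with the right values on elementary tensors is the homomorphism, by continuity, and totality of
  its image makes the extension to the multiplier \<open>m\<close> unique.\<close>

theorem tensor_morphism_eqI:
  fixes \<Phi> :: "('a::chilbert_space \<otimes>\<^sub>H 'b::chilbert_space) op \<Rightarrow> ('c::chilbert_space \<otimes>\<^sub>H 'd::chilbert_space) op"
  assumes A: "A \<subseteq> bops" "\<And>c a. a \<in> A \<Longrightarrow> scaleC_op c a \<in> A" and B: "B \<subseteq> bops"
    and add: "\<And>s t. s \<in> A \<otimes>\<^sub>A B \<Longrightarrow> t \<in> A \<otimes>\<^sub>A B \<Longrightarrow> \<Phi> (s + t) = \<Phi> s + \<Phi> t"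
    and scale: "\<And>c s. s \<in> A \<otimes>\<^sub>A B \<Longrightarrow> \<Phi> (scaleC_op c s) = scaleC_op c (\<Phi> s)"
    and norm: "\<And>s. s \<in> A \<otimes>\<^sub>A B \<Longrightarrow> norm (\<Phi> s) \<le> norm s"
    and gen: "\<And>a b. a \<in> A \<Longrightarrow> b \<in> B \<Longrightarrow> \<Phi> (a \<otimes>\<^sub>o b) = \<phi> a \<otimes>\<^sub>o \<psi> b"
    and T: "T \<in> bops" "\<And>t. t \<in> A \<otimes>\<^sub>A B \<Longrightarrow> m o\<^sub>L t \<in> A \<otimes>\<^sub>A B \<and> T o\<^sub>L \<Phi> t = \<Phi> (m o\<^sub>L t)"
    and total: "closure (span {blinfun_apply (\<phi> a \<otimes>\<^sub>o \<psi> b) x |a b x. a \<in> A \<and> b \<in> B}) = UNIV"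
  shows "tensor_morphism A \<phi> B \<psi> m = T"
proof -
  let ?S = "A \<otimes>\<^sub>A B"
  note sub = subspace_tensor_alg[of A B]
  have sc: "scaleC_op c s \<in> ?S" if "s \<in> ?S" for c s
    by (rule tensor_alg_scaleC[of A B]) (use A B that in auto)
  have cont: "continuous_on ?S \<Phi>" by (rule additive_bounded_continuous_on[OF sub add norm])
  have hom: "tensor_hom A \<phi> B \<psi> = restrict \<Phi> ?S"
    unfolding tensor_hom_def
  proof (rule the_equality)
    show "restrict \<Phi> ?S \<in> extensional ?S \<and>
      (\<forall>s\<in>?S. \<forall>t\<in>?S. restrict \<Phi> ?S (s + t) = restrict \<Phi> ?S s + restrict \<Phi> ?S t) \<and>
      (\<forall>c. \<forall>s\<in>?S. restrict \<Phi> ?S (scaleC_op c s) = scaleC_op c (restrict \<Phi> ?S s)) \<and>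
      continuous_on ?S (restrict \<Phi> ?S) \<and> (\<forall>a\<in>A. \<forall>b\<in>B. restrict \<Phi> ?S (a \<otimes>\<^sub>o b) = \<phi> a \<otimes>\<^sub>o \<psi> b)"
      using cont by (auto simp: add scale gen sc tensor_alg_gen subspace_add[OF sub] cong: continuous_on_cong)
  next
    fix \<Psi> assume \<Psi>: "\<Psi> \<in> extensional ?S \<and>
      (\<forall>s\<in>?S. \<forall>t\<in>?S. \<Psi> (s + t) = \<Psi> s + \<Psi> t) \<and>
      (\<forall>c. \<forall>s\<in>?S. \<Psi> (scaleC_op c s) = scaleC_op c (\<Psi> s)) \<and>
      continuous_on ?S \<Psi> \<and> (\<forall>a\<in>A. \<forall>b\<in>B. \<Psi> (a \<otimes>\<^sub>o b) = \<phi> a \<otimes>\<^sub>o \<psi> b)"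
    let ?E = "{s \<in> ?S. \<Psi> s - \<Phi> s = 0}"
    have "?S \<subseteq> ?E"
    proof (rule tensor_alg_subset)
      show "closed ?E"
        by (rule continuous_closed_preimage_constant[OF _ closed_tensor_alg]) (use \<Psi> cont in \<open>intro continuous_on_diff; simp\<close>)
      have r: "\<Psi> (r *\<^sub>R s) = r *\<^sub>R \<Psi> s" "\<Phi> (r *\<^sub>R s) = r *\<^sub>R \<Phi> s" if "s \<in> ?S" for r s
        using \<Psi> that scale[OF that, of "of_real r"] by (simp_all flip: scaleC_op_of_real)
      show "subspace ?E"
        unfolding subspace_def
        using r[OF subspace_0[OF sub], of 0] subspace_0[OF sub] \<Psi> subspace_add[OF sub] subspace_scale[OF sub]
        by (auto simp: r add)
    qed (use \<Psi> in \<open>auto simp: gen tensor_alg_gen\<close>)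
    then show "\<Psi> = restrict \<Phi> ?S" using \<Psi> by (auto intro!: extensionalityI[of _ ?S])
  qed
  show ?thesis
    unfolding tensor_morphism_def multiplier_ext_def hom
  proof (rule the_equality)
    show "T \<in> bops \<and> (\<forall>a\<in>?S. T o\<^sub>L restrict \<Phi> ?S a = restrict \<Phi> ?S (m o\<^sub>L a))" using T by simp
  next
    fix T' assume T': "T' \<in> bops \<and> (\<forall>a\<in>?S. T' o\<^sub>L restrict \<Phi> ?S a = restrict \<Phi> ?S (m o\<^sub>L a))"
    show "T' = T"
    proof (rule blinfun_eq_on_total[OF _ total])
      fix u assume "u \<in> {blinfun_apply (\<phi> a \<otimes>\<^sub>o \<psi> b) x |a b x. a \<in> A \<and> b \<in> B}"
      then obtain a b x where u: "u = blinfun_apply (\<phi> a \<otimes>\<^sub>o \<psi> b) x" "a \<in> A" "b \<in> B" by blast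
      have "T' o\<^sub>L \<Phi> (a \<otimes>\<^sub>o b) = T o\<^sub>L \<Phi> (a \<otimes>\<^sub>o b)"
        using T' T(2)[OF tensor_alg_gen[OF u(2,3)]] tensor_alg_gen[OF u(2,3)] by auto
      from arg_cong[OF this, of "\<lambda>S. blinfun_apply S x"]
      show "blinfun_apply T' u = blinfun_apply T u" using u by (simp add: gen)
    qed
  qed
qed

text \<open>Closure under adjoints is weakened to totality of the ranges of both \<open>a\<close>
  and \<open>adj a\<close>. For the slices of a unitary this follows from unitarity alone, so it
  covers \<open>dual_mu W\<close> as well as \<open>W\<close>.\<close>

definition nondegenerate :: "'a::chilbert_space op set \<Rightarrow> bool" where
  "nondegenerate A \<longleftrightarrow> A \<subseteq> bops \<and> (\<forall>c. \<forall>a\<in>A. scaleC_op c a \<in> A) \<and>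
     closure (span {blinfun_apply a x |a x. a \<in> A}) = UNIV \<and>
     closure (span {blinfun_apply (adj a) x |a x. a \<in> A}) = UNIV"

lemma cstar_nondegenerate: assumes A: "cstar_algebra A" shows "nondegenerate A"
proof -
  have "{blinfun_apply (adj a) x |a x. a \<in> A} = {blinfun_apply a x |a x. a \<in> A}"
    by (safe; metis cstar_adj[OF A] adj_adj[OF cstar_bops[OF A]])
  then show ?thesis using A unfolding nondegenerate_def cstar_algebra_def by auto
qed

lemma tensor_alg_total:
  assumes A: "A \<subseteq> bops" "closure (span {blinfun_apply a x |a x. a \<in> A}) = UNIV"
    and B: "B \<subseteq> bops" "closure (span {blinfun_apply b x |b x. b \<in> B}) = UNIV"
  shows "closure (span {blinfun_apply (a \<otimes>\<^sub>o b) x |a b x. a \<in> A \<and> b \<in> B}) = UNIV"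
proof -
  have "UNIV = closure (span {x \<otimes> y |x y. x \<in> {blinfun_apply a x |a x. a \<in> A} \<and> y \<in> {blinfun_apply b x |b x. b \<in>
      B}})"
    by (rule total_tensor[OF A(2) B(2), symmetric])
  also have "\<dots> \<subseteq> closure (span {blinfun_apply (a \<otimes>\<^sub>o b) x |a b x. a \<in> A \<and> b \<in> B})"
  proof (intro closure_mono span_mono subsetI)
    fix u assume "u \<in> {x \<otimes> y |x y. x \<in> {blinfun_apply a x |a x. a \<in> A} \<and> y \<in> {blinfun_apply b x |b x. b \<in> B}}"
    then obtain a x b y where u: "u = blinfun_apply a x \<otimes> blinfun_apply b y" "a \<in> A" "b \<in> B" by blast
    then have "u = blinfun_apply (a \<otimes>\<^sub>o b) (x \<otimes> y)" using A(1) B(1) by (simp add: subset_iff)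
    then show "u \<in> {blinfun_apply (a \<otimes>\<^sub>o b) x |a b x. a \<in> A \<and> b \<in> B}" using u by blast
  qed
  finally show ?thesis by blast
qed

lemma tensor_alg_total':
  assumes "A \<subseteq> bops" "closure (span {blinfun_apply a x |a x. a \<in> A}) = UNIV"
    and "B \<subseteq> bops" "closure (span {blinfun_apply b x |b x. b \<in> B}) = UNIV"
  shows "closure (span {blinfun_apply t x |t x. t \<in> A \<otimes>\<^sub>A B}) = UNIV"
proof -
  have "{blinfun_apply (a \<otimes>\<^sub>o b) x |a b x. a \<in> A \<and> b \<in> B} \<subseteq> {blinfun_apply t x |t x. t \<in> A \<otimes>\<^sub>A B}"
    using tensor_alg_gen by blast
  then have "closure (span {blinfun_apply (a \<otimes>\<^sub>o b) x |a b x. a \<in> A \<and> b \<in> B}) \<subseteq>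
      closure (span {blinfun_apply t x |t x. t \<in> A \<otimes>\<^sub>A B})"
    by (intro closure_mono span_mono)
  then show ?thesis unfolding tensor_alg_total[OF assms] by blast
qed

lemma star_rep_of_morphism:
  assumes A: "cstar_algebra A" and \<phi>: "cstar_morphism A D \<phi>"
    and D: "closure (span {blinfun_apply d x |d x. d \<in> D}) = UNIV"
  shows "star_rep A \<phi>"
proof -
  let ?M = "closure (span {blinfun_apply (\<phi> a) x |a x. a \<in> A})"
  have "blinfun_apply d x \<in> ?M" if d: "d \<in> D" for d x
  proof (rule bounded_linear_closure_span[OF blinfun.bounded_linear_left subspace_closure_span closed_closure])
    show "d \<in> closure (span {\<phi> a o\<^sub>L b |a b. a \<in> A \<and> b \<in> D})" using \<phi> d by (simp add: cstar_morphism_def)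
    show "blinfun_apply s x \<in> ?M" if s: "s \<in> {\<phi> a o\<^sub>L b |a b. a \<in> A \<and> b \<in> D}" for s
    proof -
      obtain a b where "s = \<phi> a o\<^sub>L b" "a \<in> A" using s by blast
      then have "blinfun_apply s x = blinfun_apply (\<phi> a) (blinfun_apply b x)" "a \<in> A" by simp_all
      then show ?thesis by (intro closure_span_superset) blast
    qed
  qed
  then have "closure (span {blinfun_apply d x |d x. d \<in> D}) \<subseteq> ?M"
    by (intro closure_minimal span_minimal subspace_closure_span) auto
  then have "?M = UNIV" unfolding D by blast
  then show ?thesis using A \<phi> multiplier_bops[of _ D] unfolding star_rep_def cstar_morphism_def by simp
qed

lemma rep_image_total:
  assumes "star_rep B \<phi>"
  shows "\<phi> ` B \<subseteq> bops" "closure (span {blinfun_apply b x |b x. b \<in> \<phi> ` B}) = UNIV"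
proof -
  show "\<phi> ` B \<subseteq> bops" using rep_bops[OF assms] by blast
  have *: "{blinfun_apply b x |b x. b \<in> \<phi> ` B} = {blinfun_apply (\<phi> b) x |b x. b \<in> B}" by blast
  show "closure (span {blinfun_apply b x |b x. b \<in> \<phi> ` B}) = UNIV" unfolding * by (rule rep_total[OF assms])
qed

lemma star_rep_id: "cstar_algebra B \<Longrightarrow> star_rep B (\<lambda>b. b)"
  by (auto simp: star_rep_def cstar_algebra_def)

lemma tensor_alg_adjointable: "A \<subseteq> bops \<Longrightarrow> cstar_algebra B \<Longrightarrow> A \<otimes>\<^sub>A B \<subseteq> adjointable B"
  by (intro tensor_alg_subset subspace_adjointable closed_adjointable adjointable_tensor[OF star_rep_id]) auto

text \<open>\<open>b\<close> is absorbed
  by \<open>m\<close> through \<open>m (a z \<otimes> b) = (m (a \<otimes> b)) (z \<otimes> 1)\<close>, so that no approximate unit of \<open>B\<close> is needed.\<close>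

lemma multiplier_adjointable:
  fixes A :: "'a::chilbert_space op set"
  assumes A: "nondegenerate A" and B: "cstar_algebra B" and m: "m \<in> multiplier (A \<otimes>\<^sub>A B)"
  shows "m \<in> adjointable B"
proof -
  have Ab: "A \<subseteq> bops" and Bb: "B \<subseteq> bops" using A B by (auto simp: nondegenerate_def cstar_algebra_def)
  note mb = multiplier_bops[OF m]
  have T: "t o\<^sub>L tensor_left z \<in> col_module B" if t: "t \<in> A' \<otimes>\<^sub>A B" and A': "A' \<subseteq> bops" for t z and A' :: "'a op set"
  proof (rule tensor_alg_induct[OF bounded_linear_comp_left subspace_col_module closed_col_module _ t])
    fix a b assume "a \<in> A'" "b \<in> B"
    moreover from this have "(a \<otimes>\<^sub>o b) o\<^sub>L tensor_left z = tensor_left (blinfun_apply a z) o\<^sub>L b"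
      using A' Bb by (intro blinfun_eqI) (simp add: subset_iff)
    ultimately show "(a \<otimes>\<^sub>o b) o\<^sub>L tensor_left z \<in> col_module B" by (simp add: col_module_gen)
  qed
  have gen: "m o\<^sub>L (tensor_left (blinfun_apply a z) o\<^sub>L b) \<in> col_module B" if ab: "a \<in> A" "b \<in> B" for a z b
  proof -
    have "m o\<^sub>L (tensor_left (blinfun_apply a z) o\<^sub>L b) = (m o\<^sub>L (a \<otimes>\<^sub>o b)) o\<^sub>L tensor_left z"
      using ab Ab Bb by (intro blinfun_eqI) (simp add: subset_iff)
    then show ?thesis using T[of "m o\<^sub>L (a \<otimes>\<^sub>o b)" A z] m tensor_alg_gen[OF ab] Ab by (simp add: multiplier_def)
  qed
  let ?A' = "adj ` A"
  have A'b: "?A' \<subseteq> bops" using Ab by auto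
  \<comment> \<open>The multiplier property controls \<open>adj m\<close> only through
    \<open>(a \<otimes>\<^sub>o adj b) o\<^sub>L m\<close>, whose adjoint is \<open>adj m\<close>
    times \<open>adj a \<otimes>\<^sub>o b\<close>. Therefore the test vectors come from the ranges
    of the operators \<open>adj a\<close>.\<close>
  have gen': "adj m o\<^sub>L (tensor_left (blinfun_apply (adj a) z) o\<^sub>L b) \<in> col_module B" if ab: "a \<in> A" "b \<in> B"
    for a z b
  proof -
    have "adj m o\<^sub>L (tensor_left (blinfun_apply (adj a) z) o\<^sub>L b) = adj ((a \<otimes>\<^sub>o adj b) o\<^sub>L m) o\<^sub>L tensor_left z"
      using ab Ab Bb mb cstar_adj[OF B ab(2)] by (intro blinfun_eqI) (simp add: subset_iff adj_comp adj_tensor_op)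
    moreover have "adj t \<in> ?A' \<otimes>\<^sub>A B" if "t \<in> A \<otimes>\<^sub>A B" for t
    proof -
      have "A \<otimes>\<^sub>A B \<subseteq> {t \<in> bops. adj t \<in> ?A' \<otimes>\<^sub>A B}"
      proof (rule tensor_alg_subset)
        show "closed {t \<in> bops. adj t \<in> ?A' \<otimes>\<^sub>A B}"
          by (rule closed_adj_image[OF closed_tensor_alg tensor_alg_bops[OF A'b Bb]])
        show "subspace {t \<in> bops. adj t \<in> ?A' \<otimes>\<^sub>A B}" by (rule subspace_adj_image[OF subspace_tensor_alg])
        show "a \<otimes>\<^sub>o b \<in> {t \<in> bops. adj t \<in> ?A' \<otimes>\<^sub>A B}" if "a \<in> A" "b \<in> B" for a b
          using that Ab Bb by (auto simp: subset_iff adj_tensor_op cstar_adj[OF B] tensor_alg_gen)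
      qed
      then show ?thesis using that by blast
    qed
    ultimately show ?thesis
      using T[of "adj ((a \<otimes>\<^sub>o adj b) o\<^sub>L m)" ?A' z] m tensor_alg_gen[OF ab(1) cstar_adj[OF B ab(2)]] A'b
      by (simp add: multiplier_def)
  qed
  have 1: "e \<in> col_module B \<Longrightarrow> m o\<^sub>L e \<in> col_module B" for e
  proof (rule col_module_induct[OF bounded_linear_comp_right subspace_col_module closed_col_module])
    show "m o\<^sub>L (tensor_left z o\<^sub>L b) \<in> col_module B" if b: "b \<in> B" for z b
      by (rule bounded_linear_closure_span[where S = "{blinfun_apply a x |a x. a \<in> A}" and x = z,
          OF bounded_linear_compose[OF bounded_linear_comp_right
            bounded_linear_compose[OF bounded_linear_comp_left bounded_linear_of_tensor_left]]
          subspace_col_module closed_col_module])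
        (use gen b A in \<open>auto simp: nondegenerate_def\<close>)
  qed
  have 2: "e \<in> col_module B \<Longrightarrow> adj m o\<^sub>L e \<in> col_module B" for e
  proof (rule col_module_induct[OF bounded_linear_comp_right subspace_col_module closed_col_module])
    show "adj m o\<^sub>L (tensor_left z o\<^sub>L b) \<in> col_module B" if b: "b \<in> B" for z b
      by (rule bounded_linear_closure_span[where S = "{blinfun_apply (adj a) x |a x. a \<in> A}" and x = z,
          OF bounded_linear_compose[OF bounded_linear_comp_right
            bounded_linear_compose[OF bounded_linear_comp_left bounded_linear_of_tensor_left]]
          subspace_col_module closed_col_module])
        (use gen' b A in \<open>auto simp: nondegenerate_def\<close>)
  qed
  show ?thesis using mb 1 2 by (simp add: adjointable_def)
qed

text \<open>The right-hand side does not mention \<open>A\<close>: the maps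
  \<open>id \<otimes> \<phi>\<close> for all \<open>A\<close> on a given Hilbert space are
  restrictions of one map, so the same computation applies to \<open>V\<close>, \<open>Vh\<close>
  and \<open>X\<close>.\<close>

theorem tensor_morphism_right:
  assumes A: "nondegenerate A" and \<phi>: "star_rep B \<phi>" and m: "m \<in> multiplier (A \<otimes>\<^sub>A B)"
  shows "tensor_morphism A (\<lambda>a. a) B \<phi> m = amp B \<phi> m"
proof -
  note B = rep_cstar[OF \<phi>]
  have Ab: "A \<subseteq> bops" and Bb: "B \<subseteq> bops" using A B by (auto simp: nondegenerate_def cstar_algebra_def)
  have adj: "t \<in> adjointable B" if "t \<in> A \<otimes>\<^sub>A B" for t using tensor_alg_adjointable[OF Ab B] that by blast
  have m': "m \<in> adjointable B" by (rule multiplier_adjointable[OF A B m])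
  show ?thesis
  proof (rule tensor_morphism_eqI[where \<Phi> = "amp B \<phi>"])
    have *: "{blinfun_apply (a \<otimes>\<^sub>o \<phi> b) x |a b x. a \<in> A \<and> b \<in> B} =
        {blinfun_apply (a \<otimes>\<^sub>o b) x |a b x. a \<in> A \<and> b \<in> \<phi> ` B}" by blast
    show "closure (span {blinfun_apply (a \<otimes>\<^sub>o \<phi> b) x |a b x. a \<in> A \<and> b \<in> B}) = UNIV"
      unfolding * using A rep_image_total[OF \<phi>] by (intro tensor_alg_total) (simp_all only: nondegenerate_def)
    show "m o\<^sub>L t \<in> A \<otimes>\<^sub>A B \<and> amp B \<phi> m o\<^sub>L amp B \<phi> t = amp B \<phi> (m o\<^sub>L t)" if "t \<in> A \<otimes>\<^sub>A B" for t
      using m that by (simp add: multiplier_def amp_comp[OF \<phi> m' adj])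
    show "scaleC_op c a \<in> A" if "a \<in> A" for c a using A that by (simp add: nondegenerate_def)
    show "amp B \<phi> (a \<otimes>\<^sub>o b) = a \<otimes>\<^sub>o \<phi> b" if "a \<in> A" "b \<in> B" for a b
      using that Ab by (intro amp_tensor[OF \<phi>]) auto
  qed (simp_all add: Ab Bb adj amp_add[OF \<phi>] amp_scaleC[OF \<phi>] amp_norm[OF \<phi>] amp_bops[OF \<phi> m'])
qed

lemma multiplier_swap:
  assumes "A \<subseteq> bops" "B \<subseteq> bops" "m \<in> multiplier (A \<otimes>\<^sub>A B)"
  shows "swap m \<in> multiplier (B \<otimes>\<^sub>A A)"
proof -
  have "swap m o\<^sub>L t = swap (m o\<^sub>L swap t)" "t o\<^sub>L swap m = swap (swap t o\<^sub>L m)" for t by (simp_all add: comp_assoc)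
  then show ?thesis
    using assms(3) swap_tensor_alg[OF assms(1,2)] swap_tensor_alg[OF assms(2,1)] by (simp add: multiplier_def)
qed

lemma tensor_total_left:
  assumes \<phi>: "star_rep A \<phi>" and B: "B \<subseteq> bops" "closure (span {blinfun_apply b x |b x. b \<in> B}) = UNIV"
  shows "closure (span {blinfun_apply (\<phi> a \<otimes>\<^sub>o b) x |a b x. a \<in> A \<and> b \<in> B}) = UNIV"
proof -
  have *: "{blinfun_apply (\<phi> a \<otimes>\<^sub>o b) x |a b x. a \<in> A \<and> b \<in> B} =
      {blinfun_apply (a \<otimes>\<^sub>o b) x |a b x. a \<in> \<phi> ` A \<and> b \<in> B}" by blast
  show ?thesis unfolding * by (rule tensor_alg_total[OF rep_image_total[OF \<phi>] B])
qed

lemma swap_amp_properties: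
  assumes \<phi>: "star_rep A \<phi>" and B: "B \<subseteq> bops"
  shows "\<And>t. t \<in> A \<otimes>\<^sub>A B \<Longrightarrow> swap t \<in> adjointable A"
    and "\<And>s t. s \<in> A \<otimes>\<^sub>A B \<Longrightarrow> t \<in> A \<otimes>\<^sub>A B \<Longrightarrow> swap (amp A \<phi> (swap (s + t))) =
        swap (amp A \<phi> (swap s)) + swap (amp A \<phi> (swap t))"
    and "\<And>c t. t \<in> A \<otimes>\<^sub>A B \<Longrightarrow> swap (amp A \<phi> (swap (scaleC_op c t))) = scaleC_op c (swap (amp A \<phi> (swap t)))"
    and "\<And>t. t \<in> A \<otimes>\<^sub>A B \<Longrightarrow> norm (swap (amp A \<phi> (swap t))) \<le> norm t"
    and "\<And>a b. a \<in> A \<Longrightarrow> b \<in> B \<Longrightarrow> swap (amp A \<phi> (swap (a \<otimes>\<^sub>o b))) = \<phi> a \<otimes>\<^sub>o b"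
proof -
  note A = rep_cstar[OF \<phi>]
  have Ab: "A \<subseteq> bops" using A by (auto simp: cstar_algebra_def)
  show adj: "swap t \<in> adjointable A" if "t \<in> A \<otimes>\<^sub>A B" for t
    using tensor_alg_adjointable[OF B A] swap_tensor_alg[OF Ab B that] by blast
  show "swap (amp A \<phi> (swap (s + t))) = swap (amp A \<phi> (swap s)) + swap (amp A \<phi> (swap t))"
    if "s \<in> A \<otimes>\<^sub>A B" "t \<in> A \<otimes>\<^sub>A B" for s t
    by (simp only: swap_add amp_add[OF \<phi> adj[OF that(1)] adj[OF that(2)]])
  show "swap (amp A \<phi> (swap (scaleC_op c t))) = scaleC_op c (swap (amp A \<phi> (swap t)))" if "t \<in> A \<otimes>\<^sub>A B" for c t
    by (simp only: swap_scaleC amp_scaleC[OF \<phi> adj[OF that]])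
  show "norm (swap (amp A \<phi> (swap t))) \<le> norm t" if "t \<in> A \<otimes>\<^sub>A B" for t
    using norm_swap[of "amp A \<phi> (swap t)"] amp_norm[OF \<phi> adj[OF that]] norm_swap[of t] by linarith
  show "swap (amp A \<phi> (swap (a \<otimes>\<^sub>o b))) = \<phi> a \<otimes>\<^sub>o b" if ab: "a \<in> A" "b \<in> B" for a b
    using ab Ab B rep_bops[OF \<phi> ab(1)] by (simp add: subset_iff swap_tensor_op amp_tensor[OF \<phi>])
qed

theorem tensor_morphism_left:
  assumes \<phi>: "star_rep A \<phi>" and B: "nondegenerate B" and m: "m \<in> multiplier (A \<otimes>\<^sub>A B)"
  shows "tensor_morphism A \<phi> B (\<lambda>b. b) m = swap (amp A \<phi> (swap m))"
proof -
  note A = rep_cstar[OF \<phi>]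
  have Ab: "A \<subseteq> bops" and Bb: "B \<subseteq> bops" using A B by (auto simp: nondegenerate_def cstar_algebra_def)
  note props = swap_amp_properties[OF \<phi> Bb]
  have m': "swap m \<in> adjointable A" by (rule multiplier_adjointable[OF B A multiplier_swap[OF Ab Bb m]])
  show ?thesis
  proof (rule tensor_morphism_eqI[where \<Phi> = "\<lambda>t. swap (amp A \<phi> (swap t))"])
    show "closure (span {blinfun_apply (\<phi> a \<otimes>\<^sub>o b) x |a b x. a \<in> A \<and> b \<in> B}) = UNIV"
      using tensor_total_left[OF \<phi> Bb] B by (simp add: nondegenerate_def)
    show "m o\<^sub>L t \<in> A \<otimes>\<^sub>A B \<and> swap (amp A \<phi> (swap m)) o\<^sub>L swap (amp A \<phi> (swap t)) = swap (amp A \<phi> (swap (m o\<^sub>L t)))"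
      if t: "t \<in> A \<otimes>\<^sub>A B" for t
      using m t unfolding swap_comp[of m t] amp_comp[OF \<phi> m' props(1)[OF t]] swap_comp
        by (simp add: multiplier_def)
    show "scaleC_op c a \<in> A" if "a \<in> A" for c a by (rule cstar_scaleC[OF A that])
    show "swap (amp A \<phi> (swap m)) \<in> bops" using amp_bops[OF \<phi> m'] by simp
  qed (fact props Ab Bb)+
qed

text \<open>The two legs are treated one after the other. No algebra is at hand over which the
  intermediate operator is a multiplier, so its adjointability over \<open>B\<close> is demanded; in
  the application this operator is \<open>V\<close>.\<close>

theorem tensor_morphism_both:
  assumes \<phi>: "star_rep A \<phi>" and \<psi>: "star_rep B \<psi>" and m: "m \<in> multiplier (A \<otimes>\<^sub>A B)"
    and m'': "swap (amp A \<phi> (swap m)) \<in> adjointable B"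
  shows "tensor_morphism A \<phi> B \<psi> m = amp B \<psi> (swap (amp A \<phi> (swap m)))"
proof -
  note A = rep_cstar[OF \<phi>] and B = rep_cstar[OF \<psi>]
  have Ab: "A \<subseteq> bops" and Bb: "B \<subseteq> bops" using A B by (auto simp: cstar_algebra_def)
  note props = swap_amp_properties[OF \<phi> Bb]
  have m': "swap m \<in> adjointable A"
    by (rule multiplier_adjointable[OF cstar_nondegenerate[OF B] A multiplier_swap[OF Ab Bb m]])
  let ?L = "\<lambda>t. swap (amp A \<phi> (swap t))"
  have L: "?L t \<in> adjointable B" if t: "t \<in> A \<otimes>\<^sub>A B" for t
  proof -
    have "A \<otimes>\<^sub>A B \<subseteq> A \<otimes>\<^sub>A B \<inter> ?L -` adjointable B"
    proof (rule tensor_alg_subset)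
      show "closed (A \<otimes>\<^sub>A B \<inter> ?L -` adjointable B)"
        by (rule continuous_closed_preimage[OF additive_bounded_continuous_on[OF subspace_tensor_alg props(2,4)]
              closed_tensor_alg closed_adjointable])
      have r: "?L (r *\<^sub>R t) = r *\<^sub>R ?L t" if "t \<in> A \<otimes>\<^sub>A B" for r t
        using props(3)[OF that, of "of_real r"] by (simp only: scaleC_op_of_real)
      show "subspace (A \<otimes>\<^sub>A B \<inter> ?L -` adjointable B)"
      proof (rule subspaceI)
        show "0 \<in> A \<otimes>\<^sub>A B \<inter> ?L -` adjointable B"
          using r[of 0 0] subspace_0[OF subspace_tensor_alg[of A B]] subspace_0[OF subspace_adjointable] by simp
        show "s + t \<in> A \<otimes>\<^sub>A B \<inter> ?L -` adjointable B"
          if "s \<in> A \<otimes>\<^sub>A B \<inter> ?L -` adjointable B" "t \<in> A \<otimes>\<^sub>A B \<inter> ?L -` adjointable B" for s t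
          using that props(2)[of s t] subspace_add[OF subspace_tensor_alg, of s A B t]
            subspace_add[OF subspace_adjointable, of "?L s" B "?L t"]
          by (simp only: Int_iff vimage_eq simp_thms)
        show "k *\<^sub>R t \<in> A \<otimes>\<^sub>A B \<inter> ?L -` adjointable B" if "t \<in> A \<otimes>\<^sub>A B \<inter> ?L -` adjointable B" for k t
          using that r[of t k] subspace_scale[OF subspace_tensor_alg, of t A B k]
            subspace_scale[OF subspace_adjointable, of "?L t" B k]
          by (simp only: Int_iff vimage_eq simp_thms)
      qed
    qed (use Bb in \<open>auto simp only: Int_iff vimage_eq props(5) tensor_alg_gen intro!: adjointable_tensor[OF \<psi>] rep_bops[OF \<phi>]\<close>)
    then show ?thesis using t by blast
  qed
  show ?thesis
  proof (rule tensor_morphism_eqI[where \<Phi> = "\<lambda>t. amp B \<psi> (?L t)"])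
    have *: "{blinfun_apply (\<phi> a \<otimes>\<^sub>o \<psi> b) x |a b x. a \<in> A \<and> b \<in> B} =
        {blinfun_apply (\<phi> a \<otimes>\<^sub>o b) x |a b x. a \<in> A \<and> b \<in> \<psi> ` B}" by blast
    show "closure (span {blinfun_apply (\<phi> a \<otimes>\<^sub>o \<psi> b) x |a b x. a \<in> A \<and> b \<in> B}) = UNIV"
      unfolding * by (rule tensor_total_left[OF \<phi> rep_image_total[OF \<psi>]])
    show "m o\<^sub>L t \<in> A \<otimes>\<^sub>A B \<and> amp B \<psi> (?L m) o\<^sub>L amp B \<psi> (?L t) = amp B \<psi> (?L (m o\<^sub>L t))"
      if t: "t \<in> A \<otimes>\<^sub>A B" for t
      unfolding amp_comp[OF \<psi> m'' L[OF t], symmetric] swap_comp[symmetric]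
        amp_comp[OF \<phi> m' props(1)[OF t], symmetric]
      using m t by (simp add: multiplier_def)
    show "scaleC_op c a \<in> A" if "a \<in> A" for c a by (rule cstar_scaleC[OF A that])
    show "amp B \<psi> (?L m) \<in> bops" by (rule amp_bops[OF \<psi> m''])
    show "amp B \<psi> (?L (s + t)) = amp B \<psi> (?L s) + amp B \<psi> (?L t)" if "s \<in> A \<otimes>\<^sub>A B" "t \<in> A \<otimes>\<^sub>A B" for s t
      by (simp only: props(2)[OF that] amp_add[OF \<psi> L[OF that(1)] L[OF that(2)]])
    show "amp B \<psi> (?L (scaleC_op c t)) = scaleC_op c (amp B \<psi> (?L t))" if "t \<in> A \<otimes>\<^sub>A B" for c t
      by (simp only: props(3)[OF that] amp_scaleC[OF \<psi> L[OF that]])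
    show "norm (amp B \<psi> (?L t)) \<le> norm t" if "t \<in> A \<otimes>\<^sub>A B" for t
      using amp_norm[OF \<psi> L[OF that]] props(4)[OF that] by linarith
    show "amp B \<psi> (?L (a \<otimes>\<^sub>o b)) = \<phi> a \<otimes>\<^sub>o \<psi> b" if "a \<in> A" "b \<in> B" for a b
      by (simp only: props(5)[OF that] amp_tensor[OF \<psi> rep_bops[OF \<phi> that(1)] that(2)])
  qed (fact Ab Bb)+
qed

section \<open>Compact operators\<close>

definition rank1 :: "'a::chilbert_space \<Rightarrow> 'a \<Rightarrow> 'a op" where
  "rank1 x y = Blinfun (\<lambda>z. cinner y z *\<^sub>C x)"

lemma rank1_apply [simp]: "blinfun_apply (rank1 x y) z = cinner y z *\<^sub>C x"
  unfolding rank1_def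
proof (subst bounded_linear_Blinfun_apply)
  show "bounded_linear (\<lambda>z. cinner y z *\<^sub>C x)"
  proof (rule bounded_linear_intro[of _ "norm y * norm x"])
    show "norm (cinner y z *\<^sub>C x) \<le> norm z * (norm y * norm x)" for z
      using mult_right_mono[OF cmod_cinner_le_norm[of y z], of "norm x"] by (simp add: algebra_simps)
  qed (simp_all add: cinner_add_right scaleC_add_left cinner_scaleR_right scaleC_scaleC[symmetric] scaleC_of_real)
qed simp

lemma bops_rank1 [simp]: "rank1 x y \<in> bops" by (simp add: bops_def cinner_scaleC_right scaleC_scaleC)

lemma adj_rank1: "adj (rank1 x y) = rank1 y x"
proof (rule adj_eqI)
  show "cinner (blinfun_apply (rank1 x y) z) w = cinner z (blinfun_apply (rank1 y x) w)" for z w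
    using cinner_commute[of z y] by (simp add: cinner_scaleC_left cinner_scaleC_right mult.commute)
qed simp

definition rank1_ops :: "'a::chilbert_space op set" where "rank1_ops = {rank1 x y |x y. True}"

lemma rank1_ops_bops: "rank1_ops \<subseteq> bops" by (auto simp: rank1_ops_def)

lemma rank1_compact: "rank1 x y \<in> compact_ops"
proof -
  let ?K = "(\<lambda>c. c *\<^sub>C x) ` cball 0 (norm y)"
  have "bounded_linear (\<lambda>c. c *\<^sub>C x)"
    by (rule bounded_linear_intro[of _ "norm x"]) (simp_all add: scaleC_add_left scaleR_conv_of_real scaleC_scaleC[symmetric] scaleC_of_real)
  then have K: "compact ?K" by (intro compact_continuous_image linear_continuous_on) auto
  have "blinfun_apply (rank1 x y) ` cball 0 1 \<subseteq> ?K"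
  proof safe
    fix z :: 'a assume z: "z \<in> cball 0 1"
    have "cmod (cinner y z) \<le> norm y * norm z" by (rule cmod_cinner_le_norm)
    also have "\<dots> \<le> norm y * 1" using z by (intro mult_left_mono) auto
    finally show "blinfun_apply (rank1 x y) z \<in> ?K" by auto
  qed
  then have "closure (blinfun_apply (rank1 x y) ` cball 0 1) \<subseteq> ?K"
    by (intro closure_minimal compact_imp_closed K)
  then have "compact (closure (blinfun_apply (rank1 x y) ` cball 0 1))"
    using K compact_Int_closed[OF K closed_closure, of "blinfun_apply (rank1 x y) ` cball 0 1"]
    by (simp add: Int_absorb1)
  then show ?thesis by (simp add: compact_ops_def)
qed

text \<open>The estimate persists for all larger finite sets, so that one set of basis vectors can
  serve finitely many \<open>y\<close> at once.\<close>

lemma onb_approx: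
  fixes y :: "'a::chilbert_space"
  assumes "\<epsilon> > 0"
  shows "\<exists>F. finite F \<and> F \<subseteq> onb \<and> (\<forall>G. finite G \<and> F \<subseteq> G \<and> G \<subseteq> onb \<longrightarrow> norm (y - (\<Sum>e\<in>G. cinner e y *\<^sub>C e)) < \<epsilon>)"
proof -
  have "eventually (\<lambda>F. (norm y)\<^sup>2 - \<epsilon>\<^sup>2 < (\<Sum>e\<in>F. (cmod (cinner e y))\<^sup>2)) (finite_subsets_at_top onb)"
    using parseval_norm[of y] unfolding has_sum_def by (rule order_tendstoD(1)) (use assms in simp)
  then obtain F where *: "finite F \<and> F \<subseteq> onb \<and>
      (\<forall>G. finite G \<and> F \<subseteq> G \<and> G \<subseteq> onb \<longrightarrow> (norm y)\<^sup>2 - \<epsilon>\<^sup>2 < (\<Sum>e\<in>G. (cmod (cinner e y))\<^sup>2))"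
    unfolding eventually_finite_subsets_at_top by (elim exE)
  then have F: "finite F" "F \<subseteq> onb"
    "\<And>G. finite G \<Longrightarrow> F \<subseteq> G \<Longrightarrow> G \<subseteq> onb \<Longrightarrow> (norm y)\<^sup>2 - \<epsilon>\<^sup>2 < (\<Sum>e\<in>G. (cmod (cinner e y))\<^sup>2)"
    by simp_all
  have "norm (y - (\<Sum>e\<in>G. cinner e y *\<^sub>C e)) < \<epsilon>" if G: "finite G" "F \<subseteq> G" "G \<subseteq> onb" for G
  proof (rule power_less_imp_less_base)
    show "(norm (y - (\<Sum>e\<in>G. cinner e y *\<^sub>C e)))\<^sup>2 < \<epsilon>\<^sup>2"
      using bessel_aux(3)[OF G(1,3), of y] F(3)[OF G] by linarith
  qed (use assms in simp)
  then show ?thesis using F(1,2) by blast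
qed

text \<open>The image of the unit ball has a finite net. A projection \<open>P\<close> onto finitely
  many basis vectors moves the points of the net only slightly, and \<open>1 - P\<close> is
  contractive, so \<open>P o\<^sub>L T\<close> is close to \<open>T\<close>.\<close>

lemma compact_ops_approx: "compact_ops \<subseteq> closure (span rank1_ops)"
proof
  fix T :: "'a op" assume "T \<in> compact_ops"
  then have T: "T \<in> bops" "compact (closure (blinfun_apply T ` cball 0 1))" by (auto simp: compact_ops_def)
  show "T \<in> closure (span rank1_ops)"
    unfolding closure_approachable
  proof (intro allI impI)
    fix \<epsilon> :: real assume \<epsilon>: "\<epsilon> > 0"
    \<comment> \<open>The net and the projection contribute \<open>d\<close> each, and their sum
      must stay strictly below \<open>\<epsilon>\<close>.\<close>
    define d where "d = \<epsilon> / 3"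
    have d: "d > 0" using \<epsilon> by (simp add: d_def)
    obtain k where k: "finite k" "closure (blinfun_apply T ` cball 0 1) \<subseteq> (\<Union>c\<in>k. ball c d)"
      using T(2) d unfolding compact_eq_totally_bounded by blast
    obtain F :: "'a \<Rightarrow> 'a set" where F: "\<And>c. finite (F c)" "\<And>c. F c \<subseteq> onb"
      "\<And>c G. finite G \<Longrightarrow> F c \<subseteq> G \<Longrightarrow> G \<subseteq> onb \<Longrightarrow> norm (c - (\<Sum>e\<in>G. cinner e c *\<^sub>C e)) < d"
      using onb_approx[OF d] by metis
    define G where "G = (\<Union>c\<in>k. F c)"
    have G: "finite G" "G \<subseteq> onb" using k(1) F(1,2) by (auto simp: G_def)
    define P where "P = (\<Sum>e\<in>G. rank1 e e)"
    have Pap: "blinfun_apply P y = (\<Sum>e\<in>G. cinner e y *\<^sub>C e)" for y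
      by (simp add: P_def blinfun.sum_left)
    have contr: "norm (y - blinfun_apply P y) \<le> norm y" for y
    proof (rule power2_le_imp_le)
      have "0 \<le> (\<Sum>e\<in>G. (cmod (cinner e y))\<^sup>2)" by (intro sum_nonneg) simp
      then show "(norm (y - blinfun_apply P y))\<^sup>2 \<le> (norm y)\<^sup>2"
        using bessel_aux(3)[OF G, of y] unfolding Pap by linarith
    qed simp
    have small: "norm (blinfun_apply T x - blinfun_apply P (blinfun_apply T x)) \<le> 2 * d" if x: "norm x \<le> 1" for x
    proof -
      have "blinfun_apply T x \<in> closure (blinfun_apply T ` cball 0 1)"
        using x by (intro closure_subset[THEN subsetD] imageI) auto
      then obtain c where c: "c \<in> k" "norm (c - blinfun_apply T x) < d" using k(2) by (auto simp: dist_norm)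
      let ?y = "blinfun_apply T x - c"
      have "blinfun_apply T x - blinfun_apply P (blinfun_apply T x) =
          (?y - blinfun_apply P ?y) + (c - blinfun_apply P c)"
        by (simp add: blinfun.diff_right)
      then have "norm (blinfun_apply T x - blinfun_apply P (blinfun_apply T x)) \<le>
          norm (?y - blinfun_apply P ?y) + norm (c - blinfun_apply P c)"
        by (simp only:) (rule norm_triangle_ineq)
      also have "\<dots> \<le> d + d"
      proof (rule add_mono)
        show "norm (?y - blinfun_apply P ?y) \<le> d"
          using contr[of ?y] c(2) by (simp add: norm_minus_commute[of c])
        have "F c \<subseteq> G" using c(1) by (auto simp: G_def)
        then show "norm (c - blinfun_apply P c) \<le> d" using F(3)[OF G(1) _ G(2), of c] unfolding Pap by simp
      qed
      finally show ?thesis by simp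
    qed
    have "norm (T - (P o\<^sub>L T)) \<le> 2 * d"
    proof (rule norm_blinfun_bound)
      fix x
      show "norm (blinfun_apply (T - (P o\<^sub>L T)) x) \<le> 2 * d * norm x"
      proof (cases "x = 0")
        case False
        have "norm (blinfun_apply (T - (P o\<^sub>L T)) ((1 / norm x) *\<^sub>R x)) \<le> 2 * d"
          using small[of "(1 / norm x) *\<^sub>R x"] False by (simp add: blinfun.diff_left)
        then show ?thesis using False by (simp add: blinfun.scaleR_right field_simps)
      qed simp
    qed (use d in simp)
    then have "dist (P o\<^sub>L T) T < \<epsilon>" using d by (simp add: dist_norm norm_minus_commute d_def)
    moreover have "P o\<^sub>L T = (\<Sum>e\<in>G. rank1 e (blinfun_apply (adj T) e))"
      by (rule blinfun_eqI) (simp add: Pap blinfun.sum_left adj_left[OF T(1)])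
    then have "P o\<^sub>L T \<in> span rank1_ops" by (simp only:) (intro span_sum span_base, auto simp: rank1_ops_def)
    ultimately show "\<exists>y\<in>span rank1_ops. dist y T < \<epsilon>" by blast
  qed
qed

lemma rank1_ops_compact: "rank1_ops \<subseteq> compact_ops" using rank1_compact by (auto simp: rank1_ops_def)

lemma tensor_op_closure_left:
  assumes k: "k \<in> closure (span S)" and S: "S \<subseteq> bops" and b: "b \<in> bops"
    and T: "subspace T" "closed T" "\<And>s. s \<in> S \<Longrightarrow> s \<otimes>\<^sub>o b \<in> T"
  shows "k \<otimes>\<^sub>o b \<in> T"
proof -
  let ?X = "bops \<inter> (\<lambda>k. k \<otimes>\<^sub>o b) -` T"
  have "continuous_on bops (\<lambda>k. k \<otimes>\<^sub>o b)"
    unfolding continuous_on_iff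
  proof (intro ballI allI impI)
    fix x and e :: real assume x: "x \<in> bops" "0 < e"
    have "dist (y \<otimes>\<^sub>o b) (x \<otimes>\<^sub>o b) \<le> dist y x * (norm b + 1)" if "y \<in> bops" for y
    proof -
      have "norm ((y - x) \<otimes>\<^sub>o b) \<le> norm (y - x) * norm b" by (rule norm_tensor_op) (use that x b in auto)
      also have "\<dots> \<le> norm (y - x) * (norm b + 1)" by (intro mult_left_mono) auto
      finally show ?thesis using that x b by (simp add: dist_norm tensor_op_diff_left)
    qed
    then show "\<exists>d>0. \<forall>y\<in>bops. dist y x < d \<longrightarrow> dist (y \<otimes>\<^sub>o b) (x \<otimes>\<^sub>o b) < e"
      using x(2) norm_ge_zero[of b]
      by (intro exI[of _ "e / (norm b + 1)"]) (force simp: pos_less_divide_eq add_nonneg_pos intro: le_less_trans)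
  qed
  then have "closed ?X" by (rule continuous_closed_preimage[OF _ closed_bops T(2)])
  moreover have "subspace ?X"
    using T(1) b by (auto simp: subspace_def tensor_op_add_left tensor_op_scaleR_left)
      (metis b bops_0 scaleR_zero_left tensor_op_scaleR_left)
  ultimately have "closure (span S) \<subseteq> ?X" by (intro closure_minimal span_minimal) (use S T(3) in auto)
  then show ?thesis using k by blast
qed

lemma closed_bounded_vimage: "bounded_linear F \<Longrightarrow> closed T \<Longrightarrow> closed (F -` T)"
  by (intro continuous_closed_vimage linear_continuous_at)

lemma tensor_op_closure_right:
  fixes T :: "('a::chilbert_space \<otimes>\<^sub>H 'b::chilbert_space) op set"
  assumes "k \<in> closure (span S)" "S \<subseteq> bops" "b \<in> bops"
    "subspace T" "closed T" "\<And>s. s \<in> S \<Longrightarrow> b \<otimes>\<^sub>o s \<in> T"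
  shows "b \<otimes>\<^sub>o k \<in> T"
proof -
  have kb: "k \<in> bops"
    using assms(1,2) closure_minimal[OF span_minimal[OF assms(2) subspace_bops] closed_bops] by blast
  have "k \<otimes>\<^sub>o b \<in> (\<lambda>t. swap t) -` T"
  proof (rule tensor_op_closure_left[OF assms(1-3)])
    show "closed ((\<lambda>t. swap t) -` T)" by (rule closed_bounded_vimage[OF bounded_linear_swap assms(5)])
    show "subspace ((\<lambda>t. swap t) -` T)"
      by (rule linear_subspace_vimage[OF bounded_linear.linear[OF bounded_linear_swap] assms(4)])
    show "s \<otimes>\<^sub>o b \<in> (\<lambda>t. swap t) -` T" if "s \<in> S" for s
      using assms(2,3,6) that by (simp add: subset_iff swap_tensor_op)
  qed
  then show ?thesis using kb assms(3) by (simp add: swap_tensor_op)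
qed

lemma tensor_alg_compact_left:
  fixes B :: "'b::chilbert_space op set"
  assumes B: "B \<subseteq> bops" shows "(compact_ops :: 'a::chilbert_space op set) \<otimes>\<^sub>A B = rank1_ops \<otimes>\<^sub>A B" (is "?L = ?R")
proof
  show "?L \<subseteq> ?R"
  proof (rule tensor_alg_subset[OF subspace_tensor_alg closed_tensor_alg])
    fix k :: "'a op" and b assume k: "k \<in> compact_ops" and b: "b \<in> B"
    show "k \<otimes>\<^sub>o b \<in> rank1_ops \<otimes>\<^sub>A B"
      by (rule tensor_op_closure_left[OF subsetD[OF compact_ops_approx k] rank1_ops_bops subsetD[OF B b]
            subspace_tensor_alg closed_tensor_alg]) (rule tensor_alg_gen[OF _ b])
  qed
  show "?R \<subseteq> ?L"
    by (rule tensor_alg_subset[OF subspace_tensor_alg closed_tensor_alg])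
      (rule tensor_alg_gen[OF subsetD[OF rank1_ops_compact]])
qed

lemma compact_ops_bops: "compact_ops \<subseteq> bops" by (auto simp: compact_ops_def)

lemma adj_rank1_ops: "k \<in> rank1_ops \<Longrightarrow> adj k \<in> rank1_ops" unfolding rank1_ops_def using adj_rank1 by blast

lemma adj_tensor_compact:
  assumes B: "cstar_algebra B" and t: "t \<in> compact_ops \<otimes>\<^sub>A B"
  shows "adj t \<in> compact_ops \<otimes>\<^sub>A B"
proof -
  have Bb: "B \<subseteq> bops" using B by (auto simp: cstar_algebra_def)
  show ?thesis using t unfolding tensor_alg_compact_left[OF Bb]
    by (intro adj_tensor_alg) (auto intro: rank1_ops_bops[THEN subsetD] Bb[THEN subsetD] cstar_adj[OF B] adj_rank1_ops)
qed

section \<open>Multipliers on two and three legs\<close>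

lemma multiplier_adj:
  assumes "\<And>s. s \<in> S \<Longrightarrow> adj s \<in> S" "S \<subseteq> bops" "m \<in> multiplier S"
  shows "adj m \<in> multiplier S"
proof -
  have m: "m \<in> bops" "\<And>s. s \<in> S \<Longrightarrow> m o\<^sub>L s \<in> S" "\<And>s. s \<in> S \<Longrightarrow> s o\<^sub>L m \<in> S"
    using assms(3) by (auto simp: multiplier_def)
  have "adj m o\<^sub>L s \<in> S" "s o\<^sub>L adj m \<in> S" if s: "s \<in> S" for s
  proof -
    have sb: "s \<in> bops" using s assms(2) by blast
    have "adj m o\<^sub>L s = adj (adj s o\<^sub>L m)" "s o\<^sub>L adj m = adj (m o\<^sub>L adj s)" using m(1) sb by (simp_all add: adj_comp)
    then show "adj m o\<^sub>L s \<in> S" "s o\<^sub>L adj m \<in> S" using assms(1) m(2,3) s by simp_all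
  qed
  then show ?thesis using m(1) by (simp add: multiplier_def)
qed

lemma multiplier_comp:
  assumes m: "m \<in> multiplier S" and n: "n \<in> multiplier S" shows "m o\<^sub>L n \<in> multiplier S"
proof -
  have "(m o\<^sub>L n) o\<^sub>L s = m o\<^sub>L (n o\<^sub>L s)" "s o\<^sub>L (m o\<^sub>L n) = (s o\<^sub>L m) o\<^sub>L n" for s by (simp_all only: comp_assoc)
  then show ?thesis using m n by (simp add: multiplier_def)
qed

text \<open>A rank one operator tensored with \<open>b\<close> is the column
  \<open>tensor_left x o\<^sub>L b\<close> followed on the right by
  \<open>adj (tensor_left y)\<close>. Left multiplication by \<open>m\<close> therefore acts on
  columns, and right multiplication is treated by adjoints.\<close>

lemma adjointable_multiplier_compact:
  fixes m :: "('a::chilbert_space \<otimes>\<^sub>H 'b::chilbert_space) op"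
  assumes B: "cstar_algebra B" and m: "m \<in> adjointable B"
  shows "m \<in> multiplier (compact_ops \<otimes>\<^sub>A B)"
proof -
  have Bb: "B \<subseteq> bops" using B by (auto simp: cstar_algebra_def)
  have eq: "compact_ops \<otimes>\<^sub>A B = (rank1_ops :: 'a op set) \<otimes>\<^sub>A B" by (rule tensor_alg_compact_left[OF Bb])
  have rank: "tensor_left x o\<^sub>L b o\<^sub>L adj (tensor_left y) = rank1 x y \<otimes>\<^sub>o b" if "b \<in> B" for x y :: 'a and b
    using that Bb by (intro htensor_eqI) (simp add: subset_iff bopsD tensor_scaleC_left tensor_scaleC_right)
  have col: "e o\<^sub>L adj (tensor_left y) \<in> rank1_ops \<otimes>\<^sub>A B" if "e \<in> col_module B" for e and y :: 'a
    by (rule col_module_induct[OF bounded_linear_comp_left subspace_tensor_alg closed_tensor_alg _ that])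
      (auto simp: rank rank1_ops_def intro: tensor_alg_gen)
  have left: "n o\<^sub>L t \<in> rank1_ops \<otimes>\<^sub>A B" if n: "n \<in> adjointable B" and t: "t \<in> rank1_ops \<otimes>\<^sub>A B"
    for n t :: "('a \<otimes>\<^sub>H 'b) op"
  proof (rule tensor_alg_induct[OF bounded_linear_comp_right subspace_tensor_alg closed_tensor_alg _ t])
    fix k :: "'a op" and b assume "k \<in> rank1_ops" and b: "b \<in> B"
    then obtain x y where k: "k = rank1 x y" by (auto simp: rank1_ops_def)
    have "n o\<^sub>L (k \<otimes>\<^sub>o b) = (n o\<^sub>L (tensor_left x o\<^sub>L b)) o\<^sub>L adj (tensor_left y)"
      unfolding k rank[OF b, symmetric] by (simp only: comp_assoc)
    then show "n o\<^sub>L (k \<otimes>\<^sub>o b) \<in> rank1_ops \<otimes>\<^sub>A B"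
      using col[OF adjointable_col[OF n col_module_gen[OF b]]] by simp
  qed
  have right: "t o\<^sub>L m \<in> compact_ops \<otimes>\<^sub>A B" if t: "t \<in> compact_ops \<otimes>\<^sub>A B" for t
  proof -
    have tb: "t \<in> bops" using tensor_alg_bops[OF compact_ops_bops Bb] t by blast
    have "t o\<^sub>L m = adj (adj m o\<^sub>L adj t)" using tb adjointable_bops[OF m] by (simp add: adj_comp)
    then show ?thesis
      using left[OF adjointable_adj[OF m]] adj_tensor_compact[OF B t]
        adj_tensor_compact[OF B, of "adj m o\<^sub>L adj t"] unfolding eq by simp
  qed
  show ?thesis using left[OF m] right adjointable_bops[OF m] unfolding multiplier_def eq by blast
qed

lemma multiplier_leg23:
  assumes A: "A \<subseteq> bops" and B: "B \<subseteq> bops" and m: "m \<in> multiplier B"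
  shows "id_blinfun \<otimes>\<^sub>o m \<in> multiplier (A \<otimes>\<^sub>A B)"
proof -
  note mb = multiplier_bops[OF m]
  have "(id_blinfun \<otimes>\<^sub>o m) o\<^sub>L t \<in> A \<otimes>\<^sub>A B" if t: "t \<in> A \<otimes>\<^sub>A B" for t
    by (rule tensor_alg_induct[OF bounded_linear_comp_right subspace_tensor_alg closed_tensor_alg _ t])
      (use A B m mb in \<open>auto simp: subset_iff tensor_op_comp multiplier_def intro: tensor_alg_gen\<close>)
  moreover have "t o\<^sub>L (id_blinfun \<otimes>\<^sub>o m) \<in> A \<otimes>\<^sub>A B" if t: "t \<in> A \<otimes>\<^sub>A B" for t
    by (rule tensor_alg_induct[OF bounded_linear_comp_left subspace_tensor_alg closed_tensor_alg _ t])
      (use A B m mb in \<open>auto simp: subset_iff tensor_op_comp multiplier_def intro: tensor_alg_gen\<close>)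
  ultimately show ?thesis using mb by (simp add: multiplier_def)
qed

lemma reassoc_tensor_op: "a \<in> bops \<Longrightarrow> b \<in> bops \<Longrightarrow> c \<in> bops \<Longrightarrow> reassoc ((a \<otimes>\<^sub>o b) \<otimes>\<^sub>o c) = a \<otimes>\<^sub>o b \<otimes>\<^sub>o c"
  unfolding reassoc_def by (rule htensor3_eqI) simp

lemma bounded_linear_reassoc: "bounded_linear reassoc"
  unfolding reassoc_def by (rule bounded_linear_compose[OF bounded_linear_comp_left bounded_linear_comp_right])

lemma multiplier_leg12:
  assumes A: "A \<subseteq> bops" and K: "K \<subseteq> bops" and B: "B \<subseteq> bops" and m: "m \<in> multiplier (A \<otimes>\<^sub>A K)"
  shows "leg12 m \<in> multiplier (A \<otimes>\<^sub>A K \<otimes>\<^sub>A B)"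
proof -
  note mb = multiplier_bops[OF m]
  let ?S = "A \<otimes>\<^sub>A K \<otimes>\<^sub>A B"
  have AK: "A \<otimes>\<^sub>A K \<subseteq> bops" and KB: "K \<otimes>\<^sub>A B \<subseteq> bops" by (intro tensor_alg_bops A K B)+
  have S: "reassoc (t \<otimes>\<^sub>o b) \<in> ?S" if t: "t \<in> A \<otimes>\<^sub>A K" and b: "b \<in> B" for t b
  proof -
    have bb: "b \<in> bops" using b B by blast
    have "t \<otimes>\<^sub>o b \<in> reassoc -` ?S"
    proof (rule tensor_op_closure_left[where S = "{a \<otimes>\<^sub>o k |a k. a \<in> A \<and> k \<in> K}"])
      show "closed (reassoc -` ?S)" by (rule closed_bounded_vimage[OF bounded_linear_reassoc closed_tensor_alg])
      show "subspace (reassoc -` ?S)"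
        by (rule linear_subspace_vimage[OF bounded_linear.linear[OF bounded_linear_reassoc] subspace_tensor_alg])
    qed (use t A K bb b in \<open>auto simp: tensor_alg_def[of A K] subset_iff reassoc_tensor_op intro!: tensor_alg_gen\<close>)
    then show ?thesis by simp
  qed
  have gen: "F s \<in> ?S" if F: "bounded_linear F" "\<And>a k b. a \<in> A \<Longrightarrow> k \<in> K \<Longrightarrow> b \<in> B \<Longrightarrow> F (reassoc ((a \<otimes>\<^sub>o k) \<otimes>\<^sub>o b)) \<in> ?S"
    and s: "s \<in> ?S" for F s
  proof -
    have "?S \<subseteq> F -` ?S"
    proof (rule tensor_alg_subset)
      show cl: "closed (F -` ?S)" by (rule closed_bounded_vimage[OF F(1) closed_tensor_alg])
      show sub: "subspace (F -` ?S)"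
        by (rule linear_subspace_vimage[OF bounded_linear.linear[OF F(1)] subspace_tensor_alg])
      fix a r assume a: "a \<in> A" and r: "r \<in> K \<otimes>\<^sub>A B"
      show "a \<otimes>\<^sub>o r \<in> F -` ?S"
        by (rule tensor_op_closure_right[where S = "{k \<otimes>\<^sub>o b |k b. k \<in> K \<and> b \<in> B}", OF _ _ _ sub cl])
          (use a r A K B F(2) in \<open>auto simp: tensor_alg_def[of K B] subset_iff reassoc_tensor_op\<close>)
    qed
    then show ?thesis using s by blast
  qed
  have "leg12 m o\<^sub>L s \<in> ?S" if s: "s \<in> ?S" for s
  proof (rule gen[OF bounded_linear_comp_right _ s])
    fix a k b assume abk: "a \<in> A" "k \<in> K" "b \<in> B"
    then have bb: "a \<in> bops" "k \<in> bops" "b \<in> bops" using A K B by auto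
    have "leg12 m o\<^sub>L reassoc ((a \<otimes>\<^sub>o k) \<otimes>\<^sub>o b) = reassoc ((m o\<^sub>L (a \<otimes>\<^sub>o k)) \<otimes>\<^sub>o b)"
      using mb bb unfolding leg12_def by (subst reassoc_comp[symmetric]) (auto simp: tensor_op_comp)
    then show "leg12 m o\<^sub>L reassoc ((a \<otimes>\<^sub>o k) \<otimes>\<^sub>o b) \<in> ?S"
      using S m abk tensor_alg_gen[OF abk(1,2)] by (simp add: multiplier_def)
  qed
  moreover have "s o\<^sub>L leg12 m \<in> ?S" if s: "s \<in> ?S" for s
  proof (rule gen[OF bounded_linear_comp_left _ s])
    fix a k b assume abk: "a \<in> A" "k \<in> K" "b \<in> B"
    then have bb: "a \<in> bops" "k \<in> bops" "b \<in> bops" using A K B by auto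
    have "reassoc ((a \<otimes>\<^sub>o k) \<otimes>\<^sub>o b) o\<^sub>L leg12 m = reassoc (((a \<otimes>\<^sub>o k) o\<^sub>L m) \<otimes>\<^sub>o b)"
      using mb bb unfolding leg12_def by (subst reassoc_comp[symmetric]) (auto simp: tensor_op_comp)
    then show "reassoc ((a \<otimes>\<^sub>o k) \<otimes>\<^sub>o b) o\<^sub>L leg12 m \<in> ?S"
      using S m abk tensor_alg_gen[OF abk(1,2)] by (simp add: multiplier_def)
  qed
  ultimately show ?thesis using mb by (simp add: multiplier_def)
qed

text \<open>An operator on the outer legs is a multiplier of \<open>A \<otimes> B\<close> as soon as it is one of
  \<open>A \<otimes> compact_ops \<otimes> B\<close>: multiply by a rank one projection on the middle leg and compress.\<close>

lemma multiplier_of_leg13: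
  fixes X :: "('a::chilbert_space \<otimes>\<^sub>H 'b::chilbert_space) op"
  assumes A: "A \<subseteq> bops" and B: "B \<subseteq> bops" "\<And>c b. b \<in> B \<Longrightarrow> scaleC_op c b \<in> B"
    and X: "X \<in> bops" and ne: "\<exists>x::'h. x \<noteq> 0"
    and m: "(leg13 X :: ('a \<otimes>\<^sub>H 'h::chilbert_space \<otimes>\<^sub>H 'b) op) \<in> multiplier (A \<otimes>\<^sub>A compact_ops \<otimes>\<^sub>A B)"
  shows "X \<in> multiplier (A \<otimes>\<^sub>A B)"
proof -
  obtain x :: 'h where "x \<noteq> 0" using ne by blast
  define e where "e = (1 / norm x) *\<^sub>R x"
  have e: "norm e = 1" using \<open>x \<noteq> 0\<close> by (simp add: e_def)
  define M :: "'a \<otimes>\<^sub>H 'b \<Rightarrow>\<^sub>L 'a \<otimes>\<^sub>H 'h \<otimes>\<^sub>H 'b" where "M = tensor_mid e"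
  have Mb: "M \<in> bops" by (simp add: M_def)
  have MM: "adj M o\<^sub>L (M o\<^sub>L t) = t" for t :: "('a \<otimes>\<^sub>H 'b) op"
    unfolding M_def by (simp add: adj_tensor_mid_comp[OF e] flip: comp_assoc)
  have XM: "leg13 t o\<^sub>L M = M o\<^sub>L t" if "t \<in> bops" for t :: "('a \<otimes>\<^sub>H 'b) op"
    unfolding M_def by (rule leg13_tensor_mid[OF that])
  have MX: "adj M o\<^sub>L leg13 X = X o\<^sub>L adj M"
    using arg_cong[OF XM[OF bops_adj[OF X]], of adj] X Mb by (simp add: adj_comp adj_leg13)
  let ?S = "A \<otimes>\<^sub>A (compact_ops :: 'h op set) \<otimes>\<^sub>A B"
  have into: "M o\<^sub>L t o\<^sub>L adj M \<in> ?S" if t: "t \<in> A \<otimes>\<^sub>A B" for t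
  proof (rule tensor_alg_induct[OF bounded_linear_compose[OF bounded_linear_comp_left bounded_linear_comp_right]
        subspace_tensor_alg closed_tensor_alg _ t])
    fix a b assume ab: "a \<in> A" "b \<in> B"
    then have "M o\<^sub>L (a \<otimes>\<^sub>o b) o\<^sub>L adj M = a \<otimes>\<^sub>o rank1 e e \<otimes>\<^sub>o b"
      using A B unfolding M_def
        by (intro htensor3_eqI) (simp add: subset_iff bopsD tensor_scaleC_left tensor_scaleC_right)
    then show "M o\<^sub>L (a \<otimes>\<^sub>o b) o\<^sub>L adj M \<in> ?S"
      using ab by (simp add: tensor_alg_gen rank1_compact)
  qed
  have compress: "adj M o\<^sub>L s o\<^sub>L M \<in> A \<otimes>\<^sub>A B" if s: "s \<in> ?S" for s
  proof -
    let ?F = "\<lambda>s. adj M o\<^sub>L s o\<^sub>L M"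
    have F: "bounded_linear ?F"
      by (rule bounded_linear_compose[OF bounded_linear_comp_left bounded_linear_comp_right])
    have "?S \<subseteq> ?F -` (A \<otimes>\<^sub>A B)"
    proof (rule tensor_alg_subset)
      note cl = closed_bounded_vimage[OF F closed_tensor_alg[of A B]]
      note sub = linear_subspace_vimage[OF bounded_linear.linear[OF F] subspace_tensor_alg[of A B]]
      show "closed (?F -` (A \<otimes>\<^sub>A B))" "subspace (?F -` (A \<otimes>\<^sub>A B))" by (fact cl sub)+
      fix a :: "'a op" and r :: "('h \<otimes>\<^sub>H 'b) op" assume a: "a \<in> A" and r: "r \<in> compact_ops \<otimes>\<^sub>A B"
      show "a \<otimes>\<^sub>o r \<in> ?F -` (A \<otimes>\<^sub>A B)"
      proof (rule tensor_op_closure_right[where S = "{k \<otimes>\<^sub>o b |k b. k \<in> compact_ops \<and> b \<in> B}", OF _ _ _ sub cl])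
        show "r \<in> closure (span {k \<otimes>\<^sub>o b |k b. k \<in> compact_ops \<and> b \<in> B})" using r by (simp add: tensor_alg_def)
        show "{k \<otimes>\<^sub>o b |k b. k \<in> compact_ops \<and> b \<in> B} \<subseteq> bops" using compact_ops_bops B by auto
        show "a \<in> bops" using a A by blast
        fix s :: "('h \<otimes>\<^sub>H 'b) op" assume "s \<in> {k \<otimes>\<^sub>o b |k b. k \<in> compact_ops \<and> b \<in> B}"
        then obtain k b where s: "s = k \<otimes>\<^sub>o b" "k \<in> compact_ops" "b \<in> B" by blast
        have bb: "k \<in> bops" "b \<in> bops" "a \<in> bops" using s a A B compact_ops_bops by auto
        have "?F (a \<otimes>\<^sub>o s) = a \<otimes>\<^sub>o scaleC_op (cinner e (blinfun_apply k e)) b"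
          using bb unfolding M_def s by (intro htensor_eqI) (simp add: tensor_scaleC_right)
        then show "a \<otimes>\<^sub>o s \<in> ?F -` (A \<otimes>\<^sub>A B)" using a B(2)[OF s(3)] by (simp add: tensor_alg_gen)
      qed
    qed
    then show ?thesis using s by blast
  qed
  have "X o\<^sub>L t \<in> A \<otimes>\<^sub>A B" "t o\<^sub>L X \<in> A \<otimes>\<^sub>A B" if t: "t \<in> A \<otimes>\<^sub>A B" for t
  proof -
    have "X o\<^sub>L t = adj M o\<^sub>L (leg13 X o\<^sub>L (M o\<^sub>L t o\<^sub>L adj M)) o\<^sub>L M"
      using MM[of id_blinfun] by (simp add: MX MM flip: comp_assoc) (simp add: comp_assoc MM)
    also have "\<dots> \<in> A \<otimes>\<^sub>A B" using m into[OF t] by (intro compress) (simp add: multiplier_def)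
    finally show "X o\<^sub>L t \<in> A \<otimes>\<^sub>A B" .
    have "t o\<^sub>L X = adj M o\<^sub>L ((M o\<^sub>L t o\<^sub>L adj M) o\<^sub>L leg13 X) o\<^sub>L M"
      using MM[of id_blinfun] by (simp add: comp_assoc MM XM[OF X])
    also have "\<dots> \<in> A \<otimes>\<^sub>A B" using m into[OF t] by (intro compress) (simp add: multiplier_def)
    finally show "t o\<^sub>L X \<in> A \<otimes>\<^sub>A B" .
  qed
  then show ?thesis using X by (simp add: multiplier_def)
qed

section \<open>The algebra of a multiplicative unitary\<close>

text \<open>The slice of \<open>T\<close> on its first leg by the vector functional of
  \<open>x\<close> and \<open>z\<close>; it is antilinear in \<open>x\<close> and linear in
  \<open>z\<close>.\<close>

definition mcoeff :: "'a::chilbert_space \<Rightarrow> 'a \<Rightarrow> ('a \<otimes>\<^sub>H 'b::chilbert_space) op \<Rightarrow> 'b op" where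
  "mcoeff x z T = adj (tensor_left x) o\<^sub>L (T o\<^sub>L tensor_left z)"

lemma cinner_mcoeff: "cinner y (blinfun_apply (mcoeff x z T) u) = cinner (x \<otimes> y) (blinfun_apply T (z \<otimes> u))"
  by (simp add: mcoeff_def adj_right)

lemma bops_mcoeff [simp]: "T \<in> bops \<Longrightarrow> mcoeff x z T \<in> bops" by (simp add: mcoeff_def)

lemma adj_mcoeff: "T \<in> bops \<Longrightarrow> adj (mcoeff x z T) = mcoeff z x (adj T)"
  by (simp add: mcoeff_def adj_comp comp_assoc)

lemma norm_mcoeff:
  fixes T :: "('a::chilbert_space \<otimes>\<^sub>H 'b::chilbert_space) op"
  shows "norm (mcoeff x z T) \<le> norm x * norm T * norm z"
proof -
  have "norm (mcoeff x z T) \<le> norm (adj (tensor_left x :: 'b \<Rightarrow>\<^sub>L _)) * norm (T o\<^sub>L tensor_left z)"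
    unfolding mcoeff_def by (rule norm_blinfun_compose)
  also have "\<dots> \<le> norm x * (norm T * norm z)"
    by (intro mult_mono order_trans[OF norm_blinfun_compose] mult_left_mono norm_tensor_left)
      (simp_all add: norm_adj norm_tensor_left)
  finally show ?thesis by (simp add: mult.assoc)
qed

lemma bounded_linear_mcoeff_right: "bounded_linear (\<lambda>z. mcoeff x z T)"
  unfolding mcoeff_def
  by (intro bounded_linear_compose[OF bounded_linear_comp_right] bounded_linear_of_tensor_left)

lemma mcoeff_add_left: "mcoeff (x + y) z T = mcoeff x z T + mcoeff y z T"
  by (intro blinfun_eqI cinner_extI) (simp add: cinner_mcoeff blinfun.add_left cinner_add_right tensor_add_left cinner_add_left)

lemma mcoeff_scaleC_right: "T \<in> bops \<Longrightarrow> mcoeff x (c *\<^sub>C z) T = scaleC_op c (mcoeff x z T)"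
  by (intro blinfun_eqI cinner_extI) (simp add: cinner_mcoeff tensor_scaleC_left bopsD cinner_scaleC_right)

lemma mcoeff_scaleR_left: "mcoeff (r *\<^sub>R x) z T = r *\<^sub>R mcoeff x z T"
  by (intro blinfun_eqI cinner_extI)
    (simp add: cinner_mcoeff blinfun.scaleR_left cinner_scaleR_right cinner_scaleR_left
      bounded_bilinear.scaleR_left[OF bounded_bilinear_tensor])

lemma bounded_linear_mcoeff_left: "bounded_linear (\<lambda>x. mcoeff x z T)"
proof (rule bounded_linear_intro)
  show "norm (mcoeff x z T) \<le> norm x * (norm T * norm z)" for x
    using norm_mcoeff[of x z T] by (simp add: mult.assoc)
qed (simp_all add: mcoeff_add_left mcoeff_scaleR_left)

lemma mcoeff_closure_span:
  assumes X: "x \<in> closure (span X)" and Z: "z \<in> closure (span Z)" and S: "subspace S" "closed S"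
    and gen: "\<And>x z. x \<in> X \<Longrightarrow> z \<in> Z \<Longrightarrow> mcoeff x z T \<in> S"
  shows "mcoeff x z T \<in> S"
proof (rule bounded_linear_closure_span[OF bounded_linear_mcoeff_left S _ X])
  fix x assume "x \<in> X"
  then show "mcoeff x z T \<in> S"
    using bounded_linear_closure_span[OF bounded_linear_mcoeff_right S _ Z, of x T] gen by blast
qed

section \<open>Slices by normal functionals\<close>

lemma slice_vectors:
  fixes W :: "('a::chilbert_space \<otimes>\<^sub>H 'b::chilbert_space) op"
  assumes W: "W \<in> bops" and x: "summable (\<lambda>n. (norm (x n))\<^sup>2)" and y: "summable (\<lambda>n. (norm (y n))\<^sup>2)"
  shows "(\<lambda>n. mcoeff (x n) (y n) W) sums slice (\<lambda>T. \<Sum>n. cinner (x n) (blinfun_apply T (y n))) W"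
proof -
  have "summable (\<lambda>n. norm W * ((norm (x n))\<^sup>2 + (norm (y n))\<^sup>2))" by (intro summable_mult summable_add x y)
  then have sm: "summable (\<lambda>n. mcoeff (x n) (y n) W)"
  proof (rule summable_comparison_test')
    fix n
    have "norm (x n) * norm (y n) \<le> (norm (x n))\<^sup>2 + (norm (y n))\<^sup>2"
      using sum_squares_bound[of "norm (x n)" "norm (y n)"] mult_nonneg_nonneg[OF norm_ge_zero[of "x n"] norm_ge_zero[of "y n"]]
      by linarith
    then have "norm W * (norm (x n) * norm (y n)) \<le> norm W * ((norm (x n))\<^sup>2 + (norm (y n))\<^sup>2)"
      by (intro mult_left_mono) auto
    then show "norm (mcoeff (x n) (y n) W) \<le> norm W * ((norm (x n))\<^sup>2 + (norm (y n))\<^sup>2)"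
      using norm_mcoeff[of "x n" "y n" W] by (simp add: algebra_simps)
  qed
  let ?S = "\<Sum>n. mcoeff (x n) (y n) W"
  have lim: "(\<lambda>n. mcoeff (x n) (y n) W) sums ?S" using sm by (rule summable_sums)
  have Sb: "?S \<in> bops"
  proof (rule closed_sequentially[OF closed_bops])
    show "(\<lambda>n. \<Sum>i<n. mcoeff (x i) (y i) W) \<longlonglongrightarrow> ?S" using lim by (simp add: sums_def)
    show "(\<Sum>i<n. mcoeff (x i) (y i) W) \<in> bops" for n using W by (intro subspace_sum[OF subspace_bops]) simp
  qed
  have mat: "cinner a (blinfun_apply ?S b) =
      (\<Sum>n. cinner (x n) (blinfun_apply (adj (tensor_right a) o\<^sub>L W o\<^sub>L tensor_right b) (y n)))" for a b
  proof -
    have "(\<lambda>n. cinner a (blinfun_apply (mcoeff (x n) (y n) W) b)) sums cinner a (blinfun_apply ?S b)"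
      by (rule bounded_linear.sums[OF bounded_linear_compose[OF bounded_linear_cinner_right blinfun.bounded_linear_left] lim])
    moreover have "cinner a (blinfun_apply (mcoeff (x n) (y n) W) b) =
        cinner (x n) (blinfun_apply (adj (tensor_right a) o\<^sub>L W o\<^sub>L tensor_right b) (y n))" for n
      by (simp add: cinner_mcoeff adj_right)
    ultimately show ?thesis by (simp add: sums_unique)
  qed
  have "slice (\<lambda>T. \<Sum>n. cinner (x n) (blinfun_apply T (y n))) W = ?S"
    unfolding slice_def
  proof (rule the_equality)
    show "?S \<in> bops \<and> (\<forall>a b. cinner a (blinfun_apply ?S b) =
        (\<Sum>n. cinner (x n) (blinfun_apply (adj (tensor_right a) o\<^sub>L W o\<^sub>L tensor_right b) (y n))))"
      using Sb mat by blast
    fix S' :: "'b op"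
    assume "S' \<in> bops \<and> (\<forall>a b. cinner a (blinfun_apply S' b) =
        (\<Sum>n. cinner (x n) (blinfun_apply (adj (tensor_right a) o\<^sub>L W o\<^sub>L tensor_right b) (y n))))"
    then show "S' = ?S" unfolding mat[symmetric] by (intro blinfun_eqI cinner_extI) blast
  qed
  then show ?thesis using lim by simp
qed

text \<open>A slice by a normal functional is a norm-convergent sum of slices by vector functionals;
  conversely finite sums of the latter are slices by one normal functional.\<close>

theorem qg_algebra_eq:
  assumes W: "W \<in> bops"
  shows "qg_algebra W = closure (span {mcoeff x z W |x z. True})"
proof
  let ?M = "closure (span {mcoeff x z W |x z. True})"
  have gen: "mcoeff x z W \<in> ?M" for x z by (rule closure_span_superset) blast
  show "qg_algebra W \<subseteq> ?M"
    unfolding qg_algebra_def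
  proof (rule closure_minimal)
    show "{slice \<omega> W |\<omega>. \<omega> \<in> predual} \<subseteq> ?M"
    proof safe
      fix \<omega> :: "'a op \<Rightarrow> complex" assume "\<omega> \<in> predual"
      then obtain x y where \<omega>: "\<omega> = (\<lambda>T. \<Sum>n. cinner (x n) (blinfun_apply T (y n)))"
        "summable (\<lambda>n. (norm (x n))\<^sup>2)" "summable (\<lambda>n. (norm (y n))\<^sup>2)"
        unfolding predual_def by blast
      have "(\<lambda>n. \<Sum>i<n. mcoeff (x i) (y i) W) \<longlonglongrightarrow> slice \<omega> W"
        using slice_vectors[OF W \<omega>(2,3)] by (simp add: sums_def \<omega>(1))
      moreover have "(\<Sum>i<n. mcoeff (x i) (y i) W) \<in> ?M" for n
        by (intro subspace_sum[OF subspace_closure_span] gen)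
      ultimately show "slice \<omega> W \<in> ?M" by (rule closed_sequentially[OF closed_closure, rotated])
    qed
  qed simp
  have "span {mcoeff x z W |x z. True} \<subseteq> {slice \<omega> W |\<omega>. \<omega> \<in> predual}"
  proof
    fix p assume "p \<in> span {mcoeff x z W |x z. True}"
    then have "\<exists>(n::nat) x z. p = (\<Sum>i<n. mcoeff (x i) (z i) W)"
    proof (induction rule: span_induct_alt)
      case base
      show ?case by (rule exI[of _ 0]) simp
    next
      case (step r q p)
      obtain u v where q: "q = mcoeff u v W" using step.hyps by blast
      obtain n :: nat and x z where p: "p = (\<Sum>i<n. mcoeff (x i) (z i) W)" using step.IH by blast
      have "(\<Sum>i<n. mcoeff ((x(n := r *\<^sub>R u)) i) ((z(n := v)) i) W) = p"
        unfolding p by (rule sum.cong) auto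
      then have "r *\<^sub>R q + p = (\<Sum>i<Suc n. mcoeff ((x(n := r *\<^sub>R u)) i) ((z(n := v)) i) W)"
        by (simp add: q mcoeff_scaleR_left)
      then show ?case by blast
    qed
    then obtain n :: nat and x z where p: "p = (\<Sum>i<n. mcoeff (x i) (z i) W)" by blast
    \<comment> \<open>Padding by 0 makes the finite families square-summable sequences, so that the
      sum is a slice by an element of \<open>predual\<close>.\<close>
    define x' where "x' i = (if i < n then x i else 0)" for i
    define z' where "z' i = (if i < n then z i else 0)" for i
    have x0: "x' i = 0" "z' i = 0" if "i \<notin> {..<n}" for i using that by (auto simp: x'_def z'_def)
    have s: "summable (\<lambda>n. (norm (x' n))\<^sup>2)" "summable (\<lambda>n. (norm (z' n))\<^sup>2)"
      by (rule summable_finite[of "{..<n}"]; simp add: x0)+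
    have c0: "mcoeff 0 v W = 0" for v using mcoeff_scaleR_left[of 0 0 v W] by simp
    have "(\<lambda>i. mcoeff (x' i) (z' i) W) sums (\<Sum>i<n. mcoeff (x' i) (z' i) W)"
      by (rule sums_finite) (simp_all add: x0 c0)
    also have "(\<Sum>i<n. mcoeff (x' i) (z' i) W) = p" unfolding p by (rule sum.cong) (auto simp: x'_def z'_def)
    finally have "p = slice (\<lambda>T. \<Sum>n. cinner (x' n) (blinfun_apply T (z' n))) W"
      using slice_vectors[OF W s] by (rule sums_unique2)
    then show "p \<in> {slice \<omega> W |\<omega>. \<omega> \<in> predual}" using s unfolding predual_def by blast
  qed
  then show "?M \<subseteq> qg_algebra W" unfolding qg_algebra_def by (rule closure_mono)
qed

text \<open>If \<open>v\<close> is orthogonal to all these vectors, then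
  \<open>x \<otimes> v\<close> is orthogonal to the range of \<open>W\<close>, which is the whole
  space.\<close>

lemma mcoeff_total:
  fixes W :: "('a::chilbert_space \<otimes>\<^sub>H 'b::chilbert_space) op"
  assumes W: "unitary W" and ne: "\<exists>x::'a. x \<noteq> 0"
  shows "closure (span {blinfun_apply (mcoeff x z W) u |x z u. True}) = UNIV"
proof (rule closed_subspace_eq_UNIV)
  fix v :: 'b assume v: "\<And>y. y \<in> closure (span {blinfun_apply (mcoeff x z W) u |x z u. True}) \<Longrightarrow> inner v y = 0"
  obtain x :: 'a where x: "x \<noteq> 0" using ne by blast
  have 0: "inner (x \<otimes> v) (blinfun_apply W (z \<otimes> u)) = 0" for z u
  proof -
    have "inner v (blinfun_apply (mcoeff x z W) u) = 0" by (rule v, rule closure_span_superset) blast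
    then show ?thesis unfolding Re_cinner[symmetric] cinner_mcoeff .
  qed
  have "inner (x \<otimes> v) (blinfun_apply W f) = 0" for f
    by (rule closed_eq_on_total[of "\<lambda>f. inner (x \<otimes> v) (blinfun_apply W f)" "\<lambda>_. 0" "{x \<otimes> y |x y. True}"])
      (use 0 closure_span_tensor in \<open>auto intro!: bounded_linear_compose[OF bounded_linear_inner_right] blinfun.bounded_linear_right bounded_linear_zero\<close>)
  from this[of "blinfun_apply (adj W) (x \<otimes> v)"] have "x \<otimes> v = 0" using W by simp
  then have "norm x * norm v = 0" unfolding norm_tensor[symmetric] by simp
  then show "v = 0" using x by simp
qed simp_all

lemma qg_algebra_bops: "W \<in> bops \<Longrightarrow> qg_algebra W \<subseteq> bops"
  unfolding qg_algebra_eq by (intro closure_minimal span_minimal subspace_bops closed_bops) auto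

lemma qg_algebra_scaleC:
  assumes W: "W \<in> bops" and a: "a \<in> qg_algebra W" shows "scaleC_op c a \<in> qg_algebra W"
proof -
  let ?M = "closure (span {mcoeff x z W |x z. True})"
  have gen: "scaleC_op c s \<in> ?M" if s: "s \<in> {mcoeff x z W |x z. True}" for s
  proof -
    obtain x z where "s = mcoeff x z W" using s by blast
    then have "scaleC_op c s = mcoeff x (c *\<^sub>C z) W" using mcoeff_scaleC_right[OF W] by simp
    then show ?thesis by (intro closure_span_superset) blast
  qed
  show ?thesis unfolding qg_algebra_eq[OF W]
    by (rule bounded_linear_closure_span[OF bounded_linear_scaleC_op subspace_closure_span closed_closure _ a[unfolded qg_algebra_eq[OF W]]])
      (rule gen)
qed

lemma qg_algebra_total:
  fixes W :: "('h::chilbert_space \<otimes>\<^sub>H 'h) op"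
  assumes W: "unitary W" and ne: "\<exists>x::'h. x \<noteq> 0"
  shows "closure (span {blinfun_apply a x |a x. a \<in> qg_algebra W}) = UNIV"
    and "closure (span {blinfun_apply (adj a) x |a x. a \<in> qg_algebra W}) = UNIV"
proof -
  have gen: "mcoeff x z W \<in> qg_algebra W" for x z
    unfolding qg_algebra_eq[OF unitary_bops[OF W]] by (rule closure_span_superset) blast
  have "closure (span {blinfun_apply (mcoeff x z W) u |x z u. True}) \<subseteq> closure (span {blinfun_apply a x |a x. a \<in>
      qg_algebra W})"
    by (intro closure_mono span_mono) (use gen in blast)
  then show "closure (span {blinfun_apply a x |a x. a \<in> qg_algebra W}) = UNIV"
    unfolding mcoeff_total[OF W ne] by blast
  have "blinfun_apply (mcoeff x z (adj W)) u = blinfun_apply (adj (mcoeff z x W)) u" for x z u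
    by (simp add: adj_mcoeff unitary_bops[OF W])
  then have "closure (span {blinfun_apply (mcoeff x z (adj W)) u |x z u. True}) \<subseteq>
      closure (span {blinfun_apply (adj a) x |a x. a \<in> qg_algebra W})"
    by (intro closure_mono span_mono) (use gen in blast)
  then show "closure (span {blinfun_apply (adj a) x |a x. a \<in> qg_algebra W}) = UNIV"
    unfolding mcoeff_total[OF unitary_adj[OF W] ne] by blast
qed

lemma qg_algebra_nondegenerate:
  fixes W :: "('h::chilbert_space \<otimes>\<^sub>H 'h) op"
  assumes W: "unitary W" and ne: "\<exists>x::'h. x \<noteq> 0"
  shows "nondegenerate (qg_algebra W)"
  unfolding nondegenerate_def
  using qg_algebra_bops[OF unitary_bops[OF W]] qg_algebra_scaleC[OF unitary_bops[OF W]] qg_algebra_total[OF W ne]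
    by blast

section \<open>Self-adjoint relations\<close>

lemma self_adjoint_iff: "self_adjoint Q \<Longrightarrow> (y, z) \<in> Q \<longleftrightarrow> (\<forall>x w. (x, w) \<in> Q \<longrightarrow> cinner w y = cinner x z)"
proof -
  assume "self_adjoint Q"
  then have "Q = {(y, z). \<forall>(x, w)\<in>Q. cinner w y = cinner x z}" unfolding self_adjoint_def by (rule conjunct2)
  from eqset_imp_iff[OF this, of "(y, z)"] show ?thesis by auto
qed

lemma self_adjointI: "self_adjoint Q \<Longrightarrow> (\<And>x w. (x, w) \<in> Q \<Longrightarrow> cinner w y = cinner x z) \<Longrightarrow> (y, z) \<in> Q"
  using self_adjoint_iff[of Q y z] by simp

lemma self_adjoint_sym: "self_adjoint Q \<Longrightarrow> (x, w) \<in> Q \<Longrightarrow> (y, z) \<in> Q \<Longrightarrow> cinner w y = cinner x z"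
  using self_adjoint_iff[of Q y z] by blast

lemma self_adjoint_dense: "self_adjoint Q \<Longrightarrow> closure (span (Domain Q)) = UNIV"
  using closure_mono[OF span_superset[of "Domain Q"]] unfolding self_adjoint_def by blast

lemma self_adjoint_subspace: assumes Q: "self_adjoint Q" shows "subspace Q"
  unfolding subspace_def
proof (intro conjI ballI allI)
  show "0 \<in> Q" unfolding zero_prod_def by (rule self_adjointI[OF Q]) simp
  fix p q assume "p \<in> Q" "q \<in> Q"
  then have pq: "(fst p, snd p) \<in> Q" "(fst q, snd q) \<in> Q" by simp_all
  have "(fst p + fst q, snd p + snd q) \<in> Q"
    by (intro self_adjointI[OF Q]) (simp add: cinner_add_right self_adjoint_sym[OF Q _ pq(1)] self_adjoint_sym[OF Q _ pq(2)])
  then show "p + q \<in> Q" by (simp add: plus_prod_def)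
next
  fix r :: real and p assume "p \<in> Q"
  then have p: "(fst p, snd p) \<in> Q" by simp
  have "(r *\<^sub>R fst p, r *\<^sub>R snd p) \<in> Q"
    by (intro self_adjointI[OF Q]) (simp add: cinner_scaleR_right self_adjoint_sym[OF Q _ p])
  then show "r *\<^sub>R p \<in> Q" by (simp add: scaleR_prod_def)
qed

lemma self_adjoint_scaleC:
  assumes Q: "self_adjoint Q" and p: "(y, z) \<in> Q" shows "(c *\<^sub>C y, c *\<^sub>C z) \<in> Q"
  by (rule self_adjointI[OF Q]) (simp add: cinner_scaleC_right self_adjoint_sym[OF Q _ p])

lemma self_adjoint_closed: assumes Q: "self_adjoint Q" shows "closed Q"
  unfolding closed_sequential_limits
proof (intro allI impI, elim conjE)
  fix p l assume p: "\<forall>n. p n \<in> Q" and l: "p \<longlonglongrightarrow> l"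
  have "(fst l, snd l) \<in> Q"
  proof (rule self_adjointI[OF Q])
    fix x w assume xw: "(x, w) \<in> Q"
    have "cinner w (fst (p n)) = cinner x (snd (p n))" for n
      using self_adjoint_sym[OF Q xw, of "fst (p n)" "snd (p n)"] p by simp
    moreover have "(\<lambda>n. cinner w (fst (p n))) \<longlonglongrightarrow> cinner w (fst l)" by (intro tendsto_intros l)
    moreover have "(\<lambda>n. cinner x (snd (p n))) \<longlonglongrightarrow> cinner x (snd l)" by (intro tendsto_intros l)
    ultimately show "cinner w (fst l) = cinner x (snd l)" using LIMSEQ_unique by fastforce
  qed
  then show "l \<in> Q" by simp
qed

lemma self_adjoint_Range_dense:
  assumes Q: "self_adjoint Q" and ker: "\<And>x. (x, 0) \<in> Q \<Longrightarrow> x = 0"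
  shows "closure (Range Q) = UNIV"
proof -
  have sub: "subspace (Range Q)"
    using linear_subspace_image[OF bounded_linear.linear[OF bounded_linear_snd] self_adjoint_subspace[OF Q]]
    by (simp only: Range_snd)
  show ?thesis
  proof (rule closed_subspace_eq_UNIV)
    fix v assume v: "\<And>y. y \<in> closure (Range Q) \<Longrightarrow> inner v y = 0"
    have "cinner w v = cinner x 0" if xw: "(x, w) \<in> Q" for x w
    proof (rule complex_eqI)
      have "(\<i> *\<^sub>C x, \<i> *\<^sub>C w) \<in> Q" by (rule self_adjoint_scaleC[OF Q xw])
      then have "w \<in> closure (Range Q)" "\<i> *\<^sub>C w \<in> closure (Range Q)"
        by (auto intro!: subsetD[OF closure_subset] RangeI[OF xw] RangeI)
      then show "Re (cinner w v) = Re (cinner x 0)" "Im (cinner w v) = Im (cinner x 0)"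
        using v[of w] v[of "\<i> *\<^sub>C w"] by (simp_all add: Re_cinner cinner_i_left inner_commute)
    qed
    then have "(v, 0) \<in> Q" by (rule self_adjointI[OF Q])
    then show "v = 0" by (rule ker)
  qed (use sub in \<open>simp_all add: subspace_closure\<close>)
qed

lemma tensor_graph_sym:
  assumes P: "self_adjoint P" and Q: "self_adjoint Q"
    and p: "(p, p') \<in> tensor_graph P Q" and q: "(q, q') \<in> tensor_graph P Q"
  shows "cinner p q' = cinner p' q"
proof -
  let ?G = "{(x \<otimes> y, x' \<otimes> y') |x x' y y'. (x, x') \<in> P \<and> (y, y') \<in> Q}"
  have bl: "bounded_linear (\<lambda>p. cinner (fst p) v)" "bounded_linear (\<lambda>p. cinner (snd p) v)"
    "bounded_linear (\<lambda>p. cinner v (fst p))" "bounded_linear (\<lambda>p. cinner v (snd p))" for v :: "'a \<otimes>\<^sub>H 'b"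
    by (intro bounded_linear_compose[OF bounded_linear_cinner_left] bounded_linear_compose[OF bounded_linear_cinner_right]
        bounded_linear_fst bounded_linear_snd)+
  have 0: "cinner (fst a) (snd b) = cinner (snd a) (fst b)" if "a \<in> ?G" "b \<in> ?G" for a b
    using that self_adjoint_sym[OF P] self_adjoint_sym[OF Q] by (force simp: cinner_tensor)
  have 1: "cinner (fst a) (snd b) = cinner (snd a) (fst b)" if "a \<in> ?G" "b \<in> closure (span ?G)" for a b
    by (rule closed_eq_on_total[OF bl(4,3) 0[OF that(1)] that(2)])
  have "cinner (fst a) (snd b) = cinner (snd a) (fst b)" if "a \<in> closure (span ?G)" "b \<in> closure (span ?G)" for a b
    by (rule closed_eq_on_total[OF bl(1,2) 1[OF _ that(2)] that(1)])
  from this[of "(p, p')" "(q, q')"] show ?thesis using p q by (simp add: tensor_graph_def)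
qed

lemma tensor_graph_gen: "(x, x') \<in> P \<Longrightarrow> (y, y') \<in> Q \<Longrightarrow> (x \<otimes> y, x' \<otimes> y') \<in> tensor_graph P Q"
  unfolding tensor_graph_def by (rule closure_span_superset) blast

section \<open>Modular multiplicative unitaries\<close>

lemma cinner_bar [simp]: "cinner (bar x) (bar y) = cinner y x" by (rule cinner_hconj.abs_eq)
lemma cinner_bar_left: "cinner (bar x) y = cinner (unbar y) x" by (simp add: cinner_hconj.rep_eq bar_inverse)
lemma cinner_bar_right: "cinner y (bar x) = cinner x (unbar y)" by (simp add: cinner_hconj.rep_eq bar_inverse)

lemma bounded_linear_bar: "bounded_linear bar"
proof (rule bounded_linear_intro)
  show "norm (bar x) \<le> norm x * 1" for x :: 'a by (simp add: norm_hconj.abs_eq)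
qed (simp_all add: plus_hconj.abs_eq scaleR_hconj.abs_eq)

lemma total_bar:
  fixes X :: "'a::chilbert_space set"
  assumes "closure (span X) = UNIV" shows "closure (span (bar ` X)) = UNIV"
proof -
  have "bar x \<in> closure (span (bar ` X))" for x
    by (rule bounded_linear_closure_span[OF bounded_linear_bar subspace_closure_span closed_closure, of X])
      (use assms in \<open>auto intro: closure_span_superset\<close>)
  then have "y \<in> closure (span (bar ` X))" for y using unbar_inverse[of y] by metis
  then show ?thesis by blast
qed

lemma total_superset: "closure X = UNIV \<Longrightarrow> closure (span X) = UNIV"
  using closure_mono[OF span_superset[of X]] by blast

lemma blinfun_cinner_eqI:
  fixes S T :: "'a::chilbert_space \<Rightarrow>\<^sub>L 'b::chilbert_space"
  assumes "closure (span X) = UNIV" "closure (span Y) = UNIV"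
    "\<And>x y. x \<in> X \<Longrightarrow> y \<in> Y \<Longrightarrow> cinner x (blinfun_apply S y) = cinner x (blinfun_apply T y)"
  shows "S = T"
  by (rule blinfun_eq_on_total[OF _ assms(2)], rule cinner_total_eqI[OF assms(1)]) (rule assms(3))

text \<open>Here \<open>\<zeta>\<close> sits on legs 1 and 3 and \<open>\<eta>\<close> on legs 1 and
  2. Contracting legs 2 and 3 leaves an inner product of two vectors of the first leg.\<close>

lemma cinner_perm13_assoc:
  "cinner (blinfun_apply perm13 (\<zeta> \<otimes> y)) (blinfun_apply assoc (\<eta> \<otimes> v)) =
    cinner (blinfun_apply (adj (tensor_right v)) \<zeta>) (blinfun_apply (adj (tensor_right y)) \<eta>)"
proof -
  have "adj (tensor_right y) o\<^sub>L adj perm13 o\<^sub>L assoc o\<^sub>L tensor_right v =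
      (adj (adj (tensor_right v)) o\<^sub>L adj (tensor_right y) :: 'a \<otimes>\<^sub>H 'b \<Rightarrow>\<^sub>L 'a \<otimes>\<^sub>H 'c)"
    by (rule htensor_eqI) (simp add: tensor_scaleC_left)
  from arg_cong[OF this, of "\<lambda>S. cinner \<zeta> (blinfun_apply S \<eta>)"]
  have "cinner (blinfun_apply perm13 (\<zeta> \<otimes> y)) (blinfun_apply assoc (\<eta> \<otimes> v)) =
      cinner \<zeta> (blinfun_apply (adj (tensor_right y)) \<eta> \<otimes> v)" by (simp add: adj_right)
  then show ?thesis by (simp add: adj_left)
qed

lemma cinner_perm13_left:
  "cinner (blinfun_apply perm13 (\<zeta> \<otimes> x)) (\<alpha> \<otimes> \<theta>) =
    cinner (blinfun_apply (adj (tensor_left \<alpha>)) \<zeta>) (blinfun_apply (adj (tensor_left x)) \<theta>)"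
proof -
  have "adj (tensor_right x) o\<^sub>L adj perm13 o\<^sub>L tensor_left \<alpha> =
      (adj (adj (tensor_left \<alpha>)) o\<^sub>L adj (tensor_left x) :: 'b \<otimes>\<^sub>H 'c \<Rightarrow>\<^sub>L 'a \<otimes>\<^sub>H 'c)"
    by (rule htensor_eqI) (simp add: tensor_scaleC_right)
  from arg_cong[OF this, of "\<lambda>S. cinner \<zeta> (blinfun_apply S \<theta>)"]
  have "cinner (blinfun_apply perm13 (\<zeta> \<otimes> x)) (\<alpha> \<otimes> \<theta>) =
      cinner \<zeta> (\<alpha> \<otimes> blinfun_apply (adj (tensor_left x)) \<theta>)" by (simp add: adj_right)
  then show ?thesis by (simp add: adj_left)
qed

locale modular_mu =
  fixes W :: "('h::chilbert_space \<otimes>\<^sub>H 'h) op" and Qh Q :: "('h \<times> 'h) set" and Wt :: "('h hconj \<otimes>\<^sub>H 'h) op"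
  assumes ne: "\<exists>x::'h. x \<noteq> 0"
    and W: "unitary W" and Wt: "unitary Wt"
    and pent: "leg23 W o\<^sub>L leg12 W = leg12 W o\<^sub>L leg13 W o\<^sub>L (leg23 W :: ('h \<otimes>\<^sub>H 'h \<otimes>\<^sub>H 'h) op)"
    and Qh: "positive_self_adjoint Qh" and Qh_ker: "\<And>x. (x, 0) \<in> Qh \<Longrightarrow> x = 0"
    and Q: "positive_self_adjoint Q" and Q_ker: "\<And>x. (x, 0) \<in> Q \<Longrightarrow> x = 0"
    and comm: "graph W O tensor_graph Qh Q O graph (adj W) = tensor_graph Qh Q"
    and form1: "\<And>x z y y' u u'. (y, y') \<in> Q \<Longrightarrow> (u', u) \<in> Q \<Longrightarrow>
        cinner (x \<otimes> y) (blinfun_apply W (z \<otimes> u)) = cinner (bar z \<otimes> y') (blinfun_apply Wt (bar x \<otimes> u'))"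
begin

lemma sa: "self_adjoint Qh" "self_adjoint Q"
  using Qh Q by (simp_all add: positive_self_adjoint_def)

lemma total_Domain: "closure (span (Domain Qh)) = UNIV" "closure (span (Domain Q)) = UNIV"
  using self_adjoint_dense[OF sa(1)] self_adjoint_dense[OF sa(2)] by simp_all

lemma total_Range: "closure (span (Range Qh)) = UNIV" "closure (span (Range Q)) = UNIV"
  by (rule total_superset, rule self_adjoint_Range_dense, rule sa, erule Qh_ker)
    (rule total_superset, rule self_adjoint_Range_dense, rule sa, erule Q_ker)

lemma bops_W [simp]: "W \<in> bops" "Wt \<in> bops" using W Wt by simp_all

lemma tensor_graph_W:
  assumes "(p, q) \<in> tensor_graph Qh Q"
  shows "(blinfun_apply W p, blinfun_apply W q) \<in> tensor_graph Qh Q"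
proof -
  have "(p, q) \<in> graph W O tensor_graph Qh Q O graph (adj W)" unfolding comm by (rule assms)
  then obtain c where "(blinfun_apply W p, c) \<in> tensor_graph Qh Q" "q = blinfun_apply (adj W) c"
    unfolding graph_def by blast
  then show ?thesis using W by simp
qed

text \<open>By \<open>form1\<close> the left side is a coefficient of \<open>W\<close> with
  \<open>Q\<close> on the second leg. As \<open>W\<close> commutes with
  \<open>Qh \<otimes> Q\<close>, moving that operator across cancels \<open>Q\<close> and leaves
  \<open>Qh\<close> on the first leg; density then frees \<open>y\<close> and \<open>u\<close> from
  all domain conditions.\<close>

lemma form2:
  assumes x: "(x, x') \<in> Qh" and z: "(z0, z) \<in> Qh"
  shows "cinner (bar z \<otimes> y) (blinfun_apply Wt (bar x \<otimes> u)) = cinner (x' \<otimes> y) (blinfun_apply W (z0 \<otimes> u))"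
proof -
  have el: "cinner (bar z \<otimes> y) (blinfun_apply Wt (bar x \<otimes> u)) = cinner (x' \<otimes> y) (blinfun_apply W (z0 \<otimes> u))"
    if y: "(y0, y) \<in> Q" and u: "(u, v) \<in> Q" for y0 y u v
  proof -
    have "cinner (bar z \<otimes> y) (blinfun_apply Wt (bar x \<otimes> u)) = cinner (x \<otimes> y0) (blinfun_apply W (z \<otimes> v))"
      by (rule form1[OF y u, symmetric])
    also have "\<dots> = cinner (x' \<otimes> y) (blinfun_apply W (z0 \<otimes> u))"
      by (rule tensor_graph_sym[OF sa tensor_graph_gen[OF x y] tensor_graph_W[OF tensor_graph_gen[OF z u]]])
    finally show ?thesis .
  qed
  have 1: "cinner (bar z \<otimes> y) (blinfun_apply Wt (bar x \<otimes> u)) = cinner (x' \<otimes> y) (blinfun_apply W (z0 \<otimes> u))"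
    if "y \<in> Range Q" for y u
    by (rule closed_eq_on_total[of "\<lambda>u. cinner (bar z \<otimes> y) (blinfun_apply Wt (bar x \<otimes> u))"
          "\<lambda>u. cinner (x' \<otimes> y) (blinfun_apply W (z0 \<otimes> u))" "Domain Q"])
      (use el that total_Domain(2) in \<open>auto intro!: bounded_linear_compose[OF bounded_linear_cinner_right]
        bounded_linear_compose[OF blinfun.bounded_linear_right] bounded_linear_tensor_right\<close>)
  show ?thesis
    by (rule closed_eq_on_total[of "\<lambda>y. cinner (bar z \<otimes> y) (blinfun_apply Wt (bar x \<otimes> u))"
          "\<lambda>y. cinner (x' \<otimes> y) (blinfun_apply W (z0 \<otimes> u))" "Range Q"])
      (use 1 total_Range(2) in \<open>auto intro!: bounded_linear_compose[OF bounded_linear_cinner_left] bounded_linear_tensor_right\<close>)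
qed

lemma form2_leg12:
  fixes \<xi> \<eta> :: "'h \<otimes>\<^sub>H 'h"
  assumes x: "(x, x') \<in> Qh" and z: "(z0, z) \<in> Qh"
  shows "cinner (bar z \<otimes> \<xi>) (blinfun_apply (leg12 Wt) (bar x \<otimes> \<eta>)) =
      cinner (x' \<otimes> \<xi>) (blinfun_apply (leg12 W) (z0 \<otimes> \<eta>))"
proof -
  have el: "cinner (b \<otimes> y \<otimes> y2) (blinfun_apply (leg12 T) (a \<otimes> u \<otimes> u2)) =
      cinner (b \<otimes> y) (blinfun_apply T (a \<otimes> u)) * cinner y2 u2"
    if T: "T \<in> bops" for T :: "('x::chilbert_space \<otimes>\<^sub>H 'h) op" and a b and y u y2 u2 :: 'h
  proof -
    have "cinner (b \<otimes> y \<otimes> y2) (blinfun_apply (leg12 T) (a \<otimes> u \<otimes> u2)) =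
        cinner (blinfun_apply assoc ((b \<otimes> y) \<otimes> y2)) (blinfun_apply assoc (blinfun_apply T (a \<otimes> u) \<otimes> u2))"
      using T by simp
    then show ?thesis by (simp only: unitary_cinner[OF unitary_assoc] cinner_tensor)
  qed
  have "adj (tensor_left (bar z)) o\<^sub>L leg12 Wt o\<^sub>L tensor_left (bar x) =
      (adj (tensor_left x') o\<^sub>L leg12 W o\<^sub>L tensor_left z0 :: ('h \<otimes>\<^sub>H 'h) op)"
    by (rule blinfun_cinner_eqI[OF closure_span_tensor closure_span_tensor])
      (auto simp: adj_right el form2[OF x z] simp del: leg12_tensor)
  from arg_cong[OF this, of "\<lambda>S. cinner \<xi> (blinfun_apply S \<eta>)"] show ?thesis by (simp add: adj_right)
qed

lemma adj_pent: "leg23 W o\<^sub>L leg12 W o\<^sub>L leg23 (adj W) = leg12 W o\<^sub>L (leg13 W :: ('h \<otimes>\<^sub>H 'h \<otimes>\<^sub>H 'h) op)"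
  unfolding pent using W by (simp add: comp_assoc flip: adj_leg23)

text \<open>By \<open>form2\<close>, \<open>Wt\<close> is \<open>W\<close> transposed on its first
  leg, up to conjugation by \<open>Qh\<close>. Transposition reverses products, so the pentagon
  equation in the form \<open>adj_pent\<close> returns with the two factors on the right in opposite
  order.\<close>

theorem pent_tilde:
  "leg23 W o\<^sub>L leg12 Wt o\<^sub>L leg23 (adj W) = (leg13 Wt o\<^sub>L leg12 Wt :: ('h hconj \<otimes>\<^sub>H 'h \<otimes>\<^sub>H 'h) op)"
proof (rule blinfun_cinner_eqI)
  let ?X = "{w \<otimes> \<xi> |w \<xi>. w \<in> bar ` Range Qh \<and> \<xi> \<in> {y \<otimes> y2 |(y::'h) (y2::'h). True}}"
  let ?Y = "{w \<otimes> \<xi> |w \<xi>. w \<in> bar ` Domain Qh \<and> \<xi> \<in> {y \<otimes> y2 |(y::'h) (y2::'h). True}}"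
  show "closure (span ?X) = UNIV" "closure (span ?Y) = UNIV"
    by (intro total_tensor total_bar closure_span_tensor total_Range total_Domain)+
  fix p q assume "p \<in> ?X" "q \<in> ?Y"
  then obtain z0 z y y2 x x' u u2 where p: "p = bar z \<otimes> y \<otimes> y2" and z: "(z0, z) \<in> Qh"
    and q: "q = bar x \<otimes> u \<otimes> u2" and x: "(x, x') \<in> Qh" by blast
  \<comment> \<open>The vectors of the first leg that remain when the other legs are contracted.
    \<open>Qh\<close> sends \<open>unbar b\<close> to \<open>a'\<close> and \<open>b'\<close> to
    \<open>unbar a\<close>; its symmetry is the step from the primed to the unprimed pair.\<close>
  define a where "a = blinfun_apply (adj (tensor_right u2)) (blinfun_apply (adj Wt) (bar z \<otimes> y2))"
  define b where "b = blinfun_apply (adj (tensor_right y)) (blinfun_apply Wt (bar x \<otimes> u))"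
  define a' where "a' = blinfun_apply (adj (tensor_right u)) (blinfun_apply (adj W) (x' \<otimes> y))"
  define b' where "b' = blinfun_apply (adj (tensor_right y2)) (blinfun_apply W (z0 \<otimes> u2))"
  have "cinner p (blinfun_apply (leg23 W o\<^sub>L leg12 Wt o\<^sub>L leg23 (adj W)) q) =
      cinner (bar z \<otimes> blinfun_apply (adj W) (y \<otimes> y2)) (blinfun_apply (leg12 Wt) (bar x \<otimes> blinfun_apply (adj W) (u \<otimes> u2)))"
    by (simp add: p q adj_leg23 flip: adj_left leg23_tensor)
  also have "\<dots> = cinner (x' \<otimes> blinfun_apply (adj W) (y \<otimes> y2)) (blinfun_apply (leg12 W) (z0 \<otimes> blinfun_apply (adj W) (u \<otimes> u2)))"
    by (rule form2_leg12[OF x z])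
  also have "\<dots> = cinner (x' \<otimes> y \<otimes> y2) (blinfun_apply (leg23 W o\<^sub>L leg12 W o\<^sub>L leg23 (adj W)) (z0 \<otimes> u \<otimes> u2))"
    by (simp add: adj_leg23 flip: adj_left leg23_tensor)
  also have "\<dots> = cinner (blinfun_apply (leg12 (adj W)) (x' \<otimes> y \<otimes> y2)) (blinfun_apply (leg13 W) (z0 \<otimes> u \<otimes> u2))"
    unfolding adj_pent by (simp add: adj_left flip: adj_leg12 del: leg12_tensor leg13_tensor)
  also have "\<dots> = cnj (cinner (blinfun_apply perm13 (blinfun_apply W (z0 \<otimes> u2) \<otimes> u)) (blinfun_apply assoc (blinfun_apply (adj W) (x' \<otimes> y) \<otimes> y2)))"
    by (subst cinner_commute) simp
  also have "\<dots> = cinner a' b'" unfolding cinner_perm13_assoc a'_def b'_def by (rule cinner_commute[symmetric])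
  also have "\<dots> = cinner (unbar b) (unbar a)"
  proof (rule self_adjoint_sym[OF sa(1)])
    show "(unbar b, a') \<in> Qh"
    proof (rule self_adjointI[OF sa(1)])
      fix r s assume rs: "(r, s) \<in> Qh"
      have "cinner r a' = cinner (blinfun_apply W (r \<otimes> u)) (x' \<otimes> y)" by (simp add: a'_def adj_right)
      also have "\<dots> = cnj (cinner (bar s \<otimes> y) (blinfun_apply Wt (bar x \<otimes> u)))"
        unfolding form2[OF x rs] by (rule cinner_commute)
      also have "\<dots> = cnj (cinner (bar s) b)" by (simp add: b_def adj_right)
      also have "\<dots> = cinner s (unbar b)" unfolding cinner_bar_left by (rule cinner_commute[symmetric])
      finally show "cinner s (unbar b) = cinner r a'" by simp
    qed
    show "(b', unbar a) \<in> Qh"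
    proof (rule self_adjointI[OF sa(1)])
      fix r s assume rs: "(r, s) \<in> Qh"
      have "cinner s b' = cinner (s \<otimes> y2) (blinfun_apply W (z0 \<otimes> u2))" by (simp add: b'_def adj_right)
      also have "\<dots> = cinner (bar z \<otimes> y2) (blinfun_apply Wt (bar r \<otimes> u2))" by (rule form2[OF rs z, symmetric])
      also have "\<dots> = cinner a (bar r)" by (simp add: a_def adj_left)
      also have "\<dots> = cinner r (unbar a)" by (rule cinner_bar_right)
      finally show "cinner s b' = cinner r (unbar a)" .
    qed
  qed
  also have "\<dots> = cinner a b" by (simp add: cinner_hconj.rep_eq)
  also have "\<dots> = cinner (blinfun_apply perm13 (blinfun_apply (adj Wt) (bar z \<otimes> y2) \<otimes> y)) (blinfun_apply assoc (blinfun_apply Wt (bar x \<otimes> u) \<otimes> u2))"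
    unfolding cinner_perm13_assoc a_def b_def ..
  also have "\<dots> = cinner (blinfun_apply (leg13 (adj Wt)) p) (blinfun_apply (leg12 Wt) q)"
    unfolding p q by simp
  also have "\<dots> = cinner p (blinfun_apply (leg13 Wt o\<^sub>L leg12 Wt) q)" by (simp add: adj_left flip: adj_leg13)
  finally show "cinner p (blinfun_apply (leg23 W o\<^sub>L leg12 Wt o\<^sub>L leg23 (adj W)) q) =
      cinner p (blinfun_apply (leg13 Wt o\<^sub>L leg12 Wt) q)" .
qed

lemma pent_conj:
  "adj (leg13 Wt) o\<^sub>L leg23 W = (leg12 Wt o\<^sub>L leg23 W o\<^sub>L adj (leg12 Wt) :: ('h hconj \<otimes>\<^sub>H 'h \<otimes>\<^sub>H 'h) op)"
proof -
  have "leg12 Wt o\<^sub>L (leg23 W :: ('h hconj \<otimes>\<^sub>H 'h \<otimes>\<^sub>H 'h) op) =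
      adj (leg13 Wt) o\<^sub>L (leg13 Wt o\<^sub>L leg12 Wt) o\<^sub>L leg23 W"
    using Wt by (simp add: comp_assoc)
  also have "\<dots> = adj (leg13 Wt) o\<^sub>L (leg23 W o\<^sub>L leg12 Wt)"
    unfolding pent_tilde[symmetric] using W by (simp add: comp_assoc flip: adj_leg23)
  finally show ?thesis using Wt by (simp add: comp_assoc)
qed

lemma mcoeff_tilde: "(x, x') \<in> Qh \<Longrightarrow> (z0, z) \<in> Qh \<Longrightarrow> mcoeff (bar z) (bar x) Wt = mcoeff x' z0 W"
  by (intro blinfun_eqI cinner_extI) (simp add: cinner_mcoeff form2)

text \<open>For vectors from the dense domain and range of \<open>Qh\<close>, the slices of
  \<open>Wt\<close> and of \<open>W\<close> are the same operators by
  \<open>mcoeff_tilde\<close>.\<close>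

lemma qg_algebra_tilde: "qg_algebra W = closure (span {mcoeff \<alpha> \<beta> Wt |\<alpha> \<beta>. True})"
proof -
  have 1: "mcoeff \<alpha> \<beta> Wt \<in> closure (span {mcoeff x z W |x z. True})" for \<alpha> \<beta>
  proof (rule mcoeff_closure_span)
    show "\<alpha> \<in> closure (span (bar ` Range Qh))" "\<beta> \<in> closure (span (bar ` Domain Qh))"
      by (simp_all add: total_bar total_Range total_Domain)
    show "mcoeff p q Wt \<in> closure (span {mcoeff x z W |x z. True})"
      if pq: "p \<in> bar ` Range Qh" "q \<in> bar ` Domain Qh" for p q
    proof -
      obtain x x' z0 z where "p = bar z" "q = bar x" "(x, x') \<in> Qh" "(z0, z) \<in> Qh" using pq by blast
      then have "mcoeff p q Wt = mcoeff x' z0 W" by (simp add: mcoeff_tilde)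
      then show ?thesis by (intro closure_span_superset) blast
    qed
  qed simp_all
  have 2: "mcoeff x z W \<in> closure (span {mcoeff \<alpha> \<beta> Wt |\<alpha> \<beta>. True})" for x z
  proof (rule mcoeff_closure_span)
    show "x \<in> closure (span (Range Qh))" "z \<in> closure (span (Domain Qh))"
      by (simp_all add: total_Range total_Domain)
    show "mcoeff p q W \<in> closure (span {mcoeff \<alpha> \<beta> Wt |\<alpha> \<beta>. True})" if pq: "p \<in> Range Qh" "q \<in> Domain Qh" for p q
    proof -
      obtain x z where "(x, p) \<in> Qh" "(q, z) \<in> Qh" using pq by blast
      then have "mcoeff p q W = mcoeff (bar z) (bar x) Wt" by (simp add: mcoeff_tilde)
      then show ?thesis by (intro closure_span_superset) blast
    qed
  qed simp_all
  show ?thesis unfolding qg_algebra_eq[OF bops_W(1)]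
    by (intro equalityI closure_minimal span_minimal) (use 1 2 in auto)
qed

section \<open>Products of slices\<close>

lemma mcoeff_in: "mcoeff x z W \<in> qg_algebra W"
  unfolding qg_algebra_eq[OF bops_W(1)] by (rule closure_span_superset) blast

text \<open>\<open>W\<close> on legs 2 and 3, regrouped so that it can be sliced by vectors of the
  first two legs jointly. An entangled vector is allowed there, and \<open>mcoeff_MW\<close> shows
  that the slice stays in the algebra.\<close>

definition MW :: "(('h hconj \<otimes>\<^sub>H 'h) \<otimes>\<^sub>H 'h) op" where "MW = adj assoc o\<^sub>L leg23 W o\<^sub>L assoc"

lemma mcoeff_MW_tensor: "mcoeff (a \<otimes> x) (b \<otimes> y) MW = scaleC_op (cinner a b) (mcoeff x y W)"
  by (intro blinfun_eqI cinner_extI)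
    (simp add: MW_def cinner_mcoeff adj_right cinner_scaleC_right cinner_tensor)

lemma mcoeff_MW: "mcoeff \<xi> \<eta> MW \<in> qg_algebra W"
proof (rule mcoeff_closure_span)
  show "\<xi> \<in> closure (span {x \<otimes> y |x y. True})" "\<eta> \<in> closure (span {x \<otimes> y |x y. True})"
    unfolding closure_span_tensor by simp_all
  show "subspace (qg_algebra W)" "closed (qg_algebra W)" unfolding qg_algebra_eq[OF bops_W(1)] by simp_all
  show "mcoeff p q MW \<in> qg_algebra W" if pq: "p \<in> {x \<otimes> y |x y. True}" "q \<in> {x \<otimes> y |x y. True}" for p q
  proof -
    obtain a x b y where "p = a \<otimes> x" "q = b \<otimes> y" using pq by blast
    then have "mcoeff p q MW = scaleC_op (cinner a b) (mcoeff x y W)" by (simp only: mcoeff_MW_tensor)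
    then show ?thesis using qg_algebra_scaleC[OF bops_W(1) mcoeff_in] by simp
  qed
qed

text \<open>The product is a slice of \<open>adj (leg13 Wt) o\<^sub>L leg23 W\<close>, which
  \<open>pent_conj\<close> turns into a conjugate of \<open>leg23 W\<close> by a unitary on the two
  sliced legs; that unitary is absorbed into the slicing vectors.\<close>

lemma adj_mcoeff_comp:
  "adj (mcoeff \<alpha> \<beta> Wt) o\<^sub>L mcoeff x y W = mcoeff (blinfun_apply (adj Wt) (\<beta> \<otimes> x)) (blinfun_apply (adj Wt) (\<alpha> \<otimes> y)) MW"
proof (intro blinfun_eqI cinner_extI)
  fix d c :: 'h
  have "cinner c (blinfun_apply (adj (mcoeff \<alpha> \<beta> Wt) o\<^sub>L mcoeff x y W) d) =
      cinner (blinfun_apply (mcoeff \<alpha> \<beta> Wt) c) (blinfun_apply (mcoeff x y W) d)" by (simp add: adj_right)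
  also have "\<dots> = cinner (blinfun_apply perm13 (blinfun_apply Wt (\<beta> \<otimes> c) \<otimes> x)) (\<alpha> \<otimes> blinfun_apply W (y \<otimes> d))"
    unfolding cinner_perm13_left by (simp add: mcoeff_def)
  also have "\<dots> = cinner (\<beta> \<otimes> x \<otimes> c) (blinfun_apply (adj (leg13 Wt) o\<^sub>L leg23 W) (\<alpha> \<otimes> y \<otimes> d))"
    by (simp add: adj_right)
  also have "\<dots> = cinner (blinfun_apply (leg12 (adj Wt)) (\<beta> \<otimes> x \<otimes> c)) (blinfun_apply (leg23 W) (blinfun_apply (leg12 (adj Wt)) (\<alpha> \<otimes> y \<otimes> d)))"
    unfolding pent_conj by (simp add: adj_left del: leg12_tensor flip: adj_leg12)
  also have "\<dots> = cinner c (blinfun_apply (mcoeff (blinfun_apply (adj Wt) (\<beta> \<otimes> x)) (blinfun_apply (adj Wt) (\<alpha> \<otimes> y)) MW) d)"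
    by (simp add: cinner_mcoeff MW_def adj_right)
  finally show "cinner c (blinfun_apply (adj (mcoeff \<alpha> \<beta> Wt) o\<^sub>L mcoeff x y W) d) =
      cinner c (blinfun_apply (mcoeff (blinfun_apply (adj Wt) (\<beta> \<otimes> x)) (blinfun_apply (adj Wt) (\<alpha> \<otimes> y)) MW) d)" .
qed

lemma qg_subspace: "subspace (qg_algebra W)"
  unfolding qg_algebra_eq[OF bops_W(1)] by (rule subspace_closure_span)

lemma qg_closed: "closed (qg_algebra W)"
  unfolding qg_algebra_def by (rule closed_closure)

text \<open>The factor \<open>b\<close> is approximated by slices of \<open>W\<close> and
  \<open>a\<close> by slices of \<open>Wt\<close>. For the latter the adjoint product
  \<open>adj b o\<^sub>L a\<close> is considered, which depends linearly on \<open>a\<close> without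
  restriction to \<open>bops\<close>.\<close>

lemma qg_adj_comp:
  assumes a: "a \<in> qg_algebra W" and b: "b \<in> qg_algebra W"
  shows "adj a o\<^sub>L b \<in> qg_algebra W"
proof -
  have 1: "adj (mcoeff \<alpha> \<beta> Wt) o\<^sub>L b \<in> qg_algebra W" for \<alpha> \<beta>
  proof (rule bounded_linear_closure_span[where f = "\<lambda>S. adj (mcoeff \<alpha> \<beta> Wt) o\<^sub>L S" and
        S = "{mcoeff x z W |x z. True}" and T = "qg_algebra W"])
    show "bounded_linear (\<lambda>S. adj (mcoeff \<alpha> \<beta> Wt) o\<^sub>L S)" by (rule bounded_linear_comp_right)
    show "subspace (qg_algebra W)" by (rule qg_subspace)
    show "closed (qg_algebra W)" by (rule qg_closed)
    show "b \<in> closure (span {mcoeff x z W |x z. True})" using b unfolding qg_algebra_eq[OF bops_W(1)] .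
    fix s assume "s \<in> {mcoeff x z W |x z. True}"
    then obtain x z where "s = mcoeff x z W" by blast
    then show "adj (mcoeff \<alpha> \<beta> Wt) o\<^sub>L s \<in> qg_algebra W" by (simp only: adj_mcoeff_comp mcoeff_MW)
  qed
  have 2: "adj b o\<^sub>L mcoeff \<alpha> \<beta> Wt \<in> {T \<in> bops. adj T \<in> qg_algebra W}" for \<alpha> \<beta>
    using 1[of \<alpha> \<beta>] subsetD[OF qg_algebra_bops[OF bops_W(1)] b] by (simp add: adj_comp)
  have "adj b o\<^sub>L a \<in> {T \<in> bops. adj T \<in> qg_algebra W}"
  proof (rule bounded_linear_closure_span[where f = "\<lambda>S. adj b o\<^sub>L S" and
        S = "{mcoeff \<alpha> \<beta> Wt |\<alpha> \<beta>. True}" and T = "{T \<in> bops. adj T \<in> qg_algebra W}"])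
    show "bounded_linear (\<lambda>S. adj b o\<^sub>L S)" by (rule bounded_linear_comp_right)
    show "subspace {T \<in> bops. adj T \<in> qg_algebra W}" by (rule subspace_adj_image[OF qg_subspace])
    show "closed {T \<in> bops. adj T \<in> qg_algebra W}"
      by (rule closed_adj_image[OF qg_closed qg_algebra_bops[OF bops_W(1)]])
    show "a \<in> closure (span {mcoeff \<alpha> \<beta> Wt |\<alpha> \<beta>. True})" using a unfolding qg_algebra_tilde .
    fix s assume "s \<in> {mcoeff \<alpha> \<beta> Wt |\<alpha> \<beta>. True}"
    then obtain \<alpha> \<beta> where "s = mcoeff \<alpha> \<beta> Wt" by blast
    then show "adj b o\<^sub>L s \<in> {T \<in> bops. adj T \<in> qg_algebra W}" by (simp only: 2)
  qed
  moreover have "adj (adj b o\<^sub>L a) = adj a o\<^sub>L b"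
    using subsetD[OF qg_algebra_bops[OF bops_W(1)]] a b by (simp add: adj_comp)
  ultimately show ?thesis by simp
qed

text \<open>The vectors \<open>adj Wt (\<beta> \<otimes> x)\<close> are total because
  \<open>Wt\<close> is unitary. So \<open>adj_mcoeff_comp\<close> can be read backwards: every slice
  of \<open>MW\<close> is a limit of sums of such products.\<close>

lemma qg_sub_adj_comp: "qg_algebra W \<subseteq> closure (span {adj a o\<^sub>L b |a b. a \<in> qg_algebra W \<and> b \<in>
    qg_algebra W})" (is "_ \<subseteq> ?S")
proof -
  from ne obtain x0 :: 'h where x0: "x0 \<noteq> 0" by (elim exE)
  \<comment> \<open>A unit vector of the conjugate space: slicing \<open>MW\<close> by
    \<open>a \<otimes> x\<close> and \<open>a \<otimes> y\<close> gives back the slice of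
    \<open>W\<close> by \<open>x\<close> and \<open>y\<close>.\<close>
  define a where "a = bar ((1 / norm x0) *\<^sub>R x0)"
  have a: "cinner a a = 1" using x0 by (simp add: a_def cinner_self norm_hconj.abs_eq flip: cinner_hconj.abs_eq)
  have tot: "closure (span {blinfun_apply (adj Wt) (\<beta> \<otimes> x) |\<beta> x. True}) = UNIV" (is "closure (span ?X) = _")
  proof -
    have "blinfun_apply (adj Wt) f \<in> closure (span ?X)" for f
    proof (rule bounded_linear_closure_span[OF blinfun.bounded_linear_right])
      show "f \<in> closure (span {x \<otimes> y |x y. True})" unfolding closure_span_tensor by (rule UNIV_I)
      show "blinfun_apply (adj Wt) g \<in> closure (span ?X)" if "g \<in> {x \<otimes> y |x y. True}" for g
        using that by (intro closure_span_superset) blast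
    qed simp_all
    from this[of "blinfun_apply Wt f" for f] have "f \<in> closure (span ?X)" for f
      by (simp only: unitary_adj_apply[OF Wt])
    then show ?thesis by (intro UNIV_eq_I[symmetric])
  qed
  have "mcoeff \<xi> \<eta> MW \<in> ?S" for \<xi> \<eta>
  proof (rule mcoeff_closure_span)
    show "\<xi> \<in> closure (span ?X)" "\<eta> \<in> closure (span ?X)" unfolding tot by simp_all
    show "mcoeff p q MW \<in> ?S" if pq: "p \<in> ?X" "q \<in> ?X" for p q
    proof -
      obtain \<alpha> \<beta> x y where "p = blinfun_apply (adj Wt) (\<beta> \<otimes> x)" "q = blinfun_apply (adj Wt) (\<alpha> \<otimes> y)" using pq
        by blast
      then have "mcoeff p q MW = adj (mcoeff \<alpha> \<beta> Wt) o\<^sub>L mcoeff x y W" by (simp add: adj_mcoeff_comp)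
      moreover have "mcoeff \<alpha> \<beta> Wt \<in> qg_algebra W"
        unfolding qg_algebra_tilde by (rule closure_span_superset) blast
      ultimately show ?thesis using mcoeff_in[of x y] by (intro closure_span_superset) blast
    qed
  qed simp_all
  from this[of "a \<otimes> _" "a \<otimes> _"] have "mcoeff x y W \<in> ?S" for x y
    unfolding mcoeff_MW_tensor a by (simp add: scaleC_op_of_real[of 1, simplified])
  then show ?thesis unfolding qg_algebra_eq[OF bops_W(1)] by (intro closure_minimal span_minimal) auto
qed

text \<open>Neither adjoints nor products are evident by themselves. The closed span of the products
  \<open>adj a o\<^sub>L b\<close> contains the algebra, and the adjoint of each such product lies
  in the algebra; this yields closure under adjoints, and then under products.\<close>

theorem cstar_qg_algebra: "cstar_algebra (qg_algebra W)"
proof -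
  note qb = subsetD[OF qg_algebra_bops[OF bops_W(1)]]
  have "closure (span {adj a o\<^sub>L b |a b. a \<in> qg_algebra W \<and> b \<in> qg_algebra W}) \<subseteq> {T \<in> bops. adj T \<in> qg_algebra W}"
  proof (intro closure_minimal span_minimal subspace_adj_image[OF qg_subspace] closed_adj_image[OF qg_closed qg_algebra_bops[OF bops_W(1)]] subsetI)
    fix s assume "s \<in> {adj a o\<^sub>L b |a b. a \<in> qg_algebra W \<and> b \<in> qg_algebra W}"
    then obtain a b where s: "s = adj a o\<^sub>L b" "a \<in> qg_algebra W" "b \<in> qg_algebra W"
      by blast
    then show "s \<in> {T \<in> bops. adj T \<in> qg_algebra W}" using qg_adj_comp[OF s(3,2)] by (simp add: adj_comp qb)
  qed
  then have adj: "adj a \<in> qg_algebra W" if "a \<in> qg_algebra W" for a using qg_sub_adj_comp that by blast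
  have comp: "a o\<^sub>L b \<in> qg_algebra W" if "a \<in> qg_algebra W" "b \<in> qg_algebra W" for a b
    using qg_adj_comp[OF adj[OF that(1)] that(2)] that(1) by (simp add: qb)
  show ?thesis unfolding cstar_algebra_def
    using qg_algebra_bops[OF bops_W(1)] qg_subspace qg_closed qg_algebra_scaleC[OF bops_W(1)] qg_algebra_total(1)[OF W ne] adj comp
    by blast
qed

end

section \<open>Resolvents of positive self-adjoint operators\<close>

lemma positive_inner: "positive_self_adjoint A \<Longrightarrow> (x, y) \<in> A \<Longrightarrow> 0 \<le> inner x y"
  unfolding positive_self_adjoint_def Re_cinner[symmetric] by (auto simp: complex_nonneg_Reals_iff)

text \<open>\<open>R\<close> is the inverse of \<open>1 + t A\<close>. By positivity
  \<open>norm x\<close> is at most the norm of \<open>x + t *\<^sub>R y\<close> for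
  \<open>(x, y)\<close> in \<open>A\<close>, so the inverse is a well-defined contraction; the range
  of \<open>1 + t A\<close> is dense by positivity and self-adjointness.\<close>

lemma resolvent_exists:
  fixes A :: "('a::chilbert_space \<times> 'a) set"
  assumes A: "positive_self_adjoint A" and t: "t > 0"
  shows "\<exists>R. R \<in> bops \<and> adj R = R \<and> norm R \<le> 1 \<and>
    (\<forall>x. (blinfun_apply R x, (1 / t) *\<^sub>R (x - blinfun_apply R x)) \<in> A) \<and>
    (\<forall>x y. (x, y) \<in> A \<longrightarrow> blinfun_apply R (x + t *\<^sub>R y) = x)"
proof -
  have sa: "self_adjoint A" using A by (simp add: positive_self_adjoint_def)
  note sub = self_adjoint_subspace[OF sa]
  define F where "F p = (fst p + t *\<^sub>R snd p, fst p)" for p :: "'a \<times> 'a"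
  have "bounded_linear F" unfolding F_def
    by (intro bounded_linear_Pair bounded_linear_add bounded_linear_fst
        bounded_linear_compose[OF bounded_linear_scaleR_right bounded_linear_snd])
  then have subF: "subspace (F ` A)"
    using linear_subspace_image[OF bounded_linear.linear sub] by blast
  have le: "norm x \<le> norm (x + t *\<^sub>R y)" if "(x, y) \<in> A" for x y
  proof -
    have "(norm x)\<^sup>2 \<le> (norm x)\<^sup>2 + 2 * t * inner x y + (norm (t *\<^sub>R y))\<^sup>2"
      using positive_inner[OF A that] t by simp
    also have "\<dots> = (norm (x + t *\<^sub>R y))\<^sup>2" 
      unfolding power2_norm_eq_inner by (simp add: inner_add inner_commute)
    finally show ?thesis by (rule power2_le_imp_le) simp
  qed
  have tot: "closure (span ({x + t *\<^sub>R y |x y. (x, y) \<in> A})) = UNIV"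
  proof (rule closed_subspace_eq_UNIV)
    fix z assume z: "\<And>y. y \<in> closure (span ({x + t *\<^sub>R y |x y. (x, y) \<in> A})) \<Longrightarrow> inner z y = 0"
    have i0: "inner z (x + t *\<^sub>R y) = 0" if xy: "(x, y) \<in> A" for x y
    proof (rule z, rule closure_span_superset)
      show "x + t *\<^sub>R y \<in> {x + t *\<^sub>R y |x y. (x, y) \<in> A}"
        using xy by blast
    qed
    have "cinner y z = cinner x (- (1 / t) *\<^sub>R z)" if xy: "(x, y) \<in> A" for x y
    proof -
      have "cinner z (x + t *\<^sub>R y) = 0"
      proof (rule complex_eqI)
        show "Re (cinner z (x + t *\<^sub>R y)) = Re 0" using i0[OF xy] by (simp add: Re_cinner)
        show "Im (cinner z (x + t *\<^sub>R y)) = Im 0"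
          using i0[OF self_adjoint_scaleC[OF sa xy, of \<i>]] by (simp add: Im_cinner scaleC_add_right scaleC_scaleR)
      qed
      then have "cinner (x + t *\<^sub>R y) z = 0" using cinner_commute[of "x + t *\<^sub>R y" z] by simp
      then have "of_real t * cinner y z = - cinner x z"
        by (simp add: cinner_add_left cinner_scaleR_left add_eq_0_iff)
      then show ?thesis using t by (simp add: cinner_scaleR_right cinner_minus_right field_simps)
    qed
    \<comment> \<open>A vector orthogonal to the range is an eigenvector of \<open>A\<close> for the
      eigenvalue \<open>- 1 / t\<close>, which positivity excludes unless it is 0.\<close>
    then have "(z, - (1 / t) *\<^sub>R z) \<in> A" by (rule self_adjointI[OF sa])
    then have "0 \<le> inner z (- (1 / t) *\<^sub>R z)" by (rule positive_inner[OF A])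
    then have "(1 / t) * inner z z \<le> 0" by simp
    then have "inner z z \<le> 0" using t by (simp add: divide_le_0_iff)
    then show "z = 0" using inner_ge_zero[of z] by (simp add: antisym)
  qed simp_all
  have im: "fst ` F ` A = {x + t *\<^sub>R y |x y. (x, y) \<in> A}" by (force simp: F_def image_iff)
  have "\<exists>R. (\<forall>(u, u')\<in>F ` A. blinfun_apply R u = u') \<and> norm R \<le> 1"
  proof (rule blinfun_of_graph)
    show "norm u' \<le> 1 * norm u" if "(u, u') \<in> span (F ` A)" for u u'
      using that le unfolding span_eq_iff[THEN iffD2, OF subF] by (auto simp: F_def)
    show "closure (span (fst ` F ` A)) = UNIV" unfolding im by (rule tot)
  qed simp
  then obtain R where R: "\<forall>(u, u')\<in>F ` A. blinfun_apply R u = u'" and nR: "norm R \<le> 1" by blast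
  have inv: "blinfun_apply R (x + t *\<^sub>R y) = x" if "(x, y) \<in> A" for x y
    using bspec[OF R imageI[OF that]] by (simp add: F_def)
  have gr: "(blinfun_apply R x, (1 / t) *\<^sub>R (x - blinfun_apply R x)) \<in> A" for x
  proof (rule bounded_linear_closure_span[where f = "\<lambda>x. (blinfun_apply R x, (1 / t) *\<^sub>R (x - blinfun_apply R x))"])
    show "x \<in> closure (span {x + t *\<^sub>R y |x y. (x, y) \<in> A})" unfolding tot by simp
    show "bounded_linear (\<lambda>x. (blinfun_apply R x, (1 / t) *\<^sub>R (x - blinfun_apply R x)))"
      by (intro bounded_linear_Pair bounded_linear_compose[OF bounded_linear_scaleR_right] bounded_linear_sub
          bounded_linear_ident blinfun.bounded_linear_right)
    show "(blinfun_apply R s, (1 / t) *\<^sub>R (s - blinfun_apply R s)) \<in> A" if "s \<in> {x + t *\<^sub>R y |x y. (x, y) \<in> A}" for s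
      using that t by (auto simp: inv)
  qed (simp_all add: sub self_adjoint_closed[OF sa])
  let ?y = "\<lambda>f. (1 / t) *\<^sub>R (f - blinfun_apply R f)"
  have dec: "f = blinfun_apply R f + t *\<^sub>R ?y f" for f using t by simp
  have "R \<in> bops" unfolding bops_def
  proof (intro CollectI allI)
    fix c f
    have "blinfun_apply R (c *\<^sub>C (blinfun_apply R f + t *\<^sub>R ?y f)) = c *\<^sub>C blinfun_apply R f"
      using inv[OF self_adjoint_scaleC[OF sa gr, of c f]] by (simp add: scaleC_add_right scaleC_scaleR)
    then show "blinfun_apply R (c *\<^sub>C f) = c *\<^sub>C blinfun_apply R f" unfolding dec[symmetric] .
  qed
  moreover have "adj R = R"
  proof (rule adj_eqI[OF \<open>R \<in> bops\<close>])
    fix f g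
    have "cinner (blinfun_apply R f) g = cinner (blinfun_apply R f) (blinfun_apply R g) + t * cinner (blinfun_apply R f) (?y g)"
      by (subst (1) dec[of g]) (simp only: cinner_add_right cinner_scaleR_right)
    also have "cinner (blinfun_apply R f) (?y g) = cinner (?y f) (blinfun_apply R g)"
      by (rule self_adjoint_sym[OF sa gr gr, symmetric])
    also have "cinner (blinfun_apply R f) (blinfun_apply R g) + t * cinner (?y f) (blinfun_apply R g) =
        cinner f (blinfun_apply R g)"
      by (subst (3) dec[of f]) (simp only: cinner_add_left cinner_scaleR_left)
    finally show "cinner (blinfun_apply R f) g = cinner f (blinfun_apply R g)" .
  qed
  ultimately show ?thesis using nR gr inv by blast
qed


lemma strong_limit_total:
  fixes T :: "nat \<Rightarrow> 'a::real_normed_vector \<Rightarrow>\<^sub>L 'a"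
  assumes T: "\<And>n. norm (T n) \<le> 1" and X: "\<And>x. x \<in> X \<Longrightarrow> (\<lambda>n. blinfun_apply (T n) x) \<longlonglongrightarrow> x"
    and x: "x \<in> closure (span X)"
  shows "(\<lambda>n. blinfun_apply (T n) x) \<longlonglongrightarrow> x"
proof -
  let ?S = "{x. (\<lambda>n. blinfun_apply (T n) x) \<longlonglongrightarrow> x}"
  have "subspace ?S" unfolding subspace_def
    by (auto simp: blinfun.add_right blinfun.scaleR_right intro: tendsto_add tendsto_scaleR)
  then have span: "span X \<subseteq> ?S" by (intro span_minimal) (use X in auto)
  show ?thesis unfolding LIMSEQ_iff
  proof (intro allI impI)
    fix r :: real assume "0 < r"
    then obtain y where y: "y \<in> span X" "dist y x < r / 3"
      using x unfolding closure_approachable by (metis divide_pos_pos zero_less_numeral)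
    then have "(\<lambda>n. blinfun_apply (T n) y) \<longlonglongrightarrow> y" using span by blast
    then obtain N where N: "\<And>n. n \<ge> N \<Longrightarrow> norm (blinfun_apply (T n) y - y) < r / 3"
      using \<open>0 < r\<close> unfolding LIMSEQ_iff by (metis divide_pos_pos zero_less_numeral)
    have "norm (blinfun_apply (T n) x - x) < r" if "n \<ge> N" for n
    proof -
      have "norm (blinfun_apply (T n) (x - y)) \<le> 1 * norm (x - y)"
        by (rule order_trans[OF norm_blinfun mult_right_mono[OF T]]) simp
      moreover have "blinfun_apply (T n) x - x = blinfun_apply (T n) (x - y) + (blinfun_apply (T n) y - y) + (y - x)"
        by (simp add: blinfun.diff_right)
      ultimately have "norm (blinfun_apply (T n) x - x) \<le>
          norm (x - y) + norm (blinfun_apply (T n) y - y) + norm (y - x)"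
        by (smt (verit) norm_triangle_ineq)
      then show ?thesis using N[OF that] y(2) by (simp add: dist_norm norm_minus_commute)
    qed
    then show "\<exists>N. \<forall>n\<ge>N. norm (blinfun_apply (T n) x - x) < r" by blast
  qed
qed

text \<open>\<open>R n\<close> is the resolvent for \<open>t = 1 / (n + 1)\<close>, and
  \<open>S n\<close> is \<open>A\<close> after \<open>R n\<close>; it is bounded because it equals
  \<open>(n + 1)\<close> times \<open>1 - R n\<close>.\<close>

lemma resolvent_sequence:
  fixes A :: "('a::chilbert_space \<times> 'a) set"
  assumes A: "positive_self_adjoint A"
  shows "\<exists>R S. (\<forall>n. R n \<in> bops \<and> S n \<in> bops \<and> adj (R n) = R n \<and> adj (S n) = S n \<and> norm (R n) \<le> 1 \<and> R n o\<^sub>L S n =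
      S n o\<^sub>L R n \<and>
    (\<forall>x. (blinfun_apply (R n) x, blinfun_apply (S n) x) \<in> A)) \<and> (\<forall>x. (\<lambda>n::nat. blinfun_apply (R n) x) \<longlonglongrightarrow> x)"
proof -
  let ?t = "\<lambda>n. inverse (real (Suc n))"
  have t: "0 < ?t n" for n by simp
  from choice[OF allI[OF resolvent_exists[OF A t]]] obtain R where R0:
    "\<forall>n. R n \<in> bops \<and> adj (R n) = R n \<and> norm (R n) \<le> 1 \<and>
    (\<forall>x. (blinfun_apply (R n) x, (1 / ?t n) *\<^sub>R (x - blinfun_apply (R n) x)) \<in> A) \<and>
    (\<forall>x y. (x, y) \<in> A \<longrightarrow> blinfun_apply (R n) (x + ?t n *\<^sub>R y) = x)" ..
  have R: "\<And>n. R n \<in> bops" "\<And>n. adj (R n) = R n" "\<And>n. norm (R n) \<le> 1"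
    "\<And>n x. (blinfun_apply (R n) x, (1 / ?t n) *\<^sub>R (x - blinfun_apply (R n) x)) \<in> A"
    "\<And>n x y. (x, y) \<in> A \<Longrightarrow> blinfun_apply (R n) (x + ?t n *\<^sub>R y) = x"
    using R0 by simp_all
  define S where "S n = (1 / ?t n) *\<^sub>R (id_blinfun - R n)" for n
  have S: "S n \<in> bops" "adj (S n) = S n" for n
    unfolding S_def by (intro bops_scaleR bops_diff bops_id R) (simp only: R(1,2) adj_scaleR adj_diff adj_id bops_id bops_diff)
  have S_apply: "blinfun_apply (S n) x = (1 / ?t n) *\<^sub>R (x - blinfun_apply (R n) x)" for n x
    unfolding S_def by (simp only: blinfun.scaleR_left blinfun.diff_left id_blinfun.rep_eq)
  have S_comm: "R n o\<^sub>L S n = S n o\<^sub>L R n" for n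
    by (rule blinfun_eqI) (simp only: S_apply blinfun_apply_blinfun_compose blinfun.scaleR_right blinfun.diff_right)
  have lim: "(\<lambda>n. blinfun_apply (R n) x) \<longlonglongrightarrow> x" for x
  proof (rule strong_limit_total[OF R(3)])
    show "x \<in> closure (span (Domain A))"
      using self_adjoint_dense[of A] A by (simp add: positive_self_adjoint_def)
    fix x assume "x \<in> Domain A"
    then obtain y where xy: "(x, y) \<in> A" by blast
    have "blinfun_apply (R n) x = x - ?t n *\<^sub>R blinfun_apply (R n) y" for n
      using R(5)[OF xy, of n] by (simp add: blinfun.add_right blinfun.scaleR_right eq_diff_eq)
    then have le: "norm (blinfun_apply (R n) x - x) \<le> ?t n * norm y" for n
      using order_trans[OF norm_blinfun mult_right_mono[OF R(3)], of y n] by (simp add: mult_left_mono)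
    have "(\<lambda>n. ?t n * norm y) \<longlonglongrightarrow> 0"
      by (rule tendsto_mult_left_zero[OF LIMSEQ_inverse_real_of_nat])
    then have "(\<lambda>n. blinfun_apply (R n) x - x) \<longlonglongrightarrow> 0"
      by (rule Lim_null_comparison[OF always_eventually[OF allI[OF le]]])
    then show "(\<lambda>n. blinfun_apply (R n) x) \<longlonglongrightarrow> x" by (rule LIM_zero_cancel)
  qed
  show ?thesis
    by (rule exI[of _ R], rule exI[of _ S]) (intro conjI allI R S S_comm lim, simp only: S_apply R(4))
qed

text \<open>The hypotheses say that the adjoint of the algebraic tensor product of \<open>A\<close>
  and \<open>B\<close> maps \<open>v\<close> to \<open>r\<close> and \<open>v2\<close> to
  \<open>r2\<close>; the conclusion is that this adjoint is symmetric. Vectors given only in this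
  weak sense are regularised by tensor products of resolvents, which converge strongly to the
  identity.\<close>

lemma weak_tensor_symmetric:
  assumes A: "positive_self_adjoint A" and B: "positive_self_adjoint B"
    and v: "\<And>c c' d d'. (c, c') \<in> A \<Longrightarrow> (d, d') \<in> B \<Longrightarrow> cinner v (c' \<otimes> d') = cinner r (c \<otimes> d)"
    and v2: "\<And>c c' d d'. (c, c') \<in> A \<Longrightarrow> (d, d') \<in> B \<Longrightarrow> cinner v2 (c' \<otimes> d') = cinner r2 (c \<otimes> d)"
  shows "cinner r v2 = cinner v r2"
proof -
  obtain R R' where R: "\<And>n. R n \<in> bops" "\<And>n. R' n \<in> bops" "\<And>n. adj (R n) = R n" "\<And>n. adj (R' n) = R' n"
    "\<And>n. norm (R n) \<le> 1" "\<And>n. R n o\<^sub>L R' n = R' n o\<^sub>L R n" "\<And>n x. (blinfun_apply (R n) x, blinfun_apply (R' n) x) \<in>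
        A"
    "\<And>x. (\<lambda>n::nat. blinfun_apply (R n) x) \<longlonglongrightarrow> x" using resolvent_sequence[OF A] by blast
  obtain P P' where P: "\<And>n. P n \<in> bops" "\<And>n. P' n \<in> bops" "\<And>n. adj (P n) = P n" "\<And>n. adj (P' n) = P' n"
    "\<And>n. norm (P n) \<le> 1" "\<And>n. P n o\<^sub>L P' n = P' n o\<^sub>L P n" "\<And>n x. (blinfun_apply (P n) x, blinfun_apply (P' n) x) \<in>
        B"
    "\<And>x. (\<lambda>n::nat. blinfun_apply (P n) x) \<longlonglongrightarrow> x" using resolvent_sequence[OF B] by blast
  define T where "T n = R n \<otimes>\<^sub>o P n" for n
  define T' where "T' n = R' n \<otimes>\<^sub>o P' n" for n
  have Tb: "T n \<in> bops" "T' n \<in> bops" "adj (T n) = T n" "adj (T' n) = T' n" "T n o\<^sub>L T' n = T' n o\<^sub>L T n" for n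
    using R(1-4,6) P(1-4,6) by (simp_all add: T_def T'_def adj_tensor_op tensor_op_comp)
  have nT: "norm (T n) \<le> 1" for n
    unfolding T_def by (rule order_trans[OF norm_tensor_op[OF R(1) P(1)]]) (use R(5) P(5) in \<open>simp add: mult_le_one\<close>)
  \<comment> \<open>\<open>T' n\<close> is \<open>A \<otimes> B\<close> after \<open>T n\<close>.
    Thus applying \<open>A \<otimes> B\<close> to the regularised \<open>w\<close> gives the
    regularisation of its weak image \<open>w'\<close>.\<close>
  have eq: "blinfun_apply (T' n) w = blinfun_apply (T n) w'"
    if w: "\<And>c c' d d'. (c, c') \<in> A \<Longrightarrow> (d, d') \<in> B \<Longrightarrow> cinner w (c' \<otimes> d') = cinner w' (c \<otimes> d)" for w w' n
  proof (rule htensor_cinner_eqI)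
    fix x y
    have "cinner (blinfun_apply (T' n) w) (x \<otimes> y) = cinner w (blinfun_apply (T' n) (x \<otimes> y))"
      using adj_left[OF Tb(2), of n w "x \<otimes> y"] unfolding Tb(4) .
    also have "\<dots> = cinner w' (blinfun_apply (T n) (x \<otimes> y))"
      using w[OF R(7) P(7)] R(1,2) P(1,2) by (simp add: T_def T'_def)
    also have "\<dots> = cinner (blinfun_apply (T n) w') (x \<otimes> y)"
      using adj_left[OF Tb(1), of n w' "x \<otimes> y"] unfolding Tb(3) by simp
    finally show "cinner (x \<otimes> y) (blinfun_apply (T' n) w) = cinner (x \<otimes> y) (blinfun_apply (T n) w')"
      by (metis cinner_commute)
  qed
  have lim: "(\<lambda>n. blinfun_apply (T n) w) \<longlonglongrightarrow> w" for w
  proof (rule strong_limit_total[OF nT])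
    show "w \<in> closure (span {x \<otimes> y |x y. True})" unfolding closure_span_tensor by simp
    fix w :: "'a \<otimes>\<^sub>H 'b" assume "w \<in> {x \<otimes> y |x y. True}"
    then obtain x y where w: "w = x \<otimes> y" by blast
    have "(\<lambda>n. blinfun_apply (R n) x \<otimes> blinfun_apply (P n) y) \<longlonglongrightarrow> x \<otimes> y" by (intro tendsto_intros R(8) P(8))
    then show "(\<lambda>n. blinfun_apply (T n) w) \<longlonglongrightarrow> w" using R(1) P(1) by (simp add: w T_def)
  qed
  have sym: "cinner (blinfun_apply (T n) r) (blinfun_apply (T n) v2) =
      cinner (blinfun_apply (T n) v) (blinfun_apply (T n) r2)" for n
  proof -
    have e1: "blinfun_apply (T' n) v = blinfun_apply (T n) r" by (rule eq) (rule v)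
    have e2: "blinfun_apply (T' n) v2 = blinfun_apply (T n) r2" by (rule eq) (rule v2)
    have "cinner (blinfun_apply (T n) r) (blinfun_apply (T n) v2) =
        cinner (blinfun_apply (T' n) v) (blinfun_apply (T n) v2)"
      by (simp only: e1)
    also have "\<dots> = cinner v (blinfun_apply (T' n o\<^sub>L T n) v2)"
      using adj_left[OF Tb(2), of n v "blinfun_apply (T n) v2"] unfolding Tb(4) by simp
    also have "\<dots> = cinner v (blinfun_apply (T n) (blinfun_apply (T' n) v2))" by (simp flip: Tb(5))
    also have "\<dots> = cinner (blinfun_apply (T n) v) (blinfun_apply (T n) r2)"
      using adj_left[OF Tb(1), of n v "blinfun_apply (T n) r2"] unfolding Tb(3) e2 by simp
    finally show ?thesis .
  qed
  have "(\<lambda>n. cinner (blinfun_apply (T n) r) (blinfun_apply (T n) v2)) \<longlonglongrightarrow> cinner r v2" by (intro tendsto_intros lim)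
  moreover have "(\<lambda>n. cinner (blinfun_apply (T n) v) (blinfun_apply (T n) r2)) \<longlonglongrightarrow> cinner v r2"
    by (intro tendsto_intros lim)
  ultimately show ?thesis unfolding sym by (rule LIMSEQ_unique)
qed

section \<open>Inverse and conjugate of a positive self-adjoint operator\<close>

lemma self_adjoint_iffI:
  assumes "closure (Domain Q) = UNIV" "\<And>y z. (y, z) \<in> Q \<longleftrightarrow> (\<forall>x w. (x, w) \<in> Q \<longrightarrow> cinner w y = cinner x z)"
  shows "self_adjoint Q"
proof -
  have "p \<in> Q \<longleftrightarrow> p \<in> {(y, z). \<forall>(x, w)\<in>Q. cinner w y = cinner x z}" for p
    using assms(2)[of "fst p" "snd p"] by (simp add: Ball_def split_beta)
  then show ?thesis unfolding self_adjoint_def using assms(1) by blast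
qed

lemma positive_converse:
  assumes Q: "positive_self_adjoint Q" and ker: "\<And>x. (x, 0) \<in> Q \<Longrightarrow> x = 0"
  shows "positive_self_adjoint (Q\<inverse>)"
proof -
  have sa: "self_adjoint Q" using Q by (simp add: positive_self_adjoint_def)
  have "self_adjoint (Q\<inverse>)"
  proof (rule self_adjoint_iffI)
    show "closure (Domain (Q\<inverse>)) = UNIV"
      unfolding Domain_converse by (rule self_adjoint_Range_dense[OF sa]) (erule ker)
    show "(y, z) \<in> Q\<inverse> \<longleftrightarrow> (\<forall>x w. (x, w) \<in> Q\<inverse> \<longrightarrow> cinner w y = cinner x z)" for y z
      using self_adjoint_iff[OF sa, of z y] by auto
  qed
  moreover have "cinner x w \<in> \<real>\<^sub>\<ge>\<^sub>0" if "(w, x) \<in> Q" for x w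
  proof -
    have "cinner w x \<in> \<real>\<^sub>\<ge>\<^sub>0" using Q that by (auto simp: positive_self_adjoint_def)
    then show ?thesis unfolding cinner_commute[of x w] by (simp add: complex_nonneg_Reals_iff)
  qed
  ultimately show ?thesis unfolding positive_self_adjoint_def by auto
qed

lemma positive_bar:
  assumes Q: "positive_self_adjoint Q"
  shows "positive_self_adjoint {(bar x, bar y) |x y. (x, y) \<in> Q}" (is "positive_self_adjoint ?S")
proof -
  have sa: "self_adjoint Q" using Q by (simp add: positive_self_adjoint_def)
  have mem: "(bar x, bar y) \<in> ?S \<longleftrightarrow> (x, y) \<in> Q" for x y by (auto simp: bar_inject)
  have iff: "(bar y, bar z) \<in> ?S \<longleftrightarrow> (\<forall>x w. (x, w) \<in> ?S \<longrightarrow> cinner w (bar y) = cinner x (bar z))" for y z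
  proof -
    have "(bar y, bar z) \<in> ?S \<longleftrightarrow> (\<forall>x w. (x, w) \<in> Q \<longrightarrow> cinner w y = cinner x z)"
      unfolding mem by (rule self_adjoint_iff[OF sa])
    also have "\<dots> \<longleftrightarrow> (\<forall>x w. (x, w) \<in> Q \<longrightarrow> cinner y w = cinner z x)"
      by (metis cinner_commute)
    also have "\<dots> \<longleftrightarrow> (\<forall>x w. (x, w) \<in> Q \<longrightarrow> cinner (bar w) (bar y) = cinner (bar x) (bar z))" by simp
    also have "\<dots> \<longleftrightarrow> (\<forall>x w. (x, w) \<in> ?S \<longrightarrow> cinner w (bar y) = cinner x (bar z))" by blast
    finally show ?thesis .
  qed
  have "(y, z) \<in> ?S \<longleftrightarrow> (\<forall>x w. (x, w) \<in> ?S \<longrightarrow> cinner w y = cinner x z)" for y z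
    using iff[of "unbar y" "unbar z"] by (simp only: unbar_inverse)
  moreover have "closure (Domain ?S) = UNIV"
  proof -
    have D: "Domain ?S = bar ` Domain Q" by auto
    have "bar x \<in> closure (bar ` Domain Q)" for x
      using closure_bounded_linear_image_subset[OF bounded_linear_bar, of "Domain Q"] sa
      unfolding self_adjoint_def by auto
    then show ?thesis unfolding D by (metis UNIV_eq_I unbar_inverse)
  qed
  ultimately have "self_adjoint ?S" by (intro self_adjoint_iffI)
  moreover have "cinner (bar x) (bar y) \<in> \<real>\<^sub>\<ge>\<^sub>0" if "(x, y) \<in> Q" for x y
  proof -
    have "cinner x y \<in> \<real>\<^sub>\<ge>\<^sub>0" using Q that by (auto simp: positive_self_adjoint_def)
    then show ?thesis unfolding cinner_bar cinner_commute[of y x] by (simp add: complex_nonneg_Reals_iff)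
  qed
  ultimately show ?thesis unfolding positive_self_adjoint_def by auto
qed

text \<open>\<open>form1\<close> and \<open>form2\<close> describe the coefficients of
  \<open>Wt\<close> in two ways. Comparing them for two pairs of vectors gives \<open>key\<close>,
  in which the variables separate: up to one fixed factor, \<open>adj a\<close> has the coefficients
  of the identity.\<close>

theorem (in modular_mu) commuting_scalar:
  assumes a: "a \<in> bops" and Wa: "W o\<^sub>L (a \<otimes>\<^sub>o id_blinfun) = (id_blinfun \<otimes>\<^sub>o a) o\<^sub>L W"
  shows "\<exists>c. a = scaleC_op c id_blinfun"
proof -
  let ?S = "{(bar x, bar y) |x y. (x, y) \<in> Qh}" and ?B = "Q\<inverse>"
  have pos: "positive_self_adjoint ?S" "positive_self_adjoint ?B"
    using positive_bar[OF Qh] positive_converse[OF Q Q_ker] by blast+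
  have key: "cinner x0 z1 * cinner (blinfun_apply (adj a) y) d = cinner x (blinfun_apply a z) * cinner y d"
    if x: "(x0, x) \<in> Qh" and z: "(z, z1) \<in> Qh" and y: "(y, y') \<in> Q" and d: "(d', d) \<in> Q" for x0 x z z1 y y' d d'
  proof -
    \<comment> \<open>Formally \<open>?S \<otimes> ?B\<close> maps \<open>adj Wt\<close> of
      \<open>v\<close> to \<open>adj Wt\<close> of \<open>r\<close>, and \<open>adj Wt\<close> of
      \<open>bar x0 \<otimes> d\<close> to that of \<open>bar x \<otimes> d'\<close>. The relation
      \<open>Wa\<close> enters in the first claim, where it trades \<open>a\<close> on the first leg
      for \<open>adj a\<close> on the second.\<close>
    define v where "v = bar (blinfun_apply a z) \<otimes> y'"
    define r where "r = bar z1 \<otimes> blinfun_apply (adj a) y"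
    have "cinner (blinfun_apply (adj Wt) r) (blinfun_apply (adj Wt) (bar x0 \<otimes> d)) =
        cinner (blinfun_apply (adj Wt) v) (blinfun_apply (adj Wt) (bar x \<otimes> d'))"
    proof (rule weak_tensor_symmetric[OF pos])
      fix c c' e e' assume "(c, c') \<in> ?S" "(e, e') \<in> ?B"
      then obtain p p' where c: "c = bar p" "c' = bar p'" and p: "(p, p') \<in> Qh" and e: "(e', e) \<in> Q" by blast
      have "cinner v (blinfun_apply Wt (c' \<otimes> e')) = cinner (p' \<otimes> y) (blinfun_apply W (blinfun_apply a z \<otimes> e))"
        unfolding v_def c by (rule form1[OF y e, symmetric])
      also have "blinfun_apply W (blinfun_apply a z \<otimes> e) =
          blinfun_apply (id_blinfun \<otimes>\<^sub>o a) (blinfun_apply W (z \<otimes> e))"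
        using arg_cong[OF Wa, of "\<lambda>S. blinfun_apply S (z \<otimes> e)"] a by simp
      also have "cinner (p' \<otimes> y) (blinfun_apply (id_blinfun \<otimes>\<^sub>o a) (blinfun_apply W (z \<otimes> e))) =
          cinner (p' \<otimes> blinfun_apply (adj a) y) (blinfun_apply W (z \<otimes> e))"
        using adj_left[of "id_blinfun \<otimes>\<^sub>o a" "p' \<otimes> y" "blinfun_apply W (z \<otimes> e)"] a by (simp add: adj_tensor_op)
      also have "\<dots> = cinner r (blinfun_apply Wt (c \<otimes> e))"
        unfolding r_def c by (rule form2[OF p z, symmetric])
      finally show "cinner (blinfun_apply (adj Wt) v) (c' \<otimes> e') = cinner (blinfun_apply (adj Wt) r) (c \<otimes> e)"
        by (simp add: adj_left)
      have "cinner (bar x0 \<otimes> d) (blinfun_apply Wt (c' \<otimes> e')) = cinner (p' \<otimes> d') (blinfun_apply W (x0 \<otimes> e))"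
        unfolding c by (rule form1[OF d e, symmetric])
      also have "\<dots> = cinner (bar x \<otimes> d') (blinfun_apply Wt (c \<otimes> e))"
        unfolding c by (rule form2[OF p x, symmetric])
      finally show "cinner (blinfun_apply (adj Wt) (bar x0 \<otimes> d)) (c' \<otimes> e') =
          cinner (blinfun_apply (adj Wt) (bar x \<otimes> d')) (c \<otimes> e)"
        by (simp add: adj_left)
    qed
    then have "cinner r (bar x0 \<otimes> d) = cinner v (bar x \<otimes> d')" by (simp only: unitary_cinner[OF unitary_adj[OF Wt]])
    then show ?thesis using self_adjoint_sym[OF sa(2) y d] by (simp add: r_def v_def cinner_tensor)
  qed
  \<comment> \<open>A nonzero value of \<open>cinner x0 z1\<close> is needed to divide
    \<open>key\<close> by it; with \<open>x0\<close> and \<open>z\<close> fixed, \<open>key\<close>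
    becomes an eigenvalue equation for \<open>adj a\<close>.\<close>
  have "\<exists>p\<in>Domain Qh. \<exists>q\<in>Range Qh. cinner p q \<noteq> 0"
  proof (rule ccontr)
    assume "\<not> ?thesis"
    then have 0: "cinner p q = 0" if "p \<in> Domain Qh" "q \<in> Range Qh" for p q using that by blast
    have R0: "q = 0" if "q \<in> Range Qh" for q
      by (rule cinner_total_eqI[OF total_Domain(1)]) (use 0 that in simp)
    have "x = x'" for x x' :: 'h
      by (intro cinner_total_eqI[OF total_Range(1)]) (drule R0, simp)
    then show False using ne by metis
  qed
  then obtain x0 x z z1 where x: "(x0, x) \<in> Qh" and z: "(z, z1) \<in> Qh" and nz: "cinner x0 z1 \<noteq> 0" by blast
  define k where "k = cinner x (blinfun_apply a z) / cinner x0 z1"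
  have "blinfun_apply (adj a) y = cnj k *\<^sub>C y" if yQ: "y \<in> Domain Q" for y
  proof (rule cinner_total_eqI[OF total_Range(2)])
    fix d assume "d \<in> Range Q"
    then obtain d' where "(d', d) \<in> Q" by blast
    moreover obtain y' where "(y, y') \<in> Q" using yQ by blast
    ultimately have "cinner (blinfun_apply (adj a) y) d = k * cinner y d"
      using key[OF x z] nz by (simp add: k_def field_simps)
    then show "cinner d (blinfun_apply (adj a) y) = cinner d (cnj k *\<^sub>C y)"
      unfolding cinner_commute[of d] cinner_scaleC_left by simp
  qed
  then have "adj a = scaleC_op (cnj k) id_blinfun"
    by (intro blinfun_eq_on_total[OF _ total_Domain(2)]) simp
  from arg_cong[OF this, of adj] have "a = scaleC_op k id_blinfun" using a by (simp add: adj_scaleC_op)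
  then show ?thesis ..
qed

section \<open>Corepresentations of the quantum group of a multiplicative unitary\<close>

lemma norm_unitary_conj:
  assumes U: "unitary U" and V: "unitary V" shows "norm (U o\<^sub>L (S o\<^sub>L V)) \<le> norm S"
proof -
  have "norm (U o\<^sub>L (S o\<^sub>L V)) \<le> norm U * (norm S * norm V)"
    by (intro order_trans[OF norm_blinfun_compose] mult_left_mono norm_blinfun_compose) simp
  also have "\<dots> \<le> 1 * (norm S * 1)" by (intro mult_mono norm_unitary U V) auto
  finally show ?thesis by simp
qed

lemma total_unitary_image:
  assumes U: "unitary U" and X: "closure (span X) = UNIV"
  shows "closure (span (blinfun_apply U ` X)) = UNIV"
proof -
  have "blinfun_apply U f \<in> closure (span (blinfun_apply U ` X))" for f
    by (rule bounded_linear_closure_span[OF blinfun.bounded_linear_right, of _ X])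
      (use X in \<open>auto intro: closure_span_superset\<close>)
  from this[of "blinfun_apply (adj U) y" for y] show ?thesis using U by auto
qed

lemma qg_comult_total:
  fixes U :: "('h::chilbert_space \<otimes>\<^sub>H 'h) op"
  assumes U: "unitary U" and A: "A \<subseteq> bops" "closure (span {blinfun_apply a x |a x. a \<in> A}) = UNIV"
  shows "closure (span {blinfun_apply b x |b x. b \<in> qg_comult U ` A}) = UNIV"
proof -
  have "closure (span {w \<otimes> y |w y. w \<in> {blinfun_apply a x |a x. a \<in> A} \<and> y \<in> UNIV}) = (UNIV :: ('h \<otimes>\<^sub>H 'h) set)"
    by (rule total_tensor[OF A(2)]) simp
  from total_unitary_image[OF U this] have *: "closure (span (blinfun_apply U ` {w \<otimes> y |w y. w \<in>
      {blinfun_apply a x |a x. a \<in> A} \<and> y \<in> UNIV})) = UNIV" .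
  have "blinfun_apply U ` {w \<otimes> y |w y. w \<in> {blinfun_apply a x |a x. a \<in> A} \<and> y \<in> UNIV} \<subseteq>
      {blinfun_apply b x |b x. b \<in> qg_comult U ` A}"
  proof safe
    fix y a x assume a: "a \<in> A"
    have "blinfun_apply U (blinfun_apply a x \<otimes> y) = blinfun_apply (qg_comult U a) (blinfun_apply U (x \<otimes> y))"
      using U A a by (auto simp: qg_comult_def)
    then show "\<exists>b x'. blinfun_apply U (blinfun_apply a x \<otimes> y) = blinfun_apply b x' \<and> b \<in> qg_comult U ` A" using a
      by blast
  qed
  from closure_mono[OF span_mono[OF this]] show ?thesis unfolding * by blast
qed

text \<open>The comultiplication is conjugation by \<open>U\<close>, hence so is its tensor product
  with the identity, and the corepresentation property becomes an equation between operators.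
  Conjugation is contractive for any unitary, so this serves \<open>W\<close> and
  \<open>dual_mu W\<close> alike.\<close>

theorem left_corep_relation:
  fixes U :: "('h::chilbert_space \<otimes>\<^sub>H 'h) op" and V :: "('h \<otimes>\<^sub>H 'd::chilbert_space) op"
  assumes U: "unitary U" and ne: "\<exists>x::'h. x \<noteq> 0" and D: "cstar_algebra D"
    and V: "left_corep (qg_algebra U) (qg_comult U) D V"
  shows "leg12 U o\<^sub>L leg13 V o\<^sub>L adj (leg12 U) = leg23 V o\<^sub>L leg13 V"
proof -
  let ?A = "qg_algebra U"
  have Ab: "?A \<subseteq> bops" by (rule qg_algebra_bops[OF unitary_bops[OF U]])
  have Db: "D \<subseteq> bops" using D by (simp add: cstar_algebra_def)
  have ub: "qg_comult U a \<in> bops" if "a \<in> ?A" for a using U subsetD[OF Ab that] by (simp add: qg_comult_def)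
  note Tb = subsetD[OF tensor_alg_bops[OF Ab Db]]
  have Vm: "V \<in> multiplier (?A \<otimes>\<^sub>A D)" using V by (simp add: left_corep_def unitary_multiplier_def)
  note Vb = multiplier_bops[OF Vm]
  \<comment> \<open>Brings a leg appended last in between the two legs of \<open>V\<close>; it
    becomes the second leg of the comultiplication.\<close>
  define N where "N = adj assoc o\<^sub>L (perm13 :: ('h \<otimes>\<^sub>H 'd) \<otimes>\<^sub>H 'h \<Rightarrow>\<^sub>L 'h \<otimes>\<^sub>H 'h \<otimes>\<^sub>H 'd)"
  have N: "unitary N" unfolding N_def by (intro unitary_comp unitary_adj) simp_all
  define Z where "Z = (U \<otimes>\<^sub>o id_blinfun) o\<^sub>L N"
  have Z: "unitary Z" unfolding Z_def by (intro unitary_comp unitary_tensor_op U N) simp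
  define \<Phi> where "\<Phi> t = Z o\<^sub>L ((t \<otimes>\<^sub>o id_blinfun) o\<^sub>L adj Z)" for t
  have "tensor_morphism ?A (qg_comult U) D (\<lambda>d. d) V = \<Phi> V"
  proof (rule tensor_morphism_eqI[where \<Phi> = \<Phi>])
    show "\<Phi> (s + t) = \<Phi> s + \<Phi> t" if "s \<in> ?A \<otimes>\<^sub>A D" "t \<in> ?A \<otimes>\<^sub>A D" for s t
      using that Tb by (simp add: \<Phi>_def tensor_op_add_left blinfun_compose_add_left blinfun_compose_add_right)
    show "\<Phi> (scaleC_op c s) = scaleC_op c (\<Phi> s)" if "s \<in> ?A \<otimes>\<^sub>A D" for c s
      using that Tb Z by (simp add: \<Phi>_def tensor_op_scaleC_left scaleC_op_comp_left scaleC_op_comp_right)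
    show "norm (\<Phi> s) \<le> norm s" if "s \<in> ?A \<otimes>\<^sub>A D" for s
    proof -
      have "norm (\<Phi> s) \<le> norm (s \<otimes>\<^sub>o (id_blinfun :: 'h op))" unfolding \<Phi>_def
        by (intro norm_unitary_conj Z unitary_adj)
      also have "\<dots> \<le> norm s * norm (id_blinfun :: 'h op)" by (intro norm_tensor_op Tb[OF that] bops_id)
      also have "\<dots> \<le> norm s * 1" by (intro mult_left_mono norm_unitary) simp_all
      finally show ?thesis by simp
    qed
    show "\<Phi> (a \<otimes>\<^sub>o b) = qg_comult U a \<otimes>\<^sub>o b" if ab: "a \<in> ?A" "b \<in> D" for a b
    proof -
      have b: "a \<in> bops" "b \<in> bops" using ab Ab Db by blast+
      have int: "N o\<^sub>L ((a \<otimes>\<^sub>o b) \<otimes>\<^sub>o id_blinfun) = ((a \<otimes>\<^sub>o id_blinfun) \<otimes>\<^sub>o b) o\<^sub>L N"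
        unfolding N_def by (rule htensor3'_eqI) (simp add: b)
      have "N o\<^sub>L (((a \<otimes>\<^sub>o b) \<otimes>\<^sub>o id_blinfun) o\<^sub>L adj N) = (a \<otimes>\<^sub>o id_blinfun) \<otimes>\<^sub>o b"
        using N unfolding comp_assoc[symmetric] int by (simp add: comp_assoc)
      then have "\<Phi> (a \<otimes>\<^sub>o b) = (U \<otimes>\<^sub>o id_blinfun) o\<^sub>L (((a \<otimes>\<^sub>o id_blinfun) \<otimes>\<^sub>o b) o\<^sub>L (adj U \<otimes>\<^sub>o id_blinfun))"
        unfolding \<Phi>_def Z_def using U N by (simp add: adj_comp adj_tensor_op comp_assoc) (simp flip: comp_assoc)
      then show ?thesis using U b by (simp add: qg_comult_def tensor_op_comp comp_assoc)
    qed
    show "\<Phi> V \<in> bops" unfolding \<Phi>_def using Z Vb by simp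
    show "V o\<^sub>L t \<in> ?A \<otimes>\<^sub>A D \<and> \<Phi> V o\<^sub>L \<Phi> t = \<Phi> (V o\<^sub>L t)" if t: "t \<in> ?A \<otimes>\<^sub>A D" for t
    proof
      show "V o\<^sub>L t \<in> ?A \<otimes>\<^sub>A D" using Vm t by (simp add: multiplier_def)
      have "(V o\<^sub>L t) \<otimes>\<^sub>o (id_blinfun :: 'h op) = (V \<otimes>\<^sub>o id_blinfun) o\<^sub>L (t \<otimes>\<^sub>o id_blinfun)"
        using Vb Tb[OF t] by (simp add: tensor_op_comp)
      then show "\<Phi> V o\<^sub>L \<Phi> t = \<Phi> (V o\<^sub>L t)" unfolding \<Phi>_def using Z by (simp add: comp_assoc)
    qed
    have "{blinfun_apply (qg_comult U a \<otimes>\<^sub>o b) x |a b x. a \<in> ?A \<and> b \<in> D} =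
        {blinfun_apply (a \<otimes>\<^sub>o b) x |a b x. a \<in> qg_comult U ` ?A \<and> b \<in> D}" by blast
    moreover have "closure (span {blinfun_apply (a \<otimes>\<^sub>o b) x |a b x. a \<in> qg_comult U ` ?A \<and> b \<in> D}) = UNIV"
      using D ub by (intro tensor_alg_total qg_comult_total U Ab qg_algebra_total(1) ne) (auto simp: cstar_algebra_def)
    ultimately show "closure (span {blinfun_apply (qg_comult U a \<otimes>\<^sub>o b) x |a b x. a \<in> ?A \<and> b \<in> D}) = UNIV" by simp
  qed (use Ab Db qg_algebra_scaleC[OF unitary_bops[OF U]] in auto)
  then have "reassoc (\<Phi> V) = leg23 V o\<^sub>L leg13 V" using V by (simp add: left_corep_def)
  moreover have "reassoc (\<Phi> V) = leg12 U o\<^sub>L leg13 V o\<^sub>L adj (leg12 U)"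
    using U Vb by (simp add: reassoc_def \<Phi>_def Z_def N_def leg13_eq leg12_def adj_comp comp_assoc)
  ultimately show ?thesis by simp
qed

lemma intertwine_comp: "c o\<^sub>L S = S' o\<^sub>L c \<Longrightarrow> c o\<^sub>L T = T' o\<^sub>L c \<Longrightarrow> c o\<^sub>L (S o\<^sub>L T) = (S' o\<^sub>L T') o\<^sub>L c"
  by (metis comp_assoc)

lemma unitary_comp_right_cancel: "unitary c \<Longrightarrow> S o\<^sub>L c = T o\<^sub>L c \<Longrightarrow> S = T"
  by (metis comp_assoc unitary_comp_adj comp_id_right)

lemma unitary_comp_left_cancel: "unitary c \<Longrightarrow> c o\<^sub>L S = c o\<^sub>L T \<Longrightarrow> S = T"
  by (metis unitary_adj_comp_left)

text \<open>Adjoints reverse the products and \<open>cyc\<close> moves the algebra leg to the front: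
  these are the two operations that make \<open>Vt\<close> from \<open>Vh\<close>.\<close>

lemma swap_corep_relation:
  fixes U :: "('h::chilbert_space \<otimes>\<^sub>H 'h) op" and V :: "('h \<otimes>\<^sub>H 'd::chilbert_space) op"
  assumes U: "unitary U" and V: "unitary V"
    and rel: "leg12 U o\<^sub>L leg13 V o\<^sub>L adj (leg12 U) = leg23 V o\<^sub>L leg13 V"
  shows "leg23 U o\<^sub>L leg12 (swap (adj V)) = leg12 (swap (adj V)) o\<^sub>L leg13 (swap (adj V)) o\<^sub>L leg23 U"
proof -
  have [simp]: "U \<in> bops" "V \<in> bops" using U V by simp_all
  let ?c = "cyc :: 'h \<otimes>\<^sub>H 'h \<otimes>\<^sub>H 'd \<Rightarrow>\<^sub>L _"
  have "leg12 U o\<^sub>L (leg13 (adj V) o\<^sub>L adj (leg12 U)) = leg13 (adj V) o\<^sub>L leg23 (adj V)"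
    using arg_cong[OF rel, of adj] U by (simp add: adj_comp comp_assoc adj_leg13 adj_leg23)
  from arg_cong[OF this, of "\<lambda>T. T o\<^sub>L leg12 U"]
  have r: "leg12 U o\<^sub>L leg13 (adj V) = leg13 (adj V) o\<^sub>L (leg23 (adj V) o\<^sub>L leg12 U)"
    using U by (simp add: comp_assoc)
  have c: "?c o\<^sub>L leg12 U = leg23 U o\<^sub>L ?c" "?c o\<^sub>L leg13 (adj V) = leg12 (swap (adj V)) o\<^sub>L ?c"
    "?c o\<^sub>L leg23 (adj V) = leg13 (swap (adj V)) o\<^sub>L ?c" by (simp_all add: cyc_leg12 cyc_leg13 cyc_leg23)
  have "(leg23 U o\<^sub>L leg12 (swap (adj V))) o\<^sub>L ?c = ?c o\<^sub>L (leg12 U o\<^sub>L leg13 (adj V))"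
    by (rule intertwine_comp[OF c(1,2), symmetric])
  also have "\<dots> = (leg12 (swap (adj V)) o\<^sub>L (leg13 (swap (adj V)) o\<^sub>L leg23 U)) o\<^sub>L ?c"
    unfolding r by (rule intertwine_comp[OF c(2) intertwine_comp[OF c(3,1)]])
  finally have "leg23 U o\<^sub>L leg12 (swap (adj V)) = leg12 (swap (adj V)) o\<^sub>L (leg13 (swap (adj V)) o\<^sub>L leg23 U)"
    by (rule unitary_comp_right_cancel[OF unitary_cyc])
  then show ?thesis by (simp only: comp_assoc)
qed

text \<open>\<open>dual_mu W\<close> is \<open>adj W\<close> between two flips. Conjugation by the
  flip of the first two legs removes these and exchanges \<open>leg13 V\<close> with
  \<open>leg23 V\<close>.\<close>

lemma dual_corep_relation:
  fixes W :: "('h::chilbert_space \<otimes>\<^sub>H 'h) op" and V :: "('h \<otimes>\<^sub>H 'd::chilbert_space) op"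
  assumes W: "unitary W" and V: "V \<in> bops"
    and rel: "leg12 (dual_mu W) o\<^sub>L leg13 V o\<^sub>L adj (leg12 (dual_mu W)) = leg23 V o\<^sub>L leg13 V"
  shows "leg12 (adj W) o\<^sub>L leg23 V o\<^sub>L leg12 W = leg13 V o\<^sub>L leg23 V"
proof -
  let ?f = "leg12 flip :: ('h \<otimes>\<^sub>H 'h \<otimes>\<^sub>H 'd) op"
  have ff: "?f o\<^sub>L ?f = id_blinfun" by (simp flip: leg12_comp)
  have ff': "?f o\<^sub>L (?f o\<^sub>L T) = T" for T :: "('h \<otimes>\<^sub>H 'h \<otimes>\<^sub>H 'd) op" using ff by (simp flip: comp_assoc)
  have d: "leg12 (dual_mu W) = ?f o\<^sub>L leg12 (adj W) o\<^sub>L ?f" unfolding dual_mu_def using W by (simp add: leg12_comp)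
  have d': "adj (leg12 (dual_mu W)) = ?f o\<^sub>L leg12 W o\<^sub>L ?f"
    unfolding dual_mu_def using W by (simp add: adj_leg12 adj_comp leg12_comp comp_assoc)
  have l: "leg13 V = ?f o\<^sub>L leg23 V o\<^sub>L ?f" by (rule leg12_flip_leg23[OF V, symmetric])
  have l': "leg23 V = ?f o\<^sub>L leg13 V o\<^sub>L ?f" unfolding l by (simp add: comp_assoc ff ff')
  have "leg12 (adj W) o\<^sub>L leg23 V o\<^sub>L leg12 W = ?f o\<^sub>L (leg12 (dual_mu W) o\<^sub>L leg13 V o\<^sub>L adj (leg12 (dual_mu W))) o\<^sub>L ?f"
    unfolding d' unfolding d l by (simp add: comp_assoc ff ff')
  also have "\<dots> = leg13 V o\<^sub>L leg23 V" unfolding rel by (subst l', subst (2) l) (simp add: comp_assoc ff ff')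
  finally show ?thesis .
qed


section \<open>Heisenberg pairs and slices\<close>

text \<open>The flip of legs 2 and 3 carries T_13 to T_12. The same conjugation turns
  \<open>leg13 Y\<close>, which is Y_134 on four legs, into Y_124.\<close>

lemma leg124_conj:
  fixes T :: "('v::chilbert_space \<otimes>\<^sub>H 'h::chilbert_space) op"
  assumes T: "T \<in> bops"
  shows "leg23 (leg12 flip) o\<^sub>L leg13 (leg12 T) o\<^sub>L leg23 (leg12 flip) =
      (leg12 T :: ('v \<otimes>\<^sub>H 'h \<otimes>\<^sub>H 'h \<otimes>\<^sub>H 'u::chilbert_space) op)"
proof -
  have "leg23 flip o\<^sub>L leg13 T o\<^sub>L leg23 flip = (leg12 T :: ('v \<otimes>\<^sub>H 'h \<otimes>\<^sub>H 'h) op)"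
  proof -
    let ?g = "(id_blinfun \<otimes>\<^sub>o flip) :: 'v \<otimes>\<^sub>H 'h \<otimes>\<^sub>H 'h \<Rightarrow>\<^sub>L _"
    have gg: "?g o\<^sub>L ?g = id_blinfun" by (simp add: tensor_op_comp)
    have "?g o\<^sub>L (?g o\<^sub>L S) = S" for S :: "('v \<otimes>\<^sub>H 'h \<otimes>\<^sub>H 'h) op" using gg by (simp flip: comp_assoc)
    then show ?thesis unfolding leg13_def leg23_def by (simp add: comp_assoc gg)
  qed
  from arg_cong[OF this, of leg123] show ?thesis
    using T by (simp add: leg123_comp leg123_leg12 leg123_leg13 leg123_leg23)
qed

text \<open>With \<open>Y = T\<^sub>1\<^sub>2\<^sup>* V\<^sub>2\<^sub>3 T\<^sub>1\<^sub>2 V\<^sub>2\<^sub>3\<^sup>*\<close>, this is \<open>W\<^sub>2\<^sub>3 Y\<^sub>1\<^sub>2\<^sub>4 = Y\<^sub>1\<^sub>3\<^sub>4 W\<^sub>2\<^sub>3\<close>.\<close>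

lemma heisenberg_intertwine:
  fixes W :: "('h::chilbert_space \<otimes>\<^sub>H 'h) op" and V :: "('h \<otimes>\<^sub>H 'u::chilbert_space) op" and T :: "('v::chilbert_space \<otimes>\<^sub>H 'h) op"
  assumes W: "unitary W" and V: "unitary V" and T: "unitary T"
    and T_rel: "leg23 W o\<^sub>L leg12 T = leg12 T o\<^sub>L leg13 T o\<^sub>L leg23 W"
    and V_rel: "leg12 (adj W) o\<^sub>L leg23 V o\<^sub>L leg12 W = leg13 V o\<^sub>L leg23 V"
  defines "Y \<equiv> leg12 (adj T) o\<^sub>L (leg23 V o\<^sub>L (leg12 T o\<^sub>L leg23 (adj V)))"
  shows "leg23 (leg12 W) o\<^sub>L (leg23 (leg12 flip) o\<^sub>L leg13 Y o\<^sub>L leg23 (leg12 flip)) = leg13 Y o\<^sub>L leg23 (leg12 W)"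
proof -
  have [simp]: "W \<in> bops" "V \<in> bops" "T \<in> bops" using W V T by simp_all
  \<comment> \<open>In leg numbers: \<open>w\<close> is W_23, \<open>p\<close> is T_12,
    \<open>q\<close> is T_13, \<open>a\<close> is V_34, \<open>b\<close> is V_24, and
    \<open>F\<close> is the flip of legs 2 and 3.\<close>
  define w where "w = (leg23 (leg12 W) :: ('v \<otimes>\<^sub>H 'h \<otimes>\<^sub>H 'h \<otimes>\<^sub>H 'u) op)"
  define p where "p = (leg12 T :: ('v \<otimes>\<^sub>H 'h \<otimes>\<^sub>H 'h \<otimes>\<^sub>H 'u) op)"
  define q where "q = (leg13 (leg12 T) :: ('v \<otimes>\<^sub>H 'h \<otimes>\<^sub>H 'h \<otimes>\<^sub>H 'u) op)"
  define a where "a = (leg23 (leg23 V) :: ('v \<otimes>\<^sub>H 'h \<otimes>\<^sub>H 'h \<otimes>\<^sub>H 'u) op)"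
  define b where "b = (leg23 (leg13 V) :: ('v \<otimes>\<^sub>H 'h \<otimes>\<^sub>H 'h \<otimes>\<^sub>H 'u) op)"
  define F where "F = (leg23 (leg12 flip) :: ('v \<otimes>\<^sub>H 'h \<otimes>\<^sub>H 'h \<otimes>\<^sub>H 'u) op)"
  have u: "unitary w" "unitary p" "unitary q" "unitary a" "unitary b"
    using W V T by (auto simp: w_def p_def q_def a_def b_def)
  have FF: "F o\<^sub>L (F o\<^sub>L S) = S" for S :: "('v \<otimes>\<^sub>H 'h \<otimes>\<^sub>H 'h \<otimes>\<^sub>H 'u) op"
    by (simp add: F_def flip: comp_assoc leg23_comp leg12_comp)
  have "leg23 (leg12 W) o\<^sub>L leg12 T = leg12 T o\<^sub>L (leg13 (leg12 T) o\<^sub>L (leg23 (leg12 W) :: ('v \<otimes>\<^sub>H 'h \<otimes>\<^sub>H 'h \<otimes>\<^sub>H 'u) op))"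
    using arg_cong[OF T_rel, of leg123]
      by (simp add: leg123_comp leg123_leg12 leg123_leg13 leg123_leg23 comp_assoc)
  then have r1: "w o\<^sub>L p = p o\<^sub>L (q o\<^sub>L w)" unfolding w_def p_def q_def .
  have r2: "adj w o\<^sub>L (a o\<^sub>L w) = b o\<^sub>L a"
    using arg_cong[OF V_rel, of leg23] by (simp add: leg23_comp w_def a_def b_def adj_leg23 adj_leg12 comp_assoc)
  have pa: "p o\<^sub>L a = a o\<^sub>L p" unfolding p_def a_def by (rule leg12_leg34_commute) simp_all
  have Y: "leg13 Y = adj q o\<^sub>L (a o\<^sub>L (q o\<^sub>L adj a))"
    by (simp add: Y_def leg13_comp leg13_leg23 q_def a_def adj_leg13 adj_leg12 adj_leg23)
  have Fq: "F o\<^sub>L (q o\<^sub>L F) = p" unfolding F_def q_def p_def using leg124_conj[of T] by (simp add: comp_assoc)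
  have Fq': "F o\<^sub>L (adj q o\<^sub>L F) = adj p" using leg124_conj[of "adj T"]
    by (simp add: F_def q_def p_def adj_leg13 adj_leg12 comp_assoc)
  have Fa: "F o\<^sub>L (a o\<^sub>L F) = b" using arg_cong[OF leg12_flip_leg23[of V], of leg23]
    by (simp add: F_def a_def b_def leg23_comp comp_assoc)
  have Fa': "F o\<^sub>L (adj a o\<^sub>L F) = adj b" using arg_cong[OF leg12_flip_leg23[of "adj V"], of leg23]
    by (simp add: F_def a_def b_def leg23_comp adj_leg13 adj_leg23 comp_assoc)
  have "F o\<^sub>L leg13 Y o\<^sub>L F = (F o\<^sub>L (adj q o\<^sub>L F)) o\<^sub>L ((F o\<^sub>L (a o\<^sub>L F)) o\<^sub>L ((F o\<^sub>L (q o\<^sub>L F)) o\<^sub>L (F o\<^sub>L (adj a o\<^sub>L F))))"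
    unfolding Y by (simp add: comp_assoc FF)
  then have FY: "F o\<^sub>L leg13 Y o\<^sub>L F = adj p o\<^sub>L (b o\<^sub>L (p o\<^sub>L adj b))" unfolding Fq Fq' Fa Fa' .
  have r1': "w o\<^sub>L adj p = adj q o\<^sub>L (adj p o\<^sub>L w)"
  proof (rule unitary_comp_left_cancel[OF u(3)], rule unitary_comp_left_cancel[OF u(2)])
    have "p o\<^sub>L (q o\<^sub>L (w o\<^sub>L adj p)) = (w o\<^sub>L p) o\<^sub>L adj p" unfolding r1 by (simp add: comp_assoc)
    then show "p o\<^sub>L (q o\<^sub>L (w o\<^sub>L adj p)) = p o\<^sub>L (q o\<^sub>L (adj q o\<^sub>L (adj p o\<^sub>L w)))"
      using u by (simp add: comp_assoc)
  qed
  have wb: "w o\<^sub>L (b o\<^sub>L a) = a o\<^sub>L w" unfolding r2[symmetric] using u by simp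
  have ba: "p o\<^sub>L (adj b o\<^sub>L adj w) = p o\<^sub>L (a o\<^sub>L (adj w o\<^sub>L adj a))"
  proof -
    have "adj (w o\<^sub>L (b o\<^sub>L a)) = adj (a o\<^sub>L w)" unfolding wb ..
    then have "adj a o\<^sub>L (adj b o\<^sub>L adj w) = adj w o\<^sub>L adj a" using u by (simp add: adj_comp comp_assoc)
    from arg_cong[OF this, of "\<lambda>S. a o\<^sub>L S"] show ?thesis using u by simp
  qed
  \<comment> \<open>To carry \<open>w\<close> from left to right, the trivial factors
    \<open>a o\<^sub>L adj a\<close> and \<open>adj w o\<^sub>L w\<close> are inserted, so that
    \<open>wb\<close>, \<open>ba\<close> and \<open>r1\<close> become applicable; \<open>p\<close>
    and \<open>a\<close> commute since they act on disjoint legs.\<close>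
  have "w o\<^sub>L (adj p o\<^sub>L (b o\<^sub>L (p o\<^sub>L adj b))) = adj q o\<^sub>L (adj p o\<^sub>L (w o\<^sub>L (b o\<^sub>L (p o\<^sub>L adj b))))"
    using r1' by (simp flip: comp_assoc)
  also have "\<dots> = adj q o\<^sub>L (adj p o\<^sub>L ((w o\<^sub>L (b o\<^sub>L a)) o\<^sub>L (adj a o\<^sub>L (p o\<^sub>L (adj b o\<^sub>L (adj w o\<^sub>L w))))))"
    using u by (simp add: comp_assoc)
  also have "\<dots> = adj q o\<^sub>L (adj p o\<^sub>L (a o\<^sub>L (w o\<^sub>L (adj a o\<^sub>L ((p o\<^sub>L (adj b o\<^sub>L adj w)) o\<^sub>L w)))))"
    unfolding wb by (simp add: comp_assoc)
  also have "\<dots> = adj q o\<^sub>L (adj p o\<^sub>L (a o\<^sub>L (w o\<^sub>L (adj a o\<^sub>L ((p o\<^sub>L a) o\<^sub>L (adj w o\<^sub>L (adj a o\<^sub>L w)))))))"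
    unfolding ba by (simp add: comp_assoc)
  also have "\<dots> = adj q o\<^sub>L (adj p o\<^sub>L (a o\<^sub>L ((w o\<^sub>L p) o\<^sub>L (adj w o\<^sub>L (adj a o\<^sub>L w)))))"
    unfolding pa using u by (simp add: comp_assoc)
  also have "\<dots> = adj q o\<^sub>L (adj p o\<^sub>L ((a o\<^sub>L p) o\<^sub>L (q o\<^sub>L (adj a o\<^sub>L w))))"
    unfolding r1 using u by (simp add: comp_assoc)
  also have "\<dots> = adj q o\<^sub>L (a o\<^sub>L (q o\<^sub>L adj a)) o\<^sub>L w"
    unfolding pa[symmetric] using u by (simp add: comp_assoc)
  finally have "w o\<^sub>L (F o\<^sub>L leg13 Y o\<^sub>L F) = leg13 Y o\<^sub>L w" unfolding FY unfolding Y by (simp add: comp_assoc)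
  then show ?thesis unfolding w_def F_def .
qed

text \<open>Slicing the outer legs of the four-leg relation gives the relation of
  \<open>commuting_scalar\<close> for each slice of \<open>Y\<close>. If all these slices are
  scalar, \<open>Y\<close> acts trivially on the middle leg.\<close>

lemma (in modular_mu) intertwine_leg13:
  fixes Y :: "('v::chilbert_space \<otimes>\<^sub>H 'h \<otimes>\<^sub>H 'u::chilbert_space) op"
  assumes Y: "Y \<in> bops"
    and rel: "leg23 (leg12 W) o\<^sub>L (leg23 (leg12 flip) o\<^sub>L leg13 Y o\<^sub>L leg23 (leg12 flip)) =
        leg13 Y o\<^sub>L leg23 (leg12 W)"
  shows "\<exists>X\<in>bops. Y = leg13 X"
proof -
  \<comment> \<open>\<open>J\<close> and \<open>K\<close> fix the outer vectors
    \<open>\<alpha>\<close> and \<open>\<gamma>\<close> on three and on four legs. \<open>K\<close>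
    intertwines W_23 with \<open>W\<close>, which is how the relation descends to the
    slices.\<close>
  define J :: "'v \<Rightarrow> 'u \<Rightarrow> 'h \<Rightarrow>\<^sub>L 'v \<otimes>\<^sub>H 'h \<otimes>\<^sub>H 'u"
    where "J \<alpha> \<gamma> = tensor_left \<alpha> o\<^sub>L tensor_right \<gamma>" for \<alpha> \<gamma>
  define K :: "'v \<Rightarrow> 'u \<Rightarrow> 'h \<otimes>\<^sub>H 'h \<Rightarrow>\<^sub>L 'v \<otimes>\<^sub>H 'h \<otimes>\<^sub>H 'h \<otimes>\<^sub>H 'u"
    where "K \<alpha> \<gamma> = tensor_left \<alpha> o\<^sub>L (assoc o\<^sub>L tensor_right \<gamma>)" for \<alpha> \<gamma>
  define S where "S \<alpha> \<gamma> \<beta> \<delta> = adj (J \<alpha> \<gamma>) o\<^sub>L (Y o\<^sub>L J \<beta> \<delta>)" for \<alpha> \<beta> and \<gamma> \<delta> :: 'u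
  have Jb: "J \<alpha> \<gamma> \<in> bops" for \<alpha> \<gamma> by (simp add: J_def)
  have Kb: "K \<alpha> \<gamma> \<in> bops" for \<alpha> \<gamma> by (simp add: K_def)
  have Sc: "cinner x (blinfun_apply (S \<alpha> \<gamma> \<beta> \<delta>) y) = cinner (\<alpha> \<otimes> x \<otimes> \<gamma>) (blinfun_apply Y (\<beta> \<otimes> y \<otimes> \<delta>))"
    for x y \<alpha> \<beta> \<gamma> \<delta>
    unfolding S_def using Jb by (simp add: adj_right J_def)
  have Sb: "S \<alpha> \<gamma> \<beta> \<delta> \<in> bops" for \<alpha> \<beta> \<gamma> \<delta> unfolding S_def using Jb Y by simp
  have wK: "leg23 (leg12 W) o\<^sub>L K \<alpha> \<gamma> = K \<alpha> \<gamma> o\<^sub>L W" for \<alpha> \<gamma>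
    by (rule htensor_eqI) (simp add: K_def)
  have Kw: "adj (K \<alpha> \<gamma>) o\<^sub>L leg23 (leg12 W) = W o\<^sub>L adj (K \<alpha> \<gamma>)" for \<alpha> \<gamma>
  proof -
    have "leg23 (leg12 (adj W)) o\<^sub>L K \<alpha> \<gamma> = K \<alpha> \<gamma> o\<^sub>L adj W" by (rule htensor_eqI) (simp add: K_def)
    from arg_cong[OF this, of adj] show ?thesis by (simp add: adj_comp Kb adj_leg23 adj_leg12)
  qed
  have 1: "adj (K \<alpha> \<gamma>) o\<^sub>L (leg13 Y o\<^sub>L K \<beta> \<delta>) = id_blinfun \<otimes>\<^sub>o S \<alpha> \<gamma> \<beta> \<delta>" for \<alpha> \<beta> \<gamma> \<delta>
    by (intro blinfun_cinner_eqI[OF closure_span_tensor closure_span_tensor])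
      (auto simp: adj_right Kb Sb K_def cinner_leg13[OF Y] Sc cinner_tensor simp del: leg13_tensor)
  have 2: "adj (K \<alpha> \<gamma>) o\<^sub>L ((leg23 (leg12 flip) o\<^sub>L leg13 Y o\<^sub>L leg23 (leg12 flip)) o\<^sub>L K \<beta> \<delta>) =
      S \<alpha> \<gamma> \<beta> \<delta> \<otimes>\<^sub>o id_blinfun" for \<alpha> \<beta> \<gamma> \<delta>
  proof (rule blinfun_cinner_eqI[OF closure_span_tensor closure_span_tensor])
    fix p q :: "'h \<otimes>\<^sub>H 'h" assume "p \<in> {x \<otimes> y |x y. True}" "q \<in> {x \<otimes> y |x y. True}"
    then obtain x x2 y y2 where p: "p = x \<otimes> x2" and q: "q = y \<otimes> y2" by blast
    have "cinner p (blinfun_apply (adj (K \<alpha> \<gamma>) o\<^sub>L ((leg23 (leg12 flip) o\<^sub>L leg13 Y o\<^sub>L leg23 (leg12 flip)) o\<^sub>L K \<beta> \<delta>)) q) =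
        cinner (\<alpha> \<otimes> x \<otimes> x2 \<otimes> \<gamma>) (blinfun_apply (adj (leg23 (leg12 flip))) (blinfun_apply (leg13 Y) (\<beta> \<otimes> y2 \<otimes> y \<otimes> \<delta>)))"
      by (simp add: adj_right Kb K_def p q adj_leg23 adj_leg12 del: leg13_tensor)
    also have "\<dots> = cinner (\<alpha> \<otimes> x2 \<otimes> x \<otimes> \<gamma>) (blinfun_apply (leg13 Y) (\<beta> \<otimes> y2 \<otimes> y \<otimes> \<delta>))"
      by (simp add: adj_right del: leg13_tensor)
    also have "\<dots> = cinner p (blinfun_apply (S \<alpha> \<gamma> \<beta> \<delta> \<otimes>\<^sub>o id_blinfun) q)"
      by (simp add: cinner_leg13[OF Y] p q Sb Sc cinner_tensor mult.commute del: leg13_tensor)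
    finally show "cinner p (blinfun_apply (adj (K \<alpha> \<gamma>) o\<^sub>L ((leg23 (leg12 flip) o\<^sub>L leg13 Y o\<^sub>L leg23 (leg12 flip)) o\<^sub>L K \<beta> \<delta>)) q) =
        cinner p (blinfun_apply (S \<alpha> \<gamma> \<beta> \<delta> \<otimes>\<^sub>o id_blinfun) q)" .
  qed
  have scal: "\<exists>c. S \<alpha> \<gamma> \<beta> \<delta> = scaleC_op c id_blinfun" for \<alpha> \<beta> \<gamma> \<delta>
  proof (rule commuting_scalar[OF Sb])
    have "W o\<^sub>L (S \<alpha> \<gamma> \<beta> \<delta> \<otimes>\<^sub>o id_blinfun) = (adj (K \<alpha> \<gamma>) o\<^sub>L leg23 (leg12 W)) o\<^sub>L ((leg23 (leg12 flip) o\<^sub>L leg13 Y o\<^sub>L leg23 (leg12 flip)) o\<^sub>L K \<beta> \<delta>)"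
      unfolding Kw 2[symmetric] by (simp only: comp_assoc)
    also have "\<dots> = adj (K \<alpha> \<gamma>) o\<^sub>L ((leg23 (leg12 W) o\<^sub>L (leg23 (leg12 flip) o\<^sub>L leg13 Y o\<^sub>L leg23 (leg12 flip))) o\<^sub>L K \<beta> \<delta>)"
      by (simp only: comp_assoc)
    also have "\<dots> = adj (K \<alpha> \<gamma>) o\<^sub>L (leg13 Y o\<^sub>L (leg23 (leg12 W) o\<^sub>L K \<beta> \<delta>))" unfolding rel by (simp only: comp_assoc)
    also have "\<dots> = (adj (K \<alpha> \<gamma>) o\<^sub>L (leg13 Y o\<^sub>L K \<beta> \<delta>)) o\<^sub>L W" unfolding wK by (simp only: comp_assoc)
    finally show "W o\<^sub>L (S \<alpha> \<gamma> \<beta> \<delta> \<otimes>\<^sub>o id_blinfun) = (id_blinfun \<otimes>\<^sub>o S \<alpha> \<gamma> \<beta> \<delta>) o\<^sub>L W" unfolding 1 .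
  qed
  obtain x0 :: 'h where x0: "x0 \<noteq> 0" using ne by blast
  define e where "e = (1 / norm x0) *\<^sub>R x0"
  have e: "cinner e e = 1" using x0 by (simp add: e_def cinner_self)
  \<comment> \<open>A coefficient of \<open>Y\<close> is a scalar times \<open>cinner x y\<close>,
    so compression of the middle leg by a unit vector recovers that scalar.\<close>
  define X where "X = adj (tensor_mid e) o\<^sub>L (Y o\<^sub>L tensor_mid e)"
  have Xb: "X \<in> bops" unfolding X_def using Y by simp
  have "Y = leg13 X"
  proof (rule blinfun_cinner_eqI[OF total_tensor3 total_tensor3])
    fix p q assume "p \<in> {x \<otimes> y \<otimes> z |(x::'v) (y::'h) (z::'u). True}" "q \<in>
        {x \<otimes> y \<otimes> z |(x::'v) (y::'h) (z::'u). True}"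
    then obtain \<alpha> x \<gamma> \<beta> y \<delta> where p: "p = \<alpha> \<otimes> x \<otimes> \<gamma>" and q: "q = \<beta> \<otimes> y \<otimes> \<delta>" by blast
    obtain c where c: "S \<alpha> \<gamma> \<beta> \<delta> = scaleC_op c id_blinfun" using scal by blast
    have Yc: "cinner (\<alpha> \<otimes> x \<otimes> \<gamma>) (blinfun_apply Y (\<beta> \<otimes> y \<otimes> \<delta>)) = c * cinner x y" for x y
      unfolding Sc[symmetric] c by (simp add: cinner_scaleC_right)
    have "cinner (\<alpha> \<otimes> \<gamma>) (blinfun_apply X (\<beta> \<otimes> \<delta>)) = c"
      unfolding X_def by (simp add: adj_right Yc e)
    then show "cinner p (blinfun_apply Y q) = cinner p (blinfun_apply (leg13 X) q)"
      unfolding p q cinner_leg13[OF Xb] Yc by (simp add: mult.commute)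
  qed
  then show ?thesis using Xb by blast
qed

section \<open>The universal bicharacter\<close>

lemma amp_intertwine:
  fixes V :: "('h::chilbert_space \<otimes>\<^sub>H 'b::chilbert_space) op" and T :: "('v::chilbert_space \<otimes>\<^sub>H 'h) op"
  assumes \<phi>: "star_rep B \<phi>" and V: "V \<in> adjointable B" and X: "X \<in> adjointable B" and T: "T \<in> bops"
    and rel: "leg23 V o\<^sub>L leg12 T = leg12 T o\<^sub>L leg13 X o\<^sub>L leg23 V"
  shows "leg23 (amp B \<phi> V) o\<^sub>L leg12 T = leg12 T o\<^sub>L leg13 (amp B \<phi> X) o\<^sub>L leg23 (amp B \<phi> V)"
proof -
  note a3 = adjointable3_leg12[OF \<phi> T] adjointable3_leg13[OF \<phi> X] adjointable3_leg23[OF \<phi> V]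
  have "amp3 B \<phi> (leg23 V o\<^sub>L leg12 T) = amp3 B \<phi> ((leg12 T o\<^sub>L leg13 X) o\<^sub>L leg23 V)" using rel by simp
  then show ?thesis
    by (simp only: amp3_comp[OF \<phi>] adjointable3_comp a3 amp3_leg12[OF \<phi> T] amp3_leg13[OF \<phi> X] amp3_leg23[OF \<phi> V])
qed

lemma heisenberg_cancel:
  fixes V :: "('h::chilbert_space \<otimes>\<^sub>H 'u::chilbert_space) op" and T :: "('v::chilbert_space \<otimes>\<^sub>H 'h) op"
  assumes ne: "\<exists>x::'h. x \<noteq> 0" and V: "unitary V" and T: "unitary T" and X: "X \<in> bops" "Y \<in> bops"
    and rel: "leg12 T o\<^sub>L leg13 X o\<^sub>L leg23 V = leg12 T o\<^sub>L leg13 Y o\<^sub>L leg23 V"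
  shows "X = Y"
proof (rule leg13_inject[OF _ X ne])
  have "leg12 T o\<^sub>L (leg13 X o\<^sub>L leg23 V) = leg12 T o\<^sub>L (leg13 Y o\<^sub>L leg23 V)" using rel by (simp only: comp_assoc)
  then have "leg13 X o\<^sub>L leg23 V = leg13 Y o\<^sub>L leg23 V" by (rule unitary_comp_left_cancel[OF unitary_leg12[OF T]])
  then show "leg13 X = (leg13 Y :: ('v \<otimes>\<^sub>H 'h \<otimes>\<^sub>H 'u) op)"
    by (rule unitary_comp_right_cancel[OF unitary_leg23[OF V]])
qed

text \<open>On four legs, moving T_12 across V_23 produces X_13, and across V_24 it produces X_14.
  Since X_14 commutes with V_23, the product V_23 V_24 produces X_13 X_14, and cancellation
  identifies this with Z_134.\<close>

lemma heisenberg_comult: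
  fixes V :: "('h::chilbert_space \<otimes>\<^sub>H 'u::chilbert_space) op" and T :: "('v::chilbert_space \<otimes>\<^sub>H 'h) op"
  assumes ne: "\<exists>x::'h. x \<noteq> 0" and V: "unitary V" and T: "unitary T" and X: "X \<in> bops" and Z: "Z \<in> bops"
    and rel: "leg23 V o\<^sub>L leg12 T = leg12 T o\<^sub>L leg13 X o\<^sub>L leg23 V"
    and rel': "leg23 (leg12 V o\<^sub>L leg13 V) o\<^sub>L leg12 T = leg12 T o\<^sub>L leg13 Z o\<^sub>L leg23 (leg12 V o\<^sub>L leg13 V)"
  shows "Z = leg12 X o\<^sub>L leg13 X"
proof -
  have [simp]: "V \<in> bops" "T \<in> bops" using V T by simp_all
  define A where "A = (leg23 (leg12 V) :: ('v \<otimes>\<^sub>H 'h \<otimes>\<^sub>H 'u \<otimes>\<^sub>H 'u) op)"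
  define B where "B = (leg23 (leg13 V) :: ('v \<otimes>\<^sub>H 'h \<otimes>\<^sub>H 'u \<otimes>\<^sub>H 'u) op)"
  define p where "p = (leg12 T :: ('v \<otimes>\<^sub>H 'h \<otimes>\<^sub>H 'u \<otimes>\<^sub>H 'u) op)"
  define G where "G = (leg23 (leg23 flip) :: ('v \<otimes>\<^sub>H 'h \<otimes>\<^sub>H 'u \<otimes>\<^sub>H 'u) op)"
  define X1 where "X1 = (leg13 (leg12 X) :: ('v \<otimes>\<^sub>H 'h \<otimes>\<^sub>H 'u \<otimes>\<^sub>H 'u) op)"
  define X2 where "X2 = (leg13 (leg13 X) :: ('v \<otimes>\<^sub>H 'h \<otimes>\<^sub>H 'u \<otimes>\<^sub>H 'u) op)"
  have GG: "G o\<^sub>L (G o\<^sub>L S) = S" for S :: "('v \<otimes>\<^sub>H 'h \<otimes>\<^sub>H 'u \<otimes>\<^sub>H 'u) op"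
    by (simp add: G_def flip: comp_assoc leg23_comp)
  have c12: "leg23 flip o\<^sub>L (leg12 S o\<^sub>L leg23 flip) = leg13 S" for S :: "('x::chilbert_space \<otimes>\<^sub>H 'u) op"
    by (simp add: leg13_def leg23_def comp_assoc)
  have Ap: "A o\<^sub>L p = p o\<^sub>L (X1 o\<^sub>L A)"
    using arg_cong[OF rel, of leg123] X
    by (simp add: leg123_comp leg123_leg12 leg123_leg13 leg123_leg23 comp_assoc A_def p_def X1_def)
  have GA: "G o\<^sub>L (A o\<^sub>L G) = B" unfolding G_def A_def B_def using arg_cong[OF c12[of V], of leg23]
    by (simp add: leg23_comp)
  have Gp: "G o\<^sub>L (p o\<^sub>L G) = p"
  proof -
    have "p o\<^sub>L G = G o\<^sub>L p" unfolding G_def p_def by (rule leg12_leg34_commute) simp_all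
    then show ?thesis by (simp add: GG)
  qed
  have GX: "G o\<^sub>L (X1 o\<^sub>L G) = X2"
  proof -
    have G: "G = leg13 (leg23 flip)" unfolding G_def by (rule leg13_leg23[symmetric]) simp
    show ?thesis unfolding G X1_def X2_def using arg_cong[OF c12[of X], of leg13] X by (simp add: leg13_comp)
  qed
  have "B o\<^sub>L p = G o\<^sub>L ((A o\<^sub>L p) o\<^sub>L G)"
    unfolding GA[symmetric] by (subst (1) Gp[symmetric]) (simp add: comp_assoc GG)
  also have "\<dots> = (G o\<^sub>L (p o\<^sub>L G)) o\<^sub>L ((G o\<^sub>L (X1 o\<^sub>L G)) o\<^sub>L (G o\<^sub>L (A o\<^sub>L G)))"
    unfolding Ap by (simp add: comp_assoc GG)
  finally have Bp: "B o\<^sub>L p = p o\<^sub>L (X2 o\<^sub>L B)" unfolding Gp GX GA .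
  have XA: "X2 o\<^sub>L A = A o\<^sub>L X2" unfolding X2_def A_def by (rule leg14_leg23_commute) (simp_all add: X)
  have "(A o\<^sub>L B) o\<^sub>L p = (A o\<^sub>L p) o\<^sub>L (X2 o\<^sub>L B)" using Bp by (simp add: comp_assoc)
  also have "\<dots> = p o\<^sub>L (X1 o\<^sub>L ((A o\<^sub>L X2) o\<^sub>L B))" unfolding Ap by (simp add: comp_assoc)
  also have "\<dots> = p o\<^sub>L (X1 o\<^sub>L X2) o\<^sub>L (A o\<^sub>L B)" unfolding XA[symmetric] by (simp add: comp_assoc)
  finally have "leg23 (leg12 V o\<^sub>L leg13 V) o\<^sub>L leg12 T =
      leg12 T o\<^sub>L leg13 (leg12 X o\<^sub>L leg13 X) o\<^sub>L leg23 (leg12 V o\<^sub>L leg13 V)"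
    using X by (simp add: A_def B_def p_def X1_def X2_def leg23_comp leg13_comp)
  then show ?thesis unfolding rel'
    by (intro heisenberg_cancel[OF ne _ T, of "leg12 V o\<^sub>L leg13 V"]) (use V X Z in auto)
qed

text \<open>Taking adjoints and reversing the legs keeps the shape of the relation, while
  \<open>V\<close> and \<open>T\<close> exchange roles. Results about the second leg thereby yield
  results about the first.\<close>

lemma heisenberg_dual:
  fixes V :: "('h::chilbert_space \<otimes>\<^sub>H 'u::chilbert_space) op" and T :: "('v::chilbert_space \<otimes>\<^sub>H 'h) op"
  assumes V: "V \<in> bops" and T: "T \<in> bops" and X: "X \<in> bops"
    and rel: "leg23 V o\<^sub>L leg12 T = leg12 T o\<^sub>L leg13 X o\<^sub>L leg23 V"
  shows "leg23 (swap (adj T)) o\<^sub>L leg12 (swap (adj V)) =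
    leg12 (swap (adj V)) o\<^sub>L leg13 (swap (adj X)) o\<^sub>L leg23 (swap (adj T))"
proof -
  let ?r = "rev3 :: 'v \<otimes>\<^sub>H 'h \<otimes>\<^sub>H 'u \<Rightarrow>\<^sub>L _"
  have r: "?r o\<^sub>L leg12 (adj T) = leg23 (swap (adj T)) o\<^sub>L ?r" "?r o\<^sub>L leg23 (adj V) = leg12 (swap (adj V)) o\<^sub>L ?r"
    "?r o\<^sub>L leg13 (adj X) = leg13 (swap (adj X)) o\<^sub>L ?r"
    using V T X by (simp_all add: rev3_leg12 rev3_leg13 rev3_leg23)
  have eq: "leg12 (adj T) o\<^sub>L leg23 (adj V) = leg23 (adj V) o\<^sub>L (leg13 (adj X) o\<^sub>L leg12 (adj T))"
    using arg_cong[OF rel, of adj] V T X by (simp add: adj_comp adj_leg12 adj_leg13 adj_leg23 comp_assoc)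
  have "(leg23 (swap (adj T)) o\<^sub>L leg12 (swap (adj V))) o\<^sub>L ?r = ?r o\<^sub>L (leg12 (adj T) o\<^sub>L leg23 (adj V))"
    by (rule intertwine_comp[OF r(1,2), symmetric])
  also have "\<dots> = (leg12 (swap (adj V)) o\<^sub>L (leg13 (swap (adj X)) o\<^sub>L leg23 (swap (adj T)))) o\<^sub>L ?r"
    unfolding eq by (rule intertwine_comp[OF r(2) intertwine_comp[OF r(3,1)]])
  finally have "leg23 (swap (adj T)) o\<^sub>L leg12 (swap (adj V)) =
      leg12 (swap (adj V)) o\<^sub>L (leg13 (swap (adj X)) o\<^sub>L leg23 (swap (adj T)))"
    by (rule unitary_comp_right_cancel[OF unitary_rev3])
  then show ?thesis by (simp only: comp_assoc)
qed

lemma reassoc_swap: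
  fixes S :: "('u::chilbert_space \<otimes>\<^sub>H 'v::chilbert_space \<otimes>\<^sub>H 'v) op"
  shows "reassoc (swap S) = adj cyc o\<^sub>L (S o\<^sub>L cyc)"
  by (simp add: reassoc_def cyc_def adj_comp comp_assoc)

text \<open>A first-leg comultiplication is computed after swapping, where the doubled leg comes
  last. The cyclic permutation restores the order of the legs and turns \<open>leg13\<close> and
  \<open>leg12\<close> of \<open>swap X\<close> into \<open>leg23\<close> and \<open>leg13\<close>
  of \<open>X\<close>.\<close>

lemma reassoc_swap_bicharacter:
  fixes X :: "('v::chilbert_space \<otimes>\<^sub>H 'u::chilbert_space) op"
  assumes X: "X \<in> bops"
  shows "reassoc (swap (leg13 (swap X) o\<^sub>L leg12 (swap X))) = leg23 X o\<^sub>L leg13 X"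
proof -
  have "cyc o\<^sub>L leg23 X = leg13 (swap X) o\<^sub>L cyc" "cyc o\<^sub>L leg13 X = leg12 (swap X) o\<^sub>L cyc"
    by (rule cyc_leg23[OF X], rule cyc_leg13[OF X])
  note c = intertwine_comp[OF this]
  show ?thesis unfolding reassoc_swap c[symmetric] by simp
qed

theorem proposition4p8:
  fixes W :: "('h::chilbert_space \<otimes>\<^sub>H 'h) op"
    and C Ch :: "'h op set"
    and \<Delta>C \<Delta>Ch :: "'h op \<Rightarrow> ('h \<otimes>\<^sub>H 'h) op"
    and Cu :: "'u::chilbert_space op set"
    and V :: "('h \<otimes>\<^sub>H 'u) op"
    and \<Delta>Cu :: "'u op \<Rightarrow> ('u \<otimes>\<^sub>H 'u) op"
    and \<Lambda> :: "'u op \<Rightarrow> 'h op"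
    and Chu :: "'v::chilbert_space op set"
    and Vh :: "('h \<otimes>\<^sub>H 'v) op"
    and \<Delta>Chu :: "'v op \<Rightarrow> ('v \<otimes>\<^sub>H 'v) op"
    and \<Lambda>h :: "'v op \<Rightarrow> 'h op"
    and Vt :: "('v \<otimes>\<^sub>H 'h) op"
  assumes nonzero: "\<exists>x::'h. x \<noteq> 0"
    and mult: "multiplicative_unitary W"
    and modular: "modular W"
    and C: "C = qg_algebra W" "\<Delta>C = qg_comult W"
    and Ch: "Ch = qg_algebra (dual_mu W)" "\<Delta>Ch = qg_comult (dual_mu W)"
    and V: "universal_corep TYPE('d::chilbert_space) Ch \<Delta>Ch Cu V"
    and \<Delta>Cu: "cstar_morphism Cu (Cu \<otimes>\<^sub>A Cu) \<Delta>Cu"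
      "tensor_morphism Ch (\<lambda>a. a) Cu \<Delta>Cu V = leg12 V o\<^sub>L leg13 V"
    and \<Lambda>: "cstar_morphism Cu C \<Lambda>" "tensor_morphism Ch (\<lambda>a. a) Cu \<Lambda> V = W"
    and Vh: "universal_corep TYPE('d) C \<Delta>C Chu Vh"
    and \<Delta>Chu: "cstar_morphism Chu (Chu \<otimes>\<^sub>A Chu) \<Delta>Chu"
      "tensor_morphism C (\<lambda>a. a) Chu \<Delta>Chu Vh = leg12 Vh o\<^sub>L leg13 Vh"
    and Vt: "Vt = flip o\<^sub>L adj Vh o\<^sub>L flip"
    and \<Lambda>h: "cstar_morphism Chu Ch \<Lambda>h" "tensor_morphism Chu \<Lambda>h C (\<lambda>a. a) Vt = W"
  shows "leg12 Vt \<in> unitary_multiplier (Chu \<otimes>\<^sub>A compact_ops \<otimes>\<^sub>A Cu) \<and>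
    leg23 V \<in> unitary_multiplier (Chu \<otimes>\<^sub>A compact_ops \<otimes>\<^sub>A Cu) \<and>
    (\<exists>!X. X \<in> unitary_multiplier (Chu \<otimes>\<^sub>A Cu) \<and>
       leg23 V o\<^sub>L leg12 Vt = leg12 Vt o\<^sub>L leg13 X o\<^sub>L leg23 V) \<and>
    (\<forall>X. X \<in> unitary_multiplier (Chu \<otimes>\<^sub>A Cu) \<and>
       leg23 V o\<^sub>L leg12 Vt = leg12 Vt o\<^sub>L leg13 X o\<^sub>L leg23 V \<longrightarrow>
       reassoc (tensor_morphism Chu \<Delta>Chu Cu (\<lambda>a. a) X) = leg23 X o\<^sub>L leg13 X \<and>
       tensor_morphism Chu (\<lambda>a. a) Cu \<Delta>Cu X = leg12 X o\<^sub>L leg13 X \<and>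
       tensor_morphism Chu (\<lambda>a. a) Cu \<Lambda> X = Vt \<and>
       tensor_morphism Chu \<Lambda>h Cu (\<lambda>a. a) X = V \<and>
       tensor_morphism Chu \<Lambda>h Cu \<Lambda> X = W)"
proof -
  have W: "unitary W" and pent: "leg23 W o\<^sub>L leg12 W = leg12 W o\<^sub>L leg13 W o\<^sub>L (leg23 W :: ('h \<otimes>\<^sub>H 'h \<otimes>\<^sub>H 'h) op)"
    using mult by (simp_all add: multiplicative_unitary_def)
  obtain Qh Q Wt where mu: "modular_mu W Qh Q Wt"
  proof -
    from modular[unfolded modular_def] obtain Qh Q :: "('h \<times> 'h) set" and Wt where m:
      "positive_self_adjoint Qh" "\<forall>x. (x, 0) \<in> Qh \<longrightarrow> x = 0"
      "positive_self_adjoint Q" "\<forall>x. (x, 0) \<in> Q \<longrightarrow> x = 0" "unitary Wt"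
      "graph W O tensor_graph Qh Q O graph (adj W) = tensor_graph Qh Q"
      "\<forall>x z. \<forall>(y, y')\<in>Q. \<forall>(u, u')\<in>Q\<inverse>. cinner (x \<otimes> y) (blinfun_apply W (z \<otimes> u)) =
        cinner (bar z \<otimes> y') (blinfun_apply Wt (bar x \<otimes> u'))"
      by (elim exE conjE)
    have "modular_mu W Qh Q Wt"
    proof
      fix x z y y' u u' assume y: "(y, y') \<in> Q" and u: "(u', u) \<in> Q"
      have "\<forall>(u, u')\<in>Q\<inverse>. cinner (x \<otimes> y) (blinfun_apply W (z \<otimes> u)) =
          cinner (bar z \<otimes> y') (blinfun_apply Wt (bar x \<otimes> u'))"
        using bspec[OF spec[OF spec[OF m(7), of x], of z] y] by simp
      from bspec[OF this converseI[OF u]]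
      show "cinner (x \<otimes> y) (blinfun_apply W (z \<otimes> u)) = cinner (bar z \<otimes> y') (blinfun_apply Wt (bar x \<otimes> u'))" by simp
    qed (use nonzero W pent m in auto)
    then show ?thesis by (rule that)
  qed
  interpret modular_mu W Qh Q Wt by (rule mu)
  have Wd: "dual_mu W = swap (adj W)" "unitary (dual_mu W)" unfolding dual_mu_def using W by simp_all
  have cC: "cstar_algebra C" unfolding C by (rule cstar_qg_algebra)
  have nC: "nondegenerate C" unfolding C by (rule qg_algebra_nondegenerate[OF W nonzero])
  have nCh: "nondegenerate Ch" unfolding Ch by (rule qg_algebra_nondegenerate[OF Wd(2) nonzero])
  have cCu: "cstar_algebra Cu" and Vm: "V \<in> multiplier (Ch \<otimes>\<^sub>A Cu)" and Vu: "unitary V" and Vc: "left_corep Ch \<Delta>Ch Cu V"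
    using V by (auto simp: universal_corep_def left_corep_def unitary_multiplier_def)
  have cChu: "cstar_algebra Chu" and Vhm: "Vh \<in> multiplier (C \<otimes>\<^sub>A Chu)" and Vhu: "unitary Vh" and Vhc: "left_corep C \<Delta>C Chu Vh"
    using Vh by (auto simp: universal_corep_def left_corep_def unitary_multiplier_def)
  have nCu: "nondegenerate Cu" and nChu: "nondegenerate Chu" by (rule cstar_nondegenerate; fact)+
  have sub: "C \<subseteq> bops" "Cu \<subseteq> bops" "Chu \<subseteq> bops" using cC cCu cChu by (simp_all add: cstar_algebra_def)
  have Vtu: "unitary Vt" unfolding Vt by (rule unitary_swap[OF unitary_adj[OF Vhu]])
  note [simp] = unitary_bops[OF Vu] unitary_bops[OF Vhu] unitary_bops[OF Vtu]
  have Vh_Vt: "swap (adj Vt) = Vh" unfolding Vt by (simp add: adj_comp comp_assoc)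
  have Va: "V \<in> adjointable Cu" by (rule multiplier_adjointable[OF nCh cCu Vm])
  have Vha: "Vh \<in> adjointable Chu" by (rule multiplier_adjointable[OF nC cChu Vhm])

  \<comment> \<open>\<open>V\<close> and \<open>Vh\<close> are multipliers over \<open>Ch\<close>
    and \<open>C\<close>. Through adjointability they become multipliers over the compact operators
    on the Hilbert space leg, where the equation for \<open>X\<close> is stated.\<close>
  let ?K = "compact_ops :: 'h op set" and ?S = "Chu \<otimes>\<^sub>A compact_ops \<otimes>\<^sub>A Cu :: ('v \<otimes>\<^sub>H 'h \<otimes>\<^sub>H 'u) op set"
  note Kb = compact_ops_bops[where ?'a = 'h]
  have KCu: "?K \<otimes>\<^sub>A Cu \<subseteq> bops" and KChu: "?K \<otimes>\<^sub>A Chu \<subseteq> bops" by (rule tensor_alg_bops[OF Kb]; fact)+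
  have VK: "V \<in> multiplier (?K \<otimes>\<^sub>A Cu)" by (rule adjointable_multiplier_compact[OF cCu Va])
  have VK': "adj V \<in> multiplier (?K \<otimes>\<^sub>A Cu)" by (rule adjointable_multiplier_compact[OF cCu adjointable_adj[OF Va]])
  have VhK: "Vh \<in> multiplier (?K \<otimes>\<^sub>A Chu)" by (rule adjointable_multiplier_compact[OF cChu Vha])
  have VhK': "adj Vh \<in> multiplier (?K \<otimes>\<^sub>A Chu)"
    by (rule adjointable_multiplier_compact[OF cChu adjointable_adj[OF Vha]])
  have m12: "leg12 (swap T) \<in> multiplier ?S" if "T \<in> multiplier (?K \<otimes>\<^sub>A Chu)" for T
    by (rule multiplier_leg12[OF sub(3) Kb sub(2) multiplier_swap[OF Kb sub(3) that]])
  have m23: "leg23 T \<in> multiplier ?S" if "T \<in> multiplier (?K \<otimes>\<^sub>A Cu)" for T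
    unfolding leg23_def by (rule multiplier_leg23[OF sub(3) KCu that])
  have adjVt: "adj Vt = swap Vh" unfolding Vt by (simp add: adj_comp comp_assoc)
  have M: "leg12 Vt \<in> multiplier ?S" "leg12 (adj Vt) \<in> multiplier ?S" "leg23 V \<in> multiplier ?S" "leg23 (adj V) \<in>
      multiplier ?S"
    unfolding adjVt using m12[OF VhK'] m12[OF VhK] m23[OF VK] m23[OF VK'] by (simp_all add: Vt)

  have relV: "leg12 (dual_mu W) o\<^sub>L leg13 V o\<^sub>L adj (leg12 (dual_mu W)) = leg23 V o\<^sub>L leg13 V"
    using left_corep_relation[OF Wd(2) nonzero cCu] Vc unfolding Ch by blast
  have relVh: "leg12 W o\<^sub>L leg13 Vh o\<^sub>L adj (leg12 W) = leg23 Vh o\<^sub>L leg13 Vh"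
    using left_corep_relation[OF W nonzero cChu] Vhc unfolding C by blast
  have W_Vt: "leg23 W o\<^sub>L leg12 Vt = leg12 Vt o\<^sub>L leg13 Vt o\<^sub>L leg23 W"
    using swap_corep_relation[OF W Vhu relVh] unfolding Vt .
  have Wd_V: "leg23 (dual_mu W) o\<^sub>L leg12 (swap (adj V)) =
      leg12 (swap (adj V)) o\<^sub>L leg13 (swap (adj V)) o\<^sub>L leg23 (dual_mu W)"
    by (rule swap_corep_relation[OF Wd(2) Vu relV])

  have ex: "\<exists>X. X \<in> unitary_multiplier (Chu \<otimes>\<^sub>A Cu) \<and> leg23 V o\<^sub>L leg12 Vt = leg12 Vt o\<^sub>L leg13 X o\<^sub>L leg23 V"
  proof -
    define Y where "Y = leg12 (adj Vt) o\<^sub>L (leg23 V o\<^sub>L (leg12 Vt o\<^sub>L leg23 (adj V)))"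
    have Yu: "unitary Y" unfolding Y_def using Vu Vtu
      by (intro unitary_comp unitary_leg12 unitary_leg23 unitary_adj)
    have Ym: "Y \<in> multiplier ?S" unfolding Y_def by (intro multiplier_comp M)
    have "\<exists>X\<in>bops. Y = leg13 X"
      by (rule intertwine_leg13[OF unitary_bops[OF Yu]], unfold Y_def)
        (rule heisenberg_intertwine[OF W Vu Vtu W_Vt dual_corep_relation[OF W unitary_bops[OF Vu] relV]])
    then obtain X where X: "X \<in> bops" "Y = leg13 X" by blast
    have "X \<in> multiplier (Chu \<otimes>\<^sub>A Cu)"
      by (rule multiplier_of_leg13[where ?'h = 'h]) (use sub cstar_scaleC[OF cCu] X nonzero Ym in auto)
    moreover have "unitary X" unfolding unitary_def
    proof (intro conjI X)
      show "adj X o\<^sub>L X = id_blinfun" "X o\<^sub>L adj X = id_blinfun"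
        by (rule leg13_inject[where ?'b = 'h]; use Yu X nonzero in \<open>simp add: leg13_comp flip: adj_leg13\<close>)+
    qed
    moreover have "leg23 V o\<^sub>L leg12 Vt = leg12 Vt o\<^sub>L leg13 X o\<^sub>L leg23 V"
      unfolding X(2)[symmetric] Y_def using Vu Vtu by (simp add: comp_assoc flip: adj_leg12 adj_leg23)
    ultimately show ?thesis by (auto simp: unitary_multiplier_def)
  qed
  have uniq: "X = X'" if "X \<in> bops" "X' \<in> bops" "leg23 V o\<^sub>L leg12 Vt = leg12 Vt o\<^sub>L leg13 X o\<^sub>L leg23 V"
    "leg23 V o\<^sub>L leg12 Vt = leg12 Vt o\<^sub>L leg13 X' o\<^sub>L leg23 V" for X X'
    by (rule heisenberg_cancel[OF nonzero Vu Vtu that(1,2)]) (use that(3,4) in simp)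

  have tot: "closure (span {blinfun_apply a x |a x. a \<in> A}) = UNIV" if "nondegenerate A"
    for A :: "'x::chilbert_space op set"
    using that by (simp add: nondegenerate_def)
  have rep: "star_rep Cu \<Delta>Cu" "star_rep Cu \<Lambda>" "star_rep Chu \<Delta>Chu" "star_rep Chu \<Lambda>h"
    by (rule star_rep_of_morphism[OF cCu \<Delta>Cu(1)] star_rep_of_morphism[OF cCu \<Lambda>(1)]
        star_rep_of_morphism[OF cChu \<Delta>Chu(1)] star_rep_of_morphism[OF cChu \<Lambda>h(1)];
        intro tensor_alg_total' sub tot nC nCh nCu nChu)+
  have amp_V: "amp Cu \<Delta>Cu V = leg12 V o\<^sub>L leg13 V" "amp Cu \<Lambda> V = W"
    using \<Delta>Cu(2) \<Lambda>(2) unfolding tensor_morphism_right[OF nCh rep(1) Vm] tensor_morphism_right[OF nCh rep(2) Vm]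
      by simp_all
  have amp_Vh: "amp Chu \<Delta>Chu Vh = leg12 Vh o\<^sub>L leg13 Vh"
    using \<Delta>Chu(2) unfolding tensor_morphism_right[OF nC rep(3) Vhm] .
  \<comment> \<open>The reducing morphism \<open>\<Lambda>h\<close> is specified on
    \<open>Vt\<close>. Rewritten for \<open>Vh\<close> the condition has the form of the one for
    \<open>\<Lambda>\<close> on \<open>V\<close>, with \<open>dual_mu W\<close> in place of
    \<open>W\<close>.\<close>
  have amp_Vh': "amp Chu \<Lambda>h Vh = dual_mu W"
  proof -
    have "adj Vh \<in> multiplier (C \<otimes>\<^sub>A Chu)"
      by (rule multiplier_adj[OF adj_tensor_alg[OF sub(1,3) cstar_adj[OF cC] cstar_adj[OF cChu]] tensor_alg_bops[OF sub(1,3)] Vhm])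
    from multiplier_swap[OF sub(1,3) this] have "Vt \<in> multiplier (Chu \<otimes>\<^sub>A C)" unfolding Vt .
    from tensor_morphism_left[OF rep(4) nC this] have 0: "swap (amp Chu \<Lambda>h (adj Vh)) = W"
      unfolding \<Lambda>h(2) unfolding Vt swap_swap by simp
    have "swap (swap (amp Chu \<Lambda>h (adj Vh))) = swap W" unfolding 0 ..
    then have "adj (amp Chu \<Lambda>h Vh) = swap W" unfolding swap_swap amp_adj[OF rep(4) Vha] .
    from arg_cong[OF this, of adj] show ?thesis unfolding Wd using amp_bops[OF rep(4) Vha]
      by (simp add: adj_comp comp_assoc)
  qed
  have props: "reassoc (tensor_morphism Chu \<Delta>Chu Cu (\<lambda>a. a) X) = leg23 X o\<^sub>L leg13 X \<and>
       tensor_morphism Chu (\<lambda>a. a) Cu \<Delta>Cu X = leg12 X o\<^sub>L leg13 X \<and>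
       tensor_morphism Chu (\<lambda>a. a) Cu \<Lambda> X = Vt \<and>
       tensor_morphism Chu \<Lambda>h Cu (\<lambda>a. a) X = V \<and>
       tensor_morphism Chu \<Lambda>h Cu \<Lambda> X = W"
    if Xm: "X \<in> multiplier (Chu \<otimes>\<^sub>A Cu)" and rel: "leg23 V o\<^sub>L leg12 Vt = leg12 Vt o\<^sub>L leg13 X o\<^sub>L leg23 V" for X
  proof -
    have Xa: "X \<in> adjointable Cu" by (rule multiplier_adjointable[OF nChu cCu Xm])
    have Xb: "X \<in> bops" by (rule adjointable_bops[OF Xa])
    have Xs: "swap X \<in> adjointable Chu"
      by (rule multiplier_adjointable[OF nCu cChu multiplier_swap[OF sub(3,2) Xm]])
    have Xs': "swap (adj X) \<in> adjointable Chu" using adjointable_adj[OF Xs] Xb by (simp add: adj_comp comp_assoc)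
    have adjs: "swap X = adj (swap (adj X))" using Xb by (simp add: adj_comp comp_assoc)
    let ?V' = "swap (adj V)"
    have V'u: "unitary ?V'" by (rule unitary_swap[OF unitary_adj[OF Vu]])
    \<comment> \<open>The triple \<open>Vh\<close>, \<open>?V'\<close>, \<open>swap (adj X)\<close>
      satisfies the relation of \<open>V\<close>, \<open>Vt\<close>, \<open>X\<close>, so the
      second-leg arguments apply to it verbatim.\<close>
    have rel': "leg23 Vh o\<^sub>L leg12 ?V' = leg12 ?V' o\<^sub>L leg13 (swap (adj X)) o\<^sub>L leg23 Vh"
      using heisenberg_dual[OF _ _ Xb rel] unfolding Vh_Vt by simp
    have 1: "amp Cu \<Delta>Cu X = leg12 X o\<^sub>L leg13 X"
      by (rule heisenberg_comult[OF nonzero Vu Vtu Xb amp_bops[OF rep(1) Xa] rel])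
        (use amp_intertwine[OF rep(1) Va Xa _ rel] amp_V in simp)
    \<comment> \<open>Applying \<open>\<Lambda>\<close> to the last leg turns \<open>V\<close> into
      \<open>W\<close>; by \<open>W_Vt\<close> the resulting equation is solved by \<open>Vt\<close>
      as well.\<close>
    have 2: "amp Cu \<Lambda> X = Vt"
      by (rule heisenberg_cancel[OF nonzero W Vtu amp_bops[OF rep(2) Xa]])
        (use amp_intertwine[OF rep(2) Va Xa _ rel] W_Vt amp_V in simp_all)
    have "amp Chu \<Delta>Chu (swap (adj X)) = leg12 (swap (adj X)) o\<^sub>L leg13 (swap (adj X))"
      by (rule heisenberg_comult[OF nonzero Vhu V'u adjointable_bops[OF Xs'] amp_bops[OF rep(3) Xs'] rel'])
        (use amp_intertwine[OF rep(3) Vha Xs' unitary_bops[OF V'u] rel'] amp_Vh in simp)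
    then have 3: "amp Chu \<Delta>Chu (swap X) = leg13 (swap X) o\<^sub>L leg12 (swap X)"
      unfolding adjs amp_adj[OF rep(3) Xs'] using Xb by (simp add: adj_comp adj_leg12 adj_leg13)
    \<comment> \<open>Now \<open>Vh\<close> becomes \<open>dual_mu W\<close>, and
      \<open>Wd_V\<close> says that \<open>?V'\<close> solves the resulting equation.\<close>
    have "amp Chu \<Lambda>h (swap (adj X)) = ?V'"
      by (rule heisenberg_cancel[OF nonzero Wd(2) V'u amp_bops[OF rep(4) Xs'] unitary_bops[OF V'u]])
        (use amp_intertwine[OF rep(4) Vha Xs' unitary_bops[OF V'u] rel'] Wd_V amp_Vh' in simp)
    then have 4: "swap (amp Chu \<Lambda>h (swap X)) = V"
      unfolding adjs amp_adj[OF rep(4) Xs'] by (simp add: adj_comp comp_assoc)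
    show ?thesis
    proof (intro conjI)
      show "reassoc (tensor_morphism Chu \<Delta>Chu Cu (\<lambda>a. a) X) = leg23 X o\<^sub>L leg13 X"
        unfolding tensor_morphism_left[OF rep(3) nCu Xm] 3 by (rule reassoc_swap_bicharacter[OF Xb])
      show "tensor_morphism Chu (\<lambda>a. a) Cu \<Delta>Cu X = leg12 X o\<^sub>L leg13 X" "tensor_morphism Chu (\<lambda>a. a) Cu \<Lambda> X = Vt"
        unfolding tensor_morphism_right[OF nChu rep(1) Xm] tensor_morphism_right[OF nChu rep(2) Xm]
          by (fact 1, fact 2)
      show "tensor_morphism Chu \<Lambda>h Cu (\<lambda>a. a) X = V"
        unfolding tensor_morphism_left[OF rep(4) nCu Xm] by (rule 4)
      \<comment> \<open>The first-leg map has already produced \<open>V\<close>, which is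
        adjointable over \<open>Cu\<close>, and \<open>\<Lambda>\<close> takes it to
        \<open>W\<close>.\<close>
      show "tensor_morphism Chu \<Lambda>h Cu \<Lambda> X = W"
        using tensor_morphism_both[OF rep(4) rep(2) Xm] Va unfolding 4 amp_V by blast
    qed
  qed
  show ?thesis
  proof (intro conjI)
    show "leg12 Vt \<in> unitary_multiplier ?S" "leg23 V \<in> unitary_multiplier ?S"
      using M Vu Vtu by (auto simp: unitary_multiplier_def)
    show "\<exists>!X. X \<in> unitary_multiplier (Chu \<otimes>\<^sub>A Cu) \<and> leg23 V o\<^sub>L leg12 Vt = leg12 Vt o\<^sub>L leg13 X o\<^sub>L leg23 V"
      using ex by (rule ex_ex1I) (rule uniq, auto simp: unitary_multiplier_def)
  qed (use props in \<open>auto simp: unitary_multiplier_def\<close>)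
qed

end
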